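(* Let $m\ge 1$, $d\ge 2$, $N=\binom{m+d}{d}-1$, and let $P\in\mathbb{P}^N$ be a point such that $\mathrm{sbr}(P)<\mathrm{sr}(P)$ and $\mathrm{sbr}(P)+\mathrm{sr}(P)\le 2d+1$. Let $\mathcal{S}\subset X_{m,d}$ be a $0$-dimensional reduced subscheme computing the symmetric rank of $P$ (i.e. $P\in\langle\mathcal{S}\rangle$ and $\sharp(\mathcal{S})=\mathrm{sr}(P)$), and let $\mathcal{Z}\subset X_{m,d}$ be a smoothable $0$-dimensional non-reduced subscheme such that $P\in\langle\mathcal{Z}\rangle$ and $\deg(\mathcal{Z})\le\mathrm{sbr}(P)$. Then there is a unique rational normal curve of degree $d$, $C_d=\nu_d(\ell)\subset X_{m,d}$ with $\ell\subset\mathbb{P}^m$ a line, such that $\deg((\mathcal{S}\cup\mathcal{Z})\cap C_d)\ge d+2$. Setting $$\mathcal{S}_1=\mathcal{S}\cap C_d,\qquad \mathcal{Z}_1=\mathcal{Z}\cap C_d,\qquad \mathcal{S}_2=(\mathcal{S}\cap\mathcal{Z})\setminus\mathcal{S}_1,$$ one has $$\mathcal{S}=\mathcal{S}_1\sqcup\mathcal{S}_2,\qquad \mathcal{Z}=\mathcal{Z}_1\sqcup\mathcal{S}_2 .$$ Moreover $\deg(\mathcal{Z})=\mathrm{sbr}(P)$, and the scheme $\mathcal{S}_2$ is unique, i.e. it depends only on $P$ and not on the choice of a $0$-dimensional reduced subscheme $\mathcal{S}\subset X_{m,d}$ with $P\in\langle\mathcal{S}\rangle$ and $\sharp(\mathcal{S})=\mathrm{sr}(P)$,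 nor on the choice of a smoothable $0$-dimensional non-reduced subscheme $\mathcal{Z}\subset X_{m,d}$ with $P\in\langle\mathcal{Z}\rangle$ and $\deg(\mathcal{Z})\le\mathrm{sbr}(P)$.
   Context: $K$ is an algebraically closed field of characteristic $0$; all schemes are over $K$. $\nu_d:\mathbb{P}^m\to\mathbb{P}^N$, $N=\binom{m+d}{d}-1$, is the $d$-uple Veronese embedding and $X_{m,d}=\nu_d(\mathbb{P}^m)$. The linear span $\langle\mathcal{W}\rangle$ of a closed subscheme $\mathcal{W}\subset\mathbb{P}^N$ is the smallest linear subspace containing $\mathcal{W}$ as a scheme. $\sigma_s(X_{m,d})$ is the Zariski closure of the union of all linear spans $\langle P_1,\dots,P_s\rangle$ with $P_1,\dots,P_s\in X_{m,d}$. The symmetric border rank $\mathrm{sbr}(P)$ is the minimal $s$ with $P\in\sigma_s(X_{m,d})$. The symmetric rank $\mathrm{sr}(P)$ is the minimal cardinality of a finite set $\mathcal{S}\subset X_{m,d}$ with $P\in\langle\mathcal{S}\rangle$. A $0$-dimensional scheme is smoothable if it is a flat limit of reduced finite schemes of the same degree. Unions and intersections are scheme-theoretic; $\sqcup$ denotes a disjoint union of schemes. The complement $(\mathcal{S}\cap\mathcal{Z})\setminus\mathcal{S}_1$ is a finite reduced set of points, since $\mathcal{S}$ is reduced. *)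

theory Defs
  imports
    "HOL-Library.Poly_Mapping"
    "HOL-Library.Function_Algebras"
    "HOL-Computational_Algebra.Polynomial"
    "HOL-Algebra.Ideal"
begin

section \<open>Polynomials in a finite set of variables\<close>

text \<open>A polynomial over \<open>'a\<close> in variables of type \<open>'v\<close> is a finitely supported function from
  exponent vectors to coefficients. The variables actually allowed are collected in a set \<open>V\<close>,
  which below is always finite, and \<open>K[V]\<close> is a record of HOL-Algebra.\<close>

type_synonym ('v, 'a) mpoly = "('v \<Rightarrow>\<^sub>0 nat) \<Rightarrow>\<^sub>0 'a"

definition poly_ring :: "'v set \<Rightarrow> ('v, 'a::comm_ring_1) mpoly ring" where
  "poly_ring V = \<lparr>carrier = {f. \<forall>\<alpha>\<in>Poly_Mapping.keys f. Poly_Mapping.keys \<alpha> \<subseteq> V},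
     mult = (*), one = 1, zero = 0, add = (+)\<rparr>"

definition Const :: "'a::zero \<Rightarrow> ('v, 'a) mpoly" where
  "Const c = Poly_Mapping.single 0 c"

definition Var :: "'v \<Rightarrow> ('v, 'a::zero_neq_one) mpoly" where
  "Var v = Poly_Mapping.single (Poly_Mapping.single v 1) 1"

text \<open>Evaluation at \<open>x\<close>, where coefficients are first mapped along \<open>h\<close>: \<open>h = id\<close> gives the value
  at a vector, \<open>h = Const\<close> gives substitution of polynomials.\<close>

definition eval_via :: "('a::zero \<Rightarrow> 'b::comm_semiring_1) \<Rightarrow> ('v \<Rightarrow> 'b) \<Rightarrow> ('v, 'a) mpoly \<Rightarrow> 'b" where
  "eval_via h x f = (\<Sum>\<alpha>\<in>Poly_Mapping.keys f. h (Poly_Mapping.lookup f \<alpha>) *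
     (\<Prod>v\<in>Poly_Mapping.keys \<alpha>. x v ^ Poly_Mapping.lookup \<alpha> v))"

abbreviation eval_at :: "('v \<Rightarrow> 'a::comm_semiring_1) \<Rightarrow> ('v, 'a) mpoly \<Rightarrow> 'a" where
  "eval_at \<equiv> eval_via id"

text \<open>Degrees are taken with respect to the variables in \<open>V\<close> only; other variables count as
  scalars.\<close>

definition deg_in :: "'v set \<Rightarrow> ('v \<Rightarrow>\<^sub>0 nat) \<Rightarrow> nat" where
  "deg_in V \<alpha> = (\<Sum>v\<in>Poly_Mapping.keys \<alpha> \<inter> V. Poly_Mapping.lookup \<alpha> v)"

definition monomials :: "'v set \<Rightarrow> nat \<Rightarrow> ('v \<Rightarrow>\<^sub>0 nat) set" where
  "monomials V e = {\<alpha>. Poly_Mapping.keys \<alpha> \<subseteq> V \<and> deg_in V \<alpha> = e}"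

definition forms :: "'v set \<Rightarrow> nat \<Rightarrow> ('v, 'a::comm_ring_1) mpoly set" where
  "forms V e = {f. Poly_Mapping.keys f \<subseteq> monomials V e}"

definition hom_part :: "'v set \<Rightarrow> nat \<Rightarrow> ('v, 'a::comm_ring_1) mpoly \<Rightarrow> ('v, 'a) mpoly" where
  "hom_part V e f = (\<Sum>\<alpha> | \<alpha> \<in> Poly_Mapping.keys f \<and> deg_in V \<alpha> = e.
     Poly_Mapping.single \<alpha> (Poly_Mapping.lookup f \<alpha>))"

definition homogeneous_wrt :: "'v set \<Rightarrow> ('v, 'a::comm_ring_1) mpoly set \<Rightarrow> bool" where
  "homogeneous_wrt V I \<longleftrightarrow> (\<forall>f\<in>I. \<forall>e. hom_part V e f \<in> I)"


section \<open>Projective space and its points\<close>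

definition vec_scale :: "'a::field \<Rightarrow> ('v \<Rightarrow> 'a) \<Rightarrow> 'v \<Rightarrow> 'a" where
  "vec_scale c x = (\<lambda>v. c * x v)"

definition poly_scale :: "'a::field \<Rightarrow> ('v, 'a) mpoly \<Rightarrow> ('v, 'a) mpoly" where
  "poly_scale c f = Const c * f"

global_interpretation vec: vector_space "vec_scale :: 'a::field \<Rightarrow> ('v \<Rightarrow> 'a) \<Rightarrow> _"
  by unfold_locales (simp_all add: vec_scale_def fun_eq_iff distrib_left distrib_right mult.assoc)

global_interpretation mpoly: vector_space "poly_scale :: 'a::field \<Rightarrow> ('v, 'a) mpoly \<Rightarrow> _"
proof
  fix a b :: 'a and f g :: "('v, 'a) mpoly"
  show "poly_scale a (f + g) = poly_scale a f + poly_scale a g"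
    by (simp add: poly_scale_def distrib_left)
  show "poly_scale (a + b) f = poly_scale a f + poly_scale b f"
    by (simp add: poly_scale_def Const_def single_add distrib_right)
  show "poly_scale a (poly_scale b f) = poly_scale (a * b) f"
    by (simp add: poly_scale_def Const_def mult_single mult.assoc[symmetric])
  show "poly_scale 1 f = f"
    by (simp add: poly_scale_def Const_def)
qed

text \<open>The vector space \<open>K\<^sup>V\<close> consists of the functions supported in \<open>V\<close>. The projective space
  \<open>proj_space V\<close>, of dimension \<open>card V - 1\<close>, has homogeneous coordinates indexed by \<open>V\<close>; a point is
  the set of all its (nonzero) coordinate vectors.\<close>

definition vecs :: "'v set \<Rightarrow> ('v \<Rightarrow> 'a::zero) set" where
  "vecs V = {x. \<forall>v. v \<notin> V \<longrightarrow> x v = 0}"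

definition proj_rel :: "'v set \<Rightarrow> (('v \<Rightarrow> 'a::field) \<times> ('v \<Rightarrow> 'a)) set" where
  "proj_rel V = {(x, y). x \<in> vecs V - {0} \<and> y \<in> vecs V - {0} \<and> (\<exists>c. c \<noteq> 0 \<and> y = vec_scale c x)}"

definition proj_space :: "'v set \<Rightarrow> ('v \<Rightarrow> 'a::field) set set" where
  "proj_space V = (vecs V - {0}) // proj_rel V"

text \<open>The projectivization of a vector subspace \<open>L\<close> of \<open>K\<^sup>V\<close>, as a set of points.\<close>

definition projectivization :: "'v set \<Rightarrow> ('v \<Rightarrow> 'a::field) set \<Rightarrow> ('v \<Rightarrow> 'a) set set" where
  "projectivization V L = {p \<in> proj_space V. p \<subseteq> L}"

definition line :: "'v set \<Rightarrow> ('v \<Rightarrow> 'a::field) set set \<Rightarrow> bool" where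
  "line V l \<longleftrightarrow> (\<exists>L. L \<subseteq> vecs V \<and> vec.subspace L \<and> vec.dim L = 2 \<and> l = projectivization V L)"


section \<open>Closed subschemes of projective space\<close>

text \<open>A closed subscheme of the projective space with coordinates \<open>V\<close> is represented by its
  saturated homogeneous ideal in \<open>K[V]\<close>. This correspondence is a bijection reversing inclusions,
  so that the scheme of \<open>I\<close> is contained in that of \<open>J\<close> iff \<open>J \<subseteq> I\<close>, and the empty scheme is
  the unit ideal.\<close>

definition saturation :: "'v set \<Rightarrow> ('v, 'a::comm_ring_1) mpoly set \<Rightarrow> ('v, 'a) mpoly set" where
  "saturation V I = {f \<in> carrier (poly_ring V). \<exists>e. \<forall>g\<in>forms V e. g * f \<in> I}"

definition closed_subscheme :: "'v set \<Rightarrow> ('v, 'a::field) mpoly set \<Rightarrow> bool" where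
  "closed_subscheme V I \<longleftrightarrow>
     ideal I (poly_ring V) \<and> homogeneous_wrt V I \<and> saturation V I = I"

definition subscheme_of :: "('v, 'a::field) mpoly set \<Rightarrow> ('v, 'a) mpoly set \<Rightarrow> bool" where
  "subscheme_of I J \<longleftrightarrow> J \<subseteq> I"

definition empty_scheme :: "'v set \<Rightarrow> ('v, 'a::field) mpoly set" where
  "empty_scheme V = carrier (poly_ring V)"

definition scheme_union :: "('v, 'a::field) mpoly set \<Rightarrow> ('v, 'a) mpoly set \<Rightarrow> ('v, 'a) mpoly set" where
  "scheme_union I J = I \<inter> J"

definition scheme_inter ::
  "'v set \<Rightarrow> ('v, 'a::field) mpoly set \<Rightarrow> ('v, 'a) mpoly set \<Rightarrow> ('v, 'a) mpoly set" where
  "scheme_inter V I J = saturation V (Idl\<^bsub>poly_ring V\<^esub> (I \<union> J))"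

definition is_disjoint_union ::
  "'v set \<Rightarrow> ('v, 'a::field) mpoly set \<Rightarrow> ('v, 'a) mpoly set \<Rightarrow> ('v, 'a) mpoly set \<Rightarrow> bool" where
  "is_disjoint_union V I I1 I2 \<longleftrightarrow>
     I = scheme_union I1 I2 \<and> scheme_inter V I1 I2 = empty_scheme V"

definition scheme_points :: "'v set \<Rightarrow> ('v, 'a::field) mpoly set \<Rightarrow> ('v \<Rightarrow> 'a) set set" where
  "scheme_points V I = {p \<in> proj_space V. \<forall>f\<in>I. \<forall>x\<in>p. eval_at x f = 0}"

text \<open>The ideal of the Zariski closure of a set of points, with its reduced scheme structure. (Over
  an infinite field it is homogeneous, since it asks for vanishing on all coordinate vectors.)\<close>

definition vanishing_ideal :: "'v set \<Rightarrow> ('v \<Rightarrow> 'a::field) set set \<Rightarrow> ('v, 'a) mpoly set" where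
  "vanishing_ideal V A = {f \<in> carrier (poly_ring V). \<forall>p\<in>A. \<forall>x\<in>p. eval_at x f = 0}"

definition zariski_closure :: "'v set \<Rightarrow> ('v \<Rightarrow> 'a::field) set set \<Rightarrow> ('v \<Rightarrow> 'a) set set" where
  "zariski_closure V A = scheme_points V (vanishing_ideal V A)"

definition reduced :: "'v set \<Rightarrow> ('v, 'a::field) mpoly set \<Rightarrow> bool" where
  "reduced V I \<longleftrightarrow> (\<forall>f\<in>carrier (poly_ring V). \<forall>k. f ^ k \<in> I \<longrightarrow> f \<in> I)"

text \<open>The Hilbert function, i.e. the dimension of the degree \<open>e\<close> part of \<open>K[V]/I\<close>. A scheme is
  \<open>0\<close>-dimensional if its Hilbert polynomial is a nonzero constant, which is then its degree. The
  empty scheme has degree \<open>0\<close>; the degree is meaningless in positive dimension.\<close>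

definition hilbert_fun :: "'v set \<Rightarrow> ('v, 'a::field) mpoly set \<Rightarrow> nat \<Rightarrow> nat" where
  "hilbert_fun V I e = mpoly.dim (forms V e :: ('v, 'a) mpoly set) - mpoly.dim (I \<inter> forms V e)"

definition zero_dimensional :: "'v set \<Rightarrow> ('v, 'a::field) mpoly set \<Rightarrow> bool" where
  "zero_dimensional V I \<longleftrightarrow> (\<exists>r>0. \<forall>\<^sub>F e in sequentially. hilbert_fun V I e = r)"

definition scheme_degree :: "'v set \<Rightarrow> ('v, 'a::field) mpoly set \<Rightarrow> nat" where
  "scheme_degree V I = (THE r. \<forall>\<^sub>F e in sequentially. hilbert_fun V I e = r)"

text \<open>The linear span of a scheme is the smallest linear subspace containing it as a scheme; linear
  subspaces carry their reduced structure. The span is returned as a set of points.\<close>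

definition linear_span :: "'v set \<Rightarrow> ('v, 'a::field) mpoly set \<Rightarrow> ('v \<Rightarrow> 'a) set set" where
  "linear_span V I = \<Inter>{projectivization V L | L. L \<subseteq> vecs V \<and> vec.subspace L \<and>
     subscheme_of I (vanishing_ideal V (projectivization V L))}"


section \<open>Smoothable schemes\<close>

text \<open>Affine varieties are sets of \<open>K\<close>-points \<open>T \<subseteq> K\<^sup>U\<close>.\<close>

definition affine_closed :: "'v set \<Rightarrow> ('v \<Rightarrow> 'a::field) set \<Rightarrow> bool" where
  "affine_closed U T \<longleftrightarrow>
     (\<exists>F \<subseteq> carrier (poly_ring U). T = {x \<in> vecs U. \<forall>f\<in>F. eval_at x f = 0})"

definition affine_variety :: "'v set \<Rightarrow> ('v \<Rightarrow> 'a::field) set \<Rightarrow> bool" where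
  "affine_variety U T \<longleftrightarrow> affine_closed U T \<and> T \<noteq> {} \<and>
     (\<forall>C1 C2. affine_closed U C1 \<and> affine_closed U C2 \<and> T \<subseteq> C1 \<union> C2 \<longrightarrow> T \<subseteq> C1 \<or> T \<subseteq> C2)"

definition affine_ideal :: "'v set \<Rightarrow> ('v \<Rightarrow> 'a::field) set \<Rightarrow> ('v, 'a) mpoly set" where
  "affine_ideal U T = {f \<in> carrier (poly_ring U). \<forall>x\<in>T. eval_at x f = 0}"

text \<open>Let \<open>A \<subseteq> B\<close> be subrings of a commutative ring, with ideals \<open>a\<close> of \<open>A\<close> and \<open>b\<close> of \<open>B\<close> such
  that \<open>a \<subseteq> b\<close>. The following says that \<open>B/b\<close> is a flat module over \<open>A/a\<close>, in the elementwise
  form of flatness: every linear relation among elements of \<open>B/b\<close> with coefficients in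
  \<open>A/a\<close> is a consequence of relations in \<open>A/a\<close>.\<close>

definition flat_quotient ::
  "'r::comm_ring_1 set \<Rightarrow> 'r set \<Rightarrow> 'r set \<Rightarrow> 'r set \<Rightarrow> bool" where
  "flat_quotient A a B b \<longleftrightarrow>
     (\<forall>(n::nat) r s. (\<forall>i<n. r i \<in> A \<and> s i \<in> B) \<and> (\<Sum>i<n. r i * s i) \<in> b \<longrightarrow>
        (\<exists>(k::nat) c y. (\<forall>j<k. y j \<in> B) \<and> (\<forall>i<n. \<forall>j<k. c i j \<in> A) \<and>
           (\<forall>i<n. s i - (\<Sum>j<k. c i j * y j) \<in> b) \<and>
           (\<forall>j<k. (\<Sum>i<n. r i * c i j) \<in> a)))"

text \<open>Let \<open>T\<close> be an affine variety in \<open>K\<^sup>k\<close>, whose coordinates are the variables \<open>Inl i\<close> with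
  \<open>i < k\<close>. A closed subscheme of the product of \<open>T\<close> with the projective space with coordinates \<open>V\<close>
  is given by an ideal \<open>J\<close> in the variables \<open>Inl i\<close> and \<open>Inr v\<close> that contains the ideal of \<open>T\<close>
  and is homogeneous in the variables \<open>Inr v\<close>. It is flat over \<open>T\<close> if for every \<open>v\<close> the coordinate
  ring of its affine chart \<open>Inr v \<noteq> 0\<close>, obtained by setting \<open>Inr v = 1\<close>, is flat over \<open>K[T]\<close>.\<close>

definition base_vars :: "nat \<Rightarrow> (nat + 'v) set" where
  "base_vars k = Inl ` {..<k}"

definition family ::
  "nat \<Rightarrow> 'v set \<Rightarrow> (nat + 'v \<Rightarrow> 'a::field) set \<Rightarrow> (nat + 'v, 'a) mpoly set \<Rightarrow> bool" where
  "family k V T J \<longleftrightarrow> ideal J (poly_ring (base_vars k \<union> Inr ` V)) \<and>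
     affine_ideal (base_vars k) T \<subseteq> J \<and> homogeneous_wrt (Inr ` V) J"

definition flat_family ::
  "nat \<Rightarrow> 'v set \<Rightarrow> (nat + 'v \<Rightarrow> 'a::field) set \<Rightarrow> (nat + 'v, 'a) mpoly set \<Rightarrow> bool" where
  "flat_family k V T J \<longleftrightarrow> family k V T J \<and>
     (\<forall>v\<in>V. let R = poly_ring (base_vars k \<union> Inr ` V) in
        flat_quotient (carrier (poly_ring (base_vars k))) (affine_ideal (base_vars k) T)
          (carrier R) (Idl\<^bsub>R\<^esub> (J \<union> {Var (Inr v) - 1})))"

definition fibre ::
  "'v set \<Rightarrow> (nat + 'v, 'a::field) mpoly set \<Rightarrow> (nat + 'v \<Rightarrow> 'a) \<Rightarrow> ('v, 'a) mpoly set" where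
  "fibre V J t = saturation V
     (eval_via Const (case_sum (\<lambda>i. Const (t (Inl i))) Var) ` J)"

text \<open>A scheme is smoothable if it is a fibre of a flat family over an irreducible base whose general
  fibres, i.e. those over a nonempty Zariski open subset \<open>T - C\<close>, are reduced and finite of the same
  degree.\<close>

definition smoothable :: "'v set \<Rightarrow> ('v, 'a::field) mpoly set \<Rightarrow> bool" where
  "smoothable V I \<longleftrightarrow> (\<exists>k T J t0 C. affine_variety (base_vars k) T \<and> flat_family k V T J \<and>
     t0 \<in> T \<and> fibre V J t0 = I \<and>
     affine_closed (base_vars k) C \<and> T - C \<noteq> {} \<and>
     (\<forall>t\<in>T - C. reduced V (fibre V J t) \<and> zero_dimensional V (fibre V J t) \<and>
        scheme_degree V (fibre V J t) = scheme_degree V I))"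


section \<open>Veronese varieties, symmetric rank and symmetric border rank\<close>

text \<open>The homogeneous coordinates of \<open>\<PP>\<^sup>m\<close> are indexed by \<open>{..m}\<close>, and those of the target \<open>\<PP>\<^sup>N\<close> of
  the \<open>d\<close>-uple embedding by the monomials of degree \<open>d\<close> in them; the following lemma confirms the
  value of \<open>N\<close>.\<close>

abbreviation Ver_coords :: "nat \<Rightarrow> nat \<Rightarrow> (nat \<Rightarrow>\<^sub>0 nat) set" where
  "Ver_coords m d \<equiv> monomials {..m} d"

lemma card_Ver_coords: "card (Ver_coords m d) = (m + d) choose d"
proof -
  let ?L = "{l::nat list. length l = Suc m \<and> sum_list l = d}"
  let ?f = "\<lambda>\<alpha>::nat \<Rightarrow>\<^sub>0 nat. map (Poly_Mapping.lookup \<alpha>) [0..<Suc m]"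
  have deg: "deg_in {..m} \<alpha> = sum_list (?f \<alpha>)" for \<alpha> :: "nat \<Rightarrow>\<^sub>0 nat"
  proof -
    have "deg_in {..m} \<alpha> = (\<Sum>v\<in>{..m}. Poly_Mapping.lookup \<alpha> v)"
      unfolding deg_in_def by (rule sum.mono_neutral_left) (auto simp: in_keys_iff)
    also have "\<dots> = (\<Sum>v\<in>set [0..<Suc m]. Poly_Mapping.lookup \<alpha> v)"
      by (rule sum.cong) auto
    also have "\<dots> = sum_list (?f \<alpha>)"
      by (rule sum_list_distinct_conv_sum_set[symmetric]) simp
    finally show ?thesis .
  qed
  have "bij_betw ?f (Ver_coords m d) ?L"
  proof (rule bij_betwI')
    fix \<alpha> \<beta> assume *: "\<alpha> \<in> Ver_coords m d" "\<beta> \<in> Ver_coords m d"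
    show "?f \<alpha> = ?f \<beta> \<longleftrightarrow> \<alpha> = \<beta>"
    proof
      assume eq: "?f \<alpha> = ?f \<beta>"
      have "Poly_Mapping.lookup \<alpha> v = Poly_Mapping.lookup \<beta> v" for v
      proof (cases "v \<le> m")
        case True
        then show ?thesis using eq by (auto simp del: upt_Suc)
      next
        case False
        then have "v \<notin> Poly_Mapping.keys \<alpha>" "v \<notin> Poly_Mapping.keys \<beta>"
          using * by (auto simp: monomials_def)
        then show ?thesis by (simp add: in_keys_iff)
      qed
      then show "\<alpha> = \<beta>" by (intro poly_mapping_eqI)
    qed auto
  next
    fix \<alpha> assume "\<alpha> \<in> Ver_coords m d"
    then have "deg_in {..m} \<alpha> = d"
      by (simp add: monomials_def)
    then show "?f \<alpha> \<in> ?L"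
      unfolding deg by simp
  next
    fix l assume l: "l \<in> ?L"
    define \<alpha> where "\<alpha> = Abs_poly_mapping (\<lambda>i. if i < length l then l ! i else 0)"
    have "finite {i. (if i < length l then l ! i else 0) \<noteq> 0}"
      by (rule finite_subset[of _ "{..<length l}"]) (auto split: if_splits)
    then have \<alpha>: "Poly_Mapping.lookup \<alpha> = (\<lambda>i. if i < length l then l ! i else 0)"
      unfolding \<alpha>_def by (rule lookup_Abs_poly_mapping)
    have f: "?f \<alpha> = l"
      using l by (intro nth_equalityI) (auto simp: \<alpha> simp del: upt_Suc)
    have "deg_in {..m} \<alpha> = d"
      unfolding deg f using l by simp
    moreover have "Poly_Mapping.keys \<alpha> \<subseteq> {..m}"
      using l by (auto simp: in_keys_iff \<alpha> split: if_splits)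
    ultimately have "\<alpha> \<in> Ver_coords m d"
      by (simp add: monomials_def)
    with f[symmetric] show "\<exists>\<alpha>\<in>Ver_coords m d. l = ?f \<alpha>"
      by (rule bexI)
  qed
  then have "card (Ver_coords m d) = card ?L"
    by (rule bij_betw_same_card)
  then show ?thesis
    using card_length_sum_list[of "Suc m" d] by (simp add: add.commute[of d m])
qed

definition veronese_vec :: "nat \<Rightarrow> nat \<Rightarrow> (nat \<Rightarrow> 'a::field) \<Rightarrow> (nat \<Rightarrow>\<^sub>0 nat) \<Rightarrow> 'a" where
  "veronese_vec m d x = (\<lambda>\<alpha>. if \<alpha> \<in> Ver_coords m d
     then \<Prod>i\<in>Poly_Mapping.keys \<alpha>. x i ^ Poly_Mapping.lookup \<alpha> i else 0)"

definition veronese ::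
  "nat \<Rightarrow> nat \<Rightarrow> (nat \<Rightarrow> 'a::field) set \<Rightarrow> ((nat \<Rightarrow>\<^sub>0 nat) \<Rightarrow> 'a) set" where
  "veronese m d p = proj_rel (Ver_coords m d) `` (veronese_vec m d ` p)"

definition Ver :: "nat \<Rightarrow> nat \<Rightarrow> ((nat \<Rightarrow>\<^sub>0 nat) \<Rightarrow> 'a::field) set set" where
  "Ver m d = veronese m d ` proj_space {..m}"

definition in_Ver :: "nat \<Rightarrow> nat \<Rightarrow> (nat \<Rightarrow>\<^sub>0 nat, 'a::field) mpoly set \<Rightarrow> bool" where
  "in_Ver m d I \<longleftrightarrow> closed_subscheme (Ver_coords m d) I \<and>
     subscheme_of I (vanishing_ideal (Ver_coords m d) (Ver m d))"

definition points_span ::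
  "'v set \<Rightarrow> ('v \<Rightarrow> 'a::field) set set \<Rightarrow> ('v \<Rightarrow> 'a) set set" where
  "points_span V A = linear_span V (vanishing_ideal V A)"

definition secant_variety :: "nat \<Rightarrow> nat \<Rightarrow> nat \<Rightarrow> ((nat \<Rightarrow>\<^sub>0 nat) \<Rightarrow> 'a::field) set set" where
  "secant_variety m d s = zariski_closure (Ver_coords m d)
     (\<Union>p \<in> {..<s} \<rightarrow> Ver m d. points_span (Ver_coords m d) (p ` {..<s}))"

definition sbr :: "nat \<Rightarrow> nat \<Rightarrow> ((nat \<Rightarrow>\<^sub>0 nat) \<Rightarrow> 'a::field) set \<Rightarrow> nat" where
  "sbr m d P = (LEAST s. P \<in> secant_variety m d s)"

definition sr :: "nat \<Rightarrow> nat \<Rightarrow> ((nat \<Rightarrow>\<^sub>0 nat) \<Rightarrow> 'a::field) set \<Rightarrow> nat" where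
  "sr m d P = (LEAST s. \<exists>A. A \<subseteq> Ver m d \<and> finite A \<and> card A = s \<and>
     P \<in> points_span (Ver_coords m d) A)"

definition computes_sr ::
  "nat \<Rightarrow> nat \<Rightarrow> ((nat \<Rightarrow>\<^sub>0 nat) \<Rightarrow> 'a::field) set \<Rightarrow> (nat \<Rightarrow>\<^sub>0 nat, 'a) mpoly set \<Rightarrow> bool" where
  "computes_sr m d P S \<longleftrightarrow> in_Ver m d S \<and> zero_dimensional (Ver_coords m d) S \<and>
     reduced (Ver_coords m d) S \<and> P \<in> linear_span (Ver_coords m d) S \<and>
     card (scheme_points (Ver_coords m d) S) = sr m d P"

definition bounded_by_sbr ::
  "nat \<Rightarrow> nat \<Rightarrow> ((nat \<Rightarrow>\<^sub>0 nat) \<Rightarrow> 'a::field) set \<Rightarrow> (nat \<Rightarrow>\<^sub>0 nat, 'a) mpoly set \<Rightarrow> bool" where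
  "bounded_by_sbr m d P Z \<longleftrightarrow> in_Ver m d Z \<and> zero_dimensional (Ver_coords m d) Z \<and>
     smoothable (Ver_coords m d) Z \<and> \<not> reduced (Ver_coords m d) Z \<and>
     P \<in> linear_span (Ver_coords m d) Z \<and> scheme_degree (Ver_coords m d) Z \<le> sbr m d P"

definition rational_normal_curve :: "nat \<Rightarrow> nat \<Rightarrow> (nat \<Rightarrow>\<^sub>0 nat, 'a::field) mpoly set \<Rightarrow> bool" where
  "rational_normal_curve m d C \<longleftrightarrow>
     (\<exists>l. line {..m} l \<and> C = vanishing_ideal (Ver_coords m d) (veronese m d ` l))"

definition special_curve ::
  "nat \<Rightarrow> nat \<Rightarrow> (nat \<Rightarrow>\<^sub>0 nat, 'a::field) mpoly set \<Rightarrow> (nat \<Rightarrow>\<^sub>0 nat, 'a) mpoly set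
    \<Rightarrow> (nat \<Rightarrow>\<^sub>0 nat, 'a) mpoly set \<Rightarrow> bool" where
  "special_curve m d S Z C \<longleftrightarrow> rational_normal_curve m d C \<and>
     d + 2 \<le> scheme_degree (Ver_coords m d) (scheme_inter (Ver_coords m d) (scheme_union S Z) C)"

text \<open>The scheme \<open>(S \<inter> Z) \ (S \<inter> C)\<close>; the complement is taken on points, which determine it as
  \<open>S\<close> is finite and reduced.\<close>

definition common_part ::
  "nat \<Rightarrow> nat \<Rightarrow> (nat \<Rightarrow>\<^sub>0 nat, 'a::field) mpoly set \<Rightarrow> (nat \<Rightarrow>\<^sub>0 nat, 'a) mpoly set
    \<Rightarrow> (nat \<Rightarrow>\<^sub>0 nat, 'a) mpoly set \<Rightarrow> (nat \<Rightarrow>\<^sub>0 nat, 'a) mpoly set" where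
  "common_part m d S Z C = (let W = Ver_coords m d in
     vanishing_ideal W (scheme_points W (scheme_inter W S Z) - scheme_points W (scheme_inter W S C)))"

end

theory Submission
  imports Defs
begin

text \<open>
  A finite subscheme of the Veronese variety is studied through its Macaulay dual: the space of linear
  functionals on the polynomial ring of \<open>\<PP>\<^sup>m\<close> that kill its ideal and are normalized by a linear form
  \<open>L\<close> without zeros on the scheme. Polynomials act on functionals, and schemes of degree \<open>r\<close> correspond
  to \<open>r\<close>-dimensional subspaces closed under this action (\<open>scheme_duality\<close>, \<open>perp_apolar\<close>). Unions
  become sums and intersections become intersections (\<open>scheme_inter_apolar\<close>), a reduced scheme is spanned
  by evaluations at its points (\<open>reduced_span_ev\<close>), and a point in the span of a scheme is the degree \<open>d\<close>
  part of one of its functionals (\<open>span_functional\<close>).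

  So the point \<open>P\<close> is the degree \<open>d\<close> part of a functional \<open>lamS\<close> of \<open>S\<close> and of a functional \<open>lamZ\<close> of
  \<open>Z\<close>. Their difference \<open>mu\<close> vanishes in degree \<open>d\<close>. It is not zero, since otherwise \<open>Z\<close> would contain
  all points of \<open>S\<close>. Its orbit lives on \<open>S \<union> Z\<close> and therefore has dimension at most
  \<open>sbr P + sr P \<le> 2 d + 1\<close>. On the other hand the derivatives of \<open>mu\<close> by forms of degree \<open>0, 1, \<dots>, d + 1\<close>
  form strictly increasing spaces, so that every nonzero functional vanishing in degree \<open>d\<close> has an orbit
  of dimension at least \<open>d + 2\<close> (\<open>dim_orbit_ge\<close>). Playing the two bounds against each other, by induction
  on \<open>d\<close>, shows that \<open>mu\<close> lives on a line (\<open>dim_tangent_le_2\<close>, \<open>functional_on_line\<close>). This is the line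
  of the theorem, and \<open>d + 2\<close> is the lower bound for the degree of \<open>S \<union> Z\<close> on it.

  Off the line the two functionals agree, so \<open>Z\<close> contains the points of \<open>S\<close> off the line. The rest of
  \<open>lamZ\<close> lives on the line, where an orbit of dimension \<open>e\<close> is a limit of combinations of \<open>e\<close> distinct
  evaluations: let the roots of its annihilating polynomial move apart (\<open>deform_recurrence\<close>,
  \<open>secant_varietyI\<close>). The border rank of \<open>P\<close> is thus at most the degree of the part of \<open>Z\<close> that has
  been accounted for. As \<open>Z\<close> has degree at most the border rank, nothing else is left in \<open>Z\<close>, and its
  degree is the border rank (\<open>exists_decomposition\<close>).

  Uniqueness of the line is a dimension count, because two lines have at most one functional in common
  up to scalars (\<open>line_unique\<close>). For two pairs \<open>(S, Z)\<close> and \<open>(S', Z')\<close> the mixed pair \<open>(S, Z')\<close>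
  satisfies the same hypotheses. Its line is the line of \<open>(S', Z')\<close>, since a scheme that decomposes along
  two lines is reduced, contrary to \<open>sbr P < sr P\<close> (\<open>same_line\<close>). Its line is also the line of
  \<open>(S, Z)\<close>, by counting the points of \<open>S\<close> on and off the two lines. Finally the points of \<open>S\<close> off the
  line are read off from \<open>Z'\<close> as its points off the line (\<open>off_line_points_unique\<close>).
\<close>

section \<open>Finite-dimensional subspaces of arbitrary vector spaces\<close>

locale findim_space = vector_space
begin

definition findim :: "'b set \<Rightarrow> bool" where
  "findim V \<longleftrightarrow> (\<exists>B. finite B \<and> V \<subseteq> span B)"

lemma findim_subset: "S \<subseteq> T \<Longrightarrow> findim T \<Longrightarrow> findim S"
  unfolding findim_def by blast

lemma findim_span: "finite B \<Longrightarrow> findim (span B)"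
  unfolding findim_def by blast

lemma findim_independent:
  assumes "findim V" "independent B" "B \<subseteq> V"
  shows "finite B \<and> card B \<le> dim V"
proof -
  obtain C where C: "finite C" "V \<subseteq> span C" using assms(1) unfolding findim_def by blast
  obtain D where D: "D \<subseteq> V" "independent D" "V \<subseteq> span D" "card D = dim V"
    using basis_exists by blast
  have "finite D" using independent_span_bound[OF C(1) D(2)] C(2) D(1) by blast
  then show ?thesis
    using independent_span_bound[OF _ assms(2), of D] assms(3) D(3,4) by force
qed

lemma findim_basis:
  assumes "findim V"
  obtains B where "finite B" "independent B" "B \<subseteq> V" "V \<subseteq> span B" "card B = dim V"
proof -
  obtain D where D: "D \<subseteq> V" "independent D" "V \<subseteq> span D" "card D = dim V"
    using basis_exists by blast
  then show ?thesis using that findim_independent[OF assms D(2,1)] by blast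
qed

lemma findim_dim_mono:
  assumes "S \<subseteq> T" "findim T" shows "dim S \<le> dim T"
proof -
  obtain B where "B \<subseteq> S" "independent B" "card B = dim S"
    using findim_basis[OF findim_subset[OF assms]] by metis
  then show ?thesis using findim_independent[OF assms(2), of B] assms(1) by auto
qed

lemma findim_eqI:
  assumes "subspace S" "S \<subseteq> T" "findim T" "dim T \<le> dim S"
  shows "S = T"
proof (rule ccontr)
  assume "S \<noteq> T"
  then obtain x where x: "x \<in> T" "x \<notin> S" using assms(2) by blast
  obtain B where B: "finite B" "B \<subseteq> S" "independent B" "S \<subseteq> span B" "card B = dim S"
    using findim_basis[OF findim_subset[OF assms(2,3)]] by metis
  have "span B \<subseteq> S" using B assms(1) by (simp add: span_minimal)
  then have "x \<notin> span B" using x by blast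
  then have "independent (insert x B)" "x \<notin> B"
    using B independent_insertI span_base by blast+
  then have "card (insert x B) \<le> dim T"
    using findim_independent[OF assms(3), of "insert x B"] B(2) assms(2) x(1) by blast
  then show False using B \<open>x \<notin> B\<close> assms(4) by simp
qed

lemma findim_if_independent_bounded:
  assumes "\<And>B. finite B \<Longrightarrow> independent B \<Longrightarrow> B \<subseteq> V \<Longrightarrow> card B \<le> n"
  shows "findim V"
proof -
  obtain B where B: "B \<subseteq> V" "independent B" "V \<subseteq> span B"
    using maximal_independent_subset by blast
  have "finite B"
  proof (rule ccontr)
    assume "infinite B"
    then obtain C where "C \<subseteq> B" "finite C" "card C = Suc n"
      using infinite_arbitrarily_large by blast
    then show False using assms[of C] B independent_mono by fastforce
  qed
  then show ?thesis using B(3) unfolding findim_def by blast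
qed

lemma findim_Un_span:
  assumes "findim S" "findim T"
  shows "findim (span (S \<union> T))"
proof -
  obtain B C where "finite B" "S \<subseteq> span B" "finite C" "T \<subseteq> span C"
    using assms unfolding findim_def by blast
  then have "S \<union> T \<subseteq> span (B \<union> C)" using span_mono[of B "B \<union> C"] span_mono[of C "B \<union> C"] by blast
  then have "span (S \<union> T) \<subseteq> span (B \<union> C)" by (simp add: span_minimal)
  then show ?thesis using \<open>finite B\<close> \<open>finite C\<close> unfolding findim_def by blast
qed

lemma dim_span_Un_le:
  assumes "findim S" "findim T"
  shows "dim (span (S \<union> T)) \<le> dim S + dim T"
proof -
  obtain B where B: "finite B" "S \<subseteq> span B" "card B = dim S" using findim_basis[OF assms(1)] by metis
  obtain C where C: "finite C" "T \<subseteq> span C" "card C = dim T" using findim_basis[OF assms(2)] by metis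
  have "S \<union> T \<subseteq> span (B \<union> C)"
    using B(2) C(2) span_mono[of B "B \<union> C"] span_mono[of C "B \<union> C"] by blast
  then have "span (S \<union> T) \<subseteq> span (B \<union> C)" by (simp add: span_minimal)
  then have "dim (span (S \<union> T)) \<le> card (B \<union> C)"
    by (rule dim_le_card) (use B C in auto)
  also have "\<dots> \<le> card B + card C" by (rule card_Un_le)
  finally show ?thesis using B C by simp
qed

text \<open>A basis of the intersection is extended to a basis of each summand; the two extensions
  together stay independent.\<close>

lemma dim_Int_ge:
  assumes S: "subspace S" and T: "subspace T" and "S \<subseteq> X" "T \<subseteq> X" and X: "findim X"
  shows "dim S + dim T \<le> dim X + dim (S \<inter> T)" "S \<inter> T = {0} \<Longrightarrow> dim S + dim T \<le> dim X"
proof -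
  have fS: "findim S" and fT: "findim T" using assms findim_subset by blast+
  obtain C where C: "finite C" "independent C" "C \<subseteq> S \<inter> T" "S \<inter> T \<subseteq> span C" "card C = dim (S \<inter> T)"
    using findim_basis[of "S \<inter> T"] findim_subset[OF _ fS] by (metis Int_lower1)
  have CS: "C \<subseteq> S" and CT: "C \<subseteq> T" using C(3) by auto
  obtain B where B: "C \<subseteq> B" "B \<subseteq> S" "independent B" "S \<subseteq> span B"
    using maximal_independent_subset_extend[OF CS C(2)] by metis
  obtain D where D: "C \<subseteq> D" "D \<subseteq> T" "independent D" "T \<subseteq> span D"
    using maximal_independent_subset_extend[OF CT C(2)] by metis
  have cB: "finite B" "card B = dim S" using findim_independent[OF fS B(3,2)] B basis_card_eq_dim by blast+
  have cD: "finite D" "card D = dim T" using findim_independent[OF fT D(3,2)] D basis_card_eq_dim by blast+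
  have sB: "span B \<subseteq> S" using B S by (simp add: span_minimal)
  have main: "E \<subseteq> D - C \<Longrightarrow> independent (B \<union> E) \<and> card (B \<union> E) = card B + card E" if "finite E" for E
    using that
  proof (induction E rule: finite_induct)
    case empty then show ?case using B by simp
  next
    case (insert x E)
    have "x \<notin> span (B \<union> E)"
    proof
      assume "x \<in> span (B \<union> E)"
      then obtain b e where be: "x = b + e" "b \<in> span B" "e \<in> span E" unfolding span_Un by auto
      have DE: "E \<subseteq> D - {x}" using insert by auto
      have "e \<in> T" using be(3) insert.prems D(2) T span_minimal[of E T] by auto
      moreover have "x \<in> T" using insert.prems D(2) by auto
      ultimately have "b \<in> T" using be(1) subspace_diff[OF T, of x e] by simp
      then have "b \<in> span C" using be(2) sB C(4) by auto
      then have "b \<in> span (D - {x})" using span_mono[of C "D - {x}"] D(1) insert.prems by auto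
      moreover have "e \<in> span (D - {x})" using be(3) DE span_mono by blast
      ultimately have "x \<in> span (D - {x})" using be(1) span_add by auto
      then show False using D(3) insert.prems unfolding dependent_def by auto
    qed
    then have "independent (insert x (B \<union> E))" "x \<notin> B \<union> E"
      using insert independent_insertI span_base by auto
    moreover have "finite (B \<union> E)" using cB insert by simp
    ultimately show ?case using insert by simp
  qed
  have "independent (B \<union> (D - C))" "card (B \<union> (D - C)) = card B + card (D - C)"
    using main[of "D - C"] cD by auto
  moreover have "B \<union> (D - C) \<subseteq> X" using B D assms by auto
  ultimately have "card B + card (D - C) \<le> dim X" using findim_independent[OF X] by metis
  moreover have "card (D - C) = card D - card C" "card C \<le> card D"
    using card_Diff_subset[OF C(1) D(1)] card_mono[OF cD(1) D(1)] by simp_all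
  ultimately show g: "dim S + dim T \<le> dim X + dim (S \<inter> T)" using cB cD C(5) by linarith
  show "dim S + dim T \<le> dim X" if "S \<inter> T = {0}"
  proof -
    have "dim {0} = 0" using dim_le_card[of "{0}" "{}"] by simp
    then show ?thesis using g that by simp
  qed
qed

text \<open>Finitely many linear functionals \<open>b _ v\<close> that satisfy no linear relation on
  \<open>A\<close> have a dual family in \<open>A\<close>, which may be infinite-dimensional.
  Polynomials are paired with functionals through this lemma.\<close>

lemma dual_family:
  fixes b :: "'b \<Rightarrow> 'c \<Rightarrow> 'a"
  assumes "finite B" and A: "subspace A"
    and add: "\<And>v x y. b (x + y) v = b x v + b y v"
    and scl: "\<And>v c x. b (scale c x) v = c * b x v"
    and nondeg: "\<And>c. (\<And>x. x \<in> A \<Longrightarrow> (\<Sum>v\<in>B. c v * b x v) = 0) \<Longrightarrow> \<forall>v\<in>B. c v = 0"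
  shows "\<exists>a. \<forall>v\<in>B. a v \<in> A \<and> (\<forall>w\<in>B. b (a v) w = (if v = w then 1 else 0))"
  using \<open>finite B\<close> nondeg
proof (induction B rule: finite_induct)
  case empty then show ?case by simp
next
  case (insert v B)
  have zero: "b 0 w = 0" for w using scl[of 0 0 w] by simp
  have sm: "b (sum f J) w = (\<Sum>j\<in>J. b (f j) w)" for f w and J :: "'c set"
    by (induction J rule: infinite_finite_induct) (auto simp: zero add)
  have neg: "b (x - y) w = b x w - b y w" for x y w
    using add[of "x - y" y w] by simp
  have "\<forall>w\<in>B. c w = 0" if "\<And>x. x \<in> A \<Longrightarrow> (\<Sum>w\<in>B. c w * b x w) = 0" for c
  proof -
    have "(\<Sum>w\<in>insert v B. (c(v := 0)) w * b x w) = (\<Sum>w\<in>B. c w * b x w)" for x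
      using insert(1,2) by (auto intro!: sum.cong)
    then have "\<forall>w\<in>insert v B. (c(v := 0)) w = 0" using that by (intro insert.prems) metis
    then show ?thesis using insert(2) by (metis fun_upd_other insertI2)
  qed
  then obtain a where a: "\<forall>v\<in>B. a v \<in> A \<and> (\<forall>w\<in>B. b (a v) w = (if v = w then 1 else 0))"
    using insert.IH by blast
  \<comment> \<open>Subtracting the contribution of the dual family of \<open>B\<close> makes all
    pairings with \<open>B\<close> vanish.\<close>
  define pr where "pr x = x - (\<Sum>w\<in>B. scale (b x w) (a w))" for x
  have prA: "pr x \<in> A" if "x \<in> A" for x
    unfolding pr_def using a that A by (intro subspace_diff subspace_sum subspace_scale) auto
  have pr0: "b (pr x) w = 0" if "w \<in> B" for x w
  proof -
    have "(\<Sum>u\<in>B. b x u * b (a u) w) = (\<Sum>u\<in>B. if u = w then b x u else 0)"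
      by (rule sum.cong) (use a that in auto)
    then show ?thesis unfolding pr_def neg sm scl using insert(1) that by simp
  qed
  have "\<exists>x\<in>A. b (pr x) v \<noteq> 0"
  proof (rule ccontr)
    assume "\<not> ?thesis"
    then have *: "b x v = (\<Sum>w\<in>B. b x w * b (a w) v)" if "x \<in> A" for x
      using that unfolding pr_def neg sm scl by simp
    \<comment> \<open>Otherwise \<open>b _ v\<close> is a combination of the other functionals on
      \<open>A\<close>.\<close>
    define c where "c = (\<lambda>w. if w = v then -1 else b (a w) v)"
    have "(\<Sum>w\<in>insert v B. c w * b x w) = 0" if "x \<in> A" for x
    proof -
      have "(\<Sum>w\<in>B. c w * b x w) = (\<Sum>w\<in>B. b x w * b (a w) v)"
        unfolding c_def using insert(2) by (intro sum.cong) (auto simp: mult.commute)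
      then show ?thesis using insert(1,2) *[OF that] by (simp add: c_def)
    qed
    then have "c v = 0" using insert.prems by blast
    then show False by (simp add: c_def)
  qed
  then obtain x where x: "x \<in> A" "b (pr x) v \<noteq> 0" by blast
  define y where "y = scale (1 / b (pr x) v) (pr x)"
  have y: "y \<in> A" "b y v = 1" "\<And>w. w \<in> B \<Longrightarrow> b y w = 0"
    unfolding y_def scl using x prA A pr0 by (auto intro: subspace_scale)
  define a' where "a' = (\<lambda>w. if w = v then y else a w - scale (b (a w) v) y)"
  have "\<forall>u\<in>insert v B. a' u \<in> A \<and> (\<forall>w\<in>insert v B. b (a' u) w = (if u = w then 1 else 0))"
    using a y insert(2) A unfolding a'_def
    by (auto simp: neg scl intro!: subspace_diff subspace_scale)
  then show ?case by blast
qed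

text \<open>A basis of the common kernel and the dual family together form a basis of
  \<open>A\<close>.\<close>

lemma dim_kernel_dual_family:
  fixes b :: "'b \<Rightarrow> 'c \<Rightarrow> 'a"
  assumes "finite B" and A: "subspace A" and fA: "findim A"
    and add: "\<And>v x y. b (x + y) v = b x v + b y v"
    and scl: "\<And>v c x. b (scale c x) v = c * b x v"
    and a: "\<And>v. v \<in> B \<Longrightarrow> a v \<in> A" "\<And>v w. v \<in> B \<Longrightarrow> w \<in> B \<Longrightarrow> b (a v) w = (if v = w then 1 else 0)"
  shows "dim A = dim {x \<in> A. \<forall>v\<in>B. b x v = 0} + card B"
proof -
  define K where "K = {x \<in> A. \<forall>v\<in>B. b x v = 0}"
  have zero: "b 0 w = 0" for w using scl[of 0 0 w] by simp
  have sm: "b (sum f J) w = (\<Sum>j\<in>J. b (f j) w)" for f w and J :: "'c set"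
    by (induction J rule: infinite_finite_induct) (auto simp: zero add)
  have neg: "b (x - y) w = b x w - b y w" for x y w
    using add[of "x - y" y w] by simp
  have sub: "subspace {x. b x v = 0}" for v
    by (rule subspaceI) (auto simp: zero add scl)
  have KA: "K \<subseteq> A" by (auto simp: K_def)
  obtain C where C: "finite C" "independent C" "C \<subseteq> K" "K \<subseteq> span C" "card C = dim K"
    using findim_basis[OF findim_subset[OF KA fA]] by metis
  have main: "E \<subseteq> B \<Longrightarrow> independent (C \<union> a ` E) \<and> card (C \<union> a ` E) = card C + card E" if "finite E" for E
    using that
  proof (induction E rule: finite_induct)
    case empty then show ?case using C by simp
  next
    case (insert v E)
    have "C \<union> a ` E \<subseteq> {x. b x v = 0}" using C(3) insert a by (auto simp: K_def)
    then have "span (C \<union> a ` E) \<subseteq> {x. b x v = 0}" using sub span_minimal by blast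
    then have "a v \<notin> span (C \<union> a ` E)" using a(2)[of v v] insert by auto
    then have "independent (insert (a v) (C \<union> a ` E))" "a v \<notin> C \<union> a ` E"
      using insert independent_insertI span_base by auto
    then show ?case using insert C(1) by simp
  qed
  have "A \<subseteq> span (C \<union> a ` B)"
  proof
    fix x assume x: "x \<in> A"
    define y where "y = (\<Sum>v\<in>B. scale (b x v) (a v))"
    have y: "y \<in> span (C \<union> a ` B)" unfolding y_def
      by (intro span_sum span_scale span_base) auto
    have yA: "y \<in> A" unfolding y_def using a A by (intro subspace_sum subspace_scale) auto
    have "b y w = b x w" if "w \<in> B" for w
    proof -
      have "(\<Sum>u\<in>B. b x u * b (a u) w) = (\<Sum>u\<in>B. if u = w then b x u else 0)"
        by (rule sum.cong) (use a that in auto)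
      then show ?thesis unfolding y_def sm scl using assms(1) that by simp
    qed
    then have "x - y \<in> K" unfolding K_def using x yA A by (auto simp: neg subspace_diff)
    then have "x - y \<in> span (C \<union> a ` B)" using C(4) span_mono[of C "C \<union> a ` B"] by auto
    then show "x \<in> span (C \<union> a ` B)" using y span_add by fastforce
  qed
  moreover have "C \<union> a ` B \<subseteq> A" using C KA a by auto
  ultimately show ?thesis using main[of B] assms(1) basis_card_eq_dim[of "C \<union> a ` B" A] C(5)
    by (simp add: K_def)
qed

end

locale findim_pair = vs1: findim_space s1 + vs2: findim_space s2
  for s1 :: "'a::field \<Rightarrow> 'b::ab_group_add \<Rightarrow> 'b" and s2 :: "'a \<Rightarrow> 'c::ab_group_add \<Rightarrow> 'c"
begin

sublocale vector_space_pair s1 s2 ..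

lemma findim_image:
  assumes "Vector_Spaces.linear s1 s2 f" "vs1.findim A" shows "vs2.findim (f ` A)"
proof -
  obtain B where "finite B" "A \<subseteq> vs1.span B" using assms unfolding vs1.findim_def by blast
  then have "f ` A \<subseteq> vs2.span (f ` B)" using linear_span_image[OF assms(1), of B] by blast
  then show ?thesis using \<open>finite B\<close> unfolding vs2.findim_def by blast
qed

lemma rank_nullity:
  assumes f: "Vector_Spaces.linear s1 s2 f" and A: "vs1.subspace A" and fA: "vs1.findim A"
  shows "vs1.dim A = vs1.dim {x \<in> A. f x = 0} + vs2.dim (f ` A)"
proof -
  define K where "K = {x \<in> A. f x = 0}"
  have KA: "K \<subseteq> A" by (auto simp: K_def)
  obtain C where C: "finite C" "vs1.independent C" "C \<subseteq> K" "K \<subseteq> vs1.span C" "card C = vs1.dim K"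
    using vs1.findim_basis[OF vs1.findim_subset[OF KA fA]] by metis
  obtain D where D: "finite D" "vs2.independent D" "D \<subseteq> f ` A" "f ` A \<subseteq> vs2.span D"
      "card D = vs2.dim (f ` A)"
    using vs2.findim_basis[OF findim_image[OF f fA]] by metis
  obtain g where g: "\<And>y. y \<in> D \<Longrightarrow> g y \<in> A \<and> f (g y) = y"
  proof -
    have "\<forall>y\<in>D. \<exists>x. x \<in> A \<and> f x = y" using D(3) by auto
    then show ?thesis using that by metis
  qed
  have fgE: "f ` (C \<union> g ` E) \<subseteq> insert 0 E" if "E \<subseteq> D" for E using C(3) g that by (auto simp: K_def)
  have main: "E \<subseteq> D \<Longrightarrow> vs1.independent (C \<union> g ` E) \<and> card (C \<union> g ` E) = card C + card E" if "finite E" for E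
    using that
  proof (induction E rule: finite_induct)
    case empty then show ?case using C by simp
  next
    case (insert v E)
    have "g v \<notin> vs1.span (C \<union> g ` E)"
    proof
      assume "g v \<in> vs1.span (C \<union> g ` E)"
      then have "f (g v) \<in> vs2.span (f ` (C \<union> g ` E))" using linear_span_image[OF f] by blast
      moreover have "f (g v) = v" using g insert.prems by blast
      moreover have "f ` (C \<union> g ` E) \<subseteq> insert 0 E" using fgE insert.prems by blast
      ultimately have "v \<in> vs2.span (insert 0 E)"
        using vs2.span_mono[of "f ` (C \<union> g ` E)" "insert 0 E"] by (metis subsetD)
      then have "v \<in> vs2.span E" by simp
      moreover have "E \<subseteq> D - {v}" using insert by auto
      ultimately have "v \<in> vs2.span (D - {v})" using vs2.span_mono by blast
      then show False using D(2) insert unfolding vs2.dependent_def by auto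
    qed
    then have "vs1.independent (insert (g v) (C \<union> g ` E))" "g v \<notin> C \<union> g ` E"
      using insert vs1.independent_insertI vs1.span_base by auto
    then show ?case using insert C(1) by simp
  qed
  have "A \<subseteq> vs1.span (C \<union> g ` D)"
  proof
    fix x assume x: "x \<in> A"
    have "f ` (g ` D) = D" using g by force
    then have "f x \<in> f ` vs1.span (g ` D)"
      using D(4) x linear_span_image[OF f, of "g ` D"] by auto
    then obtain y where y: "y \<in> vs1.span (g ` D)" "f y = f x" by (metis imageE)
    have "vs1.span (g ` D) \<subseteq> A" using g A by (intro vs1.span_minimal) auto
    then have "x - y \<in> K" using x y A by (auto simp: K_def vs1.subspace_diff linear_diff[OF f])
    then have "x - y \<in> vs1.span (C \<union> g ` D)" using C(4) vs1.span_mono[of C "C \<union> g ` D"] by auto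
    moreover have "y \<in> vs1.span (C \<union> g ` D)" using y(1) vs1.span_mono[of "g ` D" "C \<union> g ` D"] by auto
    ultimately show "x \<in> vs1.span (C \<union> g ` D)" using vs1.span_add by fastforce
  qed
  moreover have "C \<union> g ` D \<subseteq> A" using C KA g by auto
  ultimately show ?thesis using main[of D] D(1,5) vs1.basis_card_eq_dim[of "C \<union> g ` D" A] C(5)
    by (simp add: K_def)
qed

text \<open>A functional prescribed on \<open>A\<close> extends to the whole space with value \<open>0\<close> on \<open>J\<close>, provided
  that the two prescriptions agree on \<open>A \<inter> J\<close>.\<close>

lemma linear_extend_vanishing:
  assumes A: "vs1.subspace A" and J: "vs1.subspace J" and h: "Vector_Spaces.linear s1 s2 h"
    and "\<And>x. x \<in> A \<Longrightarrow> x \<in> J \<Longrightarrow> h x = 0"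
  obtains g where "Vector_Spaces.linear s1 s2 g" "\<And>x. x \<in> A \<Longrightarrow> g x = h x" "\<And>x. x \<in> J \<Longrightarrow> g x = 0"
proof -
  obtain C where C: "C \<subseteq> J" "vs1.independent C" "J \<subseteq> vs1.span C"
    using vs1.maximal_independent_subset by metis
  have CJA: "C \<subseteq> J \<union> A" using C by auto
  obtain B where B: "C \<subseteq> B" "B \<subseteq> J \<union> A" "vs1.independent B" "J \<union> A \<subseteq> vs1.span B"
    using vs1.maximal_independent_subset_extend[OF CJA C(2)] by metis
  obtain g where g: "Vector_Spaces.linear s1 s2 g" "\<And>x. x \<in> B \<Longrightarrow> g x = (if x \<in> C then 0 else h x)"
    using linear_independent_extend[OF B(3), of "\<lambda>x. if x \<in> C then 0 else h x"] by blast
  have sC: "g x = 0" if "x \<in> vs1.span C" for x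
  proof -
    have "C \<subseteq> {x. g x = 0}" using g(2) B(1) by auto
    moreover have "vs1.subspace {x. g x = 0}" using linear_subspace_kernel[OF g(1)] .
    ultimately show ?thesis using that vs1.span_minimal by blast
  qed
  have BA: "B - C \<subseteq> A"
  proof
    fix x assume x: "x \<in> B - C"
    have "x \<notin> J"
    proof
      assume "x \<in> J"
      then have "x \<in> vs1.span (B - {x})" using C(3) vs1.span_mono[of C "B - {x}"] x B(1) by auto
      then show False using B(3) x unfolding vs1.dependent_def by auto
    qed
    then show "x \<in> A" using x B(2) by auto
  qed
  have "g x = h x" if x: "x \<in> A" for x
  proof -
    have "x \<in> vs1.span (C \<union> (B - C))" using x B(1,4) by (auto simp: Un_absorb1)
    then obtain c a where ca: "x = c + a" "c \<in> vs1.span C" "a \<in> vs1.span (B - C)"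
      unfolding vs1.span_Un by auto
    have aA: "a \<in> A" using ca(3) BA A vs1.span_minimal by blast
    then have "c \<in> A" using ca(1) x vs1.subspace_diff[OF A x aA] by simp
    moreover have "c \<in> J" using ca(2) C(1) J vs1.span_minimal by blast
    ultimately have "h c = 0" using assms(4) by blast
    moreover have "g a = h a"
    proof -
      have "B - C \<subseteq> {x. g x = h x}" using g(2) by auto
      moreover have "vs1.subspace {x. g x = h x}"
        using g(1) h by (auto intro!: vs1.subspaceI simp: linear_0 linear_add linear_scale)
      ultimately show ?thesis using ca(3) vs1.span_minimal by blast
    qed
    ultimately show ?thesis using ca sC g(1) h by (simp add: linear_add)
  qed
  moreover have "g x = 0" if "x \<in> J" for x using that C(3) sC by auto
  ultimately show ?thesis using that g(1) by blast
qed

end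

global_interpretation vec: findim_space "vec_scale :: 'a::field \<Rightarrow> ('v \<Rightarrow> 'a) \<Rightarrow> _" ..

global_interpretation mpoly: findim_space "poly_scale :: 'a::field \<Rightarrow> ('v, 'a) mpoly \<Rightarrow> _" ..

global_interpretation vecvec: findim_pair
  "vec_scale :: 'a::field \<Rightarrow> ('v \<Rightarrow> 'a) \<Rightarrow> _" "vec_scale :: 'a \<Rightarrow> ('w \<Rightarrow> 'a) \<Rightarrow> _" ..

global_interpretation mpolyvec: findim_pair
  "poly_scale :: 'a::field \<Rightarrow> ('v, 'a) mpoly \<Rightarrow> _" "vec_scale :: 'a \<Rightarrow> ('w \<Rightarrow> 'a) \<Rightarrow> _" ..

section \<open>Polynomials acting on functions of monomials\<close>

abbreviation keys :: "('m \<Rightarrow>\<^sub>0 'a::zero) \<Rightarrow> 'm set" where "keys \<equiv> Poly_Mapping.keys"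
abbreviation lookup :: "('m \<Rightarrow>\<^sub>0 'a::zero) \<Rightarrow> 'm \<Rightarrow> 'a" where "lookup \<equiv> Poly_Mapping.lookup"
abbreviation single :: "'m \<Rightarrow> 'a::zero \<Rightarrow> ('m \<Rightarrow>\<^sub>0 'a)" where "single \<equiv> Poly_Mapping.single"

text \<open>A function on monomials is a linear functional on polynomials, given by its values on
  the monomials; \<open>pr\<close> is the pairing. Every functional
  is of this form.\<close>

definition pr :: "('m \<Rightarrow>\<^sub>0 'a::comm_semiring_0) \<Rightarrow> ('m \<Rightarrow> 'a) \<Rightarrow> 'a" where
  "pr f lam = (\<Sum>\<alpha>\<in>keys f. lookup f \<alpha> * lam \<alpha>)"

lemma pr_superset: "finite S \<Longrightarrow> keys f \<subseteq> S \<Longrightarrow> pr f lam = (\<Sum>\<alpha>\<in>S. lookup f \<alpha> * lam \<alpha>)"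
  unfolding pr_def by (rule sum.mono_neutral_left) (auto simp: in_keys_iff)

lemma pr_add: "pr (f + g) lam = pr f lam + pr g lam"
proof -
  let ?S = "keys f \<union> keys g"
  have "keys (f + g) \<subseteq> ?S" by (rule Poly_Mapping.keys_add)
  then show ?thesis
    by (subst (1 2 3) pr_superset[of ?S]) (auto simp: lookup_add distrib_right sum.distrib)
qed

lemma pr_0 [simp]: "pr 0 lam = 0" by (simp add: pr_def)

lemma pr_single [simp]: "pr (single a c) lam = c * lam a"
  by (simp add: pr_def)

lemma pr_sum: "pr (sum f J) lam = (\<Sum>j\<in>J. pr (f j) lam)"
  by (induction J rule: infinite_finite_induct) (auto simp: pr_add)

lemma pr_diff: "pr (f - g) lam = pr f lam - pr g (lam :: 'm \<Rightarrow> 'a::comm_ring)"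
  using pr_add[of "f - g" g lam] by simp

lemma pr_add_right: "pr f (\<lambda>\<alpha>. lam \<alpha> + mu \<alpha>) = pr f lam + pr f mu"
  by (simp add: pr_def distrib_left sum.distrib)

lemma pr_plus_right: "pr f (lam + mu) = pr f lam + pr f mu"
  by (simp add: pr_def distrib_left sum.distrib)

lemma pr_0_right [simp]: "pr f (\<lambda>_. 0) = 0" "pr f 0 = 0"
  by (simp_all add: pr_def)

lemma pr_scale_right: "pr f (\<lambda>\<alpha>. c * lam \<alpha>) = c * pr f lam"
  by (simp add: pr_def sum_distrib_left mult.left_commute)

lemma pr_mult_right: "pr f (\<lambda>\<alpha>. lam \<alpha> * c) = pr f lam * c"
  by (simp add: pr_def sum_distrib_right mult.assoc)

lemma pr_vec_scale: "pr f (vec_scale c lam) = c * pr f lam"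
  by (simp add: vec_scale_def pr_scale_right)

lemma pr_sum_right: "pr f (sum g J) = (\<Sum>j\<in>J. pr f (g j))"
  by (induction J rule: infinite_finite_induct)
     (simp_all only: not_False_eq_True sum.infinite sum.empty sum.insert pr_0_right pr_plus_right)

lemma pr_1 [simp]: "pr 1 lam = lam 0" for lam :: "'m::zero \<Rightarrow> 'a::comm_semiring_1"
  by (metis pr_single single_one mult_1)

lemma pr_cong: "(\<And>\<alpha>. \<alpha> \<in> keys f \<Longrightarrow> lam \<alpha> = mu \<alpha>) \<Longrightarrow> pr f lam = pr f mu"
  by (simp add: pr_def)

lemma poly_mapping_sum_single: "f = (\<Sum>\<alpha>\<in>keys f. single \<alpha> (lookup f \<alpha>))"
proof (rule poly_mapping_eqI)
  fix k
  have "lookup (\<Sum>\<alpha>\<in>keys f. single \<alpha> (lookup f \<alpha>)) k = (\<Sum>\<alpha>\<in>keys f. if \<alpha> = k then lookup f \<alpha> else 0)"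
    by (auto simp: lookup_sum lookup_single when_def intro: sum.cong)
  then show "lookup f k = lookup (\<Sum>\<alpha>\<in>keys f. single \<alpha> (lookup f \<alpha>)) k"
    by (simp add: in_keys_iff)
qed

lemma pr_mult:
  fixes f g :: "'m::comm_monoid_add \<Rightarrow>\<^sub>0 'a::comm_semiring_0"
  shows "pr (f * g) lam = pr f (\<lambda>\<alpha>. pr g (\<lambda>\<beta>. lam (\<alpha> + \<beta>)))"
proof -
  have "f * g = (\<Sum>\<alpha>\<in>keys f. \<Sum>\<beta>\<in>keys g. single (\<alpha> + \<beta>) (lookup f \<alpha> * lookup g \<beta>))"
    by (subst (1) poly_mapping_sum_single[of f], subst (1) poly_mapping_sum_single[of g])
       (simp add: sum_product mult_single)
  then show ?thesis
    by (simp add: pr_sum) (simp add: pr_def sum_distrib_left mult.assoc)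
qed

text \<open>Every coefficient is a functional, which reduces identities of polynomials to identities
  of pairings.\<close>

lemma lookup_pr: "lookup h k = pr h (\<lambda>\<alpha>. if \<alpha> = k then 1 else 0)" for h :: "'m \<Rightarrow>\<^sub>0 'a::comm_semiring_1"
  by (simp add: pr_def in_keys_iff if_distrib cong: if_cong)

lemma pr_eqI:
  fixes f g :: "'m \<Rightarrow>\<^sub>0 'a::comm_semiring_1"
  assumes "\<And>lam. pr f lam = pr g lam" shows "f = g"
proof (rule poly_mapping_eqI)
  fix k
  show "lookup f k = lookup g k" by (simp only: lookup_pr assms)
qed

text \<open>The module structure of the dual of the polynomial ring: \<open>act f lam\<close> is the
  functional \<open>g \<mapsto> lam (f g)\<close>, Macaulay's contraction of \<open>lam\<close> by
  \<open>f\<close>.\<close>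

definition act :: "('m::comm_monoid_add \<Rightarrow>\<^sub>0 'a::comm_semiring_0) \<Rightarrow> ('m \<Rightarrow> 'a) \<Rightarrow> 'm \<Rightarrow> 'a" where
  "act f lam = (\<lambda>\<beta>. pr f (\<lambda>\<alpha>. lam (\<alpha> + \<beta>)))"

lemma act_at_0: "act f lam 0 = pr f lam" by (simp add: act_def)

lemma act_add: "act (f + g) lam = act f lam + act g lam"
  by (simp add: act_def pr_add fun_eq_iff)

lemma act_diff: "act (f - g) lam = act f lam - act g (lam :: 'm::comm_monoid_add \<Rightarrow> 'a::comm_ring)"
  by (simp add: act_def pr_diff fun_eq_iff)

lemma act_0 [simp]: "act 0 lam = 0" by (simp add: act_def fun_eq_iff)

lemma act_0_right [simp]: "act f 0 = 0" by (simp add: act_def fun_eq_iff)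

lemma act_sum: "act (sum f J) lam = (\<Sum>j\<in>J. act (f j) lam)"
  by (induction J rule: infinite_finite_induct) (auto simp: act_add)

lemma act_single: "act (single a c) lam = (\<lambda>\<beta>. c * lam (a + \<beta>))"
  by (simp add: act_def)

lemma act_1 [simp]: "act 1 lam = (lam :: 'm::comm_monoid_add \<Rightarrow> 'a::comm_semiring_1)"
  by (simp add: act_def)

lemma act_plus_right: "act f (lam + mu) = act f lam + act f mu"
  by (simp add: act_def fun_eq_iff pr_add_right)

lemma act_diff_right: "act f (lam - mu) = act f lam - act f (mu :: 'm::comm_monoid_add \<Rightarrow> 'a::comm_ring)"
  using act_plus_right[of f "lam - mu" mu] by simp

lemma act_sum_right: "act f (sum g J) = (\<Sum>j\<in>J. act f (g j))"
  by (induction J rule: infinite_finite_induct)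
     (simp_all only: not_False_eq_True sum.infinite sum.empty sum.insert act_0_right act_plus_right)

lemma act_vec_scale: "act f (vec_scale c lam) = vec_scale c (act f lam)"
  by (simp add: act_def vec_scale_def pr_scale_right)

lemma act_Const [simp]: "act (Const c) lam = vec_scale c lam"
  by (simp add: Const_def act_single vec_scale_def)

lemma pr_act: "pr (f * g) lam = pr f (act g lam)"
  by (simp add: pr_mult act_def add.commute)

lemma act_mult: "act (f * g) lam = act f (act g (lam :: 'm::comm_monoid_add \<Rightarrow> 'a::comm_semiring_0))"
  by (simp add: fun_eq_iff act_def pr_mult) (simp add: add.commute add.left_commute)

lemma act_commute: "act f (act g lam) = act g (act f (lam :: 'm::comm_monoid_add \<Rightarrow> 'a::comm_semiring_0))"
  by (metis act_mult mult.commute)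

lemma act_Const_mult: "act (Const c * f) lam = vec_scale c (act f lam)"
  by (simp add: act_mult)

lemma act_poly_scale: "act (poly_scale c f) lam = vec_scale c (act f lam)"
  by (simp add: poly_scale_def act_mult)

lemma pr_poly_scale: "pr (poly_scale c f) lam = c * pr f lam"
  using act_poly_scale[of c f lam, THEN fun_cong, of 0] by (simp add: act_at_0 vec_scale_def)

lemma act_eq_pr: "act f lam \<beta> = pr (f * single \<beta> 1) (lam :: 'm::comm_monoid_add \<Rightarrow> 'a::comm_semiring_1)"
  by (simp add: pr_mult act_def)

lemma linear_act: "Vector_Spaces.linear vec_scale vec_scale (act f)"
  by (intro Vector_Spaces.linear_iff[THEN iffD2] conjI vec.vector_space_axioms)
     (simp_all add: act_plus_right act_vec_scale)

lemma linear_act_left: "Vector_Spaces.linear poly_scale vec_scale (\<lambda>f. act f lam)"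
  by (intro Vector_Spaces.linear_iff[THEN iffD2] conjI vec.vector_space_axioms mpoly.vector_space_axioms)
     (simp_all add: act_add act_poly_scale)

subsection \<open>Evaluation\<close>

definition ev :: "('v \<Rightarrow> 'b::comm_semiring_1) \<Rightarrow> ('v \<Rightarrow>\<^sub>0 nat) \<Rightarrow> 'b" where
  "ev x \<alpha> = (\<Prod>v\<in>keys \<alpha>. x v ^ lookup \<alpha> v)"

lemma ev_superset: "finite S \<Longrightarrow> keys \<alpha> \<subseteq> S \<Longrightarrow> ev x \<alpha> = (\<Prod>v\<in>S. x v ^ lookup \<alpha> v)"
  unfolding ev_def by (rule prod.mono_neutral_left) (auto simp: in_keys_iff)

lemma ev_0 [simp]: "ev x 0 = 1" by (simp add: ev_def)

lemma ev_add: "ev x (\<alpha> + \<beta>) = ev x \<alpha> * ev x \<beta>"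
proof -
  let ?S = "keys \<alpha> \<union> keys \<beta>"
  have "keys (\<alpha> + \<beta>) \<subseteq> ?S" by (rule Poly_Mapping.keys_add)
  then show ?thesis
    by (subst (1 2 3) ev_superset[of ?S]) (auto simp: lookup_add power_add prod.distrib)
qed

lemma ev_single [simp]: "ev x (single v n) = x v ^ n" by (cases "n = 0") (simp_all add: ev_def)

lemma ev_sum: "ev x (sum f J) = (\<Prod>j\<in>J. ev x (f j))"
  by (induction J rule: infinite_finite_induct) (auto simp: ev_add)

lemma ev_cong: "(\<And>v. v \<in> keys \<alpha> \<Longrightarrow> x v = y v) \<Longrightarrow> ev x \<alpha> = ev y \<alpha>"
  by (simp add: ev_def)

lemma eval_at_pr: "eval_at x f = pr f (ev x)"
  by (simp add: eval_via_def pr_def ev_def)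

lemma pr_ev_mult: "pr (f * g) (ev x) = pr f (ev x) * pr g (ev x)"
  by (simp add: pr_mult ev_add pr_scale_right pr_mult_right)

lemma pr_ev_Const [simp]: "pr (Const c) lam = c * lam 0"
  by (simp add: Const_def)

lemma pr_Var [simp]: "pr (Var v) lam = lam (single v 1)" for lam :: "_ \<Rightarrow> 'a::comm_semiring_1"
  by (simp add: Var_def)

lemma pr_ev_prod: "pr (prod f J) (ev x) = (\<Prod>j\<in>J. pr (f j) (ev x))"
  by (induction J rule: infinite_finite_induct) (auto simp: pr_ev_mult)

lemma pr_ev_power: "pr (f ^ k) (ev x) = pr f (ev x) ^ k"
  by (induction k) (auto simp: pr_ev_mult)

lemma act_ev: "act f (ev x) = vec_scale (pr f (ev x)) (ev x)"
  by (simp add: act_def vec_scale_def ev_add pr_mult_right)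

subsection \<open>Transport of polynomials along homomorphisms of monomials\<close>

definition push :: "('m \<Rightarrow> 'n) \<Rightarrow> ('m \<Rightarrow>\<^sub>0 'a::comm_semiring_1) \<Rightarrow> ('n \<Rightarrow>\<^sub>0 'a)" where
  "push h f = (\<Sum>\<alpha>\<in>keys f. single (h \<alpha>) (lookup f \<alpha>))"

lemma pr_push: "pr (push h f) lam = pr f (\<lambda>\<alpha>. lam (h \<alpha>))"
  by (simp add: push_def pr_sum) (simp add: pr_def)

lemma push_add: "push h (f + g) = push h f + push h g"
  by (rule pr_eqI) (simp add: pr_push pr_add)

lemma push_diff: "push h (f - g) = push h f - push h (g :: 'm \<Rightarrow>\<^sub>0 'a::comm_ring_1)"
  by (rule pr_eqI) (simp add: pr_push pr_diff)

lemma push_0 [simp]: "push h 0 = 0" by (simp add: push_def)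

lemma push_sum: "push h (sum f J) = (\<Sum>j\<in>J. push h (f j))"
  by (induction J rule: infinite_finite_induct) (auto simp: push_add)

lemma push_single [simp]: "push h (single \<alpha> c) = single (h \<alpha>) c"
  by (rule pr_eqI) (simp add: pr_push)

lemma push_mult:
  fixes f g :: "'m::comm_monoid_add \<Rightarrow>\<^sub>0 'a::comm_semiring_1" and h :: "'m \<Rightarrow> 'n::comm_monoid_add"
  assumes "\<And>\<alpha> \<beta>. h (\<alpha> + \<beta>) = h \<alpha> + h \<beta>"
  shows "push h (f * g) = push h f * push h g"
  by (rule pr_eqI) (simp add: pr_push pr_mult assms)

lemma keys_push: "keys (push h f) \<subseteq> h ` keys f"
proof -
  have "keys (push h f) \<subseteq> (\<Union>\<alpha>\<in>keys f. keys (single (h \<alpha>) (lookup f \<alpha>)))"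
    unfolding push_def by (rule keys_sum)
  also have "\<dots> \<subseteq> h ` keys f" by auto
  finally show ?thesis .
qed

text \<open>A monomial in variables that are themselves monomials is multiplied out by \<open>wt\<close>.\<close>

definition wt :: "(('v \<Rightarrow>\<^sub>0 nat) \<Rightarrow>\<^sub>0 nat) \<Rightarrow> ('v \<Rightarrow>\<^sub>0 nat)" where
  "wt A = (\<Sum>\<alpha>\<in>keys A. \<Sum>_\<in>{..<lookup A \<alpha>}. \<alpha>)"

lemma pr_wt: "pr (wt A) f = pr A (\<lambda>\<alpha>. pr \<alpha> f)" for f :: "'v \<Rightarrow> nat"
  by (simp add: wt_def pr_sum) (simp add: pr_def)

lemma lookup_wt: "lookup (wt A) v = pr A (\<lambda>\<alpha>. lookup \<alpha> v)"
  by (simp add: wt_def lookup_sum pr_def)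

lemma wt_add: "wt (A + B) = wt A + wt B"
  by (rule poly_mapping_eqI) (simp add: lookup_wt lookup_add pr_add)

lemma wt_0 [simp]: "wt 0 = 0" by (simp add: wt_def)

lemma wt_single_1 [simp]: "wt (single \<alpha> (Suc 0)) = \<alpha>"
  by (rule poly_mapping_eqI) (simp add: lookup_wt)

lemma ev_wt: "ev x (wt A) = ev (ev x) A"
  by (simp add: wt_def ev_sum) (simp add: ev_def)

text \<open>The coordinate ring of the Veronese variety is the image of \<open>phi\<close>, and the
  kernel of \<open>phi\<close> is the ideal of the variety. Forms of degree \<open>e\<close> go to
  forms of degree \<open>d e\<close>.\<close>

definition phi :: "(('v \<Rightarrow>\<^sub>0 nat), 'a::comm_ring_1) mpoly \<Rightarrow> ('v, 'a) mpoly" where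
  "phi = push wt"

lemma phi_add: "phi (f + g) = phi f + phi g" by (simp add: phi_def push_add)
lemma phi_diff: "phi (f - g) = phi f - phi g" by (simp add: phi_def push_diff)
lemma phi_0 [simp]: "phi 0 = 0" by (simp add: phi_def)
lemma phi_sum: "phi (sum f J) = (\<Sum>j\<in>J. phi (f j))" by (simp add: phi_def push_sum)
lemma phi_mult: "phi (f * g) = phi f * phi g" by (simp add: phi_def push_mult wt_add)
lemma phi_Const [simp]: "phi (Const c) = Const c" by (simp add: phi_def Const_def)
lemma phi_1 [simp]: "phi 1 = 1" by (metis phi_Const Const_def single_one)
lemma phi_power: "phi (f ^ k) = phi f ^ k" by (induction k) (simp_all add: phi_mult)
lemma phi_poly_scale: "phi (poly_scale c f) = poly_scale c (phi f)"
  by (simp add: poly_scale_def phi_mult)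
lemma pr_phi: "pr (phi F) lam = pr F (\<lambda>A. lam (wt A))"
  by (simp add: phi_def pr_push)

lemma pr_phi_ev: "pr (phi F) (ev x) = pr F (ev (ev x))"
  by (simp add: pr_phi ev_wt)

subsection \<open>Degrees, forms and homogeneous parts\<close>

lemma deg_in_pr: "deg_in V \<alpha> = pr \<alpha> (\<lambda>v. if v \<in> V then 1 else 0)"
proof -
  have "pr \<alpha> (\<lambda>v. if v \<in> V then 1 else 0) = (\<Sum>v\<in>keys \<alpha>. if v \<in> V then lookup \<alpha> v else 0)"
    unfolding pr_def by (rule sum.cong) auto
  then show ?thesis by (simp add: deg_in_def sum.inter_restrict)
qed

lemma deg_in_add: "deg_in V (\<alpha> + \<beta>) = deg_in V \<alpha> + deg_in V \<beta>"
  by (simp add: deg_in_pr pr_add)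

lemma deg_in_0 [simp]: "deg_in V 0 = 0" by (simp add: deg_in_def)

lemma deg_in_single [simp]: "v \<in> V \<Longrightarrow> deg_in V (single v n) = n"
  by (simp add: deg_in_pr)

lemma keys_add_nat: "keys (\<alpha> + \<beta> :: 'v \<Rightarrow>\<^sub>0 nat) = keys \<alpha> \<union> keys \<beta>"
  by (auto simp: in_keys_iff lookup_add)

lemma monomials_add: "\<alpha> \<in> monomials V i \<Longrightarrow> \<beta> \<in> monomials V j \<Longrightarrow> \<alpha> + \<beta> \<in> monomials V (i + j)"
  by (auto simp: monomials_def deg_in_add keys_add_nat)

lemma monomials_0 [simp]: "monomials (V :: 'v set) 0 = {0}"
proof -
  have "\<alpha> = 0" if "keys \<alpha> \<subseteq> V" "deg_in V \<alpha> = 0" for \<alpha> :: "'v \<Rightarrow>\<^sub>0 nat"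
  proof -
    have "\<forall>v\<in>keys \<alpha> \<inter> V. lookup \<alpha> v = 0" using that(2) by (simp add: deg_in_def)
    then show ?thesis using that(1) by (intro poly_mapping_eqI) (auto simp: in_keys_iff subset_iff)
  qed
  then show ?thesis by (auto simp: monomials_def)
qed

lemma monomial_split:
  assumes "keys \<alpha> \<subseteq> V" "deg_in V \<alpha> = Suc n"
  obtains v \<beta> where "v \<in> V" "\<alpha> = single v 1 + \<beta>" "\<beta> \<in> monomials V n"
proof -
  obtain v where v: "v \<in> keys \<alpha>"
    using assms(2) by (metis all_not_in_conv deg_in_0 keys_eq_empty nat.distinct(1))
  define \<beta> where "\<beta> = \<alpha> - single v 1"
  have eq: "\<alpha> = single v 1 + \<beta>" unfolding \<beta>_def
    using v by (intro poly_mapping_eqI) (auto simp: lookup_add lookup_minus lookup_single when_def in_keys_iff)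
  have "keys \<beta> \<subseteq> V" using assms(1) unfolding \<beta>_def by (auto simp: in_keys_iff lookup_minus)
  moreover have "deg_in V \<beta> = n"
  proof -
    have "deg_in V (single v 1 + \<beta>) = 1 + deg_in V \<beta>"
      using v assms(1) by (subst deg_in_add) auto
    then show ?thesis using assms(2) eq by simp
  qed
  ultimately show ?thesis using that[of v \<beta>] v assms eq by (auto simp: monomials_def)
qed

lemma finite_monomials: "finite V \<Longrightarrow> finite (monomials V e)"
proof (induction e)
  case (Suc n)
  have "monomials V (Suc n) \<subseteq> (\<lambda>(v, \<beta>). single v 1 + \<beta>) ` (V \<times> monomials V n)"
    by (force simp: monomials_def[of V "Suc n"] elim!: monomial_split)
  then show ?case using Suc finite_subset by blast
qed simp

lemma monomial_split_deg:
  assumes "\<alpha> \<in> monomials V (i + j)"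
  obtains \<beta> \<gamma> where "\<alpha> = \<beta> + \<gamma>" "\<beta> \<in> monomials V i" "\<gamma> \<in> monomials V j"
proof -
  have "\<exists>\<beta> \<gamma>. \<alpha> = \<beta> + \<gamma> \<and> \<beta> \<in> monomials V i \<and> \<gamma> \<in> monomials V j" using assms
  proof (induction i arbitrary: \<alpha>)
    case 0 then show ?case by (intro exI[of _ 0] exI[of _ \<alpha>]) auto
  next
    case (Suc i)
    then obtain v \<alpha>' where v: "v \<in> V" "\<alpha> = single v 1 + \<alpha>'" "\<alpha>' \<in> monomials V (i + j)"
      using monomial_split[of \<alpha> V "i + j"] by (auto simp: monomials_def)
    obtain \<beta> \<gamma> where "\<alpha>' = \<beta> + \<gamma>" "\<beta> \<in> monomials V i" "\<gamma> \<in> monomials V j" using Suc.IH[OF v(3)] by blast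
    moreover have "single v 1 \<in> monomials V 1" using v by (auto simp: monomials_def)
    ultimately show ?case using v monomials_add[of "single v 1" V 1 \<beta> i]
      by (intro exI[of _ "single v 1 + \<beta>"] exI[of _ \<gamma>]) (auto simp: add.assoc)
  qed
  then show ?thesis using that by blast
qed

lemma carrier_poly_ring: "carrier (poly_ring V) = {f. \<forall>\<alpha>\<in>keys f. keys \<alpha> \<subseteq> V}"
  by (simp add: poly_ring_def)

lemma poly_ring_simps [simp]: "mult (poly_ring V) = (*)" "one (poly_ring V) = 1"
  "zero (poly_ring V) = 0" "add (poly_ring V) = (+)"
  by (simp_all add: poly_ring_def)

lemma subspace_keys: "mpoly.subspace {f :: ('v, 'a::field) mpoly. \<forall>\<alpha>\<in>keys f. Q \<alpha>}"
proof (rule mpoly.subspaceI)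
  fix f g :: "('v, 'a) mpoly" assume "f \<in> {f. \<forall>\<alpha>\<in>keys f. Q \<alpha>}" "g \<in> {f. \<forall>\<alpha>\<in>keys f. Q \<alpha>}"
  then show "f + g \<in> {f. \<forall>\<alpha>\<in>keys f. Q \<alpha>}" using Poly_Mapping.keys_add[of f g] by auto
next
  fix c and f :: "('v, 'a) mpoly" assume f: "f \<in> {f. \<forall>\<alpha>\<in>keys f. Q \<alpha>}"
  have "keys (poly_scale c f) \<subseteq> keys f"
    unfolding poly_scale_def Const_def using keys_mult[of "single 0 c" f] by (auto split: if_splits)
  then show "poly_scale c f \<in> {f. \<forall>\<alpha>\<in>keys f. Q \<alpha>}" using f by auto
qed simp

lemma subspace_carrier: "mpoly.subspace (carrier (poly_ring V))"
  unfolding carrier_poly_ring by (rule subspace_keys)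

lemma forms_alt: "forms V e = {f. \<forall>\<alpha>\<in>keys f. \<alpha> \<in> monomials V e}"
  by (auto simp: forms_def)

lemma subspace_forms: "mpoly.subspace (forms V e)"
  unfolding forms_alt by (rule subspace_keys)

lemma forms_carrier: "forms V e \<subseteq> carrier (poly_ring V)"
  by (auto simp: forms_def carrier_poly_ring monomials_def)

lemma mult_carrier:
  "f \<in> carrier (poly_ring V) \<Longrightarrow> g \<in> carrier (poly_ring V) \<Longrightarrow> f * g \<in> carrier (poly_ring V)"
  using keys_mult[of f g] by (fastforce simp: carrier_poly_ring keys_add_nat)

lemma mult_forms: "f \<in> forms V i \<Longrightarrow> g \<in> forms V j \<Longrightarrow> f * g \<in> forms V (i + j)"
  using keys_mult[of f g] monomials_add[of _ V i _ j] by (fastforce simp: forms_def)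

lemma single_forms: "\<alpha> \<in> monomials V e \<Longrightarrow> single \<alpha> c \<in> forms V e"
  by (auto simp: forms_def)

lemma single_carrier: "keys \<alpha> \<subseteq> V \<Longrightarrow> single \<alpha> c \<in> carrier (poly_ring V)"
  by (auto simp: carrier_poly_ring)

lemma Const_forms: "Const c \<in> forms V 0"
  unfolding Const_def by (rule single_forms) simp

lemma one_forms: "1 \<in> forms V 0"
  using Const_forms[of 1 V] by (simp add: Const_def)

lemma one_carrier: "1 \<in> carrier (poly_ring V)" using one_forms forms_carrier by blast

lemma Var_forms: "v \<in> V \<Longrightarrow> Var v \<in> forms V 1"
  unfolding Var_def by (rule single_forms) (simp add: monomials_def)

lemma power_forms: "f \<in> forms V i \<Longrightarrow> f ^ k \<in> forms V (k * i)"
  by (induction k) (auto simp: one_forms intro: mult_forms)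

lemma single_poly_scale: "single \<alpha> c = poly_scale c (single \<alpha> 1)"
  by (simp add: poly_scale_def Const_def mult_single)

lemma findim_forms:
  assumes "finite V" shows "mpoly.findim (forms V e :: ('v, 'a::field) mpoly set)"
proof -
  have "f \<in> mpoly.span ((\<lambda>\<alpha>. single \<alpha> 1) ` monomials V e)" if "f \<in> forms V e" for f :: "('v, 'a) mpoly"
  proof -
    have "(\<Sum>\<alpha>\<in>keys f. poly_scale (lookup f \<alpha>) (single \<alpha> 1)) \<in> mpoly.span ((\<lambda>\<alpha>. single \<alpha> 1) ` monomials V e)"
      using that by (intro mpoly.span_sum mpoly.span_scale mpoly.span_base) (auto simp: forms_def)
    then show ?thesis
      by (subst poly_mapping_sum_single[of f], subst single_poly_scale)
  qed
  then show ?thesis using finite_monomials[OF assms] unfolding mpoly.findim_def by (intro exI[of _ "(\<lambda>\<alpha>. single \<alpha> 1) ` monomials V e"]) auto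
qed

lemma lookup_hom_part: "lookup (hom_part V e f) \<alpha> = (if deg_in V \<alpha> = e then lookup f \<alpha> else 0)"
proof -
  have "lookup (hom_part V e f) \<alpha> =
      (\<Sum>\<beta> | \<beta> \<in> keys f \<and> deg_in V \<beta> = e. if \<beta> = \<alpha> then lookup f \<beta> else 0)"
    by (auto simp: hom_part_def lookup_sum lookup_single when_def intro: sum.cong)
  then show ?thesis by (simp add: in_keys_iff)
qed

lemma hom_part_add: "hom_part V e (f + g) = hom_part V e f + hom_part V e g"
  by (rule poly_mapping_eqI) (simp add: lookup_hom_part lookup_add)

lemma hom_part_0 [simp]: "hom_part V e 0 = 0"
  by (rule poly_mapping_eqI) (simp add: lookup_hom_part)

lemma hom_part_sum: "hom_part V e (sum f J) = (\<Sum>j\<in>J. hom_part V e (f j))"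
  by (induction J rule: infinite_finite_induct) (auto simp: hom_part_add)

lemma hom_part_forms: "f \<in> carrier (poly_ring V) \<Longrightarrow> hom_part V e f \<in> forms V e"
  by (auto simp: forms_def carrier_poly_ring monomials_def in_keys_iff lookup_hom_part split: if_splits)

lemma hom_part_of_form: "f \<in> forms V j \<Longrightarrow> hom_part V e f = (if e = j then f else 0)"
  by (rule poly_mapping_eqI)
     (auto simp: lookup_hom_part forms_def monomials_def in_keys_iff)

lemma sum_hom_part: "\<exists>N. \<forall>n\<ge>N. f = (\<Sum>e\<le>n. hom_part V e f)"
proof -
  define N where "N = Max (insert 0 (deg_in V ` keys f))"
  have "f = (\<Sum>e\<le>n. hom_part V e f)" if "n \<ge> N" for n
  proof (rule poly_mapping_eqI)
    fix \<alpha>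
    have "deg_in V \<alpha> \<le> n" if "\<alpha> \<in> keys f"
    proof -
      have "deg_in V \<alpha> \<le> N" unfolding N_def using that by (intro Max_ge) auto
      then show ?thesis using \<open>n \<ge> N\<close> by simp
    qed
    then show "lookup f \<alpha> = lookup (\<Sum>e\<le>n. hom_part V e f) \<alpha>"
      by (cases "\<alpha> \<in> keys f") (auto simp: lookup_sum lookup_hom_part in_keys_iff)
  qed
  then show ?thesis by blast
qed

lemma hom_part_mult_form:
  assumes g: "g \<in> forms V k" and f: "f \<in> carrier (poly_ring V)"
  shows "hom_part V (k + e) (g * f) = g * hom_part V e f"
proof -
  obtain N where "\<forall>n\<ge>N. f = (\<Sum>e\<le>n. hom_part V e f)" using sum_hom_part by blast
  then have N: "f = (\<Sum>j\<le>max N e. hom_part V j f)" by auto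
  have "hom_part V (k + e) (g * f) = (\<Sum>j\<le>max N e. hom_part V (k + e) (g * hom_part V j f))"
    by (subst (1) N) (simp add: sum_distrib_left hom_part_sum)
  also have "\<dots> = (\<Sum>j\<le>max N e. if e = j then g * hom_part V j f else 0)"
    using hom_part_of_form[OF mult_forms[OF g hom_part_forms[OF f]]] by (intro sum.cong) auto
  finally show ?thesis by simp
qed

lemma hom_part_mult_low:
  assumes g: "g \<in> forms V k" and f: "f \<in> carrier (poly_ring V)" and "e < k"
  shows "hom_part V e (g * f) = 0"
proof (rule poly_mapping_eqI)
  fix \<alpha>
  have "deg_in V \<alpha> \<ge> k" if \<alpha>: "\<alpha> \<in> keys (g * f)"
  proof -
    obtain a b where "\<alpha> = a + b" "a \<in> keys g" using \<alpha> keys_mult[of g f] by blast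
    then show ?thesis using g by (auto simp: forms_def monomials_def deg_in_add)
  qed
  then show "lookup (hom_part V e (g * f)) \<alpha> = lookup 0 \<alpha>"
    using \<open>e < k\<close> by (cases "\<alpha> \<in> keys (g * f)") (auto simp: lookup_hom_part in_keys_iff)
qed

section \<open>Functionals on the Veronese ring\<close>

abbreviation expo :: "'v set \<Rightarrow> ('v \<Rightarrow>\<^sub>0 nat) set" where
  "expo V \<equiv> {\<beta>. keys \<beta> \<subseteq> V}"

lemma act_vecs: "lam \<in> vecs (expo V) \<Longrightarrow> act f lam \<in> vecs (expo V)"
  by (auto simp: vecs_def act_def pr_def keys_add_nat)

lemma subspace_vecs: "vec.subspace (vecs S)"
  by (rule vec.subspaceI) (auto simp: vecs_def vec_scale_def)

lemma deg_in_wt: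
  assumes "keys A \<subseteq> monomials V d" shows "deg_in V (wt A) = d * deg_in (monomials V d) A"
proof -
  have "deg_in V (wt A) = pr A (\<lambda>\<alpha>. deg_in V \<alpha>)" by (simp add: deg_in_pr pr_wt)
  also have "\<dots> = pr A (\<lambda>\<alpha>. d * (if \<alpha> \<in> monomials V d then 1 else 0))"
    by (rule pr_cong) (use assms in \<open>auto simp: monomials_def\<close>)
  also have "\<dots> = d * deg_in (monomials V d) A" by (simp only: pr_scale_right deg_in_pr)
  finally show ?thesis .
qed

lemma keys_wt: "keys A \<subseteq> monomials V d \<Longrightarrow> keys (wt A) \<subseteq> V"
proof
  fix v assume A: "keys A \<subseteq> monomials V d" and "v \<in> keys (wt A)"
  then have "pr A (\<lambda>\<alpha>. lookup \<alpha> v) \<noteq> 0" by (simp add: in_keys_iff lookup_wt)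
  then obtain \<alpha> where "\<alpha> \<in> keys A" "lookup \<alpha> v \<noteq> 0" unfolding pr_def
    by (metis (no_types, lifting) mult_0_right sum.neutral)
  moreover from this have "v \<in> keys \<alpha>" by (simp add: in_keys_iff)
  ultimately show "v \<in> V" using A unfolding monomials_def by blast
qed

lemma wt_monomials: "A \<in> monomials (monomials V d) e \<Longrightarrow> wt A \<in> monomials V (d * e)"
  using keys_wt[of A V d] deg_in_wt[of A V d] by (auto simp: monomials_def[of "monomials V d"] monomials_def[of V "d * e"])

lemma phi_forms: "F \<in> forms (monomials V d) e \<Longrightarrow> phi F \<in> forms V (d * e)"
  using keys_push[of wt F] wt_monomials[of _ V d e] unfolding forms_def phi_def by blast

lemma wt_surj: "\<beta> \<in> monomials V (d * e) \<Longrightarrow> \<exists>A\<in>monomials (monomials V d) e. wt A = \<beta>"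
proof (induction e arbitrary: \<beta>)
  case 0 then show ?case by simp
next
  case (Suc e)
  then have "\<beta> \<in> monomials V (d + d * e)" by simp
  then obtain \<alpha> \<gamma> where 1: "\<beta> = \<alpha> + \<gamma>" "\<alpha> \<in> monomials V d" "\<gamma> \<in> monomials V (d * e)"
    by (rule monomial_split_deg)
  then obtain A where A: "A \<in> monomials (monomials V d) e" "wt A = \<gamma>" using Suc.IH by blast
  have "single \<alpha> 1 \<in> monomials (monomials V d) 1" using 1 by (auto simp: monomials_def)
  then have "single \<alpha> 1 + A \<in> monomials (monomials V d) (Suc e)" using A monomials_add by fastforce
  then show ?case using 1 A by (intro bexI[of _ "single \<alpha> 1 + A"]) (auto simp: wt_add)
qed

lemma phi_surj:
  fixes f :: "('v, 'a::field) mpoly"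
  assumes "f \<in> forms V (d * e)" obtains F where "F \<in> forms (monomials V d) e" "phi F = f"
proof -
  have "\<forall>\<beta>\<in>monomials V (d * e). \<exists>A. A \<in> monomials (monomials V d) e \<and> wt A = \<beta>"
    using wt_surj by blast
  from bchoice[OF this] obtain a where
    a: "\<And>\<beta>. \<beta> \<in> monomials V (d * e) \<Longrightarrow> a \<beta> \<in> monomials (monomials V d) e \<and> wt (a \<beta>) = \<beta>"
    by blast
  define F where "F = (\<Sum>\<beta>\<in>keys f. single (a \<beta>) (lookup f \<beta>))"
  have k: "\<beta> \<in> monomials V (d * e)" if "\<beta> \<in> keys f" for \<beta> using assms that by (auto simp: forms_def)
  have "F \<in> forms (monomials V d) e"
    unfolding F_def by (rule mpoly.subspace_sum[OF subspace_forms], rule single_forms) (use k a in blast)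
  moreover have "phi F = (\<Sum>\<beta>\<in>keys f. single \<beta> (lookup f \<beta>))"
  proof -
    have "phi F = (\<Sum>\<beta>\<in>keys f. single (wt (a \<beta>)) (lookup f \<beta>))"
      unfolding F_def phi_sum by (simp add: phi_def)
    also have "\<dots> = (\<Sum>\<beta>\<in>keys f. single \<beta> (lookup f \<beta>))" by (rule sum.cong) (use k a in auto)
    finally show ?thesis .
  qed
  ultimately show ?thesis using that poly_mapping_sum_single[of f] by metis
qed

lemma sum_fun_at: "sum f J x = (\<Sum>j\<in>J. f j x)" for f :: "'b \<Rightarrow> 'c \<Rightarrow> 'd::comm_monoid_add"
  by (induction J rule: infinite_finite_induct) simp_all

subsection \<open>Linear forms and dehomogenization\<close>

definition dot :: "'v set \<Rightarrow> ('v \<Rightarrow> 'a::comm_ring_1) \<Rightarrow> ('v \<Rightarrow> 'a) \<Rightarrow> 'a" where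
  "dot V l x = (\<Sum>i\<in>V. l i * x i)"

definition lf :: "'v set \<Rightarrow> ('v \<Rightarrow> 'a::comm_ring_1) \<Rightarrow> ('v, 'a) mpoly" where
  "lf V l = (\<Sum>i\<in>V. Const (l i) * Var i)"

lemma pr_lf_ev: "pr (lf V l) (ev x) = dot V l x"
  by (simp add: lf_def dot_def pr_sum pr_ev_mult)

lemma lf_forms: "lf V l \<in> forms V 1" for l :: "'v \<Rightarrow> 'a::field"
proof -
  have "Const (l i) * Var i \<in> forms V 1" if "i \<in> V" for i
    using mult_forms[OF Const_forms Var_forms[OF that], of "l i"] by simp
  then show ?thesis unfolding lf_def by (intro mpoly.subspace_sum[OF subspace_forms])
qed

lemma act_lf: "act (lf V l) lam = (\<Sum>i\<in>V. vec_scale (l i) (act (Var i) lam))"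
  by (simp only: lf_def act_sum act_Const_mult)

text \<open>Functionals that do not change under multiplication by the linear form \<open>L\<close>.
  They are the functionals on the coordinate ring of the affine chart \<open>L = 1\<close>; their
  values in high degrees determine those in low degrees.\<close>

definition FL :: "'v set \<Rightarrow> ('v \<Rightarrow> 'a::field) \<Rightarrow> (('v \<Rightarrow>\<^sub>0 nat) \<Rightarrow> 'a) set" where
  "FL V l = {lam \<in> vecs (expo V). act (lf V l) lam = lam}"

lemma subspace_FL: "vec.subspace (FL V l)"
proof -
  have "FL V l = vecs (expo V) \<inter> {lam. act (lf V l) lam = lam}" by (auto simp: FL_def)
  moreover have "vec.subspace {lam. act (lf V l) lam = lam}"
    by (rule vec.subspaceI) (simp_all add: act_plus_right act_vec_scale)
  ultimately show ?thesis by (simp only: vec.subspace_inter subspace_vecs)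
qed

lemma act_FL: "lam \<in> FL V l \<Longrightarrow> act f lam \<in> FL V l"
  using act_vecs[of lam V f] act_commute[of "lf V l" f lam] by (simp add: FL_def)

lemma act_power_FL: "act L lam = lam \<Longrightarrow> act (L ^ k) lam = lam" for L :: "('v, 'a::field) mpoly"
proof (induction k)
  case (Suc k)
  then show ?case by (simp only: power_Suc act_mult)
qed simp

lemma ev_vecs: "x \<in> vecs V \<Longrightarrow> ev x \<in> vecs (expo V)"
proof -
  assume x: "x \<in> vecs V"
  have "ev x \<beta> = 0" if \<beta>: "\<not> keys \<beta> \<subseteq> V" for \<beta>
  proof -
    obtain i where "i \<in> keys \<beta>" "i \<notin> V" using \<beta> by blast
    then show ?thesis using x unfolding ev_def
      by (intro prod_zero) (auto simp: vecs_def in_keys_iff zero_power intro!: bexI[of _ i])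
  qed
  then show ?thesis by (simp add: vecs_def)
qed

lemma ev_FL: "x \<in> vecs V \<Longrightarrow> dot V l x = 1 \<Longrightarrow> ev x \<in> FL V l"
  by (simp add: FL_def ev_vecs act_ev pr_lf_ev)

text \<open>Homogenization of \<open>f\<close> to degree \<open>D\<close> with the linear form
  \<open>L\<close>; it is meaningful if \<open>f\<close> has degree at most \<open>D\<close>, as the
  exponent is truncated at \<open>0\<close>.\<close>

definition hz :: "'v set \<Rightarrow> ('v, 'a::field) mpoly \<Rightarrow> nat \<Rightarrow> ('v, 'a) mpoly \<Rightarrow> ('v, 'a) mpoly" where
  "hz V L D f = (\<Sum>\<beta>\<in>keys f. single \<beta> (lookup f \<beta>) * L ^ (D - deg_in V \<beta>))"

lemma hz_superset:
  "finite S \<Longrightarrow> keys f \<subseteq> S \<Longrightarrow> hz V L D f = (\<Sum>\<beta>\<in>S. single \<beta> (lookup f \<beta>) * L ^ (D - deg_in V \<beta>))"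
  unfolding hz_def by (rule sum.mono_neutral_left) (auto simp: in_keys_iff)

lemma hz_add: "hz V L D (f + g) = hz V L D f + hz V L D g"
proof -
  let ?S = "keys f \<union> keys g"
  have "keys (f + g) \<subseteq> ?S" by (rule Poly_Mapping.keys_add)
  then show ?thesis
    by (subst (1 2 3) hz_superset[of ?S]) (auto simp: lookup_add single_add distrib_right sum.distrib)
qed

lemma hz_single: "hz V L D (single \<beta> c) = single \<beta> c * L ^ (D - deg_in V \<beta>)"
  by (cases "c = 0") (simp_all add: hz_def)

lemma hz_0 [simp]: "hz V L D 0 = 0" by (simp add: hz_def)

lemma hz_diff: "hz V L D (f - g) = hz V L D f - hz V L D g"
  using hz_add[of V L D "f - g" g] by simp

lemma hz_scale: "hz V L D (poly_scale c f) = poly_scale c (hz V L D f)"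
proof -
  have k: "keys (poly_scale c f) \<subseteq> keys f"
    unfolding poly_scale_def Const_def using keys_mult[of "single 0 c" f] by (auto split: if_splits)
  have l: "single \<beta> (lookup (poly_scale c f) \<beta>) = poly_scale c (single \<beta> (lookup f \<beta>))" for \<beta>
  proof -
    have "lookup (poly_scale c f) \<beta> = c * lookup f \<beta>"
      by (simp only: lookup_pr pr_poly_scale)
    then show ?thesis by (simp add: poly_scale_def Const_def mult_single)
  qed
  show ?thesis
    by (subst hz_superset[OF _ k]) (simp_all add: hz_def l mpoly.scale_sum_right, simp add: poly_scale_def mult.assoc)
qed

lemma hz_forms:
  assumes "L \<in> forms V 1" "f \<in> carrier (poly_ring V)" "\<And>\<beta>. \<beta> \<in> keys f \<Longrightarrow> deg_in V \<beta> \<le> D"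
  shows "hz V L D f \<in> forms V D"
  unfolding hz_def
proof (rule mpoly.subspace_sum[OF subspace_forms])
  fix \<beta> assume \<beta>: "\<beta> \<in> keys f"
  then have "single \<beta> (lookup f \<beta>) \<in> forms V (deg_in V \<beta>)"
    using assms(2) by (intro single_forms) (auto simp: monomials_def carrier_poly_ring)
  then show "single \<beta> (lookup f \<beta>) * L ^ (D - deg_in V \<beta>) \<in> forms V D"
    using mult_forms[OF _ power_forms[OF assms(1), of "D - deg_in V \<beta>"]] assms(3)[OF \<beta>] by fastforce
qed

lemma hz_of_form: "f \<in> forms V e \<Longrightarrow> hz V L D f = f * L ^ (D - e)"
  unfolding hz_def by (subst (3) poly_mapping_sum_single[of f])
    (auto simp: sum_distrib_right forms_def monomials_def intro!: sum.cong)

lemma act_hz: "act L lam = lam \<Longrightarrow> act (hz V L D f) lam = act f lam"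
  by (subst (2) poly_mapping_sum_single[of f]) (simp add: hz_def act_sum act_mult act_power_FL)

lemma pr_hz: "act L lam = lam \<Longrightarrow> pr (hz V L D f) lam = pr f lam"
  using act_hz[of L lam V D f] by (metis act_at_0)

text \<open>A finite independent set of functionals fixed by a linear form \<open>L\<close> is still independent on the
  forms of every large degree: dual polynomials may be homogenized with \<open>L\<close>.\<close>

lemma dual_forms:
  assumes "1 \<le> d" and B: "finite B" "vec.independent B" "B \<subseteq> FL V l"
  shows "\<exists>e0. \<forall>e\<ge>e0. \<exists>a. \<forall>v\<in>B. a v \<in> forms (monomials V d) e \<and>
           (\<forall>w\<in>B. pr (phi (a v)) w = (if v = w then 1 else 0))"
proof -
  have "\<exists>a. \<forall>v\<in>B. a v \<in> carrier (poly_ring V) \<and> (\<forall>w\<in>B. pr (a v) w = (if v = w then 1 else 0))"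
  proof (rule mpoly.dual_family[OF B(1) subspace_carrier, where b = pr])
    fix c assume c: "\<And>x. x \<in> carrier (poly_ring V) \<Longrightarrow> (\<Sum>v\<in>B. c v * pr x v) = 0"
    have "(\<Sum>v\<in>B. vec_scale (c v) v) \<beta> = 0" for \<beta>
    proof (cases "\<beta> \<in> expo V")
      case True
      then have "single \<beta> 1 \<in> carrier (poly_ring V)" by (simp add: single_carrier)
      from c[OF this] show ?thesis by (simp add: sum_fun_at vec_scale_def)
    next
      case False
      then have "v \<beta> = 0" if "v \<in> B" for v using that B(3) by (auto simp: FL_def vecs_def)
      then have "(\<Sum>v\<in>B. c v * v \<beta>) = 0" by (intro sum.neutral) auto
      then show ?thesis by (simp add: sum_fun_at vec_scale_def)
    qed
    then have "(\<Sum>v\<in>B. vec_scale (c v) v) = 0" by auto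
    then show "\<forall>v\<in>B. c v = 0" using vec.independentD[OF B(2,1)] by blast
  qed (simp_all add: pr_add pr_poly_scale)
  then obtain a where a: "\<And>v. v \<in> B \<Longrightarrow> a v \<in> carrier (poly_ring V)"
     "\<And>v w. v \<in> B \<Longrightarrow> w \<in> B \<Longrightarrow> pr (a v) w = (if v = w then 1 else 0)" by metis
  define e0 where "e0 = Max (insert 0 (deg_in V ` (\<Union>v\<in>B. keys (a v))))"
  have e0: "deg_in V \<beta> \<le> e0" if "v \<in> B" "\<beta> \<in> keys (a v)" for v \<beta>
    unfolding e0_def using B(1) that by (intro Max_ge) auto
  have "\<exists>a'. \<forall>v\<in>B. a' v \<in> forms (monomials V d) e \<and>
           (\<forall>w\<in>B. pr (phi (a' v)) w = (if v = w then 1 else 0))" if "e \<ge> e0" for e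
  proof -
    have "e \<le> d * e" using assms(1) by simp
    then have "hz V (lf V l) (d * e) (a v) \<in> forms V (d * e)" if "v \<in> B" for v
      using hz_forms[OF lf_forms a(1)[OF that]] e0[OF that] \<open>e \<ge> e0\<close> by (meson le_trans)
    then have "\<forall>v\<in>B. \<exists>F. F \<in> forms (monomials V d) e \<and> phi F = hz V (lf V l) (d * e) (a v)"
      using phi_surj by metis
    then obtain a' where a': "\<forall>v\<in>B. a' v \<in> forms (monomials V d) e \<and> phi (a' v) = hz V (lf V l) (d * e) (a v)"
      by metis
    have "pr (phi (a' v)) w = (if v = w then 1 else 0)" if "v \<in> B" "w \<in> B" for v w
    proof -
      have "act (lf V l) w = w" using B(3) that by (auto simp: FL_def)
      then show ?thesis using a' a that by (simp add: pr_hz)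
    qed
    then show ?thesis using a' by blast
  qed
  then show ?thesis by blast
qed

lemma dim_forms_dual:
  fixes B :: "(('v \<Rightarrow>\<^sub>0 nat) \<Rightarrow> 'a::field) set"
  assumes "finite V" "finite B" "\<And>v. v \<in> B \<Longrightarrow> a v \<in> forms (monomials V d) e"
    "\<And>v w. v \<in> B \<Longrightarrow> w \<in> B \<Longrightarrow> pr (phi (a v)) w = (if v = w then 1 else 0)"
  shows "mpoly.dim (forms (monomials V d) e :: ('v \<Rightarrow>\<^sub>0 nat, 'a) mpoly set) =
    mpoly.dim {F \<in> forms (monomials V d) e. \<forall>v\<in>B. pr (phi F) v = 0} + card B"
proof -
  let ?b = "\<lambda>F v. pr (phi F) (v :: ('v \<Rightarrow>\<^sub>0 nat) \<Rightarrow> 'a)"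
  have "?b (x + y) v = ?b x v + ?b y v" "?b (poly_scale c x) v = c * ?b x v" for c x y v
    by (simp_all add: phi_add pr_add phi_poly_scale pr_poly_scale)
  from mpoly.dim_kernel_dual_family[of B "forms (monomials V d) e" ?b a, OF assms(2) subspace_forms
      findim_forms[OF finite_monomials[OF assms(1)]] this assms(3,4)]
  show ?thesis by simp
qed

subsection \<open>Evaluations at distinct points\<close>

text \<open>For every \<open>q\<close> choose a coordinate in which \<open>p\<close> and
  \<open>q\<close> differ, and multiply linear factors as in Lagrange interpolation.\<close>

lemma interpolation:
  fixes p :: "'v \<Rightarrow> 'a::field"
  assumes "finite X" "p \<notin> X"
  shows "\<exists>f. pr f (ev p) = 1 \<and> (\<forall>q\<in>X. pr f (ev q) = 0)"
proof -
  have "\<forall>q\<in>X. \<exists>i. p i \<noteq> q i" using assms(2) by (metis ext)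
  then obtain i where i: "\<And>q. q \<in> X \<Longrightarrow> p (i q) \<noteq> q (i q)" by metis
  define f where "f = (\<Prod>q\<in>X. Const (1 / (p (i q) - q (i q))) * (Var (i q) - Const (q (i q))))"
  have "pr f (ev x) = (\<Prod>q\<in>X. (x (i q) - q (i q)) / (p (i q) - q (i q)))" for x
    unfolding f_def by (simp add: pr_ev_prod pr_ev_mult pr_diff)
  then have "pr f (ev p) = 1" "\<forall>q\<in>X. pr f (ev q) = 0"
    using i assms(1) by (auto intro!: prod_zero)
  then show ?thesis by blast
qed

lemma inj_ev: "inj (ev :: ('v \<Rightarrow> 'a::field) \<Rightarrow> _)"
proof (rule injI, rule ext)
  fix x y :: "'v \<Rightarrow> 'a" and v assume "ev x = ev y"
  then have "ev x (single v 1) = ev y (single v 1)" by simp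
  then show "x v = y v" by simp
qed

lemma ev_independent: "vec.independent (ev ` X)"
proof (rule vec.independent_explicit_finite_subsets[THEN iffD2], intro allI impI)
  fix A u v assume A: "A \<subseteq> ev ` X" "finite A" "(\<Sum>v\<in>A. vec_scale (u v) v) = 0" 
  show "\<forall>v\<in>A. u v = 0"
  proof
    fix v assume v: "v \<in> A"
    obtain Y where Y: "finite Y" "A = ev ` Y" using finite_subset_image[OF A(2,1)] by blast
    then obtain p where p: "v = ev p" "p \<in> Y" using v by blast
    obtain f where f: "pr f (ev p) = 1" "\<forall>q\<in>Y - {p}. pr f (ev q) = 0"
      using interpolation[of "Y - {p}" p] Y(1) by blast
    have "0 = pr f (\<Sum>v\<in>A. vec_scale (u v) v)" using A(3) by simp
    also have "\<dots> = (\<Sum>v\<in>A. u v * pr f v)" by (simp only: pr_sum_right pr_vec_scale)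
    also have "\<dots> = (\<Sum>v\<in>{ev p}. u v * pr f v)"
    proof (rule sum.mono_neutral_right[OF A(2)])
      show "{ev p} \<subseteq> A" using p v by simp
      show "\<forall>v\<in>A - {ev p}. u v * pr f v = 0"
      proof
        fix w assume "w \<in> A - {ev p}"
        then obtain q where "q \<in> Y - {p}" "w = ev q" using Y(2) by blast
        then show "u w * pr f w = 0" using f(2) by simp
      qed
    qed
    finally show "u v = 0" using f p by simp
  qed
qed

subsection \<open>Submodules\<close>

definition submod :: "(('v \<Rightarrow>\<^sub>0 nat) \<Rightarrow> 'a::field) set \<Rightarrow> bool" where
  "submod N \<longleftrightarrow> vec.subspace N \<and> (\<forall>f. \<forall>lam\<in>N. act f lam \<in> N)"

definition orbit :: "(('v \<Rightarrow>\<^sub>0 nat) \<Rightarrow> 'a::field) \<Rightarrow> (('v \<Rightarrow>\<^sub>0 nat) \<Rightarrow> 'a) set" where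
  "orbit mu = range (\<lambda>f. act f mu)"

lemma submod_orbit: "submod (orbit mu)"
proof -
  have "vec.subspace (orbit mu)"
    unfolding orbit_def by (rule mpolyvec.linear_subspace_image[OF linear_act_left mpoly.subspace_UNIV])
  moreover have "act f lam \<in> orbit mu" if "lam \<in> orbit mu" for f lam
    using that unfolding orbit_def by (auto simp: act_mult[symmetric])
  ultimately show ?thesis by (simp add: submod_def)
qed

lemma orbit_self: "mu \<in> orbit mu" unfolding orbit_def by (rule range_eqI[of _ _ 1]) simp

lemma orbit_subset: "submod N \<Longrightarrow> mu \<in> N \<Longrightarrow> orbit mu \<subseteq> N"
  by (auto simp: submod_def orbit_def)

text \<open>The variables generate the polynomial ring.\<close>

lemma submod_if_Var:
  assumes N: "vec.subspace N" and "\<And>i lam. lam \<in> N \<Longrightarrow> act (Var i) lam \<in> N"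
  shows "submod N"
proof -
  have mono: "act (single \<beta> 1) lam \<in> N" if "lam \<in> N" for \<beta> lam
    using that
  proof (induction "deg_in UNIV \<beta>" arbitrary: \<beta> lam)
    case 0
    then have "\<beta> \<in> monomials UNIV 0" by (simp add: monomials_def del: monomials_0)
    then show ?case using 0 by simp
  next
    case (Suc n)
    then obtain v \<gamma> where v: "\<beta> = single v 1 + \<gamma>" "\<gamma> \<in> monomials UNIV n"
      using monomial_split[of \<beta> UNIV n] by (metis subset_UNIV)
    have "single \<beta> (1::'a) = Var v * single \<gamma> 1" by (simp add: v Var_def mult_single)
    then show ?case using Suc v assms(2) by (simp add: act_mult monomials_def)
  qed
  have "act f lam \<in> N" if "lam \<in> N" for f lam
    by (subst poly_mapping_sum_single[of f], subst single_poly_scale)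
       (auto simp: act_sum act_poly_scale intro!: vec.subspace_sum[OF N] vec.subspace_scale[OF N] mono[OF that])
  then show ?thesis using N by (simp add: submod_def)
qed

lemma submod_image: "submod N \<Longrightarrow> submod (act f ` N)"
  unfolding submod_def
  by (auto intro!: vecvec.linear_subspace_image[OF linear_act] simp: act_commute[of _ f])

lemma submod_kernel: "submod N \<Longrightarrow> submod {lam \<in> N. act f lam = 0}"
  unfolding submod_def
  by (auto intro!: vec.subspaceI simp: act_plus_right act_vec_scale act_commute[of f]
      vec.subspace_0 vec.subspace_add vec.subspace_scale)

section \<open>Common eigenvectors\<close>

lemma Const_add: "Const (a + b) = Const a + Const b"
  by (simp add: Const_def single_add)

lemma Const_mult: "Const (a * b) = Const a * (Const b :: ('v, 'a::comm_semiring_1) mpoly)"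
  by (simp add: Const_def mult_single)

lemma Const_0 [simp]: "Const 0 = 0" by (simp add: Const_def)
lemma Const_1 [simp]: "Const 1 = 1" by (simp add: Const_def)

text \<open>The polynomial \<open>p\<close> in one variable, evaluated at the polynomial
  \<open>X\<close>.\<close>

definition psub :: "('v, 'a::comm_ring_1) mpoly \<Rightarrow> 'a poly \<Rightarrow> ('v, 'a) mpoly" where
  "psub X p = (\<Sum>k\<le>degree p. Const (coeff p k) * X ^ k)"

lemma psub_alt: "degree p \<le> n \<Longrightarrow> psub X p = (\<Sum>k\<le>n. Const (coeff p k) * X ^ k)"
  unfolding psub_def by (rule sum.mono_neutral_left) (auto simp: coeff_eq_0)

lemma psub_0 [simp]: "psub X 0 = 0" by (simp add: psub_def)

lemma psub_add: "psub X (p + q) = psub X p + psub X q"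
proof -
  let ?n = "max (degree p) (degree q)"
  have "degree (p + q) \<le> ?n" by (rule degree_add_le_max)
  then show ?thesis
    by (subst (1 2 3) psub_alt[of _ ?n]) (auto simp: Const_add distrib_right sum.distrib)
qed

lemma psub_sum: "psub X (sum f J) = (\<Sum>j\<in>J. psub X (f j))"
  by (induction J rule: infinite_finite_induct) (auto simp: psub_add)

lemma psub_smult: "psub X (smult a p) = Const a * psub X p"
proof -
  have "degree (smult a p) \<le> degree p" by (rule degree_smult_le)
  then show ?thesis
    by (subst (1 2) psub_alt[of _ "degree p"]) (auto simp: Const_mult sum_distrib_left mult.assoc)
qed

lemma psub_pCons: "psub X (pCons a p) = Const a + X * psub X p"
proof -
  have "degree (pCons a p) \<le> Suc (degree p)" by (rule degree_pCons_le)
  then have "psub X (pCons a p) = (\<Sum>k\<le>Suc (degree p). Const (coeff (pCons a p) k) * X ^ k)"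
    by (rule psub_alt)
  also have "\<dots> = Const a + (\<Sum>k\<le>degree p. Const (coeff p k) * (X * X ^ k))"
    by (subst sum.atMost_Suc_shift) simp
  also have "(\<Sum>k\<le>degree p. Const (coeff p k) * (X * X ^ k)) = X * psub X p"
    unfolding psub_def sum_distrib_left by (rule sum.cong) (auto simp: mult.left_commute)
  finally show ?thesis .
qed

lemma psub_mult: "psub X (p * q) = psub X p * psub X q"
  by (induction p) (simp_all add: psub_add psub_smult psub_pCons algebra_simps)

lemma psub_monom: "psub X (monom c k) = Const c * X ^ k"
proof -
  have "degree (monom c k) \<le> k" by (rule degree_monom_le)
  then show ?thesis by (subst psub_alt[of _ k]) (auto simp: sum.delta if_distrib[of Const] if_distrib[of "\<lambda>x. x * _"] cong: if_cong)
qed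

text \<open>The elements \<open>g, X g, \<dots>, X^n g\<close> of the \<open>n\<close>-dimensional
  space \<open>G\<close> are linearly dependent.\<close>

lemma annihilating_poly:
  assumes G: "submod G" "vec.findim G" and g: "g \<in> G"
  shows "\<exists>p. p \<noteq> 0 \<and> degree p \<le> vec.dim G \<and> act (psub X p) g = 0"
proof -
  define n where "n = vec.dim G"
  define w where "w = (\<lambda>k. act (X ^ k) g)"
  show ?thesis
  proof (cases "inj_on w {..n}")
    \<comment> \<open>Two equal elements already give a relation; only distinct ones form a set of
      \<open>n + 1\<close> elements.\<close>
    case False
    then obtain i j where ij: "i \<le> n" "j \<le> n" "i \<noteq> j" "w i = w j" by (auto simp: inj_on_def)
    define p :: "'b poly" where "p = monom 1 i + monom (-1) j"
    have "coeff p i = 1" using ij by (simp add: p_def)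
    then have "p \<noteq> 0" by auto
    moreover have "degree p \<le> n" unfolding p_def
      using ij by (intro degree_add_le order.trans[OF degree_monom_le])
    moreover have "act (psub X p) g = 0"
      using ij(4) by (simp add: p_def psub_add psub_monom act_add act_Const_mult w_def vec_scale_def fun_eq_iff)
    ultimately show ?thesis unfolding n_def by blast
  next
    case True
    have wG: "w ` {..n} \<subseteq> G" using G(1) g by (auto simp: submod_def w_def)
    have "card (w ` {..n}) = Suc n" using True by (simp add: card_image)
    then have "vec.dependent (w ` {..n})"
      using vec.findim_independent[OF G(2) _ wG] unfolding n_def by fastforce
    then obtain u where u: "\<exists>v\<in>w ` {..n}. u v \<noteq> 0" "(\<Sum>v\<in>w ` {..n}. vec_scale (u v) v) = 0"
      using vec.dependent_finite[of "w ` {..n}"] by auto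
    define p where "p = (\<Sum>k\<le>n. monom (u (w k)) k)"
    have cp: "coeff p k = (if k \<le> n then u (w k) else 0)" for k
      by (simp add: p_def coeff_sum)
    obtain k where "k \<le> n" "u (w k) \<noteq> 0" using u(1) by auto
    then have "p \<noteq> 0" using cp[of k] by auto
    moreover have "degree p \<le> n" using cp by (auto intro: degree_le)
    moreover have "act (psub X p) g = (\<Sum>k\<le>n. vec_scale (u (w k)) (w k))"
      by (simp only: p_def psub_sum psub_monom act_sum act_Const_mult w_def)
    moreover have "\<dots> = 0" using u(2) True by (simp add: sum.reindex)
    ultimately show ?thesis unfolding n_def by metis
  qed
qed

text \<open>Splitting off the roots of \<open>p\<close> one by one, the last nonzero vector before
  \<open>0\<close> is an eigenvector.\<close>

lemma psub_root_eigenvector: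
  fixes G :: "(('v \<Rightarrow>\<^sub>0 nat) \<Rightarrow> 'a::alg_closed_field) set"
  assumes "submod G" "g \<in> G" "g \<noteq> 0" "p \<noteq> 0" "act (psub X p) g = 0"
  shows "\<exists>c. \<exists>h\<in>G. h \<noteq> 0 \<and> act (X - Const c) h = 0"
  using assms(4,5)
proof (induction "degree p" arbitrary: p)
  case 0
  then obtain a where "p = [:a:]" by (metis degree_eq_zeroE)
  then have "vec_scale a g = 0" "a \<noteq> 0" using 0 by (auto simp: psub_pCons act_Const)
  then show ?case using assms(3) by simp
next
  case (Suc n)
  then obtain c where "poly p c = 0" using alg_closed_imp_poly_has_root[of p] by auto
  then obtain q where q: "p = [:-c, 1:] * q" by (auto simp: poly_eq_0_iff_dvd)
  have q0: "q \<noteq> 0" using q Suc.prems by auto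
  then have dq: "degree q = n" using Suc(2) q by (simp add: degree_mult_eq del: mult_pCons_left)
  have "Const (-c) = - (Const c :: ('v, 'a) mpoly)"
    by (rule pr_eqI) (use pr_diff[of 0 "Const c :: ('v, 'a) mpoly"] in simp)
  then have eq: "psub X p = (X - Const c) * psub X q"
    unfolding q psub_mult by (simp add: psub_pCons)
  show ?case
  proof (cases "act (psub X q) g = 0")
    case True then show ?thesis using Suc.hyps(1)[of q] q0 dq by simp
  next
    case False
    moreover have "act (psub X q) g \<in> G" using assms by (auto simp: submod_def)
    moreover have "act (X - Const c) (act (psub X q) g) = 0"
      using Suc.prems(2) unfolding eq act_mult .
    ultimately show ?thesis by blast
  qed
qed

lemma eigenvalue:
  fixes G :: "(('v \<Rightarrow>\<^sub>0 nat) \<Rightarrow> 'a::alg_closed_field) set"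
  assumes "submod G" "vec.findim G" "G \<noteq> {0}"
  shows "\<exists>c. \<exists>h\<in>G. h \<noteq> 0 \<and> act (X - Const c) h = 0"
proof -
  have "0 \<in> G" using assms by (auto simp: submod_def vec.subspace_0)
  then obtain g where g: "g \<in> G" "g \<noteq> 0" using assms by blast
  then show ?thesis using annihilating_poly[OF assms(1,2) g(1), of X] psub_root_eigenvector[OF assms(1) g] by blast
qed

lemma act_Var_minus: "act (Var i - Const c) h = 0 \<longleftrightarrow> act (Var i) h = vec_scale c h"
  for c :: "'a::field"
  by (simp add: act_diff)

text \<open>The eigenvalues determine the values on all monomials from the value on
  \<open>1\<close>.\<close>

lemma eigenvector_eq_ev:
  assumes "\<And>i. act (Var i) g = vec_scale (c i) g"
  shows "g = vec_scale (g 0) (ev c)"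
proof
  fix \<beta>
  show "g \<beta> = vec_scale (g 0) (ev c) \<beta>"
  proof (induction "deg_in UNIV \<beta>" arbitrary: \<beta>)
    case 0
    then have "\<beta> \<in> monomials UNIV 0" by (simp add: monomials_def del: monomials_0)
    then show ?case by (simp add: vec_scale_def)
  next
    case (Suc n)
    then obtain v \<gamma> where v: "\<beta> = single v 1 + \<gamma>" "\<gamma> \<in> monomials UNIV n"
      using monomial_split[of \<beta> UNIV n] by (metis subset_UNIV)
    have "g \<beta> = act (Var v) g \<gamma>" by (simp add: v act_single Var_def)
    also have "\<dots> = c v * g \<gamma>" by (simp add: assms vec_scale_def)
    also have "g \<gamma> = g 0 * ev c \<gamma>" using Suc(1)[of \<gamma>] v by (simp add: monomials_def vec_scale_def)
    finally show ?case by (simp add: v ev_add vec_scale_def mult.left_commute)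
  qed
qed

lemma vec_dim_zero: "vec.dim {0} = 0"
  using vec.dim_le_card[of "{0}" "{}"] by simp

lemma vec_dim_pos: "vec.findim S \<Longrightarrow> x \<in> S \<Longrightarrow> x \<noteq> 0 \<Longrightarrow> 1 \<le> vec.dim S"
  using vec.findim_independent[of S "{x}"] by simp

text \<open>A nonzero submodule of least dimension consists of common eigenvectors of all variables,
  because the eigenspaces of a variable are submodules. A common eigenvector is an evaluation, i.e. a
  point of the scheme that belongs to \<open>E\<close>.\<close>

lemma eigenvector_exists:
  fixes E :: "(('v \<Rightarrow>\<^sub>0 nat) \<Rightarrow> 'a::alg_closed_field) set"
  assumes "submod E" "vec.findim E" "E \<noteq> {0}" "E \<subseteq> vecs (expo V)"
  shows "\<exists>p\<in>vecs V. ev p \<in> E"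
proof -
  define Q where "Q G \<longleftrightarrow> submod G \<and> G \<subseteq> E \<and> G \<noteq> {0}" for G
  have "Q E" using assms by (simp add: Q_def)
  then obtain G where G: "Q G" "\<And>H. Q H \<Longrightarrow> vec.dim G \<le> vec.dim H"
    using ex_has_least_nat[of Q E vec.dim] by metis
  then have G': "submod G" "G \<subseteq> E" "G \<noteq> {0}" "vec.findim G" using vec.findim_subset assms(2) by (auto simp: Q_def)
  have "\<exists>c. \<forall>h\<in>G. act (Var i) h = vec_scale c h" for i
  proof -
    obtain c h where ch: "h \<in> G" "h \<noteq> 0" "act (Var i - Const c) h = 0" using eigenvalue[OF G'(1,4,3)] by metis
    define K where "K = {h \<in> G. act (Var i - Const c) h = 0}"
    have K: "submod K" "K \<subseteq> G" using submod_kernel[OF G'(1)] by (auto simp: K_def)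
    then have "Q K" using ch G' by (auto simp: Q_def K_def)
    then have "K = G" using vec.findim_eqI[OF _ K(2) G'(4) G(2)] K(1) by (auto simp: submod_def)
    then have "\<forall>h\<in>G. act (Var i) h = vec_scale c h" by (auto simp: K_def act_Var_minus)
    then show ?thesis by blast
  qed
  then obtain c where c: "\<And>i h. h \<in> G \<Longrightarrow> act (Var i) h = vec_scale (c i) h" by metis
  have "0 \<in> G" using G' by (auto simp: submod_def vec.subspace_0)
  then obtain g where g: "g \<in> G" "g \<noteq> 0" using G' by blast
  have eq: "g = vec_scale (g 0) (ev c)" using eigenvector_eq_ev[of g c] c[OF g(1)] by blast
  then have g0: "g 0 \<noteq> 0" using g(2) by (metis vec.scale_zero_left)
  have "vec_scale (1 / g 0) g = vec_scale (1 / g 0) (vec_scale (g 0) (ev c))" using eq by simp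
  also have "\<dots> = ev c" using g0 by (simp add: vec_scale_def)
  finally have evE: "ev c \<in> E" using G'(1,2) g(1) vec.subspace_scale[of G g "1 / g 0"] by (auto simp: submod_def)
  have "c i = 0" if "i \<notin> V" for i
  proof -
    have "single i 1 \<notin> expo V" using that by simp
    then have "ev c (single i 1) = 0" using evE assms(4) unfolding vecs_def by blast
    then show ?thesis by simp
  qed
  then show ?thesis using evE by (auto simp: vecs_def)
qed

section \<open>Functionals vanishing in one degree\<close>

text \<open>The derivatives of \<open>mu\<close> by forms of degree \<open>i\<close>. If
  \<open>mu\<close> is fixed by a linear form, they contain the derivatives of lower order.\<close>

definition tangent :: "'v set \<Rightarrow> nat \<Rightarrow> (('v \<Rightarrow>\<^sub>0 nat) \<Rightarrow> 'a::field) \<Rightarrow> (('v \<Rightarrow>\<^sub>0 nat) \<Rightarrow> 'a) set" where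
  "tangent V i mu = (\<lambda>f. act f mu) ` forms V i"

lemma subspace_tangent: "vec.subspace (tangent V i mu)"
  unfolding tangent_def by (rule mpolyvec.linear_subspace_image[OF linear_act_left subspace_forms])

lemma tangent_orbit: "tangent V i mu \<subseteq> orbit mu"
  by (auto simp: tangent_def orbit_def)

text \<open>The spaces of derivatives by forms of degree \<open>i\<close> increase strictly with \<open>i\<close> until they fill
  the whole orbit, which cannot happen by degree \<open>d\<close> if \<open>mu\<close> vanishes in degree \<open>d\<close>.\<close>

lemma dim_orbit_ge:
  assumes "finite V" and mu: "mu \<in> FL V l" "mu \<noteq> 0" and fin: "vec.findim (orbit mu)"
    and van: "\<And>\<beta>. \<beta> \<in> monomials V d \<Longrightarrow> mu \<beta> = 0"
  shows "d + 2 \<le> vec.dim (orbit mu)"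
proof -
  let ?E = "\<lambda>i. tangent V i mu" and ?L = "lf V l"
  have Lmu: "act ?L mu = mu" using mu by (simp add: FL_def)
  have mono1: "?E i \<subseteq> ?E (Suc i)" for i
  proof
    fix lam assume "lam \<in> ?E i"
    then obtain f where f: "f \<in> forms V i" "lam = act f mu" by (auto simp: tangent_def)
    then have "lam = act (f * ?L) mu" by (simp add: act_mult Lmu)
    then show "lam \<in> ?E (Suc i)" using mult_forms[OF f(1) lf_forms] by (auto simp: tangent_def)
  qed
  have mono: "i \<le> j \<Longrightarrow> ?E i \<subseteq> ?E j" for i j by (rule lift_Suc_mono_le[of ?E, OF mono1])
  have fE: "vec.findim (?E i)" for i using vec.findim_subset[OF tangent_orbit fin] .
  have self: "mu \<in> ?E i" for i
    using act_power_FL[OF Lmu, of i] power_forms[OF lf_forms, of V l i] by (force simp: tangent_def)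
  \<comment> \<open>If two consecutive spaces agree, they are closed under the action and equal the
    whole orbit.\<close>
  have strict: "?E i \<noteq> ?E (Suc i)" if "i \<le> d" for i
  proof
    assume eq: "?E i = ?E (Suc i)"
    have "submod (?E i)"
    proof (rule submod_if_Var[OF subspace_tangent])
      fix v lam assume lam: "lam \<in> ?E i"
      then obtain f where f: "f \<in> forms V i" "lam = act f mu" by (auto simp: tangent_def)
      show "act (Var v) lam \<in> ?E i"
      proof (cases "v \<in> V")
        case True
        have "act (Var v) lam = act (Var v * f) mu" by (simp add: f act_mult)
        then have "act (Var v) lam \<in> ?E (Suc i)"
          using mult_forms[OF Var_forms[OF True] f(1)] by (auto simp: tangent_def)
        then show ?thesis using eq by simp
      next
        case False
        have "lam \<in> vecs (expo V)" using f mu act_vecs by (auto simp: FL_def)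
        then have "act (Var v) lam = 0"
          using False by (auto simp: Var_def act_single vecs_def keys_add_nat fun_eq_iff)
        then show ?thesis using subspace_tangent vec.subspace_0 by metis
      qed
    qed
    then have "orbit mu \<subseteq> ?E i" using orbit_subset self by blast
    then have sub: "orbit mu \<subseteq> ?E d" using mono[OF that] by blast
    \<comment> \<open>Then a monomial on which \<open>mu\<close> does not vanish acts on
      \<open>mu\<close> like a form of degree \<open>d\<close>; comparing the values on
      \<open>1\<close> contradicts the vanishing of \<open>mu\<close> in degree
      \<open>d\<close>.\<close>
    obtain \<beta> where \<beta>: "mu \<beta> \<noteq> 0" using mu(2) by (auto simp: fun_eq_iff)
    have "act (single \<beta> 1) mu \<in> ?E d" using sub by (auto simp: orbit_def)
    then obtain f where f: "f \<in> forms V d" "act (single \<beta> 1) mu = act f mu" by (auto simp: tangent_def)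
    have "pr f mu = 0" using f(1) van by (auto simp: pr_def forms_def intro!: sum.neutral)
    moreover have "pr f mu = mu \<beta>" using f(2)[THEN fun_cong, of 0] by (simp add: act_at_0)
    ultimately show False using \<beta> by simp
  qed
  have "i + 1 \<le> vec.dim (?E i)" if "i \<le> d + 1" for i
    using that
  proof (induction i)
    case 0 then show ?case using vec_dim_pos[OF fE self mu(2), of 0] by simp
  next
    case (Suc i)
    have "\<not> vec.dim (?E (Suc i)) \<le> vec.dim (?E i)"
      using vec.findim_eqI[OF subspace_tangent mono1 fE] strict[of i] Suc by auto
    then show ?case using Suc by auto
  qed
  from this[of "d + 1"] show ?thesis using vec.findim_dim_mono[OF tangent_orbit fin, of V "d + 1"] by simp
qed

text \<open>Take \<open>G\<close> of least dimension among the submodules of dimension at least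
  \<open>2\<close>, and an evaluation \<open>ev p\<close> in it. If \<open>G\<close> had dimension at
  least \<open>3\<close>, the image of \<open>x_i - p_i\<close>, being smaller than \<open>G\<close>,
  would have dimension at most \<open>1\<close> and the kernel dimension at least \<open>2\<close>, so
  that the kernel would be \<open>G\<close>. But if all variables act as scalars, every plane is a
  submodule.\<close>

lemma two_dim_submod:
  fixes E :: "(('v \<Rightarrow>\<^sub>0 nat) \<Rightarrow> 'a::alg_closed_field) set"
  assumes "submod E" "vec.findim E" "E \<subseteq> vecs (expo V)" "2 \<le> vec.dim E"
  shows "\<exists>G\<subseteq>E. submod G \<and> vec.dim G = 2"
proof -
  define Q where "Q G \<longleftrightarrow> submod G \<and> G \<subseteq> E \<and> 2 \<le> vec.dim G" for G
  have "Q E" using assms by (simp add: Q_def)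
  then obtain G where G: "Q G" "\<And>H. Q H \<Longrightarrow> vec.dim G \<le> vec.dim H"
    using ex_has_least_nat[of Q E vec.dim] by metis
  then have G': "submod G" "G \<subseteq> E" "2 \<le> vec.dim G" "vec.findim G" using vec.findim_subset assms(2) by (auto simp: Q_def)
  then have sG: "vec.subspace G" by (simp add: submod_def)
  have "vec.dim G = 2"
  proof (rule ccontr)
    assume ne: "vec.dim G \<noteq> 2"
    have "G \<noteq> {0}" using G'(3) by (auto simp: vec_dim_zero)
    then obtain p where p: "ev p \<in> G" using eigenvector_exists[OF G'(1,4)] G'(2) assms(3) by blast
    have "ev p 0 \<noteq> 0" by simp
    then have p0: "ev p \<noteq> 0" by fastforce
    have eig: "act (Var i) h = vec_scale (p i) h" if h: "h \<in> G" for i h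
    proof -
      let ?T = "Var i - Const (p i)"
      define K where "K = {h \<in> G. act ?T h = 0}"
      have K: "submod K" "K \<subseteq> G" "vec.findim K"
        using submod_kernel[OF G'(1)] vec.findim_subset[OF _ G'(4)] by (auto simp: K_def)
      have "ev p \<in> K" using p by (simp add: K_def act_Var_minus act_ev)
      then have k1: "1 \<le> vec.dim K" using vec_dim_pos K p0 by blast
      have I: "submod (act ?T ` G)" "act ?T ` G \<subseteq> G" using submod_image[OF G'(1)] G'(1) by (auto simp: submod_def)
      have rn: "vec.dim G = vec.dim K + vec.dim (act ?T ` G)"
        unfolding K_def by (rule vecvec.rank_nullity[OF linear_act sG G'(4)])
      then have "\<not> Q (act ?T ` G)" using k1 G(2)[of "act ?T ` G"] by linarith
      then have "vec.dim (act ?T ` G) \<le> 1" using I G' by (auto simp: Q_def)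
      then have "2 \<le> vec.dim K" using rn ne G'(3) by linarith
      then have "Q K" using K G' by (auto simp: Q_def)
      then have "K = G" using vec.findim_eqI[OF _ K(2) G'(4) G(2)] K(1) by (auto simp: submod_def)
      then show ?thesis using h by (auto simp: K_def act_Var_minus)
    qed
    obtain B where B: "finite B" "vec.independent B" "B \<subseteq> G" "card B = vec.dim G" using vec.findim_basis[OF G'(4)] by metis
    then obtain C where C: "C \<subseteq> B" "card C = 2" "finite C" using obtain_subset_with_card_n[of 2 B] G'(3) by metis
    have CG: "vec.span C \<subseteq> G" using C B sG by (intro vec.span_minimal) auto
    have "submod (vec.span C)"
    proof (rule submod_if_Var[OF vec.subspace_span])
      fix i lam assume lam: "lam \<in> vec.span C"
      then have "act (Var i) lam = vec_scale (p i) lam" using eig CG by blast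
      then show "act (Var i) lam \<in> vec.span C" using lam by (simp add: vec.span_scale)
    qed
    moreover have dC: "vec.dim (vec.span C) = 2"
      using vec.dim_span_eq_card_independent[OF vec.independent_mono[OF B(2) C(1)]] C by simp
    ultimately have "Q (vec.span C)" using CG G' by (auto simp: Q_def)
    then show False using G(2) dC ne G'(3) by fastforce
  qed
  then show ?thesis using G' by blast
qed

text \<open>Such a \<open>G\<close> belongs to a scheme of degree two. A functional in \<open>G\<close> that is
  not a common eigenvector of the variables generates \<open>G\<close>; if \<open>G\<close> is spanned by two evaluations, their
  sum is one.\<close>

lemma two_dim_submod_separating:
  fixes G :: "(('v \<Rightarrow>\<^sub>0 nat) \<Rightarrow> 'a::alg_closed_field) set"
  assumes "submod G" "vec.findim G" "G \<subseteq> vecs (expo V)" "vec.dim G = 2"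
  shows "\<exists>h\<in>G. \<forall>f. act f h = 0 \<longrightarrow> (\<forall>g\<in>G. act f g = 0)"
proof -
  have sG: "vec.subspace G" using assms by (simp add: submod_def)
  have "G \<noteq> {0}" using assms(4) by (auto simp: vec_dim_zero)
  then obtain p where p: "ev p \<in> G" using eigenvector_exists[OF assms(1,2)] assms(3) by blast
  have "ev p 0 \<noteq> 0" by simp
  then have p0: "ev p \<noteq> 0" by fastforce
  have "\<not> G \<subseteq> vec.span {ev p}"
  proof
    assume "G \<subseteq> vec.span {ev p}"
    then have "vec.dim G \<le> 1" using vec.dim_le_card[of G "{ev p}"] by simp
    then show False using assms(4) by simp
  qed
  then obtain h where h: "h \<in> G" "h \<notin> vec.span {ev p}" by blast
  have ind: "vec.independent {h, ev p}" "h \<noteq> ev p"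
    using h(2) p0 vec.independent_insertI[of h "{ev p}"] vec.span_base[of "ev p" "{ev p}"] by auto
  have "vec.span {h, ev p} = G"
    using vec.findim_eqI[of "vec.span {h, ev p}" G] vec.span_minimal[of "{h, ev p}" G] h p sG assms(2,4)
      vec.dim_span_eq_card_independent[OF ind(1)] ind(2) by auto
  then have rep: "\<exists>a b. g = vec_scale a h + vec_scale b (ev p)" if g: "g \<in> G" for g
  proof -
    have "g \<in> vec.span {h, ev p}" using g \<open>vec.span {h, ev p} = G\<close> by simp
    then obtain a where "g - vec_scale a h \<in> vec.span {ev p}" using vec.span_breakdown_eq[of g h "{ev p}"] by auto
    then obtain b where "g - vec_scale a h = vec_scale b (ev p)" by (auto simp: vec.span_singleton)
    then have "g = vec_scale a h + vec_scale b (ev p)" by (metis diff_eq_eq add.commute)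
    then show ?thesis by blast
  qed
  have suff: "\<forall>g\<in>G. act f g = 0" if "act f h = 0" "act f (ev p) = 0" for f
    using rep that by (fastforce simp: act_plus_right act_vec_scale)
  show ?thesis
  proof (cases "\<forall>i. act (Var i) h \<in> vec.span {h}")
    \<comment> \<open>\<open>h\<close> is a multiple of an evaluation at a second point.\<close>
    case True
    then have "\<forall>i. \<exists>c. act (Var i) h = vec_scale c h" by (auto simp: vec.span_singleton)
    then obtain c where c: "\<And>i. act (Var i) h = vec_scale (c i) h" by metis
    have hc: "h = vec_scale (h 0) (ev c)" using eigenvector_eq_ev[OF c] .
    have ah: "act f h = vec_scale (pr f (ev c)) h" for f
    proof -
      have "act f h = vec_scale (h 0) (act f (ev c))" by (subst hc) (simp add: act_vec_scale)
      also have "\<dots> = vec_scale (pr f (ev c)) (vec_scale (h 0) (ev c))" by (simp add: act_ev vec_scale_def mult.left_commute)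
      finally show ?thesis using hc by simp
    qed
    have "act f h = 0 \<and> act f (ev p) = 0" if "act f (h + ev p) = 0" for f
    proof -
      have "vec_scale (pr f (ev c)) h + vec_scale (pr f (ev p)) (ev p) = 0"
        using that by (simp add: act_plus_right ah act_ev)
      then have 0: "(\<Sum>v\<in>{h, ev p}. vec_scale (if v = h then pr f (ev c) else pr f (ev p)) v) = 0"
        using ind(2) ind(2)[symmetric] by simp
      have "(if v = h then pr f (ev c) else pr f (ev p)) = 0" if "v \<in> {h, ev p}" for v
        using vec.independentD[OF ind(1) _ _ 0 that] by simp
      from this[of h] this[of "ev p"] show ?thesis using ind(2) by (auto simp: ah act_ev)
    qed
    then show ?thesis using suff vec.subspace_add[OF sG h(1) p] by blast
  next
    case False
    then obtain i where i: "act (Var i) h \<notin> vec.span {h}" by blast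
    have "act (Var i) h \<in> G" using assms(1) h by (auto simp: submod_def)
    then obtain a b where ab: "act (Var i) h = vec_scale a h + vec_scale b (ev p)" using rep by blast
    have "b \<noteq> 0" using i ab by (auto simp: vec.span_singleton)
    have "act f (ev p) = 0" if "act f h = 0" for f
    proof -
      have "0 = act f (act (Var i) h)" using that act_commute[of f "Var i" h] by simp
      also have "\<dots> = vec_scale b (act f (ev p))" by (simp only: ab act_plus_right act_vec_scale that) simp
      finally show ?thesis using \<open>b \<noteq> 0\<close> by (metis vec.scale_eq_0_iff)
    qed
    then show ?thesis using suff h(1) by blast
  qed
qed

text \<open>By hypothesis fewer forms annihilate \<open>h\<close> than \<open>mu\<close>; compare
  the dimensions of kernel and image.\<close>

lemma dim_tangent_le:
  assumes "finite V" and "\<And>f. f \<in> forms V i \<Longrightarrow> act f h = 0 \<Longrightarrow> act f mu = 0"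
  shows "vec.dim (tangent V i mu) \<le> vec.dim (tangent V i (h :: ('v \<Rightarrow>\<^sub>0 nat) \<Rightarrow> 'a::field))"
proof -
  let ?F = "forms V i :: ('v, 'a) mpoly set"
  have rn: "mpoly.dim ?F = mpoly.dim {f \<in> ?F. act f k = 0} + vec.dim (tangent V i k)" for k
    unfolding tangent_def
    by (rule mpolyvec.rank_nullity[OF linear_act_left subspace_forms findim_forms[OF assms(1)]])
  have "mpoly.dim {f \<in> ?F. act f h = 0} \<le> mpoly.dim {f \<in> ?F. act f mu = 0}"
    by (rule mpoly.findim_dim_mono) (use assms(2) in \<open>auto intro: mpoly.findim_subset[OF _ findim_forms[OF assms(1)]]\<close>)
  then show ?thesis using rn[of h] rn[of mu] by linarith
qed

text \<open>The span of the derivatives of first order is at most two-dimensional, so \<open>mu\<close> lives on a line.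
  Otherwise some linear form \<open>u\<close> with \<open>u mu \<noteq> 0\<close> annihilates a two-dimensional submodule of the
  orbit, and the induction hypothesis applies to \<open>u mu\<close>. Linear forms that annihilate \<open>u mu\<close>
  annihilate \<open>mu\<close>, because they send \<open>mu\<close> to a functional with too small an orbit.\<close>

theorem dim_tangent_le_2:
  fixes mu :: "('v \<Rightarrow>\<^sub>0 nat) \<Rightarrow> 'a::alg_closed_field"
  assumes "finite V" and "mu \<in> FL V l" and "vec.findim (orbit mu)"
    and "\<And>\<beta>. \<beta> \<in> monomials V d \<Longrightarrow> mu \<beta> = 0" and "vec.dim (orbit mu) \<le> 2 * d + 1"
  shows "vec.dim (tangent V 1 mu) \<le> 2"
  using assms(2-5)
proof (induction d arbitrary: mu)
  case 0
  have "mu = 0"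
  proof (rule ccontr)
    assume "mu \<noteq> 0"
    from dim_orbit_ge[where d = 0, OF assms(1) 0(1) this 0(2,3)] 0(4) show False by simp
  qed
  then have "tangent V 1 mu \<subseteq> {0}" by (auto simp: tangent_def)
  then have "vec.dim (tangent V 1 mu) \<le> 0" using vec.dim_le_card[of "tangent V 1 mu" "{}"] by simp
  then show ?case by simp
next
  case (Suc d)
  note fin = Suc.prems(2)
  show ?case
  proof (cases "2 \<le> vec.dim (orbit mu)")
    case False
    then show ?thesis using vec.findim_dim_mono[OF tangent_orbit fin, of V 1] by simp
  next
    case True
    have sO: "submod (orbit mu)" "vec.subspace (orbit mu)" using submod_orbit by (auto simp: submod_def)
    have muV: "mu \<in> vecs (expo V)" using Suc.prems(1) by (simp add: FL_def)
    then have OV: "orbit mu \<subseteq> vecs (expo V)" using act_vecs by (auto simp: orbit_def)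
    \<comment> \<open>\<open>G\<close> is generated by \<open>h\<close>, so \<open>h\<close> has at
      most two independent derivatives of first order.\<close>
    obtain G where G: "G \<subseteq> orbit mu" "submod G" "vec.dim G = 2"
      using two_dim_submod[OF sO(1) fin OV True] by blast
    have fG: "vec.findim G" using vec.findim_subset[OF G(1) fin] .
    obtain h where h: "h \<in> G" "\<And>f g. act f h = 0 \<Longrightarrow> g \<in> G \<Longrightarrow> act f g = 0"
      using two_dim_submod_separating[OF G(2) fG _ G(3)] G(1) OV by blast
    have th: "vec.dim (tangent V 1 h) \<le> 2"
    proof -
      have "tangent V 1 h \<subseteq> G" using G(2) h(1) by (auto simp: tangent_def submod_def)
      then show ?thesis using vec.findim_dim_mono[OF _ fG] G(3) by metis
    qed
    show ?thesis
    proof (cases "\<exists>u\<in>forms V 1. act u h = 0 \<and> act u mu \<noteq> 0")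
      case False
      then have "vec.dim (tangent V 1 mu) \<le> vec.dim (tangent V 1 h)"
        by (intro dim_tangent_le[OF assms(1)]) blast
      then show ?thesis using th by simp
    next
      case True
      then obtain u where u: "u \<in> forms V 1" "act u h = 0" "act u mu \<noteq> 0" by blast
      define nu where "nu = act u mu"
      define K where "K = {x \<in> orbit mu. act u x = 0}"
      have K: "submod K" "K \<subseteq> orbit mu" "vec.findim K"
        using submod_kernel[OF sO(1)] vec.findim_subset[OF _ fin] by (auto simp: K_def)
      have van: "act f mu \<beta> = 0" if "f \<in> forms V 1" "\<beta> \<in> monomials V d" for f \<beta>
        unfolding act_def pr_def
      proof (intro sum.neutral ballI)
        fix \<alpha> assume "\<alpha> \<in> keys f"
        then have "\<alpha> + \<beta> \<in> monomials V (Suc d)" using that monomials_add[of \<alpha> V 1 \<beta> d] by (auto simp: forms_def)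
        then show "lookup f \<alpha> * mu (\<alpha> + \<beta>) = 0" using Suc.prems(3) by simp
      qed
      have orb: "orbit nu = act u ` orbit mu"
        by (auto simp: orbit_def nu_def act_commute[of _ u] image_image)
      have rn: "vec.dim (orbit mu) = vec.dim K + vec.dim (orbit nu)"
        unfolding K_def orb by (rule vecvec.rank_nullity[OF linear_act sO(2) fin])
      have "G \<subseteq> K" using G(1) h(2)[OF u(2)] by (auto simp: K_def)
      then have "2 \<le> vec.dim K" using vec.findim_dim_mono[OF _ K(3)] G(3) by metis
      \<comment> \<open>Passing from \<open>mu\<close> to \<open>u mu\<close> lowers the dimension
        of the orbit by at least \<open>2\<close>, as the induction on \<open>d\<close>
        requires.\<close>
      then have small: "vec.dim (orbit nu) \<le> 2 * d + 1" using rn Suc.prems(4) by simp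
      have nu: "nu \<in> FL V l" "vec.findim (orbit nu)"
        using act_FL[OF Suc.prems(1)] orb vecvec.findim_image[OF linear_act fin] by (auto simp: nu_def)
      have nuvan: "\<beta> \<in> monomials V d \<Longrightarrow> nu \<beta> = 0" for \<beta> using van[OF u(1)] by (simp add: nu_def)
      have IH: "vec.dim (tangent V 1 nu) \<le> 2" by (rule Suc.IH[OF nu nuvan small])
      have "d + 2 \<le> vec.dim (orbit nu)"
        using dim_orbit_ge[OF assms(1) nu(1) _ nu(2) nuvan] u(3) by (simp add: nu_def)
      then have Ksmall: "vec.dim K \<le> d + 1" using rn Suc.prems(4) by simp
      have "act f mu = 0" if f: "f \<in> forms V 1" "act f nu = 0" for f
      proof (rule ccontr)
        assume ne: "act f mu \<noteq> 0"
        have "act f mu \<in> K" using f(2) by (simp add: K_def orbit_def nu_def act_commute[of u])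
        then have oK: "orbit (act f mu) \<subseteq> K" using orbit_subset K(1) by blast
        have "d + 2 \<le> vec.dim (orbit (act f mu))"
          using dim_orbit_ge[OF assms(1) act_FL[OF Suc.prems(1)] ne vec.findim_subset[OF oK K(3)] van[OF f(1)]] .
        then show False using vec.findim_dim_mono[OF oK K(3)] Ksmall by simp
      qed
      then have "vec.dim (tangent V 1 mu) \<le> vec.dim (tangent V 1 nu)"
        by (intro dim_tangent_le[OF assms(1)])
      then show ?thesis using IH by simp
    qed
  qed
qed

text \<open>Coordinates for the line: \<open>v\<close> and \<open>w\<close> are the coefficients of the derivatives \<open>x_i mu\<close> with respect
  to a basis \<open>mu, tau\<close> of the space of first derivatives.\<close>

theorem functional_on_line:
  fixes mu :: "('v \<Rightarrow>\<^sub>0 nat) \<Rightarrow> 'a::alg_closed_field"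
  assumes "finite V" and mu: "mu \<in> FL V l" "mu \<noteq> 0" and fin: "vec.findim (orbit mu)"
    and van: "\<And>\<beta>. \<beta> \<in> monomials V d \<Longrightarrow> mu \<beta> = 0" and small: "vec.dim (orbit mu) \<le> 2 * d + 1"
  shows "\<exists>v w. v \<in> vecs V \<and> w \<in> vecs V \<and> dot V l v = 1 \<and> dot V l w = 0 \<and> w \<noteq> 0 \<and>
    (\<forall>u. dot V u v = 0 \<longrightarrow> dot V u w = 0 \<longrightarrow> act (lf V u) mu = 0)"
proof -
  let ?T = "tangent V 1 mu"
  have Lmu: "act (lf V l) mu = mu" using mu by (simp add: FL_def)
  have T2: "vec.dim ?T \<le> 2" by (rule dim_tangent_le_2[OF assms(1) mu(1) fin van small])
  have fT: "vec.findim ?T" using vec.findim_subset[OF tangent_orbit fin] .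
  have muT: "mu \<in> ?T" using Lmu lf_forms[of V l] by (force simp: tangent_def)
  \<comment> \<open>Otherwise the orbit would be one-dimensional, whereas its dimension is at least
    \<open>d + 2\<close>.\<close>
  have "\<not> ?T \<subseteq> vec.span {mu}"
  proof
    assume sub: "?T \<subseteq> vec.span {mu}"
    have "submod (vec.span {mu})"
    proof (rule submod_if_Var[OF vec.subspace_span])
      fix i lam assume "lam \<in> vec.span {mu}"
      then obtain c where c: "lam = vec_scale c mu" by (auto simp: vec.span_singleton)
      have "act (Var i) mu \<in> vec.span {mu}"
      proof (cases "i \<in> V")
        case True
        then have "act (Var i) mu \<in> ?T" unfolding tangent_def by (rule imageI[OF Var_forms])
        then show ?thesis using sub by blast
      next
        case False
        have "mu \<in> vecs (expo V)" using mu by (simp add: FL_def)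
        then have "act (Var i) mu = 0"
          using False by (auto simp: Var_def act_single vecs_def keys_add_nat fun_eq_iff)
        then show ?thesis using vec.span_zero by metis
      qed
      then show "act (Var i) lam \<in> vec.span {mu}" by (simp only: c act_vec_scale vec.span_scale)
    qed
    then have "orbit mu \<subseteq> vec.span {mu}" using orbit_subset vec.span_base by blast
    then have "vec.dim (orbit mu) \<le> 1" using vec.dim_le_card[of "orbit mu" "{mu}"] by simp
    then show False using dim_orbit_ge[OF assms(1) mu fin van] by simp
  qed
  then obtain tau where tau: "tau \<in> ?T" "tau \<notin> vec.span {mu}" by blast
  have ind: "vec.independent {tau, mu}" "tau \<noteq> mu"
    using tau(2) mu(2) vec.independent_insertI[of tau "{mu}"] vec.span_base[of mu "{mu}"] by auto
  have "vec.span {tau, mu} = ?T"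
    using vec.findim_eqI[of "vec.span {tau, mu}" ?T] vec.span_minimal[of "{tau, mu}" ?T] tau muT
      subspace_tangent fT T2 vec.dim_span_eq_card_independent[OF ind(1)] ind(2) by auto
  then have rep: "\<exists>a b. g = vec_scale a mu + vec_scale b tau" if g: "g \<in> ?T" for g
  proof -
    have "g \<in> vec.span {tau, mu}" using g \<open>vec.span {tau, mu} = ?T\<close> by simp
    then obtain b where "g - vec_scale b tau \<in> vec.span {mu}" using vec.span_breakdown_eq[of g tau "{mu}"] by auto
    then obtain a where "g - vec_scale b tau = vec_scale a mu" by (auto simp: vec.span_singleton)
    then have "g = vec_scale a mu + vec_scale b tau" by (metis diff_eq_eq)
    then show ?thesis by blast
  qed
  have uniq: "a = 0 \<and> b = 0" if "vec_scale a mu + vec_scale b tau = 0" for a b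
  proof -
    have 0: "(\<Sum>v\<in>{tau, mu}. vec_scale (if v = tau then b else a) v) = 0"
      using ind(2) ind(2)[symmetric] that by (simp add: add.commute)
    have "(if v = tau then b else a) = 0" if "v \<in> {tau, mu}" for v
      using vec.independentD[OF ind(1) _ _ 0 that] by simp
    from this[of tau] this[of mu] show ?thesis using ind(2) by auto
  qed
  have "\<forall>i\<in>V. \<exists>ab. act (Var i) mu = vec_scale (fst ab) mu + vec_scale (snd ab) tau"
    using rep Var_forms by (fastforce simp: tangent_def)
  then obtain ab where ab: "\<And>i. i \<in> V \<Longrightarrow> act (Var i) mu = vec_scale (fst (ab i)) mu + vec_scale (snd (ab i)) tau"
    by metis
  define v where "v = (\<lambda>i. if i \<in> V then fst (ab i) else 0)"
  define w where "w = (\<lambda>i. if i \<in> V then snd (ab i) else 0)"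
  have lin: "act (lf V u) mu = vec_scale (dot V u v) mu + vec_scale (dot V u w) tau" for u
  proof -
    have "act (lf V u) mu = (\<Sum>i\<in>V. vec_scale (u i * v i) mu + vec_scale (u i * w i) tau)"
      unfolding act_lf
      by (rule sum.cong) (simp_all add: ab v_def w_def vec.scale_right_distrib)
    also have "\<dots> = vec_scale (dot V u v) mu + vec_scale (dot V u w) tau"
      by (simp only: sum.distrib vec.scale_sum_left[symmetric] dot_def)
    finally show ?thesis .
  qed
  have "vec_scale (dot V l v - 1) mu + vec_scale (dot V l w) tau = 0"
    using lin[of l] Lmu by (simp add: vec.scale_left_diff_distrib algebra_simps)
  then have lv: "dot V l v = 1" "dot V l w = 0" using uniq by fastforce+
  have "w \<noteq> 0"
  proof
    assume w0: "w = 0"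
    have "act (Var i) mu \<in> vec.span {mu}" if "i \<in> V" for i
    proof -
      have "snd (ab i) = 0" using w0 that by (metis w_def zero_fun_apply)
      then show ?thesis using ab[OF that] by (simp add: vec.span_scale vec.span_base)
    qed
    then have all: "act (Var i) mu \<in> vec.span {mu}" if "i \<in> V" for i using that by blast
    obtain f where f: "f \<in> forms V 1" "tau = act f mu" using tau(1) by (auto simp: tangent_def)
    have "tau \<in> vec.span {mu}"
      unfolding f(2)
    proof (subst poly_mapping_sum_single[of f], unfold act_sum, rule vec.span_sum)
      fix \<alpha> assume "\<alpha> \<in> keys f"
      then have "\<alpha> \<in> monomials V 1" using f(1) by (auto simp: forms_def)
      then have "keys \<alpha> \<subseteq> V" "deg_in V \<alpha> = Suc 0" by (simp_all add: monomials_def)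
      then obtain i \<gamma> where i: "i \<in> V" "\<alpha> = single i 1 + \<gamma>" "\<gamma> \<in> monomials V 0"
        by (rule monomial_split)
      then have "\<alpha> = single i 1" by simp
      then have "act (single \<alpha> (lookup f \<alpha>)) mu = vec_scale (lookup f \<alpha>) (act (Var i) mu)"
        by (simp add: Var_def act_single vec_scale_def)
      then show "act (single \<alpha> (lookup f \<alpha>)) mu \<in> vec.span {mu}" using all[OF i(1)] vec.span_scale by metis
    qed
    then show False using tau(2) by blast
  qed
  moreover have "v \<in> vecs V" "w \<in> vecs V" by (auto simp: v_def w_def vecs_def)
  ultimately show ?thesis using lv lin by (intro exI[of _ v] exI[of _ w]) simp
qed

section \<open>Finite schemes as spaces of functionals\<close>

text \<open>Scalar-valued linear maps are treated as maps to the one-dimensional space of functions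
  on \<open>unit\<close>, so that they are linear maps between two spaces of the same two kinds as
  everywhere else.\<close>

lemma linear_functional_repr:
  assumes g: "Vector_Spaces.linear poly_scale vec_scale (g :: ('v, 'a::field) mpoly \<Rightarrow> unit \<Rightarrow> 'a)"
  shows "pr f (\<lambda>\<beta>. g (single \<beta> 1) ()) = g f ()"
proof -
  have "g f = (\<Sum>\<alpha>\<in>keys f. vec_scale (lookup f \<alpha>) (g (single \<alpha> 1)))"
    by (subst (1) poly_mapping_sum_single[of f], subst single_poly_scale)
       (simp only: mpolyvec.linear_sum[OF g] mpolyvec.linear_scale[OF g])
  then show ?thesis by (simp add: sum_fun_at vec_scale_def pr_def)
qed

lemma linear_pr: "Vector_Spaces.linear poly_scale vec_scale (\<lambda>f (_::unit). pr f xi)"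
  by (intro Vector_Spaces.linear_iff[THEN iffD2] conjI vec.vector_space_axioms mpoly.vector_space_axioms)
     (simp_all add: pr_add pr_poly_scale vec_scale_def fun_eq_iff)

lemma separating_functional:
  assumes J: "mpoly.subspace J" and f: "(f :: ('v, 'a::field) mpoly) \<notin> J"
  shows "\<exists>xi. pr f xi = 1 \<and> (\<forall>g\<in>J. pr g xi = 0)"
proof -
  obtain C where C: "C \<subseteq> J" "mpoly.independent C" "J \<subseteq> mpoly.span C"
    using mpoly.maximal_independent_subset by metis
  have "mpoly.span C \<subseteq> J" using C J by (simp add: mpoly.span_minimal)
  then have fC: "f \<notin> mpoly.span C" "f \<notin> C" using f C by auto
  then have "mpoly.independent (insert f C)" using C mpoly.independent_insertI by blast
  from mpolyvec.linear_independent_extend[OF this, of "\<lambda>x. if x = f then (\<lambda>_::unit. 1) else 0"]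
  obtain g where g: "Vector_Spaces.linear poly_scale vec_scale g"
     "\<And>x. x \<in> insert f C \<Longrightarrow> g x = (if x = f then (\<lambda>_::unit. 1) else 0)" by blast
  have "C \<subseteq> {x. g x = 0}" using g(2) fC(2) by auto
  then have "J \<subseteq> {x. g x = 0}"
    using C(3) mpoly.span_minimal[OF _ mpolyvec.linear_subspace_kernel[OF g(1)]] by blast
  then show ?thesis using g(2)[of f] linear_functional_repr[OF g(1)]
    by (intro exI[of _ "\<lambda>\<beta>. g (single \<beta> 1) ()"]) auto
qed

text \<open>The properties of an ideal of a subscheme of the Veronese variety that the extension of
  functionals rests on: it is a vector space, closed under multiplication by forms, and contains the
  homogeneous relations of the variety.\<close>

definition ver_module :: "'v set \<Rightarrow> nat \<Rightarrow> ('v \<Rightarrow>\<^sub>0 nat, 'a::field) mpoly set \<Rightarrow> bool" where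
  "ver_module V d I \<longleftrightarrow> mpoly.subspace I \<and>
     (\<forall>k. \<forall>G\<in>forms (monomials V d) k. \<forall>F\<in>I. G * F \<in> I) \<and>
     (\<forall>e. \<forall>F\<in>forms (monomials V d) e. phi F = 0 \<longrightarrow> F \<in> I)"

text \<open>The Macaulay dual of a scheme with ideal \<open>I\<close>, in the chart \<open>L =
  1\<close>: the functionals annihilated by the ideal.\<close>

definition perp ::
  "'v set \<Rightarrow> nat \<Rightarrow> ('v \<Rightarrow> 'a::field) \<Rightarrow> ('v \<Rightarrow>\<^sub>0 nat, 'a) mpoly set \<Rightarrow> (('v \<Rightarrow>\<^sub>0 nat) \<Rightarrow> 'a) set" where
  "perp V d l I = {lam \<in> FL V l. \<forall>e. \<forall>F\<in>I \<inter> forms (monomials V d) e. act (phi F) lam = 0}"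

lemma perp_pr: "lam \<in> perp V d l I \<Longrightarrow> F \<in> I \<Longrightarrow> F \<in> forms (monomials V d) e \<Longrightarrow> pr (phi F) lam = 0"
  by (auto simp: perp_def act_at_0[symmetric])

lemma submod_perp: "submod (perp V d l I)"
proof -
  have "vec.subspace (perp V d l I)"
    using subspace_FL[of V l] unfolding perp_def
    by (auto intro!: vec.subspaceI simp: act_plus_right act_vec_scale
        vec.subspace_0 vec.subspace_add vec.subspace_scale)
  moreover have "act f lam \<in> perp V d l I" if "lam \<in> perp V d l I" for f lam
    using that by (auto simp: perp_def act_FL act_commute[of _ f])
  ultimately show ?thesis by (simp add: submod_def)
qed

text \<open>A power of \<open>L\<close> raises the degree of a monomial to a multiple of
  \<open>d\<close>, so that it comes from the Veronese ring.\<close>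

lemma fill_degree:
  fixes l :: "'v \<Rightarrow> 'a::field"
  assumes "keys \<beta> \<subseteq> V" "1 \<le> d"
  obtains k G where "G \<in> forms (monomials V d) (deg_in V \<beta>)" "phi G = single \<beta> 1 * lf V l ^ k"
proof -
  have "deg_in V \<beta> \<le> d * deg_in V \<beta>" using assms(2) by simp
  then have "single \<beta> 1 * lf V l ^ (d * deg_in V \<beta> - deg_in V \<beta>) \<in> forms V (d * deg_in V \<beta>)"
    using mult_forms[OF single_forms[of \<beta> V "deg_in V \<beta>" "1::'a"]
        power_forms[OF lf_forms[of V l], of "d * deg_in V \<beta> - deg_in V \<beta>"]] assms(1)
    by (simp add: monomials_def)
  then show ?thesis by (rule phi_surj) (use that in blast)
qed

text \<open>As \<open>L\<close> acts as the identity, the value of \<open>F lam\<close> on a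
  monomial is the value of \<open>lam\<close> on a multiple of \<open>F\<close> by an element of the
  Veronese ring.\<close>

lemma perpI:
  assumes "1 \<le> d" and I: "ver_module V d I" and lam: "lam \<in> FL V l"
    and 0: "\<And>e F. F \<in> I \<Longrightarrow> F \<in> forms (monomials V d) e \<Longrightarrow> pr (phi F) lam = 0"
  shows "lam \<in> perp V d l I"
proof -
  have "act (phi F) lam \<beta> = 0" if F: "F \<in> I" "F \<in> forms (monomials V d) e" for F e \<beta>
  proof (cases "keys \<beta> \<subseteq> V")
    case True
    obtain k G where G: "G \<in> forms (monomials V d) (deg_in V \<beta>)" "phi G = single \<beta> 1 * lf V l ^ k"
      using fill_degree[OF True assms(1)] by blast
    have "act (lf V l ^ k) lam = lam" using lam act_power_FL by (auto simp: FL_def)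
    then have "pr (phi F * single \<beta> 1) lam = pr (phi F * single \<beta> 1 * lf V l ^ k) lam" by (simp add: pr_act)
    also have "\<dots> = pr (phi (G * F)) lam" by (simp add: phi_mult G(2) ac_simps)
    also have "\<dots> = 0" using 0[of "G * F"] I F G(1) mult_forms[OF G(1) F(2)] by (auto simp: ver_module_def)
    finally show ?thesis by (simp add: act_eq_pr)
  next
    case False
    have "act (phi F) lam \<in> vecs (expo V)" using lam act_vecs by (auto simp: FL_def)
    then show ?thesis using False by (simp add: vecs_def)
  qed
  then show ?thesis using lam by (auto simp: perp_def fun_eq_iff)
qed

text \<open>A functional on the forms of degree \<open>e\<close> extends to a functional on the whole scheme if it kills
  every form that a power of \<open>y = L^d\<close> moves into the ideal. The extension is prescribed to vanish on
  those polynomials whose homogenizations with \<open>L\<close> lie in the ideal in all large degrees.\<close>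

lemma extend_to_perp:
  fixes l :: "'v \<Rightarrow> 'a::field"
  assumes "1 \<le> d" and I: "ver_module V d I"
    and y: "y \<in> forms (monomials V d) 1" "phi y = lf V l ^ d"
    and xi: "\<And>F k. F \<in> forms (monomials V d) e \<Longrightarrow> y ^ k * F \<in> I \<Longrightarrow> pr (phi F) xi = 0"
  shows "\<exists>lam\<in>perp V d l I. \<forall>F\<in>forms (monomials V d) e. pr (phi F) lam = pr (phi F) xi"
proof -
  let ?W = "monomials V d" and ?L = "lf V l"
  define J where "J = {f. \<forall>\<^sub>F k in sequentially. hz V ?L (d * k) f \<in> phi ` (I \<inter> forms ?W k)}"
  have I': "mpoly.subspace I" "\<And>k G F. G \<in> forms ?W k \<Longrightarrow> F \<in> I \<Longrightarrow> G * F \<in> I"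
     "\<And>e F. F \<in> forms ?W e \<Longrightarrow> phi F = 0 \<Longrightarrow> F \<in> I" using I by (auto simp: ver_module_def)
  have sI: "mpoly.subspace (I \<inter> forms ?W k)" for k
    using I'(1) subspace_forms mpoly.subspace_inter by blast
  have sphi: "mpoly.subspace (phi ` (I \<inter> forms ?W k))" for k
  proof (rule mpoly.subspaceI)
    show "0 \<in> phi ` (I \<inter> forms ?W k)" using mpoly.subspace_0[OF sI] by force
  next
    fix x z assume "x \<in> phi ` (I \<inter> forms ?W k)" "z \<in> phi ` (I \<inter> forms ?W k)"
    then obtain F G where "F \<in> I \<inter> forms ?W k" "G \<in> I \<inter> forms ?W k" "x = phi F" "z = phi G" by blast
    then show "x + z \<in> phi ` (I \<inter> forms ?W k)"
      using mpoly.subspace_add[OF sI, of F k G] by (auto simp: phi_add[symmetric])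
  next
    fix c x assume "x \<in> phi ` (I \<inter> forms ?W k)"
    then obtain F where "F \<in> I \<inter> forms ?W k" "x = phi F" by blast
    then show "poly_scale c x \<in> phi ` (I \<inter> forms ?W k)"
      using mpoly.subspace_scale[OF sI, of F k c] by (auto simp: phi_poly_scale[symmetric])
  qed
  have sJ: "mpoly.subspace J"
  proof (rule mpoly.subspaceI)
    show "0 \<in> J" using mpoly.subspace_0[OF sphi] by (simp add: J_def)
  next
    fix f g assume "f \<in> J" "g \<in> J"
    then show "f + g \<in> J" unfolding J_def mem_Collect_eq
      by eventually_elim (simp add: hz_add mpoly.subspace_add[OF sphi])
  next
    fix c f assume "f \<in> J"
    then show "poly_scale c f \<in> J" unfolding J_def mem_Collect_eq
      by eventually_elim (simp add: hz_scale mpoly.subspace_scale[OF sphi])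
  qed
  have shift: "hz V ?L (d * k) (phi F) = phi (y ^ (k - j) * F)" if "F \<in> forms ?W j" "j \<le> k" for F j k
  proof -
    have "hz V ?L (d * k) (phi F) = phi F * ?L ^ (d * k - d * j)" by (rule hz_of_form[OF phi_forms[OF that(1)]])
    also have "?L ^ (d * k - d * j) = phi (y ^ (k - j))"
      by (simp add: phi_power y(2) power_mult[symmetric] diff_mult_distrib2)
    finally show ?thesis by (simp add: phi_mult mult.commute)
  qed
  have ypow: "y ^ n \<in> forms ?W n" for n using power_forms[OF y(1), of n] by simp
  have phiJ: "phi F \<in> J" if F: "F \<in> I" "F \<in> forms ?W j" for F j
    unfolding J_def mem_Collect_eq eventually_sequentially
  proof (intro exI[of _ j] allI impI)
    fix k assume k: "j \<le> k"
    have "y ^ (k - j) * F \<in> I \<inter> forms ?W k" using I'(2)[OF ypow F(1)] mult_forms[OF ypow F(2), of "k - j"] k by simp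
    then show "hz V ?L (d * k) (phi F) \<in> phi ` (I \<inter> forms ?W k)" using shift[OF F(2) k] by auto
  qed
  \<comment> \<open>Vanishing on these differences makes \<open>L\<close> act as the identity on the
    extension.\<close>
  have LJ: "?L * single \<beta> 1 - single \<beta> 1 \<in> J" if \<beta>: "keys \<beta> \<subseteq> V" for \<beta>
    unfolding J_def mem_Collect_eq eventually_sequentially
  proof (intro exI[of _ "Suc (deg_in V \<beta>)"] allI impI)
    fix k assume "Suc (deg_in V \<beta>) \<le> k"
    moreover have "k \<le> d * k" using assms(1) by simp
    ultimately have D: "Suc (deg_in V \<beta>) \<le> d * k" by linarith
    have "?L * single \<beta> 1 \<in> forms V (1 + deg_in V \<beta>)"
      by (rule mult_forms[OF lf_forms single_forms]) (use \<beta> in \<open>simp add: monomials_def\<close>)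
    then have "hz V ?L (d * k) (?L * single \<beta> 1) = ?L * single \<beta> 1 * ?L ^ (d * k - (1 + deg_in V \<beta>))"
      by (rule hz_of_form)
    also have "\<dots> = single \<beta> 1 * ?L ^ Suc (d * k - (1 + deg_in V \<beta>))" by (simp add: ac_simps)
    also have "Suc (d * k - (1 + deg_in V \<beta>)) = d * k - deg_in V \<beta>" using D by simp
    also have "single \<beta> 1 * ?L ^ (d * k - deg_in V \<beta>) = hz V ?L (d * k) (single \<beta> 1)" by (simp add: hz_single)
    finally have "hz V ?L (d * k) (?L * single \<beta> 1 - single \<beta> 1) = 0" by (simp add: hz_diff)
    then show "hz V ?L (d * k) (?L * single \<beta> 1 - single \<beta> 1) \<in> phi ` (I \<inter> forms ?W k)"
      using mpoly.subspace_0[OF sphi] by simp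
  qed
  \<comment> \<open>A form of degree \<open>e\<close> whose homogenization lies in the ideal is
    moved into the ideal by a power of \<open>y\<close>, so \<open>xi\<close> kills it.\<close>
  have compat: "(\<lambda>_::unit. pr f xi) = 0" if f: "f \<in> forms V (d * e)" "f \<in> J" for f
  proof -
    obtain F where F: "F \<in> forms ?W e" "phi F = f" using phi_surj[OF f(1)] by blast
    obtain K where "\<And>k. k \<ge> K \<Longrightarrow> hz V ?L (d * k) f \<in> phi ` (I \<inter> forms ?W k)"
      using f(2) by (auto simp: J_def eventually_sequentially)
    then obtain k where k: "k \<ge> e" "hz V ?L (d * k) f \<in> phi ` (I \<inter> forms ?W k)" by (meson max.cobounded1 max.cobounded2)
    then obtain F' where F': "F' \<in> I" "F' \<in> forms ?W k" "hz V ?L (d * k) f = phi F'" by auto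
    then have "phi (y ^ (k - e) * F - F') = 0" using shift[OF F(1) k(1)] F(2) by (simp add: phi_diff)
    moreover have "y ^ (k - e) * F \<in> forms ?W k" using mult_forms[OF ypow F(1), of "k - e"] k(1) by simp
    ultimately have "y ^ (k - e) * F - F' \<in> I"
      using I'(3) mpoly.subspace_diff[OF subspace_forms _ F'(2)] by blast
    then have "y ^ (k - e) * F \<in> I" using mpoly.subspace_add[OF I'(1) _ F'(1)] by fastforce
    then show ?thesis using xi[OF F(1)] F(2) by (simp add: fun_eq_iff)
  qed
  obtain g where g: "Vector_Spaces.linear poly_scale vec_scale g"
     "\<And>f. f \<in> forms V (d * e) \<Longrightarrow> g f = (\<lambda>_::unit. pr f xi)" "\<And>f. f \<in> J \<Longrightarrow> g f = 0"
    using mpolyvec.linear_extend_vanishing[OF subspace_forms sJ linear_pr compat] by blast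
  define lam where "lam = (\<lambda>\<beta>. if keys \<beta> \<subseteq> V then g (single \<beta> 1) () else 0)"
  have prlam: "pr f lam = g f ()" if "f \<in> carrier (poly_ring V)" for f
  proof -
    have "pr f lam = pr f (\<lambda>\<beta>. g (single \<beta> 1) ())"
      by (rule pr_cong) (use that in \<open>auto simp: lam_def carrier_poly_ring\<close>)
    also have "\<dots> = g f ()" by (rule linear_functional_repr[OF g(1)])
    finally show ?thesis .
  qed
  have "lam \<in> vecs (expo V)" by (simp add: lam_def vecs_def)
  moreover have "act ?L lam = lam"
  proof
    fix \<beta>
    show "act ?L lam \<beta> = lam \<beta>"
    proof (cases "keys \<beta> \<subseteq> V")
      case True
      have "?L * single \<beta> 1 - single \<beta> 1 \<in> carrier (poly_ring V)"
        using mpoly.subspace_diff[OF subspace_carrier] mult_carrier lf_forms forms_carrier single_carrier[OF True] by blast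
      then have "pr (?L * single \<beta> 1 - single \<beta> 1) lam = 0" using prlam g(3)[OF LJ[OF True]] by simp
      then show ?thesis by (simp add: pr_diff act_eq_pr)
    next
      case False
      then show ?thesis using act_vecs[OF \<open>lam \<in> vecs (expo V)\<close>, of ?L] \<open>lam \<in> vecs (expo V)\<close> by (simp add: vecs_def)
    qed
  qed
  ultimately have "lam \<in> FL V l" by (simp add: FL_def)
  moreover have "pr (phi F) lam = 0" if "F \<in> I" "F \<in> forms ?W j" for F j
    using prlam[of "phi F"] g(3)[OF phiJ[OF that]] phi_forms[OF that(2)] forms_carrier by fastforce
  ultimately have "lam \<in> perp V d l I" using perpI[OF assms(1) I] by blast
  moreover have "pr (phi F) lam = pr (phi F) xi" if "F \<in> forms ?W e" for F
    using prlam[of "phi F"] g(2)[OF phi_forms[OF that]] phi_forms[OF that] forms_carrier by fastforce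
  ultimately show ?thesis by blast
qed

text \<open>The dual forms of \<open>B\<close> in a large degree are independent modulo
  \<open>I\<close>.\<close>

lemma hilbert_fun_ge_card:
  fixes B :: "(('v \<Rightarrow>\<^sub>0 nat) \<Rightarrow> 'a::field) set" and I :: "('v \<Rightarrow>\<^sub>0 nat, 'a) mpoly set"
  assumes "finite V" "1 \<le> d" "finite B" "vec.independent B" "B \<subseteq> FL V l"
    and "\<And>e F v. F \<in> I \<Longrightarrow> F \<in> forms (monomials V d) e \<Longrightarrow> v \<in> B \<Longrightarrow> pr (phi F) v = 0"
  shows "\<forall>\<^sub>F e in sequentially. card B \<le> hilbert_fun (monomials V d) I e"
proof -
  let ?W = "monomials V d"
  obtain e0 where e0: "\<And>e. e \<ge> e0 \<Longrightarrow> \<exists>a. \<forall>v\<in>B. a v \<in> forms ?W e \<and>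
      (\<forall>w\<in>B. pr (phi (a v)) w = (if v = w then 1 else 0))"
    using dual_forms[OF assms(2-5)] by blast
  have "card B \<le> hilbert_fun ?W I e" if e: "e \<ge> e0" for e
  proof -
    obtain a where a: "\<And>v. v \<in> B \<Longrightarrow> a v \<in> forms ?W e"
      "\<And>v w. v \<in> B \<Longrightarrow> w \<in> B \<Longrightarrow> pr (phi (a v)) w = (if v = w then 1 else 0)" using e0[OF e] by metis
    define A0 where "A0 = {F \<in> forms ?W e. \<forall>v\<in>B. pr (phi F) v = 0}"
    have "mpoly.dim (forms ?W e :: ('v \<Rightarrow>\<^sub>0 nat, 'a) mpoly set) = mpoly.dim A0 + card B"
      unfolding A0_def by (rule dim_forms_dual[OF assms(1,3) a])
    moreover have "mpoly.dim (I \<inter> forms ?W e) \<le> mpoly.dim A0"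
    proof (rule mpoly.findim_dim_mono)
      show "I \<inter> forms ?W e \<subseteq> A0" using assms(6) by (auto simp: A0_def)
      show "mpoly.findim A0"
        by (rule mpoly.findim_subset[OF _ findim_forms[OF finite_monomials[OF assms(1)]]]) (auto simp: A0_def)
    qed
    ultimately show ?thesis by (simp add: hilbert_fun_def)
  qed
  then show ?thesis unfolding eventually_sequentially by blast
qed

lemma card_le_hilbert:
  fixes B :: "(('v \<Rightarrow>\<^sub>0 nat) \<Rightarrow> 'a::field) set" and Z :: "('v \<Rightarrow>\<^sub>0 nat, 'a) mpoly set"
  assumes "finite V" "1 \<le> d" "\<forall>\<^sub>F e in sequentially. hilbert_fun (monomials V d) Z e = r"
    "finite B" "vec.independent B" "B \<subseteq> perp V d l Z"
  shows "card B \<le> r"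
proof -
  have "\<forall>\<^sub>F e in sequentially. card B \<le> hilbert_fun (monomials V d) Z e"
  proof (rule hilbert_fun_ge_card[OF assms(1,2,4,5)])
    show "B \<subseteq> FL V l" using assms(6) by (auto simp: perp_def)
    show "pr (phi F) v = 0" if "F \<in> Z" "F \<in> forms (monomials V d) e" "v \<in> B" for e F v
      using perp_pr[OF _ that(1,2)] assms(6) that(3) by blast
  qed
  then have "\<forall>\<^sub>F e in sequentially. card B \<le> r" using assms(3) by eventually_elim simp
  then show ?thesis by simp
qed

lemma findim_perp:
  assumes "finite V" "1 \<le> d" "\<forall>\<^sub>F e in sequentially. hilbert_fun (monomials V d) Z e = r"
  shows "vec.findim (perp V d l Z)"
  using vec.findim_if_independent_bounded[of "perp V d l Z" r] card_le_hilbert[OF assms] by blast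

subsection \<open>Zeros and a linear form that avoids them\<close>

lemma ideal_poly_ring:
  assumes "ideal I (poly_ring W :: ('v, 'a::field) mpoly ring)"
  shows "mpoly.subspace I" "I \<subseteq> carrier (poly_ring W)"
    "f \<in> I \<Longrightarrow> g \<in> carrier (poly_ring W) \<Longrightarrow> g * f \<in> I"
proof -
  interpret ideal I "poly_ring W" by fact
  show sub: "I \<subseteq> carrier (poly_ring W)" by (rule a_subset)
  show m: "g * f \<in> I" if "f \<in> I" "g \<in> carrier (poly_ring W)" for f g
    using I_l_closed[OF that] by simp
  show "mpoly.subspace I"
  proof (rule mpoly.subspaceI)
    show "0 \<in> I" using additive_subgroup.zero_closed[OF is_additive_subgroup] by simp
    show "x + y \<in> I" if "x \<in> I" "y \<in> I" for x y using additive_subgroup.a_closed[OF is_additive_subgroup that] by simp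
    show "poly_scale c x \<in> I" if "x \<in> I" for c x
      unfolding poly_scale_def by (rule m[OF that]) (use Const_forms forms_carrier in blast)
  qed
qed

text \<open>The coordinate vectors in \<open>K\<^sup>V\<close> of the points of the scheme, seen in
  \<open>\<PP>\<^sup>m\<close> rather than on the Veronese variety.\<close>

definition zeros :: "'v set \<Rightarrow> nat \<Rightarrow> ('v \<Rightarrow>\<^sub>0 nat, 'a::field) mpoly set \<Rightarrow> ('v \<Rightarrow> 'a) set" where
  "zeros V d Z = {x \<in> vecs V - {0}. \<forall>e. \<forall>F\<in>Z \<inter> forms (monomials V d) e. pr (phi F) (ev x) = 0}"

lemma dot_scale: "dot V l (vec_scale c x) = c * dot V l x"
  by (simp add: dot_def vec_scale_def sum_distrib_left mult.left_commute)

lemma ev_scale_form: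
  assumes "f \<in> forms V e"
  shows "pr f (ev (vec_scale c x)) = c ^ e * pr f (ev x)"
proof -
  have "ev (vec_scale c x) \<alpha> = c ^ deg_in V \<alpha> * ev x \<alpha>" if "keys \<alpha> \<subseteq> V" for \<alpha>
  proof -
    have "deg_in V \<alpha> = (\<Sum>v\<in>keys \<alpha>. lookup \<alpha> v)" using that by (simp add: deg_in_def Int_absorb2)
    then show ?thesis by (simp add: ev_def vec_scale_def power_mult_distrib prod.distrib power_sum)
  qed
  then have "pr f (ev (vec_scale c x)) = pr f (\<lambda>\<alpha>. c ^ e * ev x \<alpha>)"
    by (intro pr_cong) (use assms in \<open>auto simp: forms_def monomials_def\<close>)
  then show ?thesis by (simp add: pr_scale_right)
qed

lemma lf_single: "finite V \<Longrightarrow> i \<in> V \<Longrightarrow> lf V (\<lambda>j. if j = i then 1 else 0) = Var i"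
proof -
  assume "finite V" "i \<in> V"
  have "lf V (\<lambda>j. if j = i then 1 else 0) = (\<Sum>j\<in>V. if j = i then Var j else 0)"
    unfolding lf_def by (rule sum.cong) auto
  then show ?thesis using \<open>finite V\<close> \<open>i \<in> V\<close> by simp
qed

lemma exists_avoiding_form:
  fixes X :: "('v \<Rightarrow> 'a::field_char_0) set"
  assumes "finite X" "finite V" "X \<subseteq> vecs V - {0}"
  shows "\<exists>l. \<forall>x\<in>X. dot V l x \<noteq> 0"
  using assms(1,3)
proof (induction X rule: finite_induct)
  case empty then show ?case by simp
next
  case (insert x X)
  then obtain l where l: "\<forall>x\<in>X. dot V l x \<noteq> 0" by auto
  have "x \<in> vecs V" "x \<noteq> 0" using insert.prems by auto
  then obtain j where j: "j \<in> V" "x j \<noteq> 0" by (auto simp: vecs_def fun_eq_iff)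
  \<comment> \<open>Change \<open>l\<close> by a multiple \<open>t\<close> of a coordinate that is
    not zero at \<open>x\<close>; each point excludes at most one value of \<open>t\<close>.\<close>
  define bad where "bad = insert (- dot V l x / x j) ((\<lambda>z. - dot V l z / z j) ` X)"
  have "finite bad" using insert by (simp add: bad_def)
  then obtain t where t: "t \<notin> bad" using ex_new_if_finite infinite_UNIV_char_0 by blast
  define l' where "l' = (\<lambda>i. l i + (if i = j then t else 0))"
  have l': "dot V l' z = dot V l z + t * z j" for z
  proof -
    have "(\<Sum>i\<in>V. (if i = j then t else 0) * z i) = (\<Sum>i\<in>V. if i = j then t * z i else 0)"
      by (rule sum.cong) auto
    then show ?thesis using j(1) assms(2) by (simp add: dot_def l'_def distrib_right sum.distrib)
  qed
  have ne: "dot V l z + t * z j \<noteq> 0" if "t \<noteq> - dot V l z / z j" "z j \<noteq> 0" for z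
  proof
    assume "dot V l z + t * z j = 0"
    then have "t = - dot V l z / z j" using that(2) by (simp add: field_simps eq_neg_iff_add_eq_0 add.commute)
    then show False using that by blast
  qed
  have "dot V l' z \<noteq> 0" if "z \<in> insert x X" for z
  proof (cases "z j = 0")
    case True then show ?thesis using that l j by (auto simp: l')
  next
    case False then show ?thesis using that t ne[of z] by (auto simp: l' bad_def)
  qed
  then show ?case by blast
qed

lemma zeros_scale: "x \<in> zeros V d Z \<Longrightarrow> c \<noteq> 0 \<Longrightarrow> vec_scale c x \<in> zeros V d Z"
  using vec.subspace_scale[OF subspace_vecs, of x V c]
  by (auto simp: zeros_def ev_scale_form[OF phi_forms])

lemma ev_perp:
  assumes "x \<in> zeros V d Z" "dot V l x = 1" shows "ev x \<in> perp V d l Z"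
  using assms ev_FL[of x V l] by (auto simp: zeros_def perp_def act_ev)

text \<open>Points of the scheme, normalized by a linear form that avoids them, give independent functionals,
  so there are at most as many as the degree of the scheme.\<close>

lemma finite_zeros:
  fixes Z :: "('v \<Rightarrow>\<^sub>0 nat, 'a::field_char_0) mpoly set"
  assumes "finite V" "1 \<le> d" "\<forall>\<^sub>F e in sequentially. hilbert_fun (monomials V d) Z e = r"
  shows "\<exists>X. finite X \<and> X \<subseteq> zeros V d Z \<and> (\<forall>x\<in>zeros V d Z. \<exists>z\<in>X. \<exists>c. x = vec_scale c z)"
proof -
  define Q where "Q X \<longleftrightarrow> finite X \<and> X \<subseteq> zeros V d Z \<and> (\<forall>x\<in>X. \<forall>z\<in>X. \<forall>c. x = vec_scale c z \<longrightarrow> x = z)" for X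
  have bound: "card X \<le> r" if X: "Q X" for X
  proof -
    have X0: "finite X" "X \<subseteq> vecs V - {0}" using X by (auto simp: Q_def zeros_def)
    obtain l where l: "\<And>x. x \<in> X \<Longrightarrow> dot V l x \<noteq> 0" using exists_avoiding_form[OF X0(1) assms(1) X0(2)] by blast
    define n where "n x = vec_scale (1 / dot V l x) x" for x
    have inj: "inj_on n X"
    proof (rule inj_onI)
      fix x z assume xz: "x \<in> X" "z \<in> X" "n x = n z"
      have "vec_scale (dot V l x) (n x) = x" unfolding n_def using l[OF xz(1)] by (simp add: vec_scale_def)
      then have "x = vec_scale (dot V l x * (1 / dot V l z)) z" unfolding xz(3) by (simp add: n_def)
      then show "x = z" using X xz(1,2) unfolding Q_def by blast
    qed
    have "n x \<in> zeros V d Z" "dot V l (n x) = 1" if "x \<in> X" for x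
      using X that l[OF that] zeros_scale[of x V d Z "1 / dot V l x"] by (auto simp: Q_def n_def dot_scale)
    then have sub: "ev ` n ` X \<subseteq> perp V d l Z" using ev_perp by blast
    have "card (ev ` n ` X) \<le> r"
      by (rule card_le_hilbert[OF assms _ ev_independent sub]) (use X0 in simp)
    moreover have "card (ev ` n ` X) = card X"
      using card_image[OF inj] card_image[of ev "n ` X"] inj_ev by (metis inj_on_subset subset_UNIV)
    ultimately show ?thesis by simp
  qed
  have "Q {}" by (simp add: Q_def)
  have "\<forall>X. Q X \<longrightarrow> card X < Suc r" using bound by (simp add: less_Suc_eq_le)
  from ex_has_greatest_nat[of Q "{}" card "Suc r", OF \<open>Q {}\<close> this]
  \<comment> \<open>A system of pairwise non-proportional zeros of largest cardinality represents
    all zeros.\<close>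
  obtain X where X: "Q X" "\<And>Y. Q Y \<Longrightarrow> card Y \<le> card X" by blast
  have "\<exists>z\<in>X. \<exists>c. x = vec_scale c z" if x: "x \<in> zeros V d Z" for x
  proof (rule ccontr)
    assume no: "\<not> ?thesis"
    have same: "x = z" if "z \<in> X" "z = vec_scale c x" for z c
    proof -
      have "c \<noteq> 0" using that X(1) by (auto simp: Q_def zeros_def)
      then have "x = vec_scale (1 / c) z" using that(2) by (simp add: vec_scale_def)
      then show ?thesis using no that(1) by blast
    qed
    have x2: "z \<noteq> vec_scale c x" if "z \<in> X" for z c
    proof
      assume "z = vec_scale c x"
      then have "x = z" by (rule same[OF that])
      then have "x = vec_scale 1 z" by simp
      then show False using no that by blast
    qed
    have "Q (insert x X)"
      unfolding Q_def
    proof (intro conjI ballI allI impI)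
      fix u z c assume u: "u \<in> insert x X" and z: "z \<in> insert x X" and eq: "u = vec_scale c z"
      show "u = z"
      proof (cases "u = x")
        case True
        then have "z \<notin> X" using no eq by auto
        then show ?thesis using True z by simp
      next
        case False
        then have uX: "u \<in> X" using u by simp
        then have "z \<noteq> x" using x2 eq by auto
        then have "z \<in> X" using z by simp
        then show ?thesis using X(1) uX eq unfolding Q_def by blast
      qed
    qed (use X(1) x in \<open>auto simp: Q_def\<close>)
    moreover have "x \<notin> X" using no vec.scale_one[of x] by metis
    ultimately show False using X(2)[of "insert x X"] X(1) by (auto simp: Q_def)
  qed
  then show ?thesis using X(1) by (auto simp: Q_def)
qed

subsection \<open>Linear forms are not zero divisors on a scheme that they avoid\<close>

lemma cring_poly_ring: "cring (poly_ring W :: ('v, 'a::field) mpoly ring)"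
proof (rule cringI)
  show "abelian_group (poly_ring W :: ('v, 'a) mpoly ring)"
  proof (rule abelian_groupI)
    fix x :: "('v, 'a) mpoly" assume x: "x \<in> carrier (poly_ring W)"
    show "\<exists>y\<in>carrier (poly_ring W). y \<oplus>\<^bsub>poly_ring W\<^esub> x = \<zero>\<^bsub>poly_ring W\<^esub>"
      by (rule bexI[of _ "- x"]) (use mpoly.subspace_neg[OF subspace_carrier x] in auto)
  qed (auto simp: mpoly.subspace_add[OF subspace_carrier] mpoly.subspace_0[OF subspace_carrier] add_ac)
  show "comm_monoid (poly_ring W :: ('v, 'a) mpoly ring)"
    by (rule comm_monoidI) (auto simp: mult_carrier one_carrier mult_ac)
qed (auto simp: distrib_right)

lemma ideal_poly_ringI:
  fixes I :: "('v, 'a::field) mpoly set"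
  assumes "mpoly.subspace I" "I \<subseteq> carrier (poly_ring W)"
    "\<And>f g. f \<in> I \<Longrightarrow> g \<in> carrier (poly_ring W) \<Longrightarrow> g * f \<in> I"
  shows "ideal I (poly_ring W)"
proof -
  interpret cring "poly_ring W :: ('v, 'a) mpoly ring" by (rule cring_poly_ring)
  have neg: "\<ominus>\<^bsub>poly_ring W\<^esub> x = - x" if "x \<in> carrier (poly_ring W)" for x :: "('v, 'a) mpoly"
    by (rule minus_equality) (use that mpoly.subspace_neg[OF subspace_carrier that] in auto)
  show ?thesis
  proof (rule idealI)
    show "subgroup I (add_monoid (poly_ring W))"
    proof (rule add.subgroupI)
      show "I \<noteq> {}" using mpoly.subspace_0[OF assms(1)] by blast
      show "\<ominus>\<^bsub>poly_ring W\<^esub> a \<in> I" if "a \<in> I" for a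
        using that neg[of a] mpoly.subspace_neg[OF assms(1) that] assms(2) by (auto simp: a_inv_def)
    qed (use assms(2) mpoly.subspace_add[OF assms(1)] in auto)
  qed (use assms(3) ring_axioms in \<open>auto simp: mult.commute\<close>)
qed

text \<open>A subscheme of the Veronese variety with constant Hilbert polynomial \<open>r\<close>,
  i.e. of dimension \<open>0\<close> and degree \<open>r\<close>, or empty with \<open>r =
  0\<close>.\<close>

definition ver_scheme :: "'v set \<Rightarrow> nat \<Rightarrow> ('v \<Rightarrow>\<^sub>0 nat, 'a::field) mpoly set \<Rightarrow> nat \<Rightarrow> bool" where
  "ver_scheme V d Z r \<longleftrightarrow> closed_subscheme (monomials V d) Z \<and>
     (\<forall>F\<in>carrier (poly_ring (monomials V d)). phi F = 0 \<longrightarrow> F \<in> Z) \<and>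
     (\<forall>\<^sub>F e in sequentially. hilbert_fun (monomials V d) Z e = r)"

lemma ver_module_ideal:
  assumes "ideal I (poly_ring (monomials V d))"
    and "\<And>F. F \<in> carrier (poly_ring (monomials V d)) \<Longrightarrow> phi F = 0 \<Longrightarrow> F \<in> I"
  shows "ver_module V d I"
  using ideal_poly_ring[OF assms(1)] forms_carrier assms(2) unfolding ver_module_def by blast

text \<open>If \<open>y b\<close> lies in the saturated ideal \<open>Z\<close> but \<open>b\<close> does not, then some coordinate \<open>x_i\<close> acts on \<open>b\<close>
  without torsion, and the ideal quotient \<open>Z : b\<close> has a nonzero finite-dimensional space of functionals
  fixed by \<open>x_i\<close>. An eigenvector in it is a point of the scheme at which \<open>y\<close> vanishes.\<close>

lemma mult_cancel:
  fixes l :: "'v \<Rightarrow> 'a::{alg_closed_field, field_char_0}"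
  assumes V: "finite V" "1 \<le> d" and Z: "ver_scheme V d Z r"
    and l: "\<And>x. x \<in> zeros V d Z \<Longrightarrow> dot V l x \<noteq> 0"
    and y: "y \<in> forms (monomials V d) 1" "phi y = lf V l ^ d"
    and b: "b \<in> forms (monomials V d) e" and yb: "y * b \<in> Z"
  shows "b \<in> Z"
proof (rule ccontr)
  assume nb: "b \<notin> Z"
  let ?W = "monomials V d"
  have Zid: "ideal Z (poly_ring ?W)" and sat: "saturation ?W Z = Z"
    and ker: "\<And>F. F \<in> carrier (poly_ring ?W) \<Longrightarrow> phi F = 0 \<Longrightarrow> F \<in> Z"
    and hil: "\<forall>\<^sub>F e in sequentially. hilbert_fun ?W Z e = r"
    using Z by (auto simp: ver_scheme_def closed_subscheme_def)
  note ZI = ideal_poly_ring[OF Zid]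
  have bc: "b \<in> carrier (poly_ring ?W)" using b forms_carrier by blast
  define Y where "Y i = (Var (single i d) :: ('v \<Rightarrow>\<^sub>0 nat, 'a) mpoly)" for i :: 'v
  have Y: "Y i \<in> forms ?W 1" "phi (Y i) = Var i ^ d" if "i \<in> V" for i
  proof -
    have "single i d \<in> ?W" using that by (auto simp: monomials_def)
    then show "Y i \<in> forms ?W 1" unfolding Y_def by (rule Var_forms)
    have "Var i ^ n = (single (single i n) 1 :: ('v, 'a) mpoly)" for n
      by (induction n) (simp_all add: Var_def mult_single single_add[symmetric])
    then show "phi (Y i) = Var i ^ d" by (simp add: Y_def Var_def phi_def)
  qed
  have Ypow: "Y i ^ k \<in> forms ?W k" if "i \<in> V" for i k using power_forms[OF Y(1)[OF that], of k] by simp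
  have "\<exists>i\<in>V. \<forall>k. Y i ^ k * b \<notin> Z"
  proof (rule ccontr)
    assume "\<not> ?thesis"
    then obtain k where k: "\<And>i. i \<in> V \<Longrightarrow> Y i ^ k i * b \<in> Z" by metis
    \<comment> \<open>If every \<open>x_i^(d k_i)\<close> moved \<open>b\<close> into
      \<open>Z\<close>, so would every monomial of large degree, since it is divisible by one of them;
      then \<open>b\<close> would lie in the saturation.\<close>
    define K where "K = Suc (\<Sum>i\<in>V. k i)"
    have mono: "single A 1 * b \<in> Z" if A: "A \<in> monomials ?W K" for A
    proof -
      have g: "wt A \<in> monomials V (d * K)" by (rule wt_monomials[OF A])
      have "\<exists>i\<in>V. d * k i \<le> lookup (wt A) i"
      proof (rule ccontr)
        assume "\<not> ?thesis"
        then have "(\<Sum>i\<in>V. lookup (wt A) i) \<le> (\<Sum>i\<in>V. d * k i)" by (intro sum_mono) auto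
        moreover have "(\<Sum>i\<in>V. lookup (wt A) i) = deg_in V (wt A)"
          unfolding deg_in_def by (rule sum.mono_neutral_right) (use V g in \<open>auto simp: monomials_def in_keys_iff\<close>)
        ultimately have "d * K \<le> d * (\<Sum>i\<in>V. k i)" using g by (simp add: monomials_def sum_distrib_left)
        then show False using V(2) by (simp add: K_def)
      qed
      then obtain i where i: "i \<in> V" "d * k i \<le> lookup (wt A) i" by blast
      define \<gamma> where "\<gamma> = wt A - single i (d * k i)"
      have wA: "wt A = single i (d * k i) + \<gamma>"
        unfolding \<gamma>_def by (rule poly_mapping_eqI) (use i in \<open>auto simp: lookup_add lookup_minus lookup_single when_def\<close>)
      have kK: "k i < K" unfolding K_def using member_le_sum[OF i(1), of k] V(1) by simp
      have "keys \<gamma> \<subseteq> V" using g unfolding wA by (auto simp: monomials_def keys_add_nat)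
      moreover have "deg_in V (wt A) = d * k i + deg_in V \<gamma>" unfolding wA deg_in_add using i by simp
      then have "d * k i + deg_in V \<gamma> = d * K" using g by (simp add: monomials_def)
      then have "deg_in V \<gamma> = d * K - d * k i" by linarith
      then have "deg_in V \<gamma> = d * (K - k i)" by (simp add: diff_mult_distrib2)
      ultimately have "\<gamma> \<in> monomials V (d * (K - k i))" by (simp add: monomials_def)
      then obtain A' where A': "A' \<in> monomials ?W (K - k i)" "wt A' = \<gamma>" using wt_surj by metis
      define G where "G = single A' 1 * Y i ^ k i"
      have "single (single i d) 1 ^ n = (single (single i (d * n)) 1 :: ('v, 'a) mpoly)" for n
        by (induction n) (simp_all add: mult_single single_add[symmetric])
      then have "phi G = phi (single A 1)"
        by (simp add: G_def phi_mult phi_power) (simp add: Y_def Var_def phi_def A' wA mult_single add.commute)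
      moreover have "G \<in> forms ?W K"
        using mult_forms[OF single_forms[OF A'(1)] Ypow[OF i(1), of "k i"]] kK by (simp add: G_def)
      ultimately have "single A 1 - G \<in> Z"
        using single_forms[OF A, of 1] ker[of "single A 1 - G"] forms_carrier[of ?W K]
          mpoly.subspace_diff[OF subspace_carrier, of "single A 1" ?W G] by (auto simp: phi_diff)
      then have "b * (single A 1 - G) \<in> Z" using ZI(3) bc by blast
      moreover have "single A' 1 * (Y i ^ k i * b) \<in> Z"
        using ZI(3)[OF k[OF i(1)]] single_forms[OF A'(1), of 1] forms_carrier by blast
      ultimately have "b * (single A 1 - G) + single A' 1 * (Y i ^ k i * b) \<in> Z" by (rule mpoly.subspace_add[OF ZI(1)])
      then show ?thesis by (simp add: G_def algebra_simps)
    qed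
    have "g * b \<in> Z" if "g \<in> forms ?W K" for g
    proof -
      have "(\<Sum>A\<in>keys g. poly_scale (lookup g A) (single A 1 * b)) \<in> Z"
        by (intro mpoly.subspace_sum[OF ZI(1)] mpoly.subspace_scale[OF ZI(1)] mono) (use that in \<open>auto simp: forms_def\<close>)
      moreover have "g * b = (\<Sum>A\<in>keys g. poly_scale (lookup g A) (single A 1 * b))"
        by (subst (1) poly_mapping_sum_single[of g], subst single_poly_scale)
           (simp add: sum_distrib_right poly_scale_def mult.assoc)
      ultimately show ?thesis by simp
    qed
    then have "b \<in> saturation ?W Z" using bc by (auto simp: saturation_def)
    then show False using nb sat by simp
  qed
  then obtain i where i: "i \<in> V" "\<And>k. Y i ^ k * b \<notin> Z" by blast
  \<comment> \<open>The ideal quotient \<open>Z : b\<close>.\<close>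
  define I where "I = {F \<in> carrier (poly_ring ?W). F * b \<in> Z}"
  have I: "ver_module V d I"
  proof (rule ver_module_ideal[OF ideal_poly_ringI])
    show "mpoly.subspace I"
    proof (rule mpoly.subspaceI)
      show "0 \<in> I" using mpoly.subspace_0[OF ZI(1)] mpoly.subspace_0[OF subspace_carrier] by (simp add: I_def)
      show "f + g \<in> I" if "f \<in> I" "g \<in> I" for f g
        using that by (simp add: I_def distrib_right mpoly.subspace_add[OF ZI(1)] mpoly.subspace_add[OF subspace_carrier])
      show "poly_scale c f \<in> I" if "f \<in> I" for c f
        using that mpoly.subspace_scale[OF ZI(1), of "f * b" c] mpoly.subspace_scale[OF subspace_carrier, of f ?W c]
        by (simp add: I_def poly_scale_def mult.assoc)
    qed
    show "I \<subseteq> carrier (poly_ring ?W)" by (auto simp: I_def)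
    show "g * f \<in> I" if "f \<in> I" "g \<in> carrier (poly_ring ?W)" for f g
      using that ZI(3) mult_carrier by (auto simp: I_def mult.assoc)
    show "F \<in> I" if "F \<in> carrier (poly_ring ?W)" "phi F = 0" for F
      using that ker mult_carrier[OF that(1) bc] by (auto simp: I_def phi_mult)
  qed
  define li where "li = (\<lambda>j. if j = i then 1 else 0 :: 'a)"
  have lfi: "lf V li = Var i" unfolding li_def by (rule lf_single[OF V(1) i(1)])
  \<comment> \<open>The constant term of a polynomial extends to a functional of \<open>Z :
    b\<close>, because no power of \<open>x_i^d\<close> lies in this ideal.\<close>
  have "\<exists>lam\<in>perp V d li I. \<forall>F\<in>forms ?W 0. pr (phi F) lam = pr (phi F) (\<lambda>\<beta>. if \<beta> = 0 then 1 else 0)"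
  proof (rule extend_to_perp[OF V(2) I Y(1)[OF i(1)]])
    show "phi (Y i) = lf V li ^ d" using Y(2)[OF i(1)] lfi by simp
    fix F k assume F: "F \<in> forms ?W 0" "Y i ^ k * F \<in> I"
    have "keys F \<subseteq> {0}" using F(1) by (simp add: forms_def)
    then have "F = Const (lookup F 0)"
      by (intro poly_mapping_eqI) (auto simp: Const_def lookup_single when_def in_keys_iff)
    then obtain c where c: "F = Const c" by blast
    have "c = 0"
    proof (rule ccontr)
      assume c0: "c \<noteq> 0"
      have "Y i ^ k * F * b \<in> Z" using F by (simp add: I_def)
      then have "poly_scale (1 / c) (Y i ^ k * F * b) \<in> Z" by (rule mpoly.subspace_scale[OF ZI(1)])
      moreover have "poly_scale (1 / c) (Y i ^ k * F * b) = Const (1 / c * c) * (Y i ^ k * b)"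
        by (simp only: poly_scale_def c Const_mult ac_simps)
      ultimately show False using i(2)[of k] c0 by simp
    qed
    then show "pr (phi F) (\<lambda>\<beta>. if \<beta> = 0 then 1 else 0) = 0" by (simp add: c)
  qed
  then obtain lam where lam: "lam \<in> perp V d li I" "pr (phi 1) lam = 1"
    using one_forms[of ?W] by fastforce
  have "lam \<noteq> 0" using lam(2) by auto
  have sub: "perp V d li I \<subseteq> perp V d li Z" using ZI(2,3) bc by (auto simp: perp_def I_def mult.commute)
  have "vec.findim (perp V d li I)" using vec.findim_subset[OF sub findim_perp[OF V hil]] .
  moreover have "perp V d li I \<noteq> {0}" using lam(1) \<open>lam \<noteq> 0\<close> by auto
  moreover have "perp V d li I \<subseteq> vecs (expo V)" by (auto simp: perp_def FL_def)
  ultimately obtain p where p: "p \<in> vecs V" "ev p \<in> perp V d li I"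
    using eigenvector_exists[OF submod_perp] by metis
  have "act (Var i) (ev p) = ev p" using p(2) lfi by (auto simp: perp_def FL_def)
  then have "act (Var i) (ev p) 0 = ev p 0" by simp
  then have "p i = 1" by (simp add: act_ev vec_scale_def)
  then have "p \<noteq> 0" by auto
  then have "p \<in> zeros V d Z" using p(1) perp_pr[OF subsetD[OF sub p(2)]] by (auto simp: zeros_def)
  then have "dot V l p \<noteq> 0" by (rule l)
  moreover have "y \<in> I" using yb y(1) forms_carrier by (auto simp: I_def)
  then have "pr (phi y) (ev p) = 0" using perp_pr[OF p(2) _ y(1)] by blast
  then have "dot V l p ^ d = 0" by (simp add: y(2) pr_ev_power pr_lf_ev)
  ultimately show False by simp
qed

subsection \<open>The ideal of a space of functionals\<close>

text \<open>The homogeneous ideal of the scheme whose functionals are \<open>N\<close>: the forms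
  that all of \<open>N\<close> kills.\<close>

definition apolar :: "'v set \<Rightarrow> nat \<Rightarrow> (('v \<Rightarrow>\<^sub>0 nat) \<Rightarrow> 'a::field) set \<Rightarrow> ('v \<Rightarrow>\<^sub>0 nat, 'a) mpoly set" where
  "apolar V d N = {F \<in> carrier (poly_ring (monomials V d)).
     \<forall>e. \<forall>lam\<in>N. pr (phi (hom_part (monomials V d) e F)) lam = 0}"

lemma apolar_forms:
  "F \<in> forms (monomials V d) e \<Longrightarrow> F \<in> apolar V d N \<longleftrightarrow> (\<forall>lam\<in>N. pr (phi F) lam = 0)"
  using forms_carrier[of "monomials V d" e] by (auto simp: apolar_def hom_part_of_form)

lemma apolarD:
  "F \<in> apolar V d N \<Longrightarrow> F \<in> forms (monomials V d) e \<Longrightarrow> lam \<in> N \<Longrightarrow> pr (phi F) lam = 0"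
  using apolar_forms[of F V d e N] by blast

lemma apolar_mono: "N \<subseteq> M \<Longrightarrow> apolar V d M \<subseteq> apolar V d N"
  by (auto simp: apolar_def)

lemma hom_part_apolar: "F \<in> apolar V d N \<Longrightarrow> hom_part (monomials V d) e F \<in> apolar V d N"
  using apolar_forms[OF hom_part_forms[of F "monomials V d" e], of N] by (simp add: apolar_def[of V d N])

lemma hom_part_phi:
  assumes "1 \<le> d" "F \<in> carrier (poly_ring (monomials V d))"
  shows "hom_part V (d * e) (phi F) = phi (hom_part (monomials V d) e F)"
proof -
  let ?W = "monomials V d"
  obtain N where "\<forall>n\<ge>N. F = (\<Sum>e\<le>n. hom_part ?W e F)" using sum_hom_part by blast
  then have N: "F = (\<Sum>j\<le>max N e. hom_part ?W j F)" by auto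
  have "hom_part V (d * e) (phi F) = (\<Sum>j\<le>max N e. hom_part V (d * e) (phi (hom_part ?W j F)))"
    by (subst (1) N) (simp add: phi_sum hom_part_sum)
  also have "\<dots> = (\<Sum>j\<le>max N e. if e = j then phi (hom_part ?W j F) else 0)"
    by (rule sum.cong) (use assms hom_part_of_form[OF phi_forms[OF hom_part_forms[OF assms(2)]]] in auto)
  finally show ?thesis by simp
qed

lemma apolar_ker:
  assumes "1 \<le> d" "F \<in> carrier (poly_ring (monomials V d))" "phi F = 0"
  shows "F \<in> apolar V d N"
  using assms hom_part_phi[OF assms(1,2)] by (auto simp: apolar_def simp flip: hom_part_phi)

lemma apolar_ideal:
  fixes N :: "(('v \<Rightarrow>\<^sub>0 nat) \<Rightarrow> 'a::field) set"
  assumes "submod N" shows "ideal (apolar V d N) (poly_ring (monomials V d))"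
proof (rule ideal_poly_ringI)
  let ?W = "monomials V d" and ?A = "apolar V d N"
  have scl: "hom_part ?W e (poly_scale c f) = poly_scale c (hom_part ?W e f)" if "f \<in> carrier (poly_ring ?W)" for c e f
    using hom_part_mult_form[OF Const_forms[of c] that, where e = e] by (simp add: poly_scale_def)
  show sub: "mpoly.subspace ?A"
  proof (rule mpoly.subspaceI)
    show "0 \<in> ?A" by (simp add: apolar_def mpoly.subspace_0[OF subspace_carrier])
    show "f + g \<in> ?A" if "f \<in> ?A" "g \<in> ?A" for f g
      using that by (simp add: mpoly.subspace_add[OF subspace_carrier] apolar_def hom_part_add phi_add pr_add)
    show "poly_scale c f \<in> ?A" if "f \<in> ?A" for c f
      using that by (simp add: mpoly.subspace_scale[OF subspace_carrier] apolar_def scl phi_poly_scale pr_poly_scale)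
  qed
  show "?A \<subseteq> carrier (poly_ring ?W)" by (auto simp: apolar_def)
  fix f g :: "('v \<Rightarrow>\<^sub>0 nat, 'a) mpoly" assume f: "f \<in> ?A" and g: "g \<in> carrier (poly_ring ?W)"
  have fc: "f \<in> carrier (poly_ring ?W)" using f by (simp add: apolar_def)
  have form: "h * f \<in> ?A" if h: "h \<in> forms ?W k" for h k
    unfolding apolar_def
  proof (intro CollectI conjI allI ballI)
    show "h * f \<in> carrier (poly_ring ?W)" using mult_carrier fc h forms_carrier by blast
    fix e lam assume lam: "lam \<in> N"
    show "pr (phi (hom_part ?W e (h * f))) lam = 0"
    proof (cases "e < k")
      case True then show ?thesis by (simp add: hom_part_mult_low[OF h fc])
    next
      case False
      then have "hom_part ?W e (h * f) = h * hom_part ?W (e - k) f"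
        using hom_part_mult_form[OF h fc, of "e - k"] by simp
      then have "pr (phi (hom_part ?W e (h * f))) lam = pr (phi (hom_part ?W (e - k) f)) (act (phi h) lam)"
        by (simp only: phi_mult mult.commute[of "phi h"] pr_act)
      then show ?thesis using f lam assms by (auto simp: apolar_def submod_def)
    qed
  qed
  obtain n where "g = (\<Sum>e\<le>n. hom_part ?W e g)" using sum_hom_part[of g ?W] by blast
  then have "g * f = (\<Sum>e\<le>n. hom_part ?W e g) * f" by (rule arg_cong)
  also have "\<dots> = (\<Sum>e\<le>n. hom_part ?W e g * f)" by (rule sum_distrib_right)
  also have "\<dots> \<in> ?A" by (rule mpoly.subspace_sum[OF sub], rule form[OF hom_part_forms[OF g]])
  finally show "g * f \<in> ?A" .
qed

lemma ver_module_apolar: "1 \<le> d \<Longrightarrow> submod N \<Longrightarrow> ver_module V d (apolar V d N)"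
  using ver_module_ideal[OF apolar_ideal] apolar_ker by blast

lemma pr_zero_span:
  assumes "\<And>v. v \<in> B \<Longrightarrow> pr f v = 0" "lam \<in> vec.span B" shows "pr f lam = 0"
proof -
  have "vec.subspace {lam. pr f lam = 0}" by (rule vec.subspaceI) (simp_all add: pr_plus_right pr_vec_scale)
  moreover have "B \<subseteq> {lam. pr f lam = 0}" using assms(1) by auto
  ultimately have "vec.span B \<subseteq> {lam. pr f lam = 0}" by (intro vec.span_minimal)
  then show ?thesis using assms(2) by auto
qed

text \<open>In large degrees a basis of \<open>N\<close> has a dual family of forms, so
  \<open>N\<close> imposes \<open>dim N\<close> independent conditions.\<close>

lemma hilbert_apolar:
  fixes N :: "(('v \<Rightarrow>\<^sub>0 nat) \<Rightarrow> 'a::field) set"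
  assumes "finite V" "1 \<le> d" "vec.findim N" "N \<subseteq> FL V l"
  shows "\<forall>\<^sub>F e in sequentially. hilbert_fun (monomials V d) (apolar V d N) e = vec.dim N"
proof -
  let ?W = "monomials V d"
  obtain B where B: "finite B" "vec.independent B" "B \<subseteq> N" "N \<subseteq> vec.span B" "card B = vec.dim N"
    using vec.findim_basis[OF assms(3)] by blast
  have BF: "B \<subseteq> FL V l" using B assms by blast
  obtain e0 where e0: "\<And>e. e \<ge> e0 \<Longrightarrow> \<exists>a. \<forall>v\<in>B. a v \<in> forms ?W e \<and>
      (\<forall>w\<in>B. pr (phi (a v)) w = (if v = w then 1 else 0))"
    using dual_forms[OF assms(2) B(1,2) BF] by blast
  have "hilbert_fun ?W (apolar V d N) e = card B" if e: "e \<ge> e0" for e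
  proof -
    obtain a where a: "\<And>v. v \<in> B \<Longrightarrow> a v \<in> forms ?W e"
      "\<And>v w. v \<in> B \<Longrightarrow> w \<in> B \<Longrightarrow> pr (phi (a v)) w = (if v = w then 1 else 0)" using e0[OF e] by metis
    have "{F \<in> forms ?W e. \<forall>v\<in>B. pr (phi F) v = 0} = apolar V d N \<inter> forms ?W e"
    proof (intro equalityI subsetI)
      fix F assume F: "F \<in> {F \<in> forms ?W e. \<forall>v\<in>B. pr (phi F) v = 0}"
      then have "pr (phi F) lam = 0" if "lam \<in> N" for lam
        using pr_zero_span[of B "phi F" lam] B(4) that by auto
      then have "F \<in> apolar V d N" using F by (intro apolar_forms[THEN iffD2]) auto
      then show "F \<in> apolar V d N \<inter> forms ?W e" using F by blast
    qed (use B(3) apolarD in blast)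
    then have "mpoly.dim (forms ?W e :: ('v \<Rightarrow>\<^sub>0 nat, 'a) mpoly set) = mpoly.dim (apolar V d N \<inter> forms ?W e) + card B"
      using dim_forms_dual[OF assms(1) B(1) a] by simp
    then show ?thesis by (simp add: hilbert_fun_def)
  qed
  then show ?thesis unfolding eventually_sequentially B(5) by blast
qed

lemma scheme_degree_eq:
  assumes "\<forall>\<^sub>F e in sequentially. hilbert_fun W I e = r" shows "scheme_degree W I = r"
  unfolding scheme_degree_def
proof (rule the_equality, rule assms)
  fix s assume "\<forall>\<^sub>F e in sequentially. hilbert_fun W I e = s"
  then have "\<forall>\<^sub>F e in sequentially. s = r" using assms by eventually_elim simp
  then show "s = r" by simp
qed

lemmas scheme_degree_apolar = scheme_degree_eq[OF hilbert_apolar]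

text \<open>Take the dual form of \<open>lam\<close> with respect to a basis of \<open>N\<close>
  together with \<open>lam\<close>.\<close>

lemma apolar_separates:
  fixes N :: "(('v \<Rightarrow>\<^sub>0 nat) \<Rightarrow> 'a::field) set"
  assumes d: "1 \<le> d" and N: "vec.subspace N" "vec.findim N" "N \<subseteq> FL V l"
    and lam: "lam \<in> FL V l" "lam \<notin> N"
  shows "\<exists>e. \<exists>F\<in>forms (monomials V d) e. F \<in> apolar V d N \<and> pr (phi F) lam = 1"
proof -
  obtain B where B: "finite B" "vec.independent B" "B \<subseteq> N" "N \<subseteq> vec.span B" "card B = vec.dim N"
    using vec.findim_basis[OF N(2)] by blast
  have "vec.span B \<subseteq> N" using B(3) N(1) by (simp add: vec.span_minimal)
  then have no': "lam \<notin> vec.span B" using lam(2) by blast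
  then have "vec.independent (insert lam B)" "insert lam B \<subseteq> FL V l" "finite (insert lam B)" "lam \<notin> B"
    using B vec.independent_insertI N(3) lam vec.span_base by auto
  then obtain e a where a: "\<forall>v\<in>insert lam B. a v \<in> forms (monomials V d) e \<and>
      (\<forall>w\<in>insert lam B. pr (phi (a v)) w = (if v = w then 1 else 0))"
    using dual_forms[OF d, of "insert lam B" V l] by blast
  have "pr (phi (a lam)) v = 0" if "v \<in> B" for v using a that \<open>lam \<notin> B\<close> by auto
  then have "pr (phi (a lam)) v = 0" if "v \<in> N" for v
    using that pr_zero_span[of B "phi (a lam)" v] B(4) by auto
  then have "a lam \<in> apolar V d N" using a apolar_forms by blast
  then show ?thesis using a by (intro exI[of _ e] bexI[of _ "a lam"]) auto
qed

lemma perp_apolar: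
  fixes N :: "(('v \<Rightarrow>\<^sub>0 nat) \<Rightarrow> 'a::field) set"
  assumes d: "1 \<le> d" and N: "submod N" "vec.findim N" "N \<subseteq> FL V l"
  shows "perp V d l (apolar V d N) = N"
proof (intro equalityI subsetI)
  fix lam assume "lam \<in> N"
  then show "lam \<in> perp V d l (apolar V d N)"
    by (intro perpI[OF d ver_module_apolar[OF d N(1)]]) (use N(3) apolarD in blast)+
next
  fix lam assume lam: "lam \<in> perp V d l (apolar V d N)"
  then have "lam \<in> FL V l" by (simp add: perp_def)
  then show "lam \<in> N"
    using apolar_separates[OF d _ N(2,3), of lam] N(1) perp_pr[OF lam] by (metis submod_def zero_neq_one)
qed

text \<open>A scheme is recovered from its functionals, and a functional on its forms of any degree extends
  to it; both rest on the cancellation of \<open>y\<close>.\<close>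

theorem scheme_duality:
  fixes l :: "'v \<Rightarrow> 'a::{alg_closed_field, field_char_0}"
  assumes V: "finite V" "1 \<le> d" and Z: "ver_scheme V d Z r"
    and l: "\<And>x. x \<in> zeros V d Z \<Longrightarrow> dot V l x \<noteq> 0"
  shows "vec.findim (perp V d l Z)" "Z = apolar V d (perp V d l Z)" "vec.dim (perp V d l Z) = r"
    "\<And>xi e. (\<And>F. F \<in> Z \<Longrightarrow> F \<in> forms (monomials V d) e \<Longrightarrow> pr (phi F) xi = 0) \<Longrightarrow>
       \<exists>lam\<in>perp V d l Z. \<forall>F\<in>forms (monomials V d) e. pr (phi F) lam = pr (phi F) xi"
proof -
  let ?W = "monomials V d" and ?P = "perp V d l Z"
  have Zid: "ideal Z (poly_ring ?W)" and hom: "homogeneous_wrt ?W Z"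
    and ker: "\<And>F. F \<in> carrier (poly_ring ?W) \<Longrightarrow> phi F = 0 \<Longrightarrow> F \<in> Z"
    and hil: "\<forall>\<^sub>F e in sequentially. hilbert_fun ?W Z e = r"
    using Z by (auto simp: ver_scheme_def closed_subscheme_def)
  note ZI = ideal_poly_ring[OF Zid]
  have mod: "ver_module V d Z" by (rule ver_module_ideal[OF Zid ker])
  show fP: "vec.findim ?P" by (rule findim_perp[OF V hil])
  obtain y where y: "y \<in> forms ?W 1" "phi y = lf V l ^ d"
    using phi_surj[of "lf V l ^ d" V d 1] power_forms[OF lf_forms[of V l], of d] by auto
  \<comment> \<open>Iterated cancellation of \<open>y = L^d\<close>: what a power of
    \<open>y\<close> moves into \<open>Z\<close> lies in \<open>Z\<close>, so any functional that
    kills \<open>Z\<close> in one degree can be extended.\<close>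
  have cancel: "F \<in> Z" if "F \<in> forms ?W e" "y ^ k * F \<in> Z" for F e k
    using that
  proof (induction k arbitrary: F e)
    case (Suc k)
    have "y * F \<in> forms ?W (1 + e)" using mult_forms[OF y(1)] Suc.prems by blast
    moreover have "y ^ k * (y * F) \<in> Z" using Suc.prems(2) by (simp add: ac_simps)
    ultimately have "y * F \<in> Z" by (rule Suc.IH)
    then show ?case using mult_cancel[OF V Z l y Suc.prems(1)] by blast
  qed simp
  show ext: "\<exists>lam\<in>?P. \<forall>F\<in>forms ?W e. pr (phi F) lam = pr (phi F) xi"
    if "\<And>F. F \<in> Z \<Longrightarrow> F \<in> forms ?W e \<Longrightarrow> pr (phi F) xi = 0" for xi e
    by (rule extend_to_perp[OF V(2) mod y]) (use that cancel in blast)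
  have formZ: "F \<in> Z" if F: "F \<in> forms ?W e" "\<And>lam. lam \<in> ?P \<Longrightarrow> pr (phi F) lam = 0" for F e
  proof (rule ccontr)
    assume FZ: "F \<notin> Z"
    have sZ: "mpoly.subspace (Z \<inter> forms ?W e)" using ZI(1) subspace_forms mpoly.subspace_inter by blast
    have sphi: "mpoly.subspace (phi ` (Z \<inter> forms ?W e))"
    proof (rule mpoly.subspaceI)
      show "0 \<in> phi ` (Z \<inter> forms ?W e)" using mpoly.subspace_0[OF sZ] by force
    next
      fix x z assume "x \<in> phi ` (Z \<inter> forms ?W e)" "z \<in> phi ` (Z \<inter> forms ?W e)"
      then obtain F G where "F \<in> Z \<inter> forms ?W e" "G \<in> Z \<inter> forms ?W e" "x = phi F" "z = phi G" by blast
      then show "x + z \<in> phi ` (Z \<inter> forms ?W e)"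
        using mpoly.subspace_add[OF sZ, of F G] by (auto simp: phi_add[symmetric])
    next
      fix c x assume "x \<in> phi ` (Z \<inter> forms ?W e)"
      then obtain F where "F \<in> Z \<inter> forms ?W e" "x = phi F" by blast
      then show "poly_scale c x \<in> phi ` (Z \<inter> forms ?W e)"
        using mpoly.subspace_scale[OF sZ, of F c] by (auto simp: phi_poly_scale[symmetric])
    qed
    have "phi F \<notin> phi ` (Z \<inter> forms ?W e)"
    proof
      assume "phi F \<in> phi ` (Z \<inter> forms ?W e)"
      then obtain G where G: "G \<in> Z" "G \<in> forms ?W e" "phi F = phi G" by auto
      then have "phi (F - G) = 0" by (simp add: phi_diff)
      moreover have "F - G \<in> carrier (poly_ring ?W)"
        using mpoly.subspace_diff[OF subspace_forms F(1) G(2)] forms_carrier by blast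
      ultimately have "F - G \<in> Z" using ker by blast
      then have "F - G + G \<in> Z" using mpoly.subspace_add[OF ZI(1)] G(1) by blast
      then show False using FZ by simp
    qed
    then obtain xi where xi: "pr (phi F) xi = 1" "\<forall>g\<in>phi ` (Z \<inter> forms ?W e). pr g xi = 0"
      using separating_functional[OF sphi] by blast
    then have "\<exists>lam\<in>?P. \<forall>F\<in>forms ?W e. pr (phi F) lam = pr (phi F) xi" by (intro ext) auto
    then show False using F xi(1) by fastforce
  qed
  show eq: "Z = apolar V d ?P"
  proof (intro equalityI subsetI)
    fix F assume F: "F \<in> Z"
    then have "hom_part ?W e F \<in> Z" "F \<in> carrier (poly_ring ?W)" for e
      using hom ZI(2) by (auto simp: homogeneous_wrt_def)
    then show "F \<in> apolar V d ?P" using perp_pr hom_part_forms unfolding apolar_def by blast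
  next
    fix F assume F: "F \<in> apolar V d ?P"
    then have Fc: "F \<in> carrier (poly_ring ?W)" by (simp add: apolar_def)
    have "hom_part ?W e F \<in> Z" for e
      by (rule formZ[OF hom_part_forms[OF Fc]]) (use F in \<open>auto simp: apolar_def\<close>)
    moreover obtain n where "F = (\<Sum>e\<le>n. hom_part ?W e F)" using sum_hom_part[of F ?W] by blast
    ultimately show "F \<in> Z" using mpoly.subspace_sum[OF ZI(1), of "{..n}" "\<lambda>e. hom_part ?W e F"] by metis
  qed
  have "?P \<subseteq> FL V l" by (auto simp: perp_def)
  then have "\<forall>\<^sub>F e in sequentially. hilbert_fun ?W Z e = vec.dim ?P"
    using hilbert_apolar[OF V fP] eq by simp
  then have "\<forall>\<^sub>F e in sequentially. vec.dim ?P = r" using hil by eventually_elim simp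
  then show "vec.dim ?P = r" by simp
qed

subsection \<open>Intersections\<close>

lemma Idl_poly_ring:
  assumes "A \<subseteq> carrier (poly_ring W :: ('v, 'a::field) mpoly ring)"
  shows "ideal (Idl\<^bsub>poly_ring W\<^esub> A) (poly_ring W)" "A \<subseteq> Idl\<^bsub>poly_ring W\<^esub> A"
    "\<And>I. ideal I (poly_ring W) \<Longrightarrow> A \<subseteq> I \<Longrightarrow> Idl\<^bsub>poly_ring W\<^esub> A \<subseteq> I"
proof -
  interpret cring "poly_ring W :: ('v, 'a) mpoly ring" by (rule cring_poly_ring)
  show "ideal (Idl\<^bsub>poly_ring W\<^esub> A) (poly_ring W)" by (rule genideal_ideal[OF assms])
  show "A \<subseteq> Idl\<^bsub>poly_ring W\<^esub> A" by (rule genideal_self[OF assms])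
  show "Idl\<^bsub>poly_ring W\<^esub> A \<subseteq> I" if "ideal I (poly_ring W)" "A \<subseteq> I" for I
    by (rule genideal_minimal[OF that])
qed

text \<open>In one degree, the forms of \<open>C\<close> and those apolar to \<open>N\<close> together span everything that is apolar to
  the functionals in \<open>N\<close> that kill \<open>C\<close>: the remaining functionals have a dual family in \<open>C\<close>.\<close>

lemma form_apolar_sum:
  fixes N :: "(('v \<Rightarrow>\<^sub>0 nat) \<Rightarrow> 'a::field) set"
  assumes N: "vec.subspace N" "vec.findim N"
    and C: "mpoly.subspace C" "C \<subseteq> forms (monomials V d) j"
    and G: "G \<in> forms (monomials V d) j"
      "\<And>lam. lam \<in> N \<Longrightarrow> (\<And>F. F \<in> C \<Longrightarrow> pr (phi F) lam = 0) \<Longrightarrow> pr (phi G) lam = 0"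
  shows "\<exists>F\<in>C. G - F \<in> apolar V d N"
proof -
  define S where "S = {lam \<in> N. \<forall>F\<in>C. pr (phi F) lam = 0}"
  have SN: "S \<subseteq> N" by (auto simp: S_def)
  have sS: "vec.subspace S" unfolding S_def
    using N(1) by (auto intro!: vec.subspaceI simp: pr_plus_right pr_vec_scale
        vec.subspace_0 vec.subspace_add vec.subspace_scale)
  obtain B1 where B1: "finite B1" "vec.independent B1" "B1 \<subseteq> S" "S \<subseteq> vec.span B1"
    using vec.findim_basis[OF vec.findim_subset[OF SN N(2)]] by metis
  have B1N: "B1 \<subseteq> N" using B1 SN by blast
  obtain B where B: "B1 \<subseteq> B" "B \<subseteq> N" "vec.independent B" "N \<subseteq> vec.span B"
    using vec.maximal_independent_subset_extend[OF B1N B1(2)] by metis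
  have fB: "finite B" using vec.findim_independent[OF N(2) B(3,2)] by blast
  define B2 where "B2 = B - B1"
  have "\<exists>a. \<forall>v\<in>B2. a v \<in> C \<and> (\<forall>w\<in>B2. pr (phi (a v)) w = (if v = w then 1 else 0))"
  proof (rule mpoly.dual_family[where b = "\<lambda>F v. pr (phi F) v"])
    show "finite B2" using fB by (simp add: B2_def)
    show "mpoly.subspace C" by fact
    fix c assume c: "\<And>x. x \<in> C \<Longrightarrow> (\<Sum>v\<in>B2. c v * pr (phi x) v) = 0"
    define lam where "lam = (\<Sum>v\<in>B2. vec_scale (c v) v)"
    have "lam \<in> N" unfolding lam_def
      by (intro vec.subspace_sum[OF N(1)] vec.subspace_scale[OF N(1)]) (use B in \<open>auto simp: B2_def\<close>)
    moreover have "pr (phi x) lam = 0" if "x \<in> C" for x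
      using c[OF that] by (simp only: lam_def pr_sum_right pr_vec_scale)
    ultimately have "lam \<in> vec.span B1" using B1(4) by (auto simp: S_def)
    then obtain u where u: "lam = (\<Sum>v\<in>B1. vec_scale (u v) v)" using vec.span_finite[OF B1(1)] by auto
    define t where "t v = (if v \<in> B1 then - u v else c v)" for v
    have "(\<Sum>v\<in>B. vec_scale (t v) v) = (\<Sum>v\<in>B2. vec_scale (t v) v) + (\<Sum>v\<in>B1. vec_scale (t v) v)"
      unfolding B2_def by (rule sum.subset_diff[OF B(1) fB])
    also have "(\<Sum>v\<in>B2. vec_scale (t v) v) = lam"
      unfolding lam_def by (rule sum.cong) (auto simp: t_def B2_def)
    also have "(\<Sum>v\<in>B1. vec_scale (t v) v) = - lam"
      unfolding u sum_negf[symmetric] by (rule sum.cong) (auto simp: t_def)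
    also have "lam + - lam = 0" by (rule right_minus)
    finally have "(\<Sum>v\<in>B. vec_scale (t v) v) = 0" .
    then have t0: "t v = 0" if "v \<in> B" for v using vec.independentD[OF B(3) fB subset_refl] that by blast
    show "\<forall>v\<in>B2. c v = 0"
    proof
      fix v assume "v \<in> B2"
      then show "c v = 0" using t0[of v] by (simp add: t_def B2_def)
    qed
  qed (simp_all add: phi_add pr_add phi_poly_scale pr_poly_scale)
  then obtain a where a: "\<And>v. v \<in> B2 \<Longrightarrow> a v \<in> C"
    "\<And>v w. v \<in> B2 \<Longrightarrow> w \<in> B2 \<Longrightarrow> pr (phi (a v)) w = (if v = w then 1 else 0)" by metis
  define F where "F = (\<Sum>v\<in>B2. poly_scale (pr (phi G) v) (a v))"
  have FC: "F \<in> C" unfolding F_def by (intro mpoly.subspace_sum[OF C(1)] mpoly.subspace_scale[OF C(1)] a(1))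
  have prF: "pr (phi F) w = (\<Sum>v\<in>B2. pr (phi G) v * pr (phi (a v)) w)" for w
    by (simp add: F_def phi_sum pr_sum phi_poly_scale pr_poly_scale)
  have "pr (phi (G - F)) w = 0" if w: "w \<in> B" for w
  proof (cases "w \<in> B1")
    case True
    then have "w \<in> S" using B1 by blast
    then have "pr (phi G) w = 0" "pr (phi F) w = 0" using G(2) FC by (auto simp: S_def)
    then show ?thesis by (simp add: phi_diff pr_diff)
  next
    case False
    then have w2: "w \<in> B2" using w by (simp add: B2_def)
    have "pr (phi F) w = (\<Sum>v\<in>B2. if v = w then pr (phi G) v else 0)"
      unfolding prF by (rule sum.cong) (use a(2) w2 in auto)
    also have "\<dots> = pr (phi G) w" using w2 fB by (simp add: B2_def)
    finally show ?thesis by (simp add: phi_diff pr_diff)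
  qed
  then have "pr (phi (G - F)) lam = 0" if "lam \<in> N" for lam using pr_zero_span[of B] B(4) that by blast
  moreover have "G - F \<in> forms (monomials V d) j" using mpoly.subspace_diff[OF subspace_forms G(1)] FC C(2) by blast
  ultimately have "G - F \<in> apolar V d N" using apolar_forms by blast
  then show ?thesis using FC by blast
qed

text \<open>The functionals on the intersection are those of \<open>N\<close> that the ideal
  \<open>C\<close> annihilates. The functionals of \<open>N\<close> that kill the degree
  \<open>j\<close> part of \<open>C\<close> form a decreasing sequence, since \<open>y = L^d\<close>
  acts on \<open>N\<close> as the identity, and they are constant from some \<open>j1\<close> on. In
  degrees at least \<open>j1\<close> a form apolar to the intersection is a sum of a form of
  \<open>C\<close> and a form apolar to \<open>N\<close>, and saturation sees only large
  degrees.\<close>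

theorem scheme_inter_apolar:
  fixes N :: "(('v \<Rightarrow>\<^sub>0 nat) \<Rightarrow> 'a::field) set"
  assumes d: "1 \<le> d" and N: "submod N" "vec.findim N" "N \<subseteq> FL V l"
    and C: "ideal C (poly_ring (monomials V d))" "homogeneous_wrt (monomials V d) C"
      "\<And>F. F \<in> carrier (poly_ring (monomials V d)) \<Longrightarrow> phi F = 0 \<Longrightarrow> F \<in> C"
  shows "scheme_inter (monomials V d) (apolar V d N) C = apolar V d (N \<inter> perp V d l C)"
proof -
  let ?W = "monomials V d" and ?A = "apolar V d N" and ?N' = "N \<inter> perp V d l C"
  let ?I = "Idl\<^bsub>poly_ring ?W\<^esub> (?A \<union> C)"
  have sN: "vec.subspace N" using N(1) by (simp add: submod_def)
  note CI = ideal_poly_ring[OF C(1)]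
  have Csub: "?A \<union> C \<subseteq> carrier (poly_ring ?W)" using CI(2) by (auto simp: apolar_def)
  note I = Idl_poly_ring[OF Csub]
  note II = ideal_poly_ring[OF I(1)]
  have N': "submod ?N'" using N(1) submod_perp[of V d l C] by (auto simp: submod_def vec.subspace_inter)
  obtain y where y: "y \<in> forms ?W 1" "phi y = lf V l ^ d"
    using phi_surj[of "lf V l ^ d" V d 1] power_forms[OF lf_forms[of V l], of d] by auto
  have act_y: "act (phi (y ^ k)) lam = lam" if "lam \<in> N" for k lam
  proof -
    have "act (lf V l) lam = lam" using that N(3) by (auto simp: FL_def)
    then show ?thesis by (simp add: phi_power y(2) act_power_FL)
  qed
  show ?thesis
    unfolding scheme_inter_def
  proof (intro equalityI subsetI)
    fix F assume F: "F \<in> saturation ?W ?I"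
    then obtain k where Fc: "F \<in> carrier (poly_ring ?W)" and k: "\<And>g. g \<in> forms ?W k \<Longrightarrow> g * F \<in> ?I"
      by (auto simp: saturation_def)
    have "C \<subseteq> apolar V d ?N'"
    proof
      fix G assume G: "G \<in> C"
      then have "hom_part ?W e G \<in> C" for e using C(2) by (auto simp: homogeneous_wrt_def)
      then show "G \<in> apolar V d ?N'"
        using G CI(2) perp_pr hom_part_forms unfolding apolar_def by blast
    qed
    moreover have "?A \<subseteq> apolar V d ?N'" by (rule apolar_mono) auto
    ultimately have sub: "?I \<subseteq> apolar V d ?N'" by (intro I(3) apolar_ideal[OF N']) auto
    have yk: "y ^ k \<in> forms ?W k" using power_forms[OF y(1), of k] by simp
    then have "y ^ k * F \<in> apolar V d ?N'" using k sub by blast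
    then have *: "pr (phi (hom_part ?W (k + e) (y ^ k * F))) lam = 0" if "lam \<in> ?N'" for e lam
      using that by (auto simp: apolar_def)
    have "pr (phi (hom_part ?W e F)) lam = 0" if lam: "lam \<in> ?N'" for e lam
    proof -
      have "0 = pr (phi (y ^ k * hom_part ?W e F)) lam"
        using *[OF lam, of e] by (simp only: hom_part_mult_form[OF yk Fc])
      then have "0 = pr (phi (hom_part ?W e F) * phi (y ^ k)) lam"
        by (simp only: phi_mult mult.commute[of "phi (y ^ k)"])
      then show ?thesis using lam by (simp add: pr_act act_y)
    qed
    then show "F \<in> apolar V d ?N'" using Fc by (auto simp: apolar_def)
  next
    fix F assume F: "F \<in> apolar V d ?N'"
    then have Fc: "F \<in> carrier (poly_ring ?W)" by (simp add: apolar_def)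
    define S where "S j = {lam \<in> N. \<forall>G\<in>C \<inter> forms ?W j. pr (phi G) lam = 0}" for j
    have S1: "S (Suc j) \<subseteq> S j" for j
    proof
      fix lam assume lam: "lam \<in> S (Suc j)"
      have "pr (phi G) lam = 0" if G: "G \<in> C" "G \<in> forms ?W j" for G
      proof -
        have "y * G \<in> C \<inter> forms ?W (Suc j)"
          using CI(3)[OF G(1), of y] y(1) forms_carrier mult_forms[OF y(1) G(2)] by auto
        then have "pr (phi (y * G)) lam = 0" using lam unfolding S_def by blast
        then show ?thesis using act_y[of lam 1] lam by (simp add: S_def phi_mult mult.commute[of "phi y"] pr_act)
      qed
      then show "lam \<in> S j" using lam by (auto simp: S_def)
    qed
    have Smono: "i \<le> j \<Longrightarrow> S j \<subseteq> S i" for i j by (rule lift_Suc_antimono_le[of S, OF S1])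
    have SN: "S j \<subseteq> N" for j by (auto simp: S_def)
    have sS: "vec.subspace (S j)" for j unfolding S_def
      using sN by (auto intro!: vec.subspaceI simp: pr_plus_right pr_vec_scale
          vec.subspace_0 vec.subspace_add vec.subspace_scale)
    obtain j1 where j1: "\<And>j. vec.dim (S j1) \<le> vec.dim (S j)"
      using ex_has_least_nat[of "\<lambda>_. True" 0 "\<lambda>j. vec.dim (S j)"] by auto
    have Seq: "S j = S j1" if "j \<ge> j1" for j
      using vec.findim_eqI[OF sS Smono[OF that] vec.findim_subset[OF SN N(2)] j1] .
    have S': "S j1 \<subseteq> ?N'"
    proof
      fix lam assume lam: "lam \<in> S j1"
      have "lam \<in> S j" for j
      proof (cases "j1 \<le> j")
        case True then show ?thesis using lam Seq[of j] by blast
      next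
        case False then show ?thesis using lam Smono[of j j1] by auto
      qed
      then have "pr (phi G) lam = 0" if "G \<in> C" "G \<in> forms ?W j" for G j using that by (auto simp: S_def)
      moreover have "ver_module V d C" by (rule ver_module_ideal[OF C(1) C(3)])
      moreover have "lam \<in> FL V l" using lam SN N(3) by blast
      ultimately have "lam \<in> perp V d l C" using perpI[OF d] by blast
      then show "lam \<in> ?N'" using lam SN by blast
    qed
    have key: "G \<in> ?I" if G: "G \<in> forms ?W j" "j \<ge> j1" "\<And>lam. lam \<in> ?N' \<Longrightarrow> pr (phi G) lam = 0" for G j
    proof -
      have "\<exists>H\<in>C \<inter> forms ?W j. G - H \<in> ?A"
      proof (rule form_apolar_sum[OF sN N(2) _ _ G(1)])
        show "mpoly.subspace (C \<inter> forms ?W j)" using CI(1) subspace_forms mpoly.subspace_inter by blast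
        fix lam assume "lam \<in> N" "\<And>F. F \<in> C \<inter> forms ?W j \<Longrightarrow> pr (phi F) lam = 0"
        then have "lam \<in> S j" by (auto simp: S_def)
        then show "pr (phi G) lam = 0" using G(3) S' Seq[OF G(2)] by blast
      qed auto
      then obtain H where "H \<in> C" "G - H \<in> ?A" by blast
      then have "G - H + H \<in> ?I" using mpoly.subspace_add[OF II(1)] I(2) by blast
      then show ?thesis by simp
    qed
    have "g * F \<in> ?I" if g: "g \<in> forms ?W j1" for g
    proof -
      have "g * hom_part ?W e F \<in> ?I" for e
      proof (rule key)
        show "g * hom_part ?W e F \<in> forms ?W (j1 + e)" by (rule mult_forms[OF g hom_part_forms[OF Fc]])
        fix lam assume "lam \<in> ?N'"
        then have "act (phi g) lam \<in> ?N'" using N' by (simp add: submod_def)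
        then have "pr (phi (hom_part ?W e F)) (act (phi g) lam) = 0" using F by (auto simp: apolar_def)
        then show "pr (phi (g * hom_part ?W e F)) lam = 0"
          by (simp only: phi_mult mult.commute[of "phi g"] pr_act)
      qed simp
      then have "(\<Sum>e\<le>n. g * hom_part ?W e F) \<in> ?I" for n by (intro mpoly.subspace_sum[OF II(1)])
      moreover obtain n where "F = (\<Sum>e\<le>n. hom_part ?W e F)" using sum_hom_part[of F ?W] by blast
      then have "g * F = g * (\<Sum>e\<le>n. hom_part ?W e F)" by (rule arg_cong)
      ultimately show ?thesis by (simp only: sum_distrib_left)
    qed
    then show "F \<in> saturation ?W ?I" using Fc by (auto simp: saturation_def)
  qed
qed

section \<open>Points of projective space\<close>

text \<open>The projective point with coordinate vector \<open>x\<close>, if \<open>x\<close> is not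
  zero.\<close>

definition pt :: "('v \<Rightarrow> 'a::field) \<Rightarrow> ('v \<Rightarrow> 'a) set" where
  "pt x = {vec_scale c x | c. c \<noteq> 0}"

lemma pt_self: "x \<in> pt x"
  unfolding pt_def by (rule CollectI, rule exI[of _ 1]) simp

lemma proj_rel_pt: "x \<in> vecs V - {0} \<Longrightarrow> proj_rel V `` {x} = pt x"
  using vec.subspace_scale[OF subspace_vecs, of x V]
  by (auto simp: proj_rel_def pt_def)

lemma proj_space_pt: "proj_space V = pt ` (vecs V - {0})"
proof -
  have "proj_space V = (\<lambda>x. proj_rel V `` {x}) ` (vecs V - {0})" by (auto simp: proj_space_def quotient_def)
  also have "\<dots> = pt ` (vecs V - {0})" by (rule image_cong[OF refl proj_rel_pt])
  finally show ?thesis .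
qed

lemma pt_eqI: "y \<in> pt x \<Longrightarrow> pt y = pt (x :: 'v \<Rightarrow> 'a::field)"
proof -
  assume "y \<in> pt x"
  then obtain c where c: "c \<noteq> 0" "y = vec_scale c x" by (auto simp: pt_def)
  have "vec_scale k y = vec_scale (k * c) x" for k by (simp add: c(2))
  moreover have "vec_scale k x = vec_scale (k / c) y" for k using c by simp
  ultimately show ?thesis unfolding pt_def using c(1)
    by (metis (no_types, opaque_lifting) divide_eq_0_iff mult_eq_0_iff)
qed

lemma pt_subset_subspace: "vec.subspace L \<Longrightarrow> pt x \<subseteq> L \<longleftrightarrow> x \<in> L"
  using pt_self[of x] vec.subspace_scale[of L x] by (auto simp: pt_def)

lemma poly_zero_off_finite:
  assumes "finite B" "\<And>t. t \<notin> B \<Longrightarrow> poly p t = (0 :: 'a::field_char_0)"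
  shows "p = 0"
proof (rule ccontr)
  assume "p \<noteq> 0"
  then have "finite {t. poly p t = 0}" by (rule poly_roots_finite)
  moreover have "UNIV - B \<subseteq> {t. poly p t = 0}" using assms(2) by auto
  ultimately have "finite (UNIV - B)" by (rule rev_finite_subset)
  then have "finite (UNIV :: 'a set)" using assms(1) finite_Diff2 by blast
  then show False using infinite_UNIV_char_0 by blast
qed

text \<open>Along the multiples of \<open>y\<close>, the polynomial \<open>F\<close> is a polynomial
  in the scalar whose coefficients are the values at \<open>y\<close> of the homogeneous
  parts.\<close>

lemma vanish_pt:
  fixes y :: "'v \<Rightarrow> 'a::field_char_0"
  assumes F: "F \<in> carrier (poly_ring W)"
  shows "(\<forall>x\<in>pt y. eval_at x F = 0) \<longleftrightarrow> (\<forall>e. pr (hom_part W e F) (ev y) = 0)"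
proof -
  obtain n where n: "\<And>k. k \<ge> n \<Longrightarrow> F = (\<Sum>e\<le>k. hom_part W e F)" using sum_hom_part[of F W] by blast
  have ev: "pr F (ev (vec_scale c y)) = (\<Sum>e\<le>k. c ^ e * pr (hom_part W e F) (ev y))" if "k \<ge> n" for c k
    by (subst n[OF that]) (simp only: pr_sum ev_scale_form[OF hom_part_forms[OF F]])
  show ?thesis
  proof
    assume all: "\<forall>x\<in>pt y. eval_at x F = 0"
    show "\<forall>e. pr (hom_part W e F) (ev y) = 0"
    proof
      fix e
      let ?k = "max n e"
      define p where "p = (\<Sum>e\<le>?k. monom (pr (hom_part W e F) (ev y)) e)"
      have "p = 0"
      proof (rule poly_zero_off_finite[of "{0}"])
        fix t :: 'a assume "t \<notin> {0}"
        then have "eval_at (vec_scale t y) F = 0" using all by (auto simp: pt_def)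
        then have "pr F (ev (vec_scale t y)) = 0" by (simp only: eval_at_pr)
        then show "poly p t = 0" using ev[of ?k t]
          by (simp add: p_def poly_sum poly_monom mult.commute)
      qed simp
      then have "coeff p e = 0" by simp
      moreover have "coeff p e = pr (hom_part W e F) (ev y)" by (simp add: p_def coeff_sum)
      ultimately show "pr (hom_part W e F) (ev y) = 0" by simp
    qed
  next
    assume "\<forall>e. pr (hom_part W e F) (ev y) = 0"
    then have "pr F (ev (vec_scale c y)) = 0" for c using ev[of n c] by simp
    then show "\<forall>x\<in>pt y. eval_at x F = 0" unfolding eval_at_pr pt_def by blast
  qed
qed

subsection \<open>Separation by linear forms\<close>

lemma vecs_sum: "finite V \<Longrightarrow> x \<in> vecs V \<Longrightarrow> x = (\<Sum>i\<in>V. vec_scale (x i) (\<lambda>j. if j = i then 1 else 0))"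
proof
  fix j assume V: "finite V" "x \<in> vecs V"
  have "(\<Sum>i\<in>V. vec_scale (x i) (\<lambda>j. if j = i then 1 else 0)) j = (\<Sum>i\<in>V. if j = i then x i else 0)"
    unfolding sum_fun_at by (rule sum.cong) (auto simp: vec_scale_def)
  also have "\<dots> = x j" using V by (auto simp: vecs_def)
  finally show "x j = (\<Sum>i\<in>V. vec_scale (x i) (\<lambda>j. if j = i then 1 else 0)) j" by simp
qed

lemma separating_form:
  fixes x :: "'v \<Rightarrow> 'a::field"
  assumes "finite V" "vec.subspace N" "N \<subseteq> vecs V" "x \<in> vecs V" "x \<notin> N"
  shows "\<exists>u. dot V u x \<noteq> 0 \<and> (\<forall>z\<in>N. dot V u z = 0)"
proof -
  obtain C where C: "C \<subseteq> N" "vec.independent C" "N \<subseteq> vec.span C"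
    using vec.maximal_independent_subset by metis
  have "vec.span C \<subseteq> N" using C assms(2) by (simp add: vec.span_minimal)
  then have xC: "x \<notin> vec.span C" "x \<notin> C" using assms(5) C by auto
  then have "vec.independent (insert x C)" using C vec.independent_insertI by blast
  from vecvec.linear_independent_extend[OF this, of "\<lambda>z. if z = x then (\<lambda>_::unit. 1) else 0"]
  obtain g :: "('v \<Rightarrow> 'a) \<Rightarrow> unit \<Rightarrow> 'a" where g: "Vector_Spaces.linear vec_scale vec_scale g"
     "\<forall>z\<in>insert x C. g z = (if z = x then (\<lambda>_::unit. 1) else 0)" by (elim exE conjE)
  have "C \<subseteq> {z. g z = 0}" using g(2) xC(2) by auto
  then have gN: "N \<subseteq> {z. g z = 0}"
    using C(3) vec.span_minimal[OF _ vecvec.linear_subspace_kernel[OF g(1)]] by blast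
  define u where "u i = g (\<lambda>j. if j = i then 1 else 0) ()" for i
  have "g z () = dot V u z" if "z \<in> vecs V" for z
  proof -
    have "g z = (\<Sum>i\<in>V. vec_scale (z i) (g (\<lambda>j. if j = i then 1 else 0)))"
      by (subst (1) vecs_sum[OF assms(1) that])
         (simp only: vecvec.linear_sum[OF g(1)] vecvec.linear_scale[OF g(1)])
    then show ?thesis by (simp add: sum_fun_at vec_scale_def dot_def u_def mult.commute)
  qed
  then have gu: "dot V u z = g z ()" if "z \<in> vecs V" for z using that by simp
  have "dot V u x = 1" using gu[OF assms(4)] g(2) by simp
  moreover have "dot V u z = 0" if "z \<in> N" for z
    using gu[of z] gN assms(3) that by (simp add: subset_iff)
  ultimately show ?thesis by (intro exI[of _ u]) simp
qed

lemma subspace_hyperplane: "vec.subspace {x \<in> vecs V. dot V u x = 0}"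
proof -
  have "vec.subspace {x. dot V u x = 0}"
    by (rule vec.subspaceI) (simp_all add: dot_scale, simp_all add: dot_def distrib_left sum.distrib)
  moreover have "{x \<in> vecs V. dot V u x = 0} = vecs V \<inter> {x. dot V u x = 0}" by auto
  ultimately show ?thesis by (simp only: vec.subspace_inter subspace_vecs)
qed

lemma form_1_dot:
  assumes "finite V" "g \<in> forms V 1"
  shows "pr g (ev x) = dot V (\<lambda>i. lookup g (single i 1)) x"
proof -
  have "keys g \<subseteq> (\<lambda>i. single i 1) ` V"
  proof
    fix \<alpha> assume "\<alpha> \<in> keys g"
    then have "keys \<alpha> \<subseteq> V" "deg_in V \<alpha> = Suc 0" using assms(2) by (auto simp: forms_def monomials_def)
    then obtain i \<gamma> where "i \<in> V" "\<alpha> = single i 1 + \<gamma>" "\<gamma> \<in> monomials V 0" by (rule monomial_split)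
    then show "\<alpha> \<in> (\<lambda>i. single i 1) ` V" by auto
  qed
  then have "pr g (ev x) = (\<Sum>\<alpha>\<in>(\<lambda>i. single i 1) ` V. lookup g \<alpha> * ev x \<alpha>)"
    using assms(1) by (intro pr_superset) auto
  also have "\<dots> = (\<Sum>i\<in>V. lookup g (single i 1) * ev x (single i 1))"
  proof (rule sum.reindex_cong[of "\<lambda>i. single i 1"])
    have "i = j" if "single i (1 :: nat) = single j 1" for i j :: 'v
      using that by (metis keys_single one_neq_zero singleton_inject)
    then show "inj_on (\<lambda>i. single i (1 :: nat)) V" by (intro inj_onI)
  qed auto
  finally show ?thesis by (simp add: dot_def)
qed

subsection \<open>Polynomials vanishing on a hyperplane\<close>

text \<open>Induction on the number of variables: expand in powers of one variable \<open>v\<close>.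
  For fixed values of the other variables the coefficients \<open>fj j\<close> vanish, as a nonzero
  polynomial in one variable has finitely many roots.\<close>

lemma poly_zero_if_vanishing:
  fixes f :: "('v, 'a::field_char_0) mpoly"
  assumes "finite V" "f \<in> carrier (poly_ring V)" "\<And>x. x \<in> vecs V \<Longrightarrow> pr f (ev x) = 0"
  shows "f = 0"
  using assms
proof (induction V arbitrary: f rule: finite_induct)
  case empty
  then have "keys f \<subseteq> {0}" by (auto simp: carrier_poly_ring)
  moreover have "lookup f 0 = 0"
  proof -
    have "pr f (ev (0 :: 'v \<Rightarrow> 'a)) = lookup f 0"
      using pr_superset[of "{0}" f "ev 0"] \<open>keys f \<subseteq> {0}\<close> by simp
    then show ?thesis using empty(2)[of 0] by (simp add: vecs_def)
  qed
  ultimately show ?case by (intro poly_mapping_eqI) (auto simp: in_keys_iff)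
next
  case (insert v V)
  define r where "r A = A - single v (lookup A v)" for A :: "'v \<Rightarrow>\<^sub>0 nat"
  have Ar: "A = single v (lookup A v) + r A" for A
    unfolding r_def by (rule poly_mapping_eqI) (auto simp: lookup_add lookup_minus lookup_single when_def)
  have rv: "lookup (r A) v = 0" for A by (simp add: r_def lookup_minus)
  have rk: "keys (r A) \<subseteq> V" if "A \<in> keys f" for A
  proof -
    have "keys A \<subseteq> insert v V" using that insert.prems(1) by (auto simp: carrier_poly_ring)
    moreover have "keys (r A) \<subseteq> keys A - {v}"
      using rv[of A] by (auto simp: in_keys_iff r_def lookup_minus)
    ultimately show ?thesis by blast
  qed
  define fj where "fj j = (\<Sum>A | A \<in> keys f \<and> lookup A v = j. single (r A) (lookup f A))" for j
  have fj0: "fj j = 0" for j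
  proof (rule insert.IH)
    show "fj j \<in> carrier (poly_ring V)" unfolding fj_def
      by (rule mpoly.subspace_sum[OF subspace_carrier]) (auto intro!: single_carrier dest: rk)
    fix x :: "'v \<Rightarrow> 'a" assume x: "x \<in> vecs V"
    define p where "p = (\<Sum>A\<in>keys f. monom (lookup f A * ev x (r A)) (lookup A v))"
    have "p = 0"
    proof (rule poly_zero_off_finite[of "{}"])
      fix t :: 'a
      have e1: "ev (x(v := t)) A = t ^ lookup A v * ev x (r A)" for A
      proof -
        have "ev (x(v := t)) A = ev (x(v := t)) (single v (lookup A v)) * ev (x(v := t)) (r A)"
          by (subst Ar[of A]) (rule ev_add)
        moreover have "ev (x(v := t)) (r A) = ev x (r A)"
          by (rule ev_cong) (use rv[of A] in \<open>auto simp: in_keys_iff\<close>)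
        ultimately show ?thesis by simp
      qed
      have "x(v := t) \<in> vecs (insert v V)" using x by (auto simp: vecs_def)
      then have "pr f (ev (x(v := t))) = 0" by (rule insert.prems(2))
      then show "poly p t = 0"
        by (simp add: p_def poly_sum poly_monom pr_def e1 ac_simps)
    qed simp
    then have "coeff p j = 0" by simp
    moreover have "coeff p j = (\<Sum>A\<in>keys f. if lookup A v = j then lookup f A * ev x (r A) else 0)"
      by (simp add: p_def coeff_sum)
    moreover have "\<dots> = pr (fj j) (ev x)"
      by (simp add: fj_def pr_sum sum.inter_filter[symmetric])
    ultimately show "pr (fj j) (ev x) = 0" by simp
  qed
  show ?case
  proof (rule poly_mapping_eqI)
    fix A
    show "lookup f A = lookup 0 A"
    proof (rule ccontr)
      assume "lookup f A \<noteq> lookup 0 A"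
      then have A: "A \<in> keys f" by (simp add: in_keys_iff)
      have "0 = lookup (fj (lookup A v)) (r A)" by (simp add: fj0)
      also have "\<dots> = (\<Sum>A' | A' \<in> keys f \<and> lookup A' v = lookup A v. if A' = A then lookup f A' else 0)"
        unfolding fj_def lookup_sum
      proof (rule sum.cong)
        fix A' assume "A' \<in> {A' \<in> keys f. lookup A' v = lookup A v}"
        then have "r A' = r A \<longleftrightarrow> A' = A" using Ar[of A] Ar[of A'] by auto
        then show "lookup (single (r A') (lookup f A')) (r A) = (if A' = A then lookup f A' else 0)"
          by (simp add: lookup_single when_def)
      qed simp
      also have "\<dots> = lookup f A" using A by simp
      finally show False using A by (simp add: in_keys_iff)
    qed
  qed
qed

lemma single_ev_Var: "single A 1 = ev Var A" for A :: "'v \<Rightarrow>\<^sub>0 nat"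
proof -
  have "(single A 1 :: ('v, 'a::comm_semiring_1) mpoly) = ev Var A"
  proof (induction "deg_in UNIV A" arbitrary: A)
    case 0
    then have "A \<in> monomials UNIV 0" by (simp add: monomials_def del: monomials_0)
    then show ?case by simp
  next
    case (Suc n)
    then obtain v B where v: "A = single v 1 + B" "B \<in> monomials UNIV n"
      using monomial_split[of A UNIV n] by (metis subset_UNIV)
    have "single A 1 = Var v * (single B 1 :: ('v, 'a) mpoly)" by (simp add: v Var_def mult_single)
    then show ?case using Suc(1)[of B] v by (simp add: monomials_def ev_add)
  qed
  then show "single A 1 = (ev Var A :: ('v, 'a) mpoly)" .
qed

text \<open>Modulo the linear form \<open>g\<close>, one variable can be eliminated; what remains vanishes at all points
  if \<open>f\<close> vanishes on the hyperplane.\<close>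

lemma vanishing_on_hyperplane:
  fixes Z :: "('v, 'a::field_char_0) mpoly set"
  assumes W: "finite W" "2 \<le> card W" and Z: "ideal Z (poly_ring W)"
    and g: "g \<in> Z" "g \<in> forms W 1" "g \<noteq> 0"
    and f: "f \<in> vanishing_ideal W (projectivization W {x \<in> vecs W. pr g (ev x) = 0})"
  shows "f \<in> Z"
proof -
  note ZI = ideal_poly_ring[OF Z]
  define u where "u = (\<lambda>i. lookup g (single i 1))"
  have gd: "pr g (ev x) = dot W u x" for x unfolding u_def by (rule form_1_dot[OF W(1) g(2)])
  define L where "L = {x \<in> vecs W. dot W u x = 0}"
  have sL: "vec.subspace L" unfolding L_def by (rule subspace_hyperplane)
  have fc: "f \<in> carrier (poly_ring W)" using f by (simp add: vanishing_ideal_def)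
  have fL: "\<forall>x\<in>pt y. eval_at x f = 0" if "y \<in> L" "y \<noteq> 0" for y
  proof -
    have "pt y \<subseteq> L" using pt_subset_subspace[OF sL] that by blast
    moreover have "pt y \<in> proj_space W" using that unfolding proj_space_pt L_def by blast
    ultimately show ?thesis using f unfolding vanishing_ideal_def projectivization_def gd L_def by blast
  qed
  have "\<exists>a\<in>W. u a \<noteq> 0"
  proof (rule ccontr)
    assume "\<not> ?thesis"
    then have "pr g (ev x) = 0" for x by (simp add: gd dot_def)
    then have "g = 0" using poly_zero_if_vanishing[OF W(1)] g(2) forms_carrier by blast
    then show False using g(3) by blast
  qed
  then obtain a where a: "a \<in> W" "u a \<noteq> 0" by blast
  have "\<exists>b\<in>W. b \<noteq> a"
  proof (rule ccontr)
    assume "\<not> ?thesis"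
    then have "W \<subseteq> {a}" by blast
    then have "card W \<le> 1" using card_mono[of "{a}" W] by simp
    then show False using W(2) by simp
  qed
  then obtain b where b: "b \<in> W" "b \<noteq> a" by blast
  \<comment> \<open>The origin is not the coordinate vector of a point, so vanishing there needs an argument:
    \<open>f\<close> vanishes on the nonzero multiples of the vector \<open>z\<close> of the hyperplane, hence has no
    constant term.\<close>
  define z where "z = (\<lambda>i. if i = a then - u b else if i = b then u a else 0)"
  have "dot W u z = u a * - u b + u b * u a"
  proof -
    have "dot W u z = (\<Sum>i\<in>W. (if i = a then u a * - u b else 0) + (if i = b then u b * u a else 0))"
      unfolding dot_def by (rule sum.cong) (use b in \<open>auto simp: z_def\<close>)
    also have "\<dots> = u a * - u b + u b * u a" using W(1) a b by (simp add: sum.distrib)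
    finally show ?thesis .
  qed
  then have zL: "z \<in> L" using a b by (auto simp: L_def vecs_def z_def)
  have "z b \<noteq> 0" using a b by (simp add: z_def)
  then have "z \<noteq> 0" by auto
  then have "pr (hom_part W 0 f) (ev z) = 0" using vanish_pt[OF fc] fL[OF zL] by blast
  moreover have "pr (hom_part W 0 f) (ev y) = lookup f 0" for y :: "'v \<Rightarrow> 'a"
  proof -
    have "keys (hom_part W 0 f) \<subseteq> {0}" using hom_part_forms[OF fc, of 0] by (simp add: forms_def)
    then show ?thesis using pr_superset[of "{0}" "hom_part W 0 f" "ev y"] by (simp add: lookup_hom_part)
  qed
  ultimately have f00: "lookup f 0 = 0" by simp
  have f0: "pr f (ev 0) = 0"
  proof -
    have "ev (0 :: 'v \<Rightarrow> 'a) A = (if A = 0 then 1 else 0)" for A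
    proof (cases "A = 0")
      case False
      then obtain i where "i \<in> keys A" by (metis all_not_in_conv keys_eq_empty)
      then have "ev (0 :: 'v \<Rightarrow> 'a) A = 0"
        unfolding ev_def by (intro prod_zero) (auto simp: in_keys_iff zero_power)
      then show ?thesis using False by simp
    qed simp
    then have "ev (0 :: 'v \<Rightarrow> 'a) = (\<lambda>A. if A = 0 then 1 else 0)" by (rule ext)
    then have "pr f (ev 0) = lookup f 0" by (simp only: lookup_pr)
    then show ?thesis using f00 by simp
  qed
  \<comment> \<open>On the hyperplane the variable \<open>a\<close> is the combination
    \<open>S\<close> of the others, and \<open>\<Psi>\<close> substitutes it.\<close>
  define S where "S = (\<Sum>i\<in>W - {a}. Const (- u i / u a) * Var i)"
  define \<Psi> where "\<Psi> = (\<lambda>i. if i = a then S else Var i :: ('v, 'a) mpoly)"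
  have Sc: "S \<in> carrier (poly_ring W)" unfolding S_def
  proof (rule mpoly.subspace_sum[OF subspace_carrier])
    fix i assume "i \<in> W - {a}"
    then have "i \<in> W" by simp
    show "Const (- u i / u a) * Var i \<in> carrier (poly_ring W)"
      by (rule mult_carrier[OF subsetD[OF forms_carrier Const_forms] subsetD[OF forms_carrier Var_forms[OF \<open>i \<in> W\<close>]]])
  qed
  then have \<Psi>c: "\<Psi> i \<in> carrier (poly_ring W)" if "i \<in> W" for i
    by (simp add: \<Psi>_def subsetD[OF forms_carrier Var_forms[OF that]])
  have gS: "Var a - S \<in> Z"
  proof -
    have "g = lf W u"
    proof -
      have "pr (g - lf W u) (ev x) = 0" for x by (simp add: pr_diff gd pr_lf_ev)
      moreover have "g - lf W u \<in> carrier (poly_ring W)"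
        using mpoly.subspace_diff[OF subspace_forms g(2) lf_forms] forms_carrier by blast
      ultimately have "g - lf W u = 0" using poly_zero_if_vanishing[OF W(1)] by blast
      then show ?thesis by simp
    qed
    moreover have "poly_scale (1 / u a) (lf W u) = Var a - S"
    proof -
      have "lf W u = Const (u a) * Var a + (\<Sum>i\<in>W - {a}. Const (u i) * Var i)"
        unfolding lf_def by (rule sum.remove[OF W(1) a(1)])
      moreover have "poly_scale (1 / u a) (\<Sum>i\<in>W - {a}. Const (u i) * Var i) = - S"
      proof -
        have "Const (- u i / u a) = - (Const (1 / u a) * Const (u i) :: ('v, 'a) mpoly)" for i
        proof -
          have "Const (- u i / u a) + Const (1 / u a * u i) = (0 :: ('v, 'a) mpoly)"
            unfolding Const_add[symmetric] by simp
          then show ?thesis unfolding Const_mult by (rule eq_neg_iff_add_eq_0[THEN iffD2])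
        qed
        then show ?thesis by (simp add: S_def poly_scale_def sum_distrib_left sum_negf[symmetric] mult.assoc)
      qed
      moreover have "poly_scale (1 / u a) (Const (u a) * Var a) = (Var a :: ('v, 'a) mpoly)"
      proof -
        have "poly_scale (1 / u a) (Const (u a) * Var a) = Const (1 / u a * u a) * (Var a :: ('v, 'a) mpoly)"
          by (simp only: poly_scale_def Const_mult mult.assoc)
        then show ?thesis using a(2) by simp
      qed
      ultimately show ?thesis by (simp only: mpoly.scale_right_distrib) simp
    qed
    ultimately show ?thesis using mpoly.subspace_scale[OF ZI(1) g(1), of "1 / u a"] by simp
  qed
  have dif: "ev Var A - ev \<Psi> A \<in> Z \<and> ev \<Psi> A \<in> carrier (poly_ring W)" if "keys A \<subseteq> W" for A
    using that
  proof (induction "deg_in W A" arbitrary: A)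
    case 0
    then have "A \<in> monomials W 0" by (simp add: monomials_def del: monomials_0)
    then show ?case using mpoly.subspace_0[OF ZI(1)] one_carrier by simp
  next
    case (Suc n)
    then obtain v B where v: "v \<in> W" "A = single v 1 + B" "B \<in> monomials W n"
      using monomial_split[of A W n] by metis
    then have IH: "ev Var B - ev \<Psi> B \<in> Z" "ev \<Psi> B \<in> carrier (poly_ring W)"
      using Suc(1)[of B] by (auto simp: monomials_def)
    have vZ: "Var v - \<Psi> v \<in> Z" using gS mpoly.subspace_0[OF ZI(1)] by (simp add: \<Psi>_def)
    have "ev Var A - ev \<Psi> A = Var v * (ev Var B - ev \<Psi> B) + ev \<Psi> B * (Var v - \<Psi> v)"
      by (simp add: v(2) ev_add algebra_simps)
    moreover have "Var v * (ev Var B - ev \<Psi> B) \<in> Z"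
      using ZI(3)[OF IH(1)] Var_forms[OF v(1)] forms_carrier by blast
    ultimately show ?case
      using mpoly.subspace_add[OF ZI(1)] ZI(3)[OF vZ IH(2)] mult_carrier[OF \<Psi>c[OF v(1)] IH(2)]
      by (simp add: v(2) ev_add)
  qed
  define f' where "f' = (\<Sum>A\<in>keys f. poly_scale (lookup f A) (ev \<Psi> A))"
  have kA: "keys A \<subseteq> W" if "A \<in> keys f" for A using that fc by (auto simp: carrier_poly_ring)
  have "f = (\<Sum>A\<in>keys f. poly_scale (lookup f A) (ev Var A))"
    by (subst (1) poly_mapping_sum_single[of f], subst single_poly_scale) (simp add: single_ev_Var)
  then have "f - f' = (\<Sum>A\<in>keys f. poly_scale (lookup f A) (ev Var A - ev \<Psi> A))"
    by (simp add: f'_def sum_subtractf mpoly.scale_right_diff_distrib)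
  also have "\<dots> \<in> Z"
    by (intro mpoly.subspace_sum[OF ZI(1)] mpoly.subspace_scale[OF ZI(1)]) (use dif kA in blast)
  finally have ff': "f - f' \<in> Z" .
  have "f' = 0"
  proof (rule poly_zero_if_vanishing[OF W(1)])
    show "f' \<in> carrier (poly_ring W)" unfolding f'_def
      by (intro mpoly.subspace_sum[OF subspace_carrier] mpoly.subspace_scale[OF subspace_carrier]) (use dif kA in blast)
    fix x :: "'v \<Rightarrow> 'a" assume x: "x \<in> vecs W"
    define \<sigma> where "\<sigma> i = pr (\<Psi> i) (ev x)" for i
    have \<sigma>: "\<sigma> i = (if i = a then (\<Sum>i\<in>W - {a}. - u i / u a * x i) else x i)" for i
      by (simp add: \<sigma>_def \<Psi>_def S_def pr_sum pr_ev_mult)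
    have "dot W u \<sigma> = u a * \<sigma> a + (\<Sum>i\<in>W - {a}. u i * \<sigma> i)"
      unfolding dot_def by (rule sum.remove[OF W(1) a(1)])
    also have "(\<Sum>i\<in>W - {a}. u i * \<sigma> i) = (\<Sum>i\<in>W - {a}. u i * x i)"
      by (rule sum.cong) (auto simp: \<sigma>)
    also have "u a * \<sigma> a = (\<Sum>i\<in>W - {a}. - (u i * x i))"
      using a(2) by (simp add: \<sigma> sum_distrib_left)
    finally have "dot W u \<sigma> = 0" by (simp add: sum_negf)
    then have "\<sigma> \<in> L" using x a by (auto simp: L_def vecs_def \<sigma>)
    then have "pr f (ev \<sigma>) = 0"
    proof (cases "\<sigma> = 0")
      case True then show ?thesis using f0 by simp
    next
      case False
      then have "eval_at \<sigma> f = 0" using fL[OF \<open>\<sigma> \<in> L\<close>] pt_self by blast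
      then show ?thesis by (simp only: eval_at_pr)
    qed
    moreover have "pr (ev \<Psi> A) (ev x) = ev \<sigma> A" for A
      by (simp add: ev_def[of \<Psi>] ev_def[of \<sigma>] pr_ev_prod pr_ev_power \<sigma>_def)
    ultimately show "pr f' (ev x) = 0"
      by (simp add: f'_def pr_sum pr_poly_scale) (simp add: pr_def)
  qed
  then show ?thesis using ff' by simp
qed

text \<open>The hyperplane \<open>g = 0\<close> contains the scheme by the preceding lemma, and
  hence its span.\<close>

lemma linear_span_killed:
  fixes Z :: "('v, 'a::field_char_0) mpoly set"
  assumes W: "finite W" "2 \<le> card W" and Z: "ideal Z (poly_ring W)"
    and P: "P \<in> linear_span W Z" "x \<in> P" and g: "g \<in> Z" "g \<in> forms W 1"
  shows "pr g (ev x) = 0"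
proof (cases "g = 0")
  case False
  let ?L = "{x \<in> vecs W. pr g (ev x) = 0}"
  have L: "?L \<subseteq> vecs W" "vec.subspace ?L"
    using subspace_hyperplane[of W "\<lambda>i. lookup g (single i 1)"] by (auto simp: form_1_dot[OF W(1) g(2)])
  have "vanishing_ideal W (projectivization W ?L) \<subseteq> Z"
    using vanishing_on_hyperplane[OF W Z g False] by blast
  then have "P \<in> projectivization W ?L"
    using P(1) L unfolding linear_span_def subscheme_of_def by blast
  then show ?thesis using P(2) by (auto simp: projectivization_def)
qed simp

section \<open>The Veronese variety and the curves of lines on it\<close>

lemma veronese_vec_ev: "veronese_vec m d x = (\<lambda>\<alpha>. if \<alpha> \<in> Ver_coords m d then ev x \<alpha> else 0)"
  by (simp add: veronese_vec_def ev_def fun_eq_iff)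

lemma veronese_vec_vecs: "veronese_vec m d x \<in> vecs (Ver_coords m d)"
  by (simp add: veronese_vec_ev vecs_def)

lemma veronese_vec_scale: "veronese_vec m d (vec_scale c x) = vec_scale (c ^ d) (veronese_vec m d x)"
proof
  fix \<alpha>
  have "ev (vec_scale c x) \<alpha> = c ^ d * ev x \<alpha>" if "\<alpha> \<in> Ver_coords m d"
    using ev_scale_form[OF single_forms[OF that, of 1], of c x] by simp
  then show "veronese_vec m d (vec_scale c x) \<alpha> = vec_scale (c ^ d) (veronese_vec m d x) \<alpha>"
    by (simp add: veronese_vec_ev vec_scale_def)
qed

lemma veronese_vec_nonzero: "x \<in> vecs {..m} - {0} \<Longrightarrow> veronese_vec m d x \<noteq> 0"
proof -
  assume x: "x \<in> vecs {..m} - {0}"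
  then obtain i where "x i \<noteq> 0" by (auto simp: fun_eq_iff)
  then have i: "i \<in> {..m}" "x i \<noteq> 0" using x by (auto simp: vecs_def)
  then have "single i d \<in> Ver_coords m d" by (auto simp: monomials_def)
  then have "veronese_vec m d x (single i d) \<noteq> 0" using i by (simp add: veronese_vec_ev)
  then show ?thesis by auto
qed

lemma veronese_pt: "x \<in> vecs {..m} - {0} \<Longrightarrow> veronese m d (pt x) = pt (veronese_vec m d x)"
proof -
  assume x: "x \<in> vecs {..m} - {0}"
  have nz: "veronese_vec m d z \<in> vecs (Ver_coords m d) - {0}" if "z \<in> pt x" for z
  proof -
    obtain c where "c \<noteq> 0" "z = vec_scale c x" using \<open>z \<in> pt x\<close> by (auto simp: pt_def)
    then have "z \<in> vecs {..m} - {0}" using x vec.subspace_scale[OF subspace_vecs] by auto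
    then show ?thesis using veronese_vec_nonzero veronese_vec_vecs by blast
  qed
  have "veronese m d (pt x) = (\<Union>z\<in>pt x. proj_rel (Ver_coords m d) `` {veronese_vec m d z})"
    by (auto simp: veronese_def)
  also have "\<dots> = (\<Union>z\<in>pt x. pt (veronese_vec m d z))"
    by (rule SUP_cong[OF refl proj_rel_pt[OF nz]])
  also have "\<dots> = (\<Union>z\<in>pt x. pt (veronese_vec m d x))"
  proof (rule SUP_cong[OF refl])
    fix z assume "z \<in> pt x"
    then obtain c where "c \<noteq> 0" "z = vec_scale c x" by (auto simp: pt_def)
    then have "veronese_vec m d z = vec_scale (c ^ d) (veronese_vec m d x)" "c ^ d \<noteq> 0"
      by (simp_all add: veronese_vec_scale)
    then have "veronese_vec m d z \<in> pt (veronese_vec m d x)" unfolding pt_def by blast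
    then show "pt (veronese_vec m d z) = pt (veronese_vec m d x)" by (rule pt_eqI)
  qed
  also have "\<dots> = pt (veronese_vec m d x)" using pt_self[of x] by blast
  finally show ?thesis .
qed

lemma Ver_pt: "Ver m d = (\<lambda>x. pt (veronese_vec m d x)) ` (vecs {..m} - {0})"
  unfolding Ver_def proj_space_pt image_image using veronese_pt by (rule image_cong[OF refl])

lemma pr_ev_veronese:
  assumes "F \<in> forms (Ver_coords m d) e" shows "pr F (ev (veronese_vec m d x)) = pr (phi F) (ev x)"
  unfolding pr_phi_ev
  by (rule pr_cong, rule ev_cong) (use assms in \<open>auto simp: veronese_vec_ev forms_def monomials_def[of "Ver_coords m d"]\<close>)

lemma vanishing_ideal_veronese:
  fixes X :: "(nat \<Rightarrow> 'a::field_char_0) set"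
  shows "vanishing_ideal (Ver_coords m d) ((\<lambda>x. pt (veronese_vec m d x)) ` X) = apolar {..m} d (ev ` X)"
proof -
  have "(\<forall>x\<in>pt (veronese_vec m d y). eval_at x F = 0) \<longleftrightarrow>
      (\<forall>e. pr (phi (hom_part (Ver_coords m d) e F)) (ev y) = 0)"
    if "F \<in> carrier (poly_ring (Ver_coords m d))" for F :: "(nat \<Rightarrow>\<^sub>0 nat, 'a) mpoly" and y
    unfolding vanish_pt[OF that] using pr_ev_veronese[OF hom_part_forms[OF that]] by metis
  then show ?thesis unfolding vanishing_ideal_def apolar_def by blast
qed

lemma apolar_span: "apolar V d (vec.span B) = apolar V d B"
  using pr_zero_span[of B] vec.span_base[of _ B] by (auto simp: apolar_def)

lemma submod_span_ev: "submod (vec.span (ev ` X))"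
proof (rule submod_if_Var[OF vec.subspace_span])
  fix i lam assume "lam \<in> vec.span (ev ` X)"
  then have "act (Var i) lam \<in> vec.span (act (Var i) ` ev ` X)"
    using vecvec.linear_span_image[OF linear_act] by blast
  moreover have "act (Var i) ` ev ` X \<subseteq> vec.span (ev ` X)"
  proof clarify
    fix x assume "x \<in> X"
    then show "act (Var i) (ev x) \<in> vec.span (ev ` X)"
      unfolding act_ev by (intro vec.span_scale vec.span_base imageI)
  qed
  ultimately show "act (Var i) lam \<in> vec.span (ev ` X)" using vec.span_minimal[OF _ vec.subspace_span] by blast
qed

lemma apolar_ev_ideal: "ideal (apolar V d (ev ` X)) (poly_ring (monomials V d))"
  using apolar_ideal[OF submod_span_ev] by (simp add: apolar_span)

lemma homogeneous_apolar: "homogeneous_wrt (monomials V d) (apolar V d N)"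
  by (simp add: homogeneous_wrt_def hom_part_apolar)

lemma in_Ver_ver_scheme:
  fixes Z :: "(nat \<Rightarrow>\<^sub>0 nat, 'a::field_char_0) mpoly set"
  assumes "1 \<le> d" "in_Ver m d Z" "\<forall>\<^sub>F e in sequentially. hilbert_fun (Ver_coords m d) Z e = r"
  shows "ver_scheme {..m} d Z r"
  using assms apolar_ker[OF assms(1), of _ "{..m}"]
  unfolding ver_scheme_def in_Ver_def subscheme_of_def Ver_pt vanishing_ideal_veronese by blast

subsection \<open>Functionals on a line\<close>

text \<open>The functionals of schemes supported scheme-theoretically on the line through
  \<open>v\<close> and \<open>w\<close>: all linear equations of the line annihilate them.\<close>

definition on_line :: "'v set \<Rightarrow> ('v \<Rightarrow> 'a::field) \<Rightarrow> ('v \<Rightarrow> 'a) \<Rightarrow> ('v \<Rightarrow> 'a) \<Rightarrow> (('v \<Rightarrow>\<^sub>0 nat) \<Rightarrow> 'a) set" where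
  "on_line V l v w = {lam \<in> FL V l. \<forall>u. dot V u v = 0 \<longrightarrow> dot V u w = 0 \<longrightarrow> act (lf V u) lam = 0}"

text \<open>In the chart \<open>L = 1\<close> the line is parametrized by \<open>v + t
  w\<close>.\<close>

definition line_basis :: "'v set \<Rightarrow> ('v \<Rightarrow> 'a::field) \<Rightarrow> ('v \<Rightarrow> 'a) \<Rightarrow> ('v \<Rightarrow> 'a) \<Rightarrow> bool" where
  "line_basis V l v w \<longleftrightarrow> v \<in> vecs V \<and> w \<in> vecs V \<and> dot V l v = 1 \<and> dot V l w = 0 \<and> w \<noteq> 0"

lemma submod_on_line: "submod (on_line V l v w)"
proof -
  have "vec.subspace (on_line V l v w)"
    using subspace_FL[of V l] unfolding on_line_def
    by (auto intro!: vec.subspaceI simp: act_plus_right act_vec_scale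
        vec.subspace_0 vec.subspace_add vec.subspace_scale)
  moreover have "act f lam \<in> on_line V l v w" if "lam \<in> on_line V l v w" for f lam
    using that by (auto simp: on_line_def act_FL act_commute[of _ f])
  ultimately show ?thesis by (simp add: submod_def)
qed

lemma ev_nonzero: "ev x \<noteq> (0 :: _ \<Rightarrow> 'a::field)"
proof
  assume "ev x = 0"
  then have "ev x 0 = (0 :: 'a)" by simp
  then show False by simp
qed

lemma dot_0 [simp]: "dot V l 0 = 0" by (simp add: dot_def)

lemma dot_add: "dot V u (x + y) = dot V u x + dot V u y"
  by (simp add: dot_def distrib_left sum.distrib)

lemma dot_add_left: "dot V (\<lambda>i. a i + b i) x = dot V a x + dot V b x"
  by (simp add: dot_def distrib_right sum.distrib)

lemma dot_scale_left: "dot V (\<lambda>i. c * a i) x = c * dot V a x"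
  by (simp add: dot_def sum_distrib_left mult.assoc)

lemma dot_single: "finite V \<Longrightarrow> i \<in> V \<Longrightarrow> dot V (\<lambda>j. if j = i then 1 else 0) x = x i"
proof -
  assume "finite V" "i \<in> V"
  have "dot V (\<lambda>j. if j = i then 1 else 0) x = (\<Sum>j\<in>V. if j = i then x j else 0)"
    unfolding dot_def by (rule sum.cong) auto
  then show ?thesis using \<open>finite V\<close> \<open>i \<in> V\<close> by simp
qed

lemma lf_add: "lf V (\<lambda>i. a i + b i) = lf V a + lf V b"
  by (simp add: lf_def Const_add distrib_right sum.distrib)

lemma lf_scale: "lf V (\<lambda>i. c * a i) = poly_scale c (lf V a)"
  by (simp add: lf_def Const_mult poly_scale_def sum_distrib_left mult.assoc)

lemma line_coordinate:
  assumes "finite V" "line_basis V l v w"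
  shows "\<exists>xi. dot V xi v = 0 \<and> dot V xi w = 1"
proof -
  obtain j where j: "j \<in> V" "w j \<noteq> 0" using assms(2) by (force simp: line_basis_def vecs_def fun_eq_iff)
  define xi where "xi = (\<lambda>i. (1 / w j) * ((if i = j then 1 else 0) + (- v j) * l i))"
  have "dot V xi x = (1 / w j) * (x j - v j * dot V l x)" for x
    unfolding xi_def dot_scale_left dot_add_left dot_single[OF assms(1) j(1)] by simp
  then show ?thesis using assms(2) j(2) by (intro exI[of _ xi]) (simp add: line_basis_def)
qed

text \<open>On a line every linear form acts as a combination of \<open>1\<close> and one coordinate \<open>xi\<close>.\<close>

lemma act_lf_on_line:
  assumes V: "finite V" "line_basis V l v w" and xi: "dot V xi v = 0" "dot V xi w = 1"
    and lam: "lam \<in> on_line V l v w"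
  shows "act (lf V u) lam = vec_scale (dot V u v) lam + vec_scale (dot V u w) (act (lf V xi) lam)"
proof -
  define u' where "u' = (\<lambda>i. u i + ((- dot V u v) * l i + (- dot V u w) * xi i))"
  have "dot V u' v = 0" "dot V u' w = 0"
    using V(2) xi unfolding u'_def dot_add_left dot_scale_left by (simp_all add: line_basis_def)
  then have "act (lf V u') lam = 0" using lam by (simp add: on_line_def)
  moreover have "act (lf V l) lam = lam" using lam by (simp add: on_line_def FL_def)
  ultimately have "act (lf V u) lam + (vec_scale (- dot V u v) lam + vec_scale (- dot V u w) (act (lf V xi) lam)) = 0"
    by (simp only: u'_def lf_add lf_scale act_add act_poly_scale)
  then have "act (lf V u) lam = - (vec_scale (- dot V u v) lam + vec_scale (- dot V u w) (act (lf V xi) lam))"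
    by (rule eq_neg_iff_add_eq_0[THEN iffD2])
  then show ?thesis by (simp only: vec.scale_minus_left minus_add_distrib minus_minus)
qed

lemma act_Var_on_line:
  assumes V: "finite V" "line_basis V l v w" and xi: "dot V xi v = 0" "dot V xi w = 1"
    and lam: "lam \<in> on_line V l v w"
  shows "act (Var i) lam = vec_scale (v i) lam + vec_scale (w i) (act (lf V xi) lam)"
proof (cases "i \<in> V")
  case True
  show ?thesis
    using act_lf_on_line[OF assms, of "\<lambda>j. if j = i then 1 else 0"]
    by (simp only: lf_single[OF V(1) True] dot_single[OF V(1) True])
next
  case False
  have "lam \<in> vecs (expo V)" using lam by (simp add: on_line_def FL_def)
  then have "act (Var i) lam = 0"
    using False by (auto simp: Var_def act_single vecs_def keys_add_nat fun_eq_iff)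
  moreover have "v i = 0" "w i = 0" using V(2) False by (auto simp: line_basis_def vecs_def)
  ultimately show ?thesis by simp
qed

text \<open>The restriction of a monomial to the line, as a polynomial in the parameter
  \<open>t\<close>.\<close>

definition line_poly :: "('v \<Rightarrow> 'a::comm_ring_1) \<Rightarrow> ('v \<Rightarrow> 'a) \<Rightarrow> ('v \<Rightarrow>\<^sub>0 nat) \<Rightarrow> 'a poly" where
  "line_poly v w = ev (\<lambda>i. [:v i, w i:])"

lemma poly_line_poly: "poly (line_poly v w \<beta>) t = ev (v + vec_scale t w) \<beta>"
  by (simp add: line_poly_def ev_def poly_prod poly_power vec_scale_def)

text \<open>Polynomials act on the functionals of a line through their restrictions to the
  line.\<close>

lemma act_single_on_line:
  assumes V: "finite V" "line_basis V l v w" and xi: "dot V xi v = 0" "dot V xi w = 1"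
    and lam: "lam \<in> on_line V l v w"
  shows "act (single \<beta> 1) lam = act (psub (lf V xi) (line_poly v w \<beta>)) lam"
proof (induction "deg_in UNIV \<beta>" arbitrary: \<beta>)
  case 0
  then have "\<beta> \<in> monomials UNIV 0" by (simp add: monomials_def del: monomials_0)
  then show ?case by (simp add: line_poly_def psub_def)
next
  case (Suc n)
  then obtain i \<gamma> where i: "\<beta> = single i 1 + \<gamma>" "\<gamma> \<in> monomials UNIV n"
    using monomial_split[of \<beta> UNIV n] by (metis subset_UNIV)
  let ?X = "lf V xi"
  have "single \<beta> 1 = single \<gamma> 1 * (Var i :: ('a, 'b) mpoly)" by (simp add: i Var_def mult_single add.commute)
  then have "act (single \<beta> 1) lam = act (Var i) (act (single \<gamma> 1) lam)" by (simp only: act_mult act_commute)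
  also have "act (single \<gamma> 1) lam = act (psub ?X (line_poly v w \<gamma>)) lam"
    using Suc(1)[of \<gamma>] i by (simp add: monomials_def)
  also have "act (Var i) \<dots> = act (psub ?X (line_poly v w \<gamma>)) (act (Var i) lam)" by (rule act_commute)
  also have "act (Var i) lam = act (psub ?X [:v i, w i:]) lam"
    by (simp add: act_Var_on_line[OF assms] psub_pCons act_add act_mult act_vec_scale)
  also have "act (psub ?X (line_poly v w \<gamma>)) \<dots> = act (psub ?X (line_poly v w \<beta>)) lam"
    by (simp only: act_mult[symmetric] psub_mult[symmetric]) (simp add: i line_poly_def ev_add mult.commute)
  finally show ?case .
qed

lemma act_zero_if_vanishing_on_line:
  fixes v w :: "'v \<Rightarrow> 'a::field_char_0"
  assumes V: "finite V" "line_basis V l v w" and lam: "lam \<in> on_line V l v w"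
    and f: "\<And>t. pr f (ev (v + vec_scale t w)) = 0"
  shows "act f lam = 0"
proof -
  obtain xi where xi: "dot V xi v = 0" "dot V xi w = 1" using line_coordinate[OF V] by blast
  define p where "p = (\<Sum>\<beta>\<in>keys f. smult (lookup f \<beta>) (line_poly v w \<beta>))"
  have "p = 0"
    by (rule poly_zero_off_finite[of "{}"]) (use f in \<open>simp_all add: p_def poly_sum poly_line_poly pr_def\<close>)
  have "act f lam = (\<Sum>\<beta>\<in>keys f. vec_scale (lookup f \<beta>) (act (single \<beta> 1) lam))"
    by (subst (1) poly_mapping_sum_single[of f], subst single_poly_scale) (simp only: act_sum act_poly_scale)
  also have "\<dots> = act (psub (lf V xi) p) lam"
    by (simp only: act_single_on_line[OF V xi lam] p_def psub_sum psub_smult act_sum act_Const_mult)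
  finally show ?thesis using \<open>p = 0\<close> by simp
qed

text \<open>A point off the line is separated from it by a linear form.\<close>

lemma ev_on_line_iff:
  assumes V: "finite V" "line_basis V l v w" and x: "x \<in> vecs V" "dot V l x = 1"
  shows "ev x \<in> on_line V l v w \<longleftrightarrow> x \<in> vec.span {v, w}"
proof
  assume "ev x \<in> on_line V l v w"
  then have all: "dot V u x = 0" if "dot V u v = 0" "dot V u w = 0" for u
  proof -
    have "dot V u x = 0 \<or> ev x = 0"
      using \<open>ev x \<in> on_line V l v w\<close> that by (simp add: on_line_def act_ev pr_lf_ev)
    then show ?thesis using ev_nonzero by blast
  qed
  show "x \<in> vec.span {v, w}"
  proof (rule ccontr)
    assume no: "x \<notin> vec.span {v, w}"
    have "vec.span {v, w} \<subseteq> vecs V" using V(2) subspace_vecs by (intro vec.span_minimal) (auto simp: line_basis_def)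
    from separating_form[OF V(1) vec.subspace_span this x(1) no]
    obtain u where u: "dot V u x \<noteq> 0" "\<forall>z\<in>vec.span {v, w}. dot V u z = 0" by blast
    then have "dot V u v = 0" "dot V u w = 0" by (simp_all add: vec.span_base)
    then show False using all u(1) by blast
  qed
next
  assume x': "x \<in> vec.span {v, w}"
  have "dot V u x = 0" if "dot V u v = 0" "dot V u w = 0" for u
  proof -
    have "vec.subspace {z. dot V u z = 0}" by (rule vec.subspaceI) (simp_all add: dot_scale dot_add)
    then have "vec.span {v, w} \<subseteq> {z. dot V u z = 0}" using that by (intro vec.span_minimal) auto
    then show ?thesis using x' by auto
  qed
  then show "ev x \<in> on_line V l v w"
    using ev_FL[OF x] by (simp add: on_line_def act_ev pr_lf_ev)
qed

text \<open>A linear equation \<open>u\<close> of \<open>X\<close> becomes a form on the Veronese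
  variety after multiplication by \<open>L^(d - 1)\<close>, which acts as the identity.\<close>

lemma perp_line_killed:
  assumes "1 \<le> d" and lam: "lam \<in> perp V d l (apolar V d (ev ` X))" and u: "\<And>x. x \<in> X \<Longrightarrow> dot V u x = 0"
  shows "act (lf V u) lam = 0"
proof -
  have L: "act (lf V l) lam = lam" using lam by (simp add: perp_def FL_def)
  have "lf V u * lf V l ^ (d - 1) \<in> forms V (1 + (d - 1) * 1)"
    by (rule mult_forms[OF lf_forms power_forms[OF lf_forms]])
  then have "lf V u * lf V l ^ (d - 1) \<in> forms V (d * 1)" using assms(1) by simp
  then obtain G where G: "G \<in> forms (monomials V d) 1" "phi G = lf V u * lf V l ^ (d - 1)" by (rule phi_surj)
  have "pr (phi G) (ev x) = 0" if "x \<in> X" for x using u[OF that] by (simp add: G(2) pr_ev_mult pr_lf_ev)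
  then have "G \<in> apolar V d (ev ` X)" using apolar_forms[OF G(1)] by blast
  then have "act (phi G) lam = 0" using lam G(1) by (auto simp: perp_def)
  then show ?thesis by (simp add: G(2) act_mult act_power_FL[OF L])
qed

text \<open>The functionals of the curve that is the image of a line. A form that vanishes on the
  line acts as \<open>0\<close>, since it acts through its restriction.\<close>

lemma perp_line:
  fixes v w :: "'v \<Rightarrow> 'a::field_char_0"
  assumes d: "1 \<le> d" and V: "finite V" "line_basis V l v w"
  shows "perp V d l (apolar V d (ev ` (vec.span {v, w} - {0}))) = on_line V l v w"
proof (intro equalityI subsetI)
  fix lam assume lam: "lam \<in> perp V d l (apolar V d (ev ` (vec.span {v, w} - {0})))"
  have "act (lf V u) lam = 0" if "dot V u v = 0" "dot V u w = 0" for u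
  proof (rule perp_line_killed[OF d lam])
    fix x assume "x \<in> vec.span {v, w} - {0}"
    moreover have "vec.subspace {z. dot V u z = 0}" by (rule vec.subspaceI) (simp_all add: dot_scale dot_add)
    then have "vec.span {v, w} \<subseteq> {z. dot V u z = 0}" using that by (intro vec.span_minimal) auto
    ultimately show "dot V u x = 0" by auto
  qed
  then show "lam \<in> on_line V l v w" using lam by (simp add: on_line_def perp_def)
next
  fix lam assume lam: "lam \<in> on_line V l v w"
  have "act (phi F) lam = 0" if F: "F \<in> apolar V d (ev ` (vec.span {v, w} - {0}))" "F \<in> forms (monomials V d) e" for F e
  proof (rule act_zero_if_vanishing_on_line[OF V lam])
    fix t
    have "dot V l (v + vec_scale t w) = 1" using V(2) by (simp add: dot_add dot_scale line_basis_def)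
    then have "v + vec_scale t w \<noteq> 0" by (metis dot_0 zero_neq_one)
    moreover have "v + vec_scale t w \<in> vec.span {v, w}"
      by (intro vec.span_add vec.span_scale vec.span_base) auto
    ultimately show "pr (phi F) (ev (v + vec_scale t w)) = 0" using apolarD[OF F] by blast
  qed
  then show "lam \<in> perp V d l (apolar V d (ev ` (vec.span {v, w} - {0})))"
    using lam by (auto simp: perp_def on_line_def)
qed

text \<open>A linear form \<open>u\<close> that is not identically zero on the line has at most one
  zero there. If it annihilates a functional of the line, then the coordinate \<open>xi\<close> acts
  on this functional as a scalar, so that it is a multiple of
  the evaluation at the zero, and \<open>0\<close> if the zero lies on \<open>L = 0\<close>.\<close>

lemma two_lines:
  assumes V: "finite V" "line_basis V l v w"
    and u: "dot V u v \<noteq> 0 \<or> dot V u w \<noteq> 0"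
  shows "\<exists>q. \<forall>lam\<in>on_line V l v w. act (lf V u) lam = 0 \<longrightarrow> lam \<in> vec.span {ev q}"
proof -
  obtain xi where xi: "dot V xi v = 0" "dot V xi w = 1" using line_coordinate[OF V] by blast
  define c where "c = - dot V u v / dot V u w"
  have "lam \<in> vec.span {ev (v + vec_scale c w)}"
    if lam: "lam \<in> on_line V l v w" and 0: "act (lf V u) lam = 0" for lam
  proof -
    have eq: "vec_scale (dot V u v) lam + vec_scale (dot V u w) (act (lf V xi) lam) = 0"
      using act_lf_on_line[OF V xi lam, of u] 0 by simp
    show ?thesis
    proof (cases "dot V u w = 0")
      case True
      then have "lam = 0" using eq u by simp
      then show ?thesis using vec.span_zero by metis
    next
      case False
      have "vec_scale (dot V u w) (act (lf V xi) lam) = vec_scale (- dot V u v) lam"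
        using eq by (simp add: vec.scale_minus_left add_eq_0_iff)
      then have "vec_scale (1 / dot V u w) (vec_scale (dot V u w) (act (lf V xi) lam)) = vec_scale (1 / dot V u w) (vec_scale (- dot V u v) lam)"
        by simp
      then have xc: "act (lf V xi) lam = vec_scale c lam" using False by (simp add: c_def)
      have "act (Var i) lam = vec_scale ((v + vec_scale c w) i) lam" for i
        unfolding act_Var_on_line[OF V xi lam] xc
        by (simp add: vec.scale_left_distrib vec_scale_def fun_eq_iff algebra_simps)
      then have "lam = vec_scale (lam 0) (ev (v + vec_scale c w))" by (rule eigenvector_eq_ev)
      then show ?thesis by (metis insertI1 vec.span_base vec.span_scale)
    qed
  qed
  then show ?thesis by blast
qed

section \<open>Spans and secant varieties\<close>

lemma dot_sum: "dot V u (sum f J) = (\<Sum>j\<in>J. dot V u (f j))"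
  by (induction J rule: infinite_finite_induct)
     (simp_all only: not_False_eq_True sum.infinite sum.empty sum.insert dot_0 dot_add)

text \<open>A linear subspace that contains the points as a scheme is cut out by linear forms; these vanish at the
  points and hence at every combination of them.\<close>

lemma points_spanI:
  fixes x :: "'v \<Rightarrow> 'a::field_char_0"
  assumes W: "finite W" and x: "x \<in> vecs W - {0}" "x = (\<Sum>j\<in>J. vec_scale (c j) (y j))"
    and A: "\<And>j. j \<in> J \<Longrightarrow> pt (y j) \<in> A"
  shows "pt x \<in> points_span W A"
  unfolding points_span_def linear_span_def
proof (rule InterI, clarify)
  fix L assume L: "L \<subseteq> vecs W" "vec.subspace L"
    "subscheme_of (vanishing_ideal W A) (vanishing_ideal W (projectivization W L))"
  have "x \<in> L"
  proof (rule ccontr)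
    assume "x \<notin> L"
    then obtain u where u: "dot W u x \<noteq> 0" "\<And>z. z \<in> L \<Longrightarrow> dot W u z = 0"
      using separating_form[OF W L(2,1)] x(1) by blast
    have "lf W u \<in> carrier (poly_ring W)" using lf_forms forms_carrier by blast
    moreover have "eval_at z (lf W u) = 0" if "p \<in> projectivization W L" "z \<in> p" for p z
    proof -
      have "z \<in> L" using that by (auto simp: projectivization_def)
      then show ?thesis unfolding eval_at_pr pr_lf_ev by (rule u(2))
    qed
    ultimately have "lf W u \<in> vanishing_ideal W (projectivization W L)" by (simp add: vanishing_ideal_def)
    then have "lf W u \<in> vanishing_ideal W A" using L(3) by (auto simp: subscheme_of_def)
    then have "eval_at (y j) (lf W u) = 0" if "j \<in> J" for j
      using A[OF that] pt_self[of "y j"] unfolding vanishing_ideal_def by blast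
    then have "dot W u (y j) = 0" if "j \<in> J" for j using that unfolding eval_at_pr pr_lf_ev by blast
    then have "dot W u x = 0" by (simp add: x(2) dot_sum dot_scale)
    then show False using u(1) by blast
  qed
  then show "pt x \<in> projectivization W L"
    using x(1) pt_subset_subspace[OF L(2)] by (auto simp: projectivization_def proj_space_pt)
qed

text \<open>The coordinates in \<open>\<PP>\<^sup>N\<close> are indexed by the monomials of degree
  \<open>d\<close>, so the restriction of a functional to degree \<open>d\<close> is a coordinate
  vector.\<close>

definition degree_part :: "nat \<Rightarrow> nat \<Rightarrow> ((nat \<Rightarrow>\<^sub>0 nat) \<Rightarrow> 'a::zero) \<Rightarrow> (nat \<Rightarrow>\<^sub>0 nat) \<Rightarrow> 'a" where
  "degree_part m d lam = (\<lambda>\<alpha>. if \<alpha> \<in> Ver_coords m d then lam \<alpha> else 0)"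

lemma degree_part_ev: "degree_part m d (ev x) = veronese_vec m d x"
  by (simp add: degree_part_def veronese_vec_ev)

lemma degree_part_scale: "degree_part m d (vec_scale c lam) = vec_scale c (degree_part m d lam)"
  by (simp add: degree_part_def vec_scale_def fun_eq_iff)

lemma degree_part_sum: "degree_part m d (sum f J) = (\<Sum>j\<in>J. degree_part m d (f j))" for f :: "_ \<Rightarrow> _ \<Rightarrow> 'a::comm_monoid_add"
  by (rule ext) (simp add: degree_part_def sum_fun_at)

lemma degree_part_vecs: "degree_part m d lam \<in> vecs (Ver_coords m d)"
  by (simp add: degree_part_def vecs_def)

lemma finite_Ver_coords: "finite (Ver_coords m d)"
  by (rule finite_monomials) simp

lemma sr_le:
  fixes x :: "(nat \<Rightarrow>\<^sub>0 nat) \<Rightarrow> 'a::field_char_0"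
  assumes "finite X" "X \<subseteq> vecs {..m} - {0}" and x: "x \<noteq> 0"
    "x = degree_part m d (\<Sum>a\<in>X. vec_scale (c a) (ev a))"
  shows "sr m d (pt x) \<le> card X"
proof -
  let ?A = "(\<lambda>a. pt (veronese_vec m d a)) ` X"
  have A: "?A \<subseteq> Ver m d" unfolding Ver_pt using assms(2) by blast
  have "x = (\<Sum>a\<in>X. vec_scale (c a) (veronese_vec m d a))"
    by (simp only: x(2) degree_part_sum degree_part_scale degree_part_ev)
  moreover have "x \<in> vecs (Ver_coords m d) - {0}" using x degree_part_vecs by auto
  ultimately have P: "pt x \<in> points_span (Ver_coords m d) ?A"
    using points_spanI[OF finite_Ver_coords, where A = ?A and J = X and y = "veronese_vec m d"] by blast
  have "finite ?A" using assms(1) by simp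
  then have "sr m d (pt x) \<le> card ?A" unfolding sr_def by (intro Least_le exI[of _ ?A] conjI A refl P)
  also have "\<dots> \<le> card X" by (rule card_image_le[OF assms(1)])
  finally show ?thesis .
qed

subsection \<open>Moving a multiple root\<close>

lemma psub_linear_factors:
  fixes g :: "('v \<Rightarrow>\<^sub>0 nat) \<Rightarrow> 'a::alg_closed_field"
  assumes "p \<noteq> 0" "act (psub X p) g = 0"
  shows "\<exists>as. length as \<le> degree p \<and> act (\<Prod>a\<leftarrow>as. X - Const a) g = 0"
  using assms
proof (induction "degree p" arbitrary: p g)
  case 0
  then obtain a where "p = [:a:]" by (metis degree_eq_zeroE)
  then have "vec_scale a g = 0" "a \<noteq> 0" using 0 by (auto simp: psub_pCons)
  then show ?case by (intro exI[of _ "[]"]) simp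
next
  case (Suc n)
  then obtain c where "poly p c = 0" using alg_closed_imp_poly_has_root[of p] by auto
  then obtain q where q: "p = [:-c, 1:] * q" by (auto simp: poly_eq_0_iff_dvd)
  have q0: "q \<noteq> 0" using q Suc.prems by auto
  then have dq: "degree q = n" using Suc(2) q by (simp add: degree_mult_eq del: mult_pCons_left)
  have "Const (-c) + (Const c :: ('v, 'a) mpoly) = 0" unfolding Const_add[symmetric] by simp
  then have mc: "Const (-c) = - (Const c :: ('v, 'a) mpoly)" by (rule eq_neg_iff_add_eq_0[THEN iffD2])
  have "psub X p = psub X q * (X - Const c)"
    unfolding q psub_mult by (simp add: psub_pCons mc mult.commute)
  then have "act (psub X q) (act (X - Const c) g) = 0" using Suc.prems(2) by (simp add: act_mult)
  then obtain as where as: "length as \<le> n" "act (\<Prod>a\<leftarrow>as. X - Const a) (act (X - Const c) g) = 0"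
    using Suc.hyps(1)[of q "act (X - Const c) g"] q0 dq by auto
  then have "act (\<Prod>a\<leftarrow>as @ [c]. X - Const a) g = 0" by (simp add: act_mult)
  then show ?case using as(1) Suc(2) by (intro exI[of _ "as @ [c]"]) auto
qed

text \<open>The values of a functional on the powers of \<open>X\<close> satisfy a linear recurrence with the given roots.
  If the \<open>i\<close>-th root moves with velocity \<open>i\<close>, the solution moves polynomially, and it is a
  combination of geometric sequences as soon as the roots are distinct.\<close>

lemma deform_recurrence:
  fixes g :: "('v \<Rightarrow>\<^sub>0 nat) \<Rightarrow> 'a::field_char_0"
  assumes "act (\<Prod>a\<leftarrow>as. X - Const a) g = 0"
  shows "\<exists>S B. finite B \<and> (\<forall>k. poly (S k) 0 = act (X ^ k) g 0) \<and>
    (\<forall>t. t \<notin> B \<longrightarrow> (\<exists>c. \<forall>k. poly (S k) t = (\<Sum>i<length as. c i * (as ! i + of_nat i * t) ^ k)))"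
  using assms
proof (induction as arbitrary: g rule: rev_induct)
  case Nil
  then have "g = 0" by (simp only: list.map prod_list.Nil act_1)
  then have "act (X ^ k) g 0 = 0" for k by simp
  then show ?case by (intro exI[of _ "\<lambda>_. 0"] exI[of _ "{}"]) simp
next
  case (snoc a as)
  define n where "n = length as"
  have "act (\<Prod>a\<leftarrow>as. X - Const a) (act (X - Const a) g) = 0"
    using snoc.prems by (simp only: map_append list.map prod_list.append prod_list.Cons prod_list.Nil mult_1_right act_mult)
  then obtain S' B' where S': "finite B'" "\<And>k. poly (S' k) 0 = act (X ^ k) (act (X - Const a) g) 0"
    "\<And>t. t \<notin> B' \<Longrightarrow> \<exists>c. \<forall>k. poly (S' k) t = (\<Sum>i<n. c i * (as ! i + of_nat i * t) ^ k)"
    using snoc.IH[of "act (X - Const a) g"] unfolding n_def by blast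
  \<comment> \<open>The recurrence of order one for the last root \<open>a\<close>, which moves as
    \<open>a + n t\<close>, driven by the moving solution for the other roots.\<close>
  define S where "S = rec_nat [:g 0:] (\<lambda>k s. [:a, of_nat n:] * s + S' k)"
  have S0: "S 0 = [:g 0:]" and SS: "S (Suc k) = [:a, of_nat n:] * S k + S' k" for k
    by (simp_all add: S_def)
  have at0: "poly (S k) 0 = act (X ^ k) g 0" for k
  proof (induction k)
    case (Suc k)
    have "act (X ^ k) (act (X - Const a) g) = act (X ^ Suc k) g - vec_scale a (act (X ^ k) g)"
      by (simp add: act_diff act_diff_right act_vec_scale act_mult[symmetric] mult.commute)
    then have "poly (S' k) 0 = act (X ^ Suc k) g 0 - a * act (X ^ k) g 0"
      by (simp only: S'(2)) (simp add: vec_scale_def)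
    then show ?case using Suc by (simp add: SS)
  qed (simp add: S0)
  define b where "b i t = (as @ [a]) ! i + of_nat i * t" for i t
  \<comment> \<open>The parameters at which the last root meets another one.\<close>
  define B where "B = B' \<union> (\<lambda>i. (as ! i - a) / (of_nat n - of_nat i)) ` {..<n}"
  have "\<exists>c. \<forall>k. poly (S k) t = (\<Sum>i<Suc n. c i * b i t ^ k)" if t: "t \<notin> B" for t
  proof -
    have bi: "b i t = as ! i + of_nat i * t" if "i < n" for i using that by (simp add: b_def n_def nth_append)
    have bn: "b n t = a + of_nat n * t" by (simp add: b_def n_def)
    have ne: "b i t \<noteq> b n t" if i: "i < n" for i
    proof
      assume "b i t = b n t"
      then have "as ! i - a = (of_nat n - of_nat i) * t" using bi[OF i] bn by (simp add: algebra_simps)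
      moreover have "of_nat n - of_nat i \<noteq> (0 :: 'a)" using i by simp
      ultimately have "t = (as ! i - a) / (of_nat n - of_nat i)" by (simp add: field_simps)
      then show False using t i by (auto simp: B_def)
    qed
    obtain c' where c': "\<And>k. poly (S' k) t = (\<Sum>i<n. c' i * (as ! i + of_nat i * t) ^ k)"
      using S'(3)[of t] t by (auto simp: B_def)
    \<comment> \<open>Coefficients of the solution of the inhomogeneous recurrence by geometric
      sequences; the last one is adjusted to the initial value \<open>g 0\<close>.\<close>
    define c where "c i = (if i < n then c' i / (b i t - b n t) else g 0 - (\<Sum>i<n. c' i / (b i t - b n t)))" for i
    have "poly (S k) t = (\<Sum>i<Suc n. c i * b i t ^ k)" for k
    proof (induction k)
      case 0
      have "(\<Sum>i<n. c i) = (\<Sum>i<n. c' i / (b i t - b n t))" by (rule sum.cong) (auto simp: c_def)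
      then show ?case by (simp add: S0 c_def)
    next
      case (Suc k)
      have "poly (S (Suc k)) t = b n t * (\<Sum>i<Suc n. c i * b i t ^ k) + (\<Sum>i<n. c' i * b i t ^ k)"
        using c'[of k] bi by (simp add: SS bn Suc algebra_simps)
      also have "(\<Sum>i<n. c' i * b i t ^ k) = (\<Sum>i<n. c i * (b i t - b n t) * b i t ^ k)"
        by (rule sum.cong) (use ne in \<open>auto simp: c_def\<close>)
      also have "b n t * (\<Sum>i<Suc n. c i * b i t ^ k) + \<dots> = (\<Sum>i<Suc n. c i * b i t ^ Suc k)"
        by (simp add: sum_distrib_left distrib_left sum.distrib[symmetric] algebra_simps)
      finally show ?case .
    qed
    then show ?thesis by blast
  qed
  moreover have "finite B" using S'(1) by (simp add: B_def)
  ultimately show ?case using at0 unfolding b_def n_def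
    by (intro exI[of _ S] exI[of _ B]) simp
qed

text \<open>A functional on a line with an orbit of dimension \<open>e\<close> is a limit of
  combinations of \<open>e\<close> evaluations on the line: a coordinate of the line satisfies an
  equation of degree \<open>e\<close> on it, and the roots of this equation can be moved
  apart.\<close>

lemma secant_varietyI:
  fixes lam :: "(nat \<Rightarrow>\<^sub>0 nat) \<Rightarrow> 'a::{alg_closed_field, field_char_0}"
  assumes line: "line_basis {..m} l v w" and lam: "lam \<in> on_line {..m} l v w" "vec.findim (orbit lam)"
    and X: "finite X" "X \<subseteq> vecs {..m} - {0}"
    and x: "x \<noteq> 0" "x = degree_part m d (lam + (\<Sum>a\<in>X. vec_scale (q a) (ev a)))"
    and s: "vec.dim (orbit lam) + card X \<le> s"
  shows "pt x \<in> secant_variety m d s"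
proof -
  let ?W = "Ver_coords m d" and ?V = "{..m}"
  have fV: "finite ?V" by simp
  obtain xi where xi: "dot ?V xi v = 0" "dot ?V xi w = 1" using line_coordinate[OF fV line] by blast
  let ?X = "lf ?V xi"
  obtain p where "p \<noteq> 0" "degree p \<le> vec.dim (orbit lam)" "act (psub ?X p) lam = 0"
    using annihilating_poly[OF submod_orbit lam(2) orbit_self] by blast
  then obtain as where as: "length as \<le> vec.dim (orbit lam)" "act (\<Prod>a\<leftarrow>as. ?X - Const a) lam = 0"
    using psub_linear_factors[of p ?X lam] by force
  obtain S B where SB: "finite B" "\<And>k. poly (S k) 0 = act (?X ^ k) lam 0"
    "\<And>t. t \<notin> B \<Longrightarrow> \<exists>c. \<forall>k. poly (S k) t = (\<Sum>i<length as. c i * (as ! i + of_nat i * t) ^ k)"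
    using deform_recurrence[OF as(2)] by blast
  \<comment> \<open>A polynomial curve in \<open>K\<^sup>W\<close> through \<open>x\<close> at
    \<open>t = 0\<close>; at almost all \<open>t\<close> it is a combination of at most
    \<open>s\<close> points of the Veronese variety.\<close>
  define Q where "Q \<beta> = (if \<beta> \<in> ?W then (\<Sum>k\<le>degree (line_poly v w \<beta>). smult (coeff (line_poly v w \<beta>) k) (S k))
      + [:\<Sum>a\<in>X. q a * ev a \<beta>:] else 0)" for \<beta>
  define xt where "xt t \<beta> = poly (Q \<beta>) t" for t \<beta>
  have xtW: "xt t \<in> vecs ?W" for t by (simp add: xt_def Q_def vecs_def)
  have x0: "xt 0 = x"
  proof
    fix \<beta>
    have "lam \<beta> = act (psub ?X (line_poly v w \<beta>)) lam 0"
      using act_single_on_line[OF fV line xi lam(1), of \<beta>, THEN fun_cong, of 0] by (simp add: act_single)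
    also have "\<dots> = (\<Sum>k\<le>degree (line_poly v w \<beta>). coeff (line_poly v w \<beta>) k * act (?X ^ k) lam 0)"
      by (simp add: psub_def act_sum act_Const_mult sum_fun_at vec_scale_def)
    finally show "xt 0 \<beta> = x \<beta>"
      by (simp add: xt_def Q_def x(2) degree_part_def poly_sum SB(2) sum_fun_at vec_scale_def)
  qed
  have comb: "\<exists>c. xt t = (\<Sum>i<length as. vec_scale (c i) (veronese_vec m d (v + vec_scale (as ! i + of_nat i * t) w)))
      + (\<Sum>a\<in>X. vec_scale (q a) (veronese_vec m d a))" if t: "t \<notin> B" for t
  proof -
    obtain c where c: "\<And>k. poly (S k) t = (\<Sum>i<length as. c i * (as ! i + of_nat i * t) ^ k)" using SB(3)[OF t] by blast
    have "xt t \<beta> = ((\<Sum>i<length as. vec_scale (c i) (veronese_vec m d (v + vec_scale (as ! i + of_nat i * t) w)))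
      + (\<Sum>a\<in>X. vec_scale (q a) (veronese_vec m d a))) \<beta>" for \<beta>
    proof (cases "\<beta> \<in> ?W")
      case True
      let ?p = "line_poly v w \<beta>"
      have "(\<Sum>k\<le>degree ?p. coeff ?p k * poly (S k) t)
          = (\<Sum>i<length as. \<Sum>k\<le>degree ?p. coeff ?p k * (c i * (as ! i + of_nat i * t) ^ k))"
        unfolding c sum_distrib_left by (rule sum.swap)
      also have "\<dots> = (\<Sum>i<length as. c i * poly ?p (as ! i + of_nat i * t))"
        by (simp add: poly_altdef sum_distrib_left mult.left_commute)
      finally show ?thesis using True
        by (simp add: xt_def Q_def poly_sum poly_line_poly sum_fun_at vec_scale_def veronese_vec_ev)
    next
      case False
      then show ?thesis by (simp add: xt_def Q_def sum_fun_at vec_scale_def veronese_vec_ev)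
    qed
    then show ?thesis by blast
  qed
  define U :: "((nat \<Rightarrow>\<^sub>0 nat) \<Rightarrow> 'a) set set" where "U = (\<Union>p \<in> {..<s} \<rightarrow> Ver m d. points_span ?W (p ` {..<s}))"
  have line_pt: "v + vec_scale b w \<in> vecs ?V - {0}" for b
  proof -
    have "dot ?V l (v + vec_scale b w) = 1" using line by (simp add: dot_add dot_scale line_basis_def)
    then have "v + vec_scale b w \<noteq> 0" by (metis dot_0 zero_neq_one)
    moreover have "v + vec_scale b w \<in> vecs ?V"
      using line by (intro vec.subspace_add[OF subspace_vecs] vec.subspace_scale[OF subspace_vecs]) (simp_all add: line_basis_def)
    ultimately show ?thesis by blast
  qed
  have inU: "pt (xt t) \<in> U" if t: "t \<notin> B" "xt t \<noteq> 0" for t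
  proof -
    obtain c where c: "xt t = (\<Sum>i<length as. vec_scale (c i) (veronese_vec m d (v + vec_scale (as ! i + of_nat i * t) w)))
      + (\<Sum>a\<in>X. vec_scale (q a) (veronese_vec m d a))" using comb[OF t(1)] by blast
    obtain ys where ys: "set ys = X" "length ys = card X" using finite_distinct_list[OF X(1)] distinct_card by metis
    define zs where "zs = map (\<lambda>i. v + vec_scale (as ! i + of_nat i * t) w) [0..<length as] @ ys"
    have zs: "length zs \<le> s" "set zs \<subseteq> vecs ?V - {0}"
      using as(1) s ys line_pt X(2) by (auto simp: zs_def)
    \<comment> \<open>A map on all of \<open>{..<s}\<close> is needed, so the list of points is
      filled up with the point \<open>v\<close>.\<close>
    define p where "p j = (if j < length zs then pt (veronese_vec m d (zs ! j)) else pt (veronese_vec m d v))" for j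
    have v0: "v \<in> vecs ?V - {0}" using line_pt[of 0] by simp
    have pV: "p \<in> {..<s} \<rightarrow> Ver m d"
    proof (rule Pi_I)
      fix j
      have "zs ! j \<in> vecs ?V - {0}" if "j < length zs" using zs(2) that nth_mem by blast
      then show "p j \<in> Ver m d" unfolding Ver_pt p_def using v0 by auto
    qed
    have mem: "pt (veronese_vec m d z) \<in> p ` {..<s}" if z: "z \<in> set zs" for z
    proof -
      obtain j where "j < length zs" "z = zs ! j" using z by (metis in_set_conv_nth)
      then show ?thesis using zs(1) by (intro image_eqI[of _ _ j]) (auto simp: p_def)
    qed
    define J where "J = (Inl ` {..<length as} \<union> Inr ` X :: (nat + (nat \<Rightarrow> 'a)) set)"
    define y where "y = case_sum (\<lambda>i. veronese_vec m d (v + vec_scale (as ! i + of_nat i * t) w)) (\<lambda>a :: nat \<Rightarrow> 'a. veronese_vec m d a)"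
    have xtJ: "xt t = (\<Sum>j\<in>J. vec_scale (case_sum c q j) (y j))"
      unfolding J_def c
      by (subst sum.union_disjoint) (auto simp: X(1) y_def sum.reindex inj_on_def)
    have yJ: "pt (y j) \<in> p ` {..<s}" if "j \<in> J" for j
    proof -
      have "\<exists>z\<in>set zs. y j = veronese_vec m d z"
      proof (cases j)
        case (Inl i)
        then have "v + vec_scale (as ! i + of_nat i * t) w \<in> set zs" using that by (auto simp: J_def zs_def)
        then show ?thesis using Inl by (auto simp: y_def)
      next
        case (Inr a)
        then have "a \<in> set zs" using that ys(1) by (auto simp: J_def zs_def)
        then show ?thesis using Inr by (auto simp: y_def)
      qed
      then show ?thesis using mem by auto
    qed
    have "xt t \<in> vecs ?W - {0}" using xtW t(2) by blast
    from points_spanI[OF finite_Ver_coords this xtJ yJ]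
    have "pt (xt t) \<in> points_span ?W (p ` {..<s})" by blast
    then show ?thesis using pV unfolding U_def by blast
  qed
  obtain \<beta>0 where \<beta>0: "x \<beta>0 \<noteq> 0" using x(1) by (auto simp: fun_eq_iff)
  \<comment> \<open>Parameters to be avoided: those where the roots collide and those where the
    vector might vanish.\<close>
  define B0 where "B0 = B \<union> {t. poly (Q \<beta>0) t = 0}"
  have "poly (Q \<beta>0) 0 \<noteq> 0" using \<beta>0 fun_cong[OF x0, of \<beta>0] by (simp add: xt_def)
  then have "Q \<beta>0 \<noteq> 0" by (metis poly_0)
  then have fB0: "finite B0" using SB(1) poly_roots_finite by (simp add: B0_def)
  have "eval_at z F = 0" if F: "F \<in> vanishing_ideal ?W U" and z: "z \<in> pt x" for F z
  proof -
    obtain b where b: "b \<noteq> 0" "z = vec_scale b x" using z by (auto simp: pt_def)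
    \<comment> \<open>An equation \<open>F\<close> of the spans, restricted to the curve, is a
      polynomial in \<open>t\<close> that vanishes at almost all \<open>t\<close>, hence also at
      \<open>t = 0\<close>.\<close>
    define R where "R = (\<Sum>A\<in>keys F. smult (lookup F A) (ev (\<lambda>\<alpha>. smult b (Q \<alpha>)) A))"
    have R: "poly R t = pr F (ev (vec_scale b (xt t)))" for t
      by (simp add: R_def poly_sum pr_def ev_def poly_prod poly_power vec_scale_def xt_def)
    have "R = 0"
    proof (rule poly_zero_off_finite[OF fB0])
      fix t assume t: "t \<notin> B0"
      then have "xt t \<beta>0 \<noteq> 0" by (simp add: B0_def xt_def)
      then have "xt t \<noteq> 0" by auto
      then have "pt (xt t) \<in> U" using inU t by (simp add: B0_def)
      moreover have "vec_scale b (xt t) \<in> pt (xt t)" using b(1) by (auto simp: pt_def)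
      ultimately have "eval_at (vec_scale b (xt t)) F = 0" using F unfolding vanishing_ideal_def by blast
      then show "poly R t = 0" by (simp only: R eval_at_pr)
    qed
    then have "pr F (ev z) = 0" using R[of 0] x0 b(2) by simp
    then show ?thesis by (simp only: eval_at_pr)
  qed
  moreover have "pt x \<in> proj_space ?W" using x degree_part_vecs by (auto simp: proj_space_pt)
  ultimately show ?thesis
    unfolding secant_variety_def zariski_closure_def scheme_points_def U_def[symmetric] by blast
qed

section \<open>Decomposition along a line\<close>

text \<open>Multiply an interpolating polynomial by a linear equation of the line that is not zero
  at \<open>a\<close>.\<close>

lemma isolating_poly:
  fixes v w :: "'v \<Rightarrow> 'a::field_char_0"
  assumes V: "finite V" "line_basis V l v w" and A: "finite A"
    and a: "a \<in> vecs V" "dot V l a = 1" "a \<notin> vec.span {v, w}"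
  shows "\<exists>f. act f (ev a) = ev a \<and> (\<forall>b\<in>A - {a}. act f (ev b) = 0) \<and> (\<forall>lam\<in>on_line V l v w. act f lam = 0)"
proof -
  have "ev a \<notin> on_line V l v w" using ev_on_line_iff[OF V a(1,2)] a(3) by blast
  then obtain u where u: "dot V u v = 0" "dot V u w = 0" "act (lf V u) (ev a) \<noteq> 0"
    using ev_FL[OF a(1,2)] by (auto simp: on_line_def)
  then have ua: "dot V u a \<noteq> 0" by (auto simp: act_ev pr_lf_ev)
  obtain h where h: "pr h (ev a) = 1" "\<forall>b\<in>A - {a}. pr h (ev b) = 0"
    using interpolation[of "A - {a}" a] A by auto
  define f where "f = Const (1 / dot V u a) * (h * lf V u)"
  have f: "act f lam = vec_scale (1 / dot V u a) (act h (act (lf V u) lam))" for lam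
    by (simp only: f_def act_mult act_Const)
  have "act f (ev b) = vec_scale (dot V u b / dot V u a * pr h (ev b)) (ev b)" for b
    unfolding f[of "ev b"] by (simp add: act_ev pr_lf_ev act_vec_scale)
  then have "act f (ev a) = ev a" "\<forall>b\<in>A - {a}. act f (ev b) = 0" using ua h by simp_all
  moreover have "\<forall>lam\<in>on_line V l v w. act f lam = 0" using u by (simp add: f on_line_def)
  ultimately show ?thesis by blast
qed

lemma span_ev_sum:
  assumes "finite A" "lam \<in> vec.span (ev ` A)"
  shows "\<exists>b. lam = (\<Sum>a\<in>A. vec_scale (b a) (ev (a :: 'v \<Rightarrow> 'a::field)))"
proof -
  have "finite (ev ` A :: (('v \<Rightarrow>\<^sub>0 nat) \<Rightarrow> 'a) set)" using assms(1) by simp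
  then obtain u where "lam = (\<Sum>e\<in>ev ` A. vec_scale (u e) e)"
    using assms(2) vec.span_finite by blast
  also have "\<dots> = (\<Sum>a\<in>A. vec_scale (u (ev a)) (ev a))"
    by (rule sum.reindex_cong[OF inj_on_subset[OF inj_ev subset_UNIV]]) auto
  finally show ?thesis by (rule exI[of _ "\<lambda>a. u (ev a)"])
qed

lemma on_line_Int_span_ev:
  fixes v w :: "'v \<Rightarrow> 'a::field_char_0"
  assumes V: "finite V" "line_basis V l v w" and A: "finite A"
    "\<And>a. a \<in> A \<Longrightarrow> a \<in> vecs V \<and> dot V l a = 1 \<and> a \<notin> vec.span {v, w}"
  shows "on_line V l v w \<inter> vec.span (ev ` A) = {0}"
proof -
  have "lam = 0" if lam: "lam \<in> on_line V l v w" "lam \<in> vec.span (ev ` A)" for lam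
  proof -
    obtain b where b: "lam = (\<Sum>a\<in>A. vec_scale (b a) (ev a))" using span_ev_sum[OF A(1) lam(2)] by blast
    have "vec_scale (b a) (ev a) = 0" if a: "a \<in> A" for a
    proof -
      obtain f where f: "act f (ev a) = ev a" "\<forall>b\<in>A - {a}. act f (ev b) = 0" "\<forall>lam\<in>on_line V l v w. act f lam = 0"
        using isolating_poly[OF V A(1)] A(2)[OF a] by blast
      have "act f lam = (\<Sum>a'\<in>A. vec_scale (b a') (act f (ev a')))" by (simp only: b act_sum_right act_vec_scale)
      also have "\<dots> = vec_scale (b a) (act f (ev a)) + (\<Sum>a'\<in>A - {a}. vec_scale (b a') (act f (ev a')))"
        by (rule sum.remove[OF A(1) a])
      also have "(\<Sum>a'\<in>A - {a}. vec_scale (b a') (act f (ev a'))) = 0" by (rule sum.neutral) (use f in simp)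
      finally have "act f lam = vec_scale (b a) (ev a)" by (simp only: f(1) add_0_right)
      then show ?thesis using f(3) lam(1) by metis
    qed
    then show ?thesis unfolding b by (intro sum.neutral) blast
  qed
  moreover have "0 \<in> on_line V l v w" using submod_on_line[of V l v w] by (auto simp: submod_def vec.subspace_0)
  ultimately show ?thesis using vec.span_zero by blast
qed

text \<open>The functionals of a reduced scheme with points \<open>A\<close> and of a second scheme,
  both of which span the point of \<open>x\<close>, in the numerical situation of the theorem. That
  all coefficients \<open>c a\<close> are nonzero reflects the minimality of \<open>A\<close>.\<close>

definition spanning_pair ::
  "nat \<Rightarrow> nat \<Rightarrow> (nat \<Rightarrow> 'a::field) \<Rightarrow> ((nat \<Rightarrow>\<^sub>0 nat) \<Rightarrow> 'a) \<Rightarrow> (nat \<Rightarrow> 'a) set \<Rightarrow> ((nat \<Rightarrow>\<^sub>0 nat) \<Rightarrow> 'a) set \<Rightarrow> bool" where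
  "spanning_pair m d l x A N \<longleftrightarrow> 1 \<le> d \<and> x \<noteq> 0 \<and>
     finite A \<and> (\<forall>a\<in>A. a \<in> vecs {..m} \<and> dot {..m} l a = 1) \<and> card A = sr m d (pt x) \<and>
     (\<exists>c. (\<forall>a\<in>A. c a \<noteq> 0) \<and> x = degree_part m d (\<Sum>a\<in>A. vec_scale (c a) (ev a))) \<and>
     submod N \<and> vec.findim N \<and> N \<subseteq> FL {..m} l \<and> (\<exists>lam\<in>N. x = degree_part m d lam) \<and>
     vec.dim N \<le> sbr m d (pt x) \<and> sbr m d (pt x) < sr m d (pt x) \<and>
     sbr m d (pt x) + sr m d (pt x) \<le> 2 * d + 1"

text \<open>The scheme with functionals \<open>N\<close> is the disjoint union of its part on the
  line and the points of \<open>A\<close> off the line, and its union with \<open>A\<close> has degree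
  at least \<open>d + 2\<close> on the line.\<close>

definition decomposes_along ::
  "nat \<Rightarrow> nat \<Rightarrow> (nat \<Rightarrow> 'a::field) \<Rightarrow> (nat \<Rightarrow> 'a) set \<Rightarrow> ((nat \<Rightarrow>\<^sub>0 nat) \<Rightarrow> 'a) set \<Rightarrow> (nat \<Rightarrow> 'a) \<Rightarrow> (nat \<Rightarrow> 'a) \<Rightarrow> bool" where
  "decomposes_along m d l A N v w \<longleftrightarrow> line_basis {..m} l v w \<and>
     N = vec.span ((N \<inter> on_line {..m} l v w) \<union> ev ` (A - vec.span {v, w})) \<and>
     vec.dim N = vec.dim (N \<inter> on_line {..m} l v w) + card (A - vec.span {v, w}) \<and>
     d + 2 \<le> vec.dim (vec.span (N \<union> ev ` A) \<inter> on_line {..m} l v w)"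

lemma dim_span_ev: "finite A \<Longrightarrow> vec.dim (vec.span (ev ` A :: (('v \<Rightarrow>\<^sub>0 nat) \<Rightarrow> 'a::field) set)) = card A"
  using vec.dim_span_eq_card_independent[OF ev_independent[of A]] card_image[OF inj_on_subset[OF inj_ev subset_UNIV], of A]
  by simp

lemma spanning_pair_sum:
  assumes "spanning_pair m d l x A N"
  shows "vec.findim (vec.span (N \<union> ev ` A))" "vec.dim (vec.span (N \<union> ev ` A)) \<le> 2 * d + 1"
proof -
  have A: "finite A" "vec.findim N" and num: "vec.dim N + card A \<le> 2 * d + 1"
    using assms by (auto simp: spanning_pair_def)
  have fA: "vec.findim (ev ` A)" 
    using A(1) vec.span_superset[of "ev ` A"] unfolding vec.findim_def by (intro exI[of _ "ev ` A"]) simp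
  show "vec.findim (vec.span (N \<union> ev ` A))" by (rule vec.findim_Un_span[OF A(2) fA])
  have "vec.dim (vec.span (N \<union> ev ` A)) \<le> vec.dim N + vec.dim (ev ` A)" by (rule vec.dim_span_Un_le[OF A(2) fA])
  also have "vec.dim (ev ` A) = card A" using dim_span_ev[OF A(1)] by simp
  finally show "vec.dim (vec.span (N \<union> ev ` A)) \<le> 2 * d + 1" using num by simp
qed

text \<open>The difference of the two functionals vanishes in degree \<open>d\<close>, so it lives on a line. Off that line
  the two functionals agree, so the second scheme contains the points \<open>A\<close> off the line. The second
  functional is a limit of combinations of as many evaluations as the degree of its line part and
  its points off the line, so that this number is at least the border rank and nothing else is left
  in \<open>N\<close>.\<close>

theorem exists_decomposition:
  fixes l :: "nat \<Rightarrow> 'a::{alg_closed_field, field_char_0}"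
  assumes sp: "spanning_pair m d l x A N"
  shows "(\<exists>v w. decomposes_along m d l A N v w) \<and> vec.dim N = sbr m d (pt x)"
proof -
  let ?V = "{..m}"
  have V: "finite ?V" by simp
  have d: "1 \<le> d" and x: "x \<noteq> 0" and A: "finite A" "\<And>a. a \<in> A \<Longrightarrow> a \<in> vecs ?V \<and> dot ?V l a = 1"
    "card A = sr m d (pt x)" and N: "submod N" "vec.findim N" "N \<subseteq> FL ?V l"
    and num: "vec.dim N \<le> sbr m d (pt x)" "sbr m d (pt x) < sr m d (pt x)"
    using sp by (auto simp: spanning_pair_def)
  obtain c where c: "\<And>a. a \<in> A \<Longrightarrow> c a \<noteq> 0" and xS: "x = degree_part m d (\<Sum>a\<in>A. vec_scale (c a) (ev a))"
    using sp by (auto simp: spanning_pair_def)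
  obtain lamZ where lamZ: "lamZ \<in> N" "x = degree_part m d lamZ" using sp by (auto simp: spanning_pair_def)
  have sN: "vec.subspace N" using N(1) by (simp add: submod_def)
  define lamS where "lamS = (\<Sum>a\<in>A. vec_scale (c a) (ev a))"
  define mu where "mu = lamZ - lamS"
  let ?M = "vec.span (N \<union> ev ` A)"
  note M = spanning_pair_sum[OF sp]
  have evA: "ev a \<in> FL ?V l" if "a \<in> A" for a using ev_FL A(2)[OF that] by blast
  have lamSM: "lamS \<in> vec.span (ev ` A)" unfolding lamS_def
    by (intro vec.span_sum vec.span_scale vec.span_base) auto
  have spA: "vec.span (ev ` A) \<subseteq> ?M" by (rule vec.span_mono) auto
  have NM: "N \<subseteq> ?M" using vec.span_superset by blast
  have "submod ?M"
  proof (rule submod_if_Var[OF vec.subspace_span])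
    fix i lam assume "lam \<in> ?M"
    then have "act (Var i) lam \<in> vec.span (act (Var i) ` (N \<union> ev ` A))"
      using vecvec.linear_span_image[OF linear_act] by blast
    moreover have "act (Var i) ` (N \<union> ev ` A) \<subseteq> ?M"
    proof (clarsimp simp: image_Un, intro conjI subsetI)
      fix z assume "z \<in> act (Var i) ` N"
      then show "z \<in> ?M" using N(1) NM by (auto simp: submod_def)
    next
      fix z assume "z \<in> act (Var i) ` ev ` A"
      then obtain a where "a \<in> A" "z = vec_scale (pr (Var i) (ev a)) (ev a)" by (auto simp: act_ev)
      then show "z \<in> ?M" by (simp only:) (intro vec.span_scale vec.span_base, blast)
    qed
    ultimately show "act (Var i) lam \<in> ?M" using vec.span_minimal[OF _ vec.subspace_span] by blast
  qed
  moreover have muM: "mu \<in> ?M" unfolding mu_def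
    using lamZ(1) NM lamSM spA by (intro vec.span_diff) auto
  ultimately have orbM: "orbit mu \<subseteq> ?M" using orbit_subset by blast
  have fin: "vec.findim (orbit mu)" using vec.findim_subset[OF orbM M(1)] .
  have small: "vec.dim (orbit mu) \<le> 2 * d + 1" using vec.findim_dim_mono[OF orbM M(1)] M(2) by simp
  have "lamS \<in> FL ?V l" unfolding lamS_def
    by (intro vec.subspace_sum[OF subspace_FL] vec.subspace_scale[OF subspace_FL] evA)
  then have muF: "mu \<in> FL ?V l" unfolding mu_def using lamZ(1) N(3) vec.subspace_diff[OF subspace_FL] by blast
  have van: "mu \<beta> = 0" if "\<beta> \<in> monomials ?V d" for \<beta>
  proof -
    have "degree_part m d lamZ \<beta> = degree_part m d lamS \<beta>" using lamZ(2) xS by (simp add: lamS_def)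
    then show ?thesis using that by (simp add: degree_part_def mu_def)
  qed
  \<comment> \<open>Otherwise isolating the points of \<open>A\<close> in \<open>lamZ = lamS\<close>
    shows that \<open>N\<close> contains \<open>sr P\<close> independent evaluations, more than its
    dimension.\<close>
  have mu0: "mu \<noteq> 0"
  proof
    assume "mu = 0"
    then have eq: "lamZ = lamS" by (simp add: mu_def)
    have "ev a \<in> N" if a: "a \<in> A" for a
    proof -
      obtain h where h: "pr h (ev a) = 1" "\<forall>b\<in>A - {a}. pr h (ev b) = 0"
        using interpolation[of "A - {a}" a] A by auto
      have "act h lamS = (\<Sum>b\<in>A. vec_scale (c b * pr h (ev b)) (ev b))"
        by (simp add: lamS_def act_sum_right act_vec_scale act_ev)
      also have "\<dots> = vec_scale (c a * pr h (ev a)) (ev a) + (\<Sum>b\<in>A - {a}. vec_scale (c b * pr h (ev b)) (ev b))"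
        by (rule sum.remove[OF A(1) a])
      also have "(\<Sum>b\<in>A - {a}. vec_scale (c b * pr h (ev b)) (ev b)) = 0" by (rule sum.neutral) (use h in simp)
      finally have "act h lamS = vec_scale (c a) (ev a)" by (simp only: h(1) mult_1_right add_0_right)
      then have "vec_scale (c a) (ev a) \<in> N" using N(1) lamZ(1) eq by (metis submod_def)
      then have "vec_scale (1 / c a) (vec_scale (c a) (ev a)) \<in> N" by (rule vec.subspace_scale[OF sN])
      then show ?thesis using c[OF a] by simp
    qed
    then have "ev ` A \<subseteq> N" by blast
    then have "card (ev ` A :: ((nat \<Rightarrow>\<^sub>0 nat) \<Rightarrow> 'a) set) \<le> vec.dim N"
      using vec.findim_independent[OF N(2) ev_independent] by blast
    moreover have "card (ev ` A :: ((nat \<Rightarrow>\<^sub>0 nat) \<Rightarrow> 'a) set) = card A"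
      by (rule card_image[OF inj_on_subset[OF inj_ev subset_UNIV]])
    ultimately show False using A(3) num by simp
  qed
  obtain v w where vw: "line_basis ?V l v w" and
    kill: "\<And>u. dot ?V u v = 0 \<Longrightarrow> dot ?V u w = 0 \<Longrightarrow> act (lf ?V u) mu = 0"
    using functional_on_line[OF V muF mu0 fin van small] unfolding line_basis_def by metis
  let ?O = "on_line ?V l v w" and ?Lam = "vec.span {v, w}"
  have sO: "vec.subspace ?O" using submod_on_line by (auto simp: submod_def)
  have muO: "mu \<in> ?O" using muF kill by (simp add: on_line_def)
  define A2 where "A2 = A - ?Lam"
  have A2: "finite A2" "\<And>a. a \<in> A2 \<Longrightarrow> a \<in> vecs ?V \<and> dot ?V l a = 1 \<and> a \<notin> ?Lam"
    using A by (auto simp: A2_def)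
  \<comment> \<open>The part of \<open>lamZ\<close> on the line.\<close>
  define lam1 where "lam1 = mu + (\<Sum>a\<in>A \<inter> ?Lam. vec_scale (c a) (ev a))"
  have lam1O: "lam1 \<in> ?O" unfolding lam1_def
    by (intro vec.subspace_add[OF sO muO] vec.subspace_sum[OF sO] vec.subspace_scale[OF sO])
       (use ev_on_line_iff[OF V vw] A(2) in blast)
  have lamZ_eq: "lamZ = lam1 + (\<Sum>a\<in>A2. vec_scale (c a) (ev a))"
  proof -
    have "lamS = (\<Sum>a\<in>A2. vec_scale (c a) (ev a)) + (\<Sum>a\<in>A \<inter> ?Lam. vec_scale (c a) (ev a))"
      unfolding lamS_def A2_def
      using sum.Int_Diff[OF A(1), of "\<lambda>a. vec_scale (c a) (ev a)" ?Lam] by (simp only: add.commute)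
    then show ?thesis by (simp add: lam1_def mu_def algebra_simps)
  qed
  \<comment> \<open>A polynomial that isolates \<open>a\<close> sends \<open>lamZ\<close> to a
    nonzero multiple of \<open>ev a\<close>.\<close>
  have evN: "ev a \<in> N" if a: "a \<in> A2" for a
  proof -
    obtain f where f: "act f (ev a) = ev a" "\<forall>b\<in>A2 - {a}. act f (ev b) = 0" "\<forall>lam\<in>?O. act f lam = 0"
      using isolating_poly[OF V vw A2(1)] A2(2)[OF a] by blast
    have "act f lamZ = act f lam1 + (\<Sum>b\<in>A2. vec_scale (c b) (act f (ev b)))"
      by (simp only: lamZ_eq act_plus_right act_sum_right act_vec_scale)
    also have "(\<Sum>b\<in>A2. vec_scale (c b) (act f (ev b))) =
        vec_scale (c a) (act f (ev a)) + (\<Sum>b\<in>A2 - {a}. vec_scale (c b) (act f (ev b)))"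
      by (rule sum.remove[OF A2(1) a])
    also have "(\<Sum>b\<in>A2 - {a}. vec_scale (c b) (act f (ev b))) = 0" by (rule sum.neutral) (use f in simp)
    finally have "act f lamZ = act f lam1 + (vec_scale (c a) (act f (ev a)) + 0)" .
    moreover have "act f lam1 = 0" using f(3) lam1O by blast
    ultimately have "act f lamZ = vec_scale (c a) (ev a)" by (simp only: f(1) add_0_right add_0_left)
    then have "vec_scale (c a) (ev a) \<in> N" using N(1) lamZ(1) by (metis submod_def)
    then have "vec_scale (1 / c a) (vec_scale (c a) (ev a)) \<in> N" by (rule vec.subspace_scale[OF sN])
    then show ?thesis using c[of a] a by (simp add: A2_def)
  qed
  have "(\<Sum>a\<in>A2. vec_scale (c a) (ev a)) \<in> N"
    by (intro vec.subspace_sum[OF sN] vec.subspace_scale[OF sN] evN)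
  then have lam1N: "lam1 \<in> N" using vec.subspace_diff[OF sN lamZ(1)] lamZ_eq by (metis add_diff_cancel_right')
  define N1 where "N1 = N \<inter> ?O"
  have N1: "vec.subspace N1" "submod N1" "N1 \<subseteq> N" "vec.findim N1"
    using N submod_on_line[of ?V l v w] vec.findim_subset[of N1 N]
    by (auto simp: N1_def submod_def vec.subspace_inter)
  have orb1: "orbit lam1 \<subseteq> N1" using orbit_subset[OF N1(2)] lam1N lam1O by (simp add: N1_def)
  define E2 where "E2 = vec.span (ev ` A2)"
  have E2: "vec.subspace E2" "E2 \<subseteq> N" "vec.dim E2 = card A2"
    using vec.span_minimal[of "ev ` A2" N] evN sN dim_span_ev[OF A2(1)] by (auto simp: E2_def)
  have "N1 \<inter> E2 \<subseteq> {0}" using on_line_Int_span_ev[OF V vw A2] by (auto simp: N1_def E2_def)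
  then have NE: "N1 \<inter> E2 = {0}" using vec.subspace_0 N1(1) E2(1) by blast
  have le1: "vec.dim N1 + card A2 \<le> vec.dim N"
    using vec.dim_Int_ge(2)[OF N1(1) E2(1) N1(3) E2(2) N(2) NE] E2(3) by simp
  have "pt x \<in> secant_variety m d (vec.dim (orbit lam1) + card A2)"
  proof (rule secant_varietyI[OF vw lam1O _ A2(1)])
    show "vec.findim (orbit lam1)" using vec.findim_subset[OF orb1 N1(4)] .
    have "a \<noteq> 0" if "a \<in> A2" for a using A2(2)[OF that] by auto
    then show "A2 \<subseteq> vecs ?V - {0}" using A2 by auto
    show "x = degree_part m d (lam1 + (\<Sum>a\<in>A2. vec_scale (c a) (ev a)))" using lamZ(2) lamZ_eq by simp
  qed (use x in auto)
  then have "sbr m d (pt x) \<le> vec.dim (orbit lam1) + card A2" unfolding sbr_def by (rule Least_le)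
  also have "vec.dim (orbit lam1) \<le> vec.dim N1" by (rule vec.findim_dim_mono[OF orb1 N1(4)])
  finally have sb: "sbr m d (pt x) \<le> vec.dim N1 + card A2" by simp
  then have dimN: "vec.dim N = vec.dim N1 + card A2" "vec.dim N = sbr m d (pt x)" using le1 num by simp_all
  have "vec.span (N1 \<union> ev ` A2) = N"
  proof (rule vec.findim_eqI[OF vec.subspace_span _ N(2)])
    show sub: "vec.span (N1 \<union> ev ` A2) \<subseteq> N" using N1(3) evN sN by (intro vec.span_minimal) auto
    have "N1 \<subseteq> vec.span (N1 \<union> ev ` A2)" "E2 \<subseteq> vec.span (N1 \<union> ev ` A2)"
      using vec.span_superset[of "N1 \<union> ev ` A2"] by (auto simp: E2_def intro: vec.span_mono[THEN subsetD])
    from vec.dim_Int_ge(2)[OF N1(1) E2(1) this vec.findim_subset[OF sub N(2)] NE]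
    show "vec.dim N \<le> vec.dim (vec.span (N1 \<union> ev ` A2))" using dimN(1) E2(3) by simp
  qed
  moreover have "d + 2 \<le> vec.dim (?M \<inter> ?O)"
  proof -
    have "d + 2 \<le> vec.dim (orbit mu)" by (rule dim_orbit_ge[OF V muF mu0 fin van])
    also have "\<dots> \<le> vec.dim (?M \<inter> ?O)"
      using orbM orbit_subset[OF submod_on_line muO] vec.findim_subset[OF _ M(1)]
      by (intro vec.findim_dim_mono) auto
    finally show ?thesis .
  qed
  ultimately have "decomposes_along m d l A N v w"
    using vw dimN(1) by (simp add: decomposes_along_def N1_def A2_def)
  then show ?thesis using dimN(2) by blast
qed

section \<open>Uniqueness of the decomposition\<close>

text \<open>The points of \<open>A\<close> off the line can be recognized from \<open>N\<close> and
  the line alone.\<close>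

lemma points_off_line:
  fixes l :: "nat \<Rightarrow> 'a::field_char_0"
  assumes dec: "decomposes_along m d l A N v w"
    and A: "finite A" "\<And>a. a \<in> A \<Longrightarrow> a \<in> vecs {..m} \<and> dot {..m} l a = 1"
  shows "A - vec.span {v, w} = {p \<in> vecs {..m}. dot {..m} l p = 1 \<and> p \<notin> vec.span {v, w} \<and> ev p \<in> N}"
proof -
  let ?V = "{..m}" and ?Lam = "vec.span {v, w}"
  let ?O = "on_line ?V l v w"
  define A2 where "A2 = A - ?Lam"
  have V: "finite ?V" and vw: "line_basis ?V l v w" and N: "N = vec.span ((N \<inter> ?O) \<union> ev ` A2)"
    using dec by (auto simp: decomposes_along_def A2_def)
  have fA2: "finite A2" using A(1) by (simp add: A2_def)
  show ?thesis
    unfolding A2_def[symmetric]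
  proof (intro equalityI subsetI CollectI)
    fix a assume a: "a \<in> A2"
    then have "ev a \<in> N" by (subst N) (intro vec.span_base, blast)
    then show "a \<in> vecs ?V \<and> dot ?V l a = 1 \<and> a \<notin> ?Lam \<and> ev a \<in> N" using a A(2) by (auto simp: A2_def)
  next
    fix p assume p: "p \<in> {p \<in> vecs ?V. dot ?V l p = 1 \<and> p \<notin> ?Lam \<and> ev p \<in> N}"
    show "p \<in> A2"
    proof (rule ccontr)
      assume pA: "p \<notin> A2"
      obtain f where f: "act f (ev p) = ev p" "\<forall>b\<in>A2 - {p}. act f (ev b) = 0" "\<forall>lam\<in>?O. act f lam = 0"
        using isolating_poly[OF V vw fA2, of p] p by blast
      have "(N \<inter> ?O) \<union> ev ` A2 \<subseteq> {lam. act f lam = 0}" using f pA by auto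
      then have "N \<subseteq> {lam. act f lam = 0}"
        by (subst N) (rule vec.span_minimal[OF _ vecvec.linear_subspace_kernel[OF linear_act]])
      then have "act f (ev p) = 0" using p by blast
      then show False using f(1) ev_nonzero by metis
    qed
  qed
qed

text \<open>The functionals of \<open>S \<union> Z\<close> on the line come from the part of
  \<open>N\<close> on the line and the points of \<open>A\<close> on the line, so these two have total
  dimension at least \<open>d + 2\<close>.\<close>

lemma line_part_large:
  fixes l :: "nat \<Rightarrow> 'a::field_char_0"
  assumes dec: "decomposes_along m d l A N v w"
    and A: "finite A" "\<And>a. a \<in> A \<Longrightarrow> a \<in> vecs {..m} \<and> dot {..m} l a = 1" and fN: "vec.findim N"
  shows "d + 2 + card (A - vec.span {v, w}) \<le> vec.dim N + card (A \<inter> vec.span {v, w})"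
proof -
  let ?V = "{..m}" and ?Lam = "vec.span {v, w}"
  let ?O = "on_line ?V l v w"
  define A1 A2 where "A1 = A \<inter> ?Lam" and "A2 = A - ?Lam"
  have V: "finite ?V" and vw: "line_basis ?V l v w" and N: "N = vec.span ((N \<inter> ?O) \<union> ev ` A2)"
    and dN: "vec.dim N = vec.dim (N \<inter> ?O) + card A2" and big: "d + 2 \<le> vec.dim (vec.span (N \<union> ev ` A) \<inter> ?O)"
    using dec by (auto simp: decomposes_along_def A2_def)
  have fin: "finite A1" "finite A2" using A(1) by (auto simp: A1_def A2_def)
  have sO: "vec.subspace ?O" using submod_on_line[of ?V l v w] by (auto simp: submod_def)
  define T where "T = vec.span ((N \<inter> ?O) \<union> ev ` A1)"
  have "ev ` A1 \<subseteq> ?O" using ev_on_line_iff[OF V vw] A(2) by (auto simp: A1_def)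
  then have TO: "T \<subseteq> ?O" unfolding T_def using sO by (intro vec.span_minimal) auto
  have fN1: "vec.findim (N \<inter> ?O)" using vec.findim_subset[OF _ fN] by blast
  have fA1: "vec.findim (ev ` A1)"
    using fin(1) vec.span_superset[of "ev ` A1"] unfolding vec.findim_def by (intro exI[of _ "ev ` A1"]) simp
  have fT: "vec.findim T" unfolding T_def by (rule vec.findim_Un_span[OF fN1 fA1])
  have zero: "?O \<inter> vec.span (ev ` A2) = {0}"
    by (rule on_line_Int_span_ev[OF V vw fin(2)]) (use A(2) in \<open>auto simp: A2_def\<close>)
  have "vec.span (N \<union> ev ` A) \<inter> ?O \<subseteq> T"
  proof
    fix lam assume lam: "lam \<in> vec.span (N \<union> ev ` A) \<inter> ?O"
    have "N \<union> ev ` A \<subseteq> vec.span (((N \<inter> ?O) \<union> ev ` A1) \<union> ev ` A2)"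
    proof (intro Un_least)
      have "vec.span ((N \<inter> ?O) \<union> ev ` A2) \<subseteq> vec.span (((N \<inter> ?O) \<union> ev ` A1) \<union> ev ` A2)"
        by (rule vec.span_mono) auto
      then show "N \<subseteq> vec.span (((N \<inter> ?O) \<union> ev ` A1) \<union> ev ` A2)" using N by simp
      have "ev ` A \<subseteq> ((N \<inter> ?O) \<union> ev ` A1) \<union> ev ` A2" by (auto simp: A1_def A2_def)
      then show "ev ` A \<subseteq> vec.span (((N \<inter> ?O) \<union> ev ` A1) \<union> ev ` A2)" using vec.span_superset by blast
    qed
    then have "lam \<in> vec.span (((N \<inter> ?O) \<union> ev ` A1) \<union> ev ` A2)"
      using lam vec.span_minimal[OF _ vec.subspace_span] by blast
    then obtain s t where st: "lam = s + t" "s \<in> T" "t \<in> vec.span (ev ` A2)"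
      unfolding vec.span_Un T_def by blast
    have "t = lam - s" using st(1) by simp
    then have "t \<in> ?O" using vec.subspace_diff[OF sO, of lam s] lam st(2) TO by blast
    then have "t = 0" using zero st(3) by blast
    then show "lam \<in> T" using st by simp
  qed
  then have "d + 2 \<le> vec.dim T" using big vec.findim_dim_mono[OF _ fT] le_trans by blast
  also have "vec.dim T \<le> vec.dim (N \<inter> ?O) + vec.dim (ev ` A1)" unfolding T_def by (rule vec.dim_span_Un_le[OF fN1 fA1])
  also have "vec.dim (ev ` A1) = card A1" using dim_span_ev[OF fin(1)] by simp
  finally show ?thesis using dN by (simp add: A1_def A2_def)
qed

lemma span_pair_vecs: "line_basis V l v w \<Longrightarrow> vec.span {v, w} \<subseteq> vecs V"
  using subspace_vecs[of V] by (intro vec.span_minimal) (auto simp: line_basis_def)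

lemma dim_span_pair:
  assumes "line_basis V l v w" shows "vec.dim (vec.span {v, w}) = 2"
proof -
  have v: "v \<notin> vec.span {w}"
  proof
    assume "v \<in> vec.span {w}"
    then obtain c where "v = vec_scale c w" by (auto simp: vec.span_singleton)
    then have "dot V l v = c * dot V l w" by (simp add: dot_scale)
    moreover have "dot V l w = 0" "dot V l v = 1" using assms unfolding line_basis_def by blast+
    ultimately show False by simp
  qed
  have "w \<noteq> 0" using assms by (simp add: line_basis_def)
  then have "vec.independent {v, w}" "v \<noteq> w"
    using v vec.independent_insertI[of v "{w}"] vec.span_base[of w "{w}"] by auto
  then show ?thesis using vec.dim_span_eq_card_independent by fastforce
qed

lemma line_separation:
  fixes V :: "'v set" and l :: "'v \<Rightarrow> 'b::field"
  assumes V: "finite V" "line_basis V l v w" and L: "vec.subspace L" "L \<subseteq> vecs V" "vec.dim L = 2" "L \<noteq> vec.span {v, w}"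
  shows "\<exists>u. (\<forall>x\<in>L. dot V u x = 0) \<and> (dot V u v \<noteq> 0 \<or> dot V u w \<noteq> 0)"
proof -
  have "finite ((\<lambda>i j. if j = i then 1 else 0) ` V)" using V(1) by simp
  moreover have "x \<in> vec.span ((\<lambda>i j. if j = i then 1 else 0) ` V)" if "x \<in> vecs V" for x :: "'v \<Rightarrow> 'b"
    by (subst vecs_sum[OF V(1) that]) (intro vec.span_sum vec.span_scale vec.span_base imageI)
  ultimately have "vec.findim (vecs V :: ('v \<Rightarrow> 'b) set)" unfolding vec.findim_def by blast
  then have fL: "vec.findim L" using vec.findim_subset[OF L(2)] by blast
  have "\<not> vec.span {v, w} \<subseteq> L"
    using vec.findim_eqI[OF vec.subspace_span _ fL, of "{v, w}"] dim_span_pair[OF V(2)] L(3,4) by auto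
  then obtain x where x: "x \<in> vec.span {v, w}" "x \<notin> L" by blast
  obtain u where u: "dot V u x \<noteq> 0" "\<forall>z\<in>L. dot V u z = 0"
    using separating_form[OF V(1) L(1,2) _ x(2)] x(1) span_pair_vecs[OF V(2)] by blast
  have "dot V u v \<noteq> 0 \<or> dot V u w \<noteq> 0"
  proof (rule ccontr)
    assume "\<not> ?thesis"
    moreover have "vec.subspace {z. dot V u z = 0}" by (rule vec.subspaceI) (simp_all add: dot_scale dot_add)
    ultimately have "vec.span {v, w} \<subseteq> {z. dot V u z = 0}" by (intro vec.span_minimal) auto
    then show False using x(1) u(1) by blast
  qed
  then show ?thesis using u(2) by blast
qed

text \<open>Two lines have only the multiples of one evaluation in common. If both carried
  functionals of dimension \<open>d + 2\<close>, they would need room for \<open>2 d + 3\<close>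
  dimensions in \<open>M\<close>.\<close>

lemma line_unique:
  fixes l :: "nat \<Rightarrow> 'a::field_char_0"
  assumes vw: "line_basis {..m} l v w" and M: "vec.subspace M" "vec.findim M" "vec.dim M \<le> 2 * d + 1"
    and big: "d + 2 \<le> vec.dim (M \<inter> on_line {..m} l v w)"
    and L: "vec.subspace L" "L \<subseteq> vecs {..m}" "vec.dim L = 2"
    and K: "vec.subspace K" "\<And>u lam. lam \<in> K \<Longrightarrow> (\<forall>x\<in>L. dot {..m} u x = 0) \<Longrightarrow> act (lf {..m} u) lam = 0"
      "d + 2 \<le> vec.dim (M \<inter> K)"
  shows "L = vec.span {v, w}"
proof (rule ccontr)
  let ?O = "on_line {..m} l v w"
  assume "L \<noteq> vec.span {v, w}"
  then obtain u where u: "\<forall>x\<in>L. dot {..m} u x = 0" "dot {..m} u v \<noteq> 0 \<or> dot {..m} u w \<noteq> 0"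
    using line_separation[OF _ vw L] by auto
  obtain q where q: "\<forall>lam\<in>?O. act (lf {..m} u) lam = 0 \<longrightarrow> lam \<in> vec.span {ev q}"
    using two_lines[OF _ vw u(2)] by auto
  have sO: "vec.subspace ?O" using submod_on_line[of "{..m}" l v w] by (auto simp: submod_def)
  have sub: "(M \<inter> ?O) \<inter> (M \<inter> K) \<subseteq> vec.span {ev q}" using q K(2) u(1) by blast
  have "vec.dim ((M \<inter> ?O) \<inter> (M \<inter> K)) \<le> card {ev q}" by (rule vec.dim_le_card[OF sub]) simp
  moreover have "vec.dim (M \<inter> ?O) + vec.dim (M \<inter> K) \<le> vec.dim M + vec.dim ((M \<inter> ?O) \<inter> (M \<inter> K))"
    using M(1) sO K(1) by (intro vec.dim_Int_ge(1) M(2) vec.subspace_inter) auto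
  ultimately show False using big K(3) M(3) by simp
qed

lemma on_line_killed:
  assumes "lam \<in> on_line V l v w" "\<forall>x\<in>vec.span {v, w}. dot V u x = 0"
  shows "act (lf V u) lam = 0"
  using assms vec.span_base[of _ "{v, w}"] by (auto simp: on_line_def)

text \<open>Otherwise a linear equation of the first line annihilates the functionals of
  \<open>N\<close> on that line; decomposed along the second line, such a functional consists of
  evaluations at points of \<open>A'\<close> and a part on the second line that is a multiple of one
  evaluation. Hence \<open>N\<close> is spanned by evaluations. But then the scheme of
  \<open>N\<close> is reduced and spans the point of \<open>x\<close>, so its degree is at least the
  symmetric rank.\<close>

lemma same_line:
  fixes l :: "nat \<Rightarrow> 'a::field_char_0"
  assumes sp: "spanning_pair m d l x A N" and sp': "spanning_pair m d l x A' N"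
    and dec: "decomposes_along m d l A N v w" and dec': "decomposes_along m d l A' N v' w'"
  shows "vec.span {v, w} = vec.span {v', w'}"
proof (rule ccontr)
  let ?V = "{..m}"
  let ?O = "on_line ?V l v w" and ?O' = "on_line ?V l v' w'"
  assume ne: "vec.span {v, w} \<noteq> vec.span {v', w'}"
  have V: "finite ?V" by simp
  have vw: "line_basis ?V l v w" and vw': "line_basis ?V l v' w'"
    using dec dec' by (auto simp: decomposes_along_def)
  define A2 A2' where "A2 = A - vec.span {v, w}" and "A2' = A' - vec.span {v', w'}"
  have N: "N = vec.span ((N \<inter> ?O) \<union> ev ` A2)" "N = vec.span ((N \<inter> ?O') \<union> ev ` A2')"
    using dec dec' by (auto simp: decomposes_along_def A2_def A2'_def)
  have Nsub: "submod N" "vec.subspace N" "vec.findim N" "N \<subseteq> FL ?V l" using sp by (auto simp: spanning_pair_def submod_def)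
  have A2': "finite A2'" "\<And>a. a \<in> A2' \<Longrightarrow> a \<in> vecs ?V \<and> dot ?V l a = 1 \<and> a \<notin> vec.span {v', w'}"
    using sp' by (auto simp: spanning_pair_def A2'_def)
  have sO': "vec.subspace ?O'" using submod_on_line[of ?V l v' w'] by (auto simp: submod_def)
  obtain u where u: "\<forall>x\<in>vec.span {v, w}. dot ?V u x = 0" "dot ?V u v' \<noteq> 0 \<or> dot ?V u w' \<noteq> 0"
    using line_separation[OF V vw' vec.subspace_span span_pair_vecs[OF vw] dim_span_pair[OF vw] ne] by blast
  obtain q where q: "\<forall>lam\<in>?O'. act (lf ?V u) lam = 0 \<longrightarrow> lam \<in> vec.span {ev q}"
    using two_lines[OF V vw' u(2)] by auto
  \<comment> \<open>The points of the scheme of \<open>N\<close>.\<close>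
  define Y where "Y = {y. ev y \<in> N}"
  have evA2': "ev ` A2' \<subseteq> N"
  proof -
    have "ev ` A2' \<subseteq> vec.span ((N \<inter> ?O') \<union> ev ` A2')"
      using vec.span_superset[of "(N \<inter> ?O') \<union> ev ` A2'"] by blast
    also have "\<dots> = N" by (rule N(2)[symmetric])
    finally show ?thesis .
  qed
  have part: "N \<inter> ?O \<subseteq> vec.span (ev ` Y)"
  proof
    fix lam assume lam: "lam \<in> N \<inter> ?O"
    then have "lam \<in> vec.span ((N \<inter> ?O') \<union> ev ` A2')" using N(2) by blast
    then obtain s t where st: "lam = s + t" "s \<in> vec.span (N \<inter> ?O')" "t \<in> vec.span (ev ` A2')"
      unfolding vec.span_Un by blast
    have "vec.subspace (N \<inter> ?O')" by (rule vec.subspace_inter[OF Nsub(2) sO'])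
    then have "vec.span (N \<inter> ?O') \<subseteq> N \<inter> ?O'" by (rule vec.span_minimal[OF subset_refl])
    then have s: "s \<in> N" "s \<in> ?O'" using st(2) by blast+
    obtain b where b: "t = (\<Sum>a\<in>A2'. vec_scale (b a) (ev a))" using span_ev_sum[OF A2'(1) st(3)] by blast
    let ?u = "lf ?V u"
    have 0: "act ?u s + act ?u t = 0"
      using on_line_killed[of lam ?V l v w u] lam u(1) by (simp add: st(1) act_plus_right)
    have "act ?u (vec_scale (b a) (ev a)) = 0" if a: "a \<in> A2'" for a
    proof -
      obtain f where f: "act f (ev a) = ev a" "\<forall>b\<in>A2' - {a}. act f (ev b) = 0" "\<forall>lam\<in>?O'. act f lam = 0"
        using isolating_poly[OF V vw' A2'(1)] A2'(2)[OF a] by blast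
      have "act f t = (\<Sum>a'\<in>A2'. vec_scale (b a') (act f (ev a')))" by (simp only: b act_sum_right act_vec_scale)
      also have "\<dots> = vec_scale (b a) (act f (ev a)) + (\<Sum>a'\<in>A2' - {a}. vec_scale (b a') (act f (ev a')))"
        by (rule sum.remove[OF A2'(1) a])
      also have "(\<Sum>a'\<in>A2' - {a}. vec_scale (b a') (act f (ev a'))) = 0" by (rule sum.neutral) (use f in simp)
      finally have ft: "act f t = vec_scale (b a) (ev a)" by (simp only: f(1) add_0_right)
      have "0 = act f (act ?u s + act ?u t)" by (simp only: 0 act_0_right)
      also have "\<dots> = act ?u (act f s) + act ?u (act f t)"
        by (simp only: act_plus_right act_commute[of f])
      also have "act f s = 0" using f(3) s(2) by blast
      finally have "0 = act ?u (act f t)" by (simp only: act_0_right add_0_left)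
      then show ?thesis unfolding ft by (rule sym)
    qed
    then have "act ?u t = 0" unfolding b act_sum_right by (rule sum.neutral[OF ballI])
    then have "act ?u s = 0" using 0 by (metis add_0_right)
    then have "s \<in> vec.span {ev q}" using q s(2) by blast
    then obtain k where k: "s = vec_scale k (ev q)" by (auto simp: vec.span_singleton)
    have "s \<in> vec.span (ev ` Y)"
    proof (cases "k = 0")
      case True
      then have "s = 0" using k by simp
      then show ?thesis using vec.span_zero by metis
    next
      case False
      then have "ev q = vec_scale (1 / k) s" using k by simp
      then have "q \<in> Y" unfolding Y_def using vec.subspace_scale[OF Nsub(2) s(1)] by (metis mem_Collect_eq)
      then show ?thesis unfolding k by (intro vec.span_scale vec.span_base imageI)
    qed
    moreover have "t \<in> vec.span (ev ` Y)"
      using st(3) vec.span_mono[of "ev ` A2'" "ev ` Y"] evA2' by (auto simp: Y_def)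
    ultimately show "lam \<in> vec.span (ev ` Y)" unfolding st(1) by (rule vec.span_add)
  qed
  have "ev ` A2 \<subseteq> N"
  proof -
    have "ev ` A2 \<subseteq> vec.span ((N \<inter> ?O) \<union> ev ` A2)"
      using vec.span_superset[of "(N \<inter> ?O) \<union> ev ` A2"] by blast
    also have "\<dots> = N" by (rule N(1)[symmetric])
    finally show ?thesis .
  qed
  then have "ev ` A2 \<subseteq> vec.span (ev ` Y)" using vec.span_superset[of "ev ` Y"] by (auto simp: Y_def)
  then have "vec.span ((N \<inter> ?O) \<union> ev ` A2) \<subseteq> vec.span (ev ` Y)"
    using part by (intro vec.span_minimal[OF _ vec.subspace_span] Un_least)
  then have NY: "N \<subseteq> vec.span (ev ` Y)" unfolding N(1)[symmetric] .
  have YN: "ev ` Y \<subseteq> N" by (auto simp: Y_def)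
  have cY: "finite (ev ` Y)" "card (ev ` Y) \<le> vec.dim N" using vec.findim_independent[OF Nsub(3) ev_independent YN] by auto
  have injY: "inj_on ev Y" by (rule inj_on_subset[OF inj_ev subset_UNIV])
  have fY: "finite Y" using finite_imageD[OF cY(1) injY] .
  have YV: "Y \<subseteq> vecs ?V - {0}"
  proof
    fix y assume "y \<in> Y"
    then have F: "ev y \<in> FL ?V l" using Nsub(4) by (auto simp: Y_def)
    have "y i = 0" if "i \<notin> ?V" for i
    proof -
      have "single i 1 \<notin> expo ?V" using that by simp
      then have "ev y (single i 1) = 0" using F unfolding FL_def vecs_def by blast
      then show ?thesis by simp
    qed
    then have "y \<in> vecs ?V" by (simp add: vecs_def)
    moreover have "y \<noteq> 0"
    proof
      assume "y = 0"
      have "act (lf ?V l) (ev y) = ev y" using F by (simp add: FL_def)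
      then have "ev y = vec_scale (dot ?V l y) (ev y)" by (simp only: act_ev pr_lf_ev)
      then have "ev y = 0" using \<open>y = 0\<close> by simp
      then show False using ev_nonzero by blast
    qed
    ultimately show "y \<in> vecs ?V - {0}" by blast
  qed
  obtain lam where lam: "lam \<in> N" "x = degree_part m d lam" using sp by (auto simp: spanning_pair_def)
  obtain b where b: "lam = (\<Sum>y\<in>Y. vec_scale (b y) (ev y))" using span_ev_sum[OF fY] NY lam(1) by blast
  have "sr m d (pt x) \<le> card Y"
    by (rule sr_le[OF fY YV]) (use sp lam(2) b in \<open>auto simp: spanning_pair_def\<close>)
  also have "card Y \<le> vec.dim N" using cY(2) card_image[OF injY] by simp
  finally show False using sp by (simp add: spanning_pair_def)
qed

text \<open>The mixed pair \<open>A, N'\<close> decomposes along some line, which is the line of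
  \<open>A', N'\<close> because the second scheme is the same. It is also the line of \<open>A,
  N\<close>: at most one point of \<open>A\<close> lies on both lines, and the bounds of
  \<open>line_part_large\<close> for the two lines add up to \<open>2 d + 4 \<le> 2 sbr P + 2\<close>,
  contrary to \<open>2 sbr P < sbr P + sr P \<le> 2 d + 1\<close>.\<close>

theorem off_line_points_unique:
  fixes l :: "nat \<Rightarrow> 'a::{alg_closed_field, field_char_0}"
  assumes sp: "spanning_pair m d l x A N" and sp': "spanning_pair m d l x A' N'"
    and dec: "decomposes_along m d l A N v w" and dec': "decomposes_along m d l A' N' v' w'"
  shows "A - vec.span {v, w} = A' - vec.span {v', w'}"
proof -
  let ?V = "{..m}"
  have V: "finite ?V" by simp
  have mix: "spanning_pair m d l x A N'" using sp sp' by (auto simp: spanning_pair_def)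
  obtain v2 w2 where dec2: "decomposes_along m d l A N' v2 w2" using exists_decomposition[OF mix] by blast
  have eq2: "vec.span {v2, w2} = vec.span {v', w'}" by (rule same_line[OF mix sp' dec2 dec'])
  have A: "finite A" "\<And>a. a \<in> A \<Longrightarrow> a \<in> vecs ?V \<and> dot ?V l a = 1" using sp by (auto simp: spanning_pair_def)
  have A': "finite A'" "\<And>a. a \<in> A' \<Longrightarrow> a \<in> vecs ?V \<and> dot ?V l a = 1" using sp' by (auto simp: spanning_pair_def)
  have vw: "line_basis ?V l v w" "line_basis ?V l v2 w2" using dec dec2 by (auto simp: decomposes_along_def)
  have fin: "vec.findim N" "vec.findim N'" using sp sp' by (auto simp: spanning_pair_def)
  define L1 L2 where "L1 = vec.span {v, w}" and "L2 = vec.span {v2, w2}"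
  have "L1 = L2"
  proof (rule ccontr)
    assume ne: "L1 \<noteq> L2"
    obtain u where u: "\<forall>x\<in>L2. dot ?V u x = 0" "dot ?V u v \<noteq> 0 \<or> dot ?V u w \<noteq> 0"
      using line_separation[OF V vw(1) vec.subspace_span span_pair_vecs[OF vw(2)] dim_span_pair[OF vw(2)]] ne
      by (auto simp: L1_def L2_def)
    obtain q where q: "\<forall>lam\<in>on_line ?V l v w. act (lf ?V u) lam = 0 \<longrightarrow> lam \<in> vec.span {ev q}"
      using two_lines[OF V vw(1) u(2)] by auto
    have sub: "ev ` (A \<inter> L1 \<inter> L2) \<subseteq> vec.span {ev q}"
    proof clarify
      fix a assume a: "a \<in> A" "a \<in> L1" "a \<in> L2"
      have "ev a \<in> on_line ?V l v w" using ev_on_line_iff[OF V vw(1)] A(2)[OF a(1)] a(2) by (simp add: L1_def)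
      moreover have "act (lf ?V u) (ev a) = 0" using u(1) a(3) by (simp add: act_ev pr_lf_ev)
      ultimately show "ev a \<in> vec.span {ev q}" using q by blast
    qed
    have "card (ev ` (A \<inter> L1 \<inter> L2)) \<le> card {ev q}"
      using vec.independent_span_bound[OF _ ev_independent sub] by simp
    then have c1: "card (A \<inter> L1 \<inter> L2) \<le> 1"
      using card_image[OF inj_on_subset[OF inj_ev subset_UNIV], of "A \<inter> L1 \<inter> L2"] by simp
    have i1: "card (A \<inter> L2) \<le> card (A - L1) + 1"
    proof -
      have "A \<inter> L2 \<subseteq> (A - L1) \<union> (A \<inter> L1 \<inter> L2)" by blast
      then have "card (A \<inter> L2) \<le> card ((A - L1) \<union> (A \<inter> L1 \<inter> L2))" using A(1) by (intro card_mono) auto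
      also have "\<dots> \<le> card (A - L1) + card (A \<inter> L1 \<inter> L2)" by (rule card_Un_le)
      finally show ?thesis using c1 by simp
    qed
    have i2: "card (A \<inter> L1) \<le> card (A - L2) + 1"
    proof -
      have "A \<inter> L1 \<subseteq> (A - L2) \<union> (A \<inter> L1 \<inter> L2)" by blast
      then have "card (A \<inter> L1) \<le> card ((A - L2) \<union> (A \<inter> L1 \<inter> L2))" using A(1) by (intro card_mono) auto
      also have "\<dots> \<le> card (A - L2) + card (A \<inter> L1 \<inter> L2)" by (rule card_Un_le)
      finally show ?thesis using c1 by simp
    qed
    have "d + 2 + card (A - L1) \<le> vec.dim N + card (A \<inter> L1)"
      unfolding L1_def by (rule line_part_large[OF dec A fin(1)])
    moreover have "d + 2 + card (A - L2) \<le> vec.dim N' + card (A \<inter> L2)"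
      unfolding L2_def by (rule line_part_large[OF dec2 A fin(2)])
    moreover have "vec.dim N \<le> sbr m d (pt x)" "vec.dim N' \<le> sbr m d (pt x)"
      "sbr m d (pt x) < sr m d (pt x)" "sbr m d (pt x) + sr m d (pt x) \<le> 2 * d + 1"
      using sp sp' by (auto simp: spanning_pair_def)
    ultimately show False using i1 i2 by linarith
  qed
  then have "A - vec.span {v, w} = A - vec.span {v2, w2}" by (simp add: L1_def L2_def)
  also have "\<dots> = {p \<in> vecs ?V. dot ?V l p = 1 \<and> p \<notin> vec.span {v2, w2} \<and> ev p \<in> N'}"
    by (rule points_off_line[OF dec2 A])
  also have "\<dots> = A' - vec.span {v', w'}" unfolding eq2 by (rule points_off_line[OF dec' A', symmetric])
  finally show ?thesis .
qed

section \<open>From schemes to functionals\<close>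

text \<open>The Veronese coordinates determine the values of \<open>L^d\<close>, which fixes the
  scalar, and of \<open>L^(d - 1) x_i\<close>, which gives the coordinates.\<close>

lemma veronese_pt_inj:
  fixes a b :: "nat \<Rightarrow> 'a::field"
  assumes "1 \<le> d" and a: "a \<in> vecs {..m}" "dot {..m} l a = 1" and b: "b \<in> vecs {..m}" "dot {..m} l b = 1"
    and eq: "veronese_vec m d a \<in> pt (veronese_vec m d b)"
  shows "a = b"
proof -
  let ?L = "lf {..m} l"
  obtain c where c: "veronese_vec m d a = vec_scale c (veronese_vec m d b)" using eq by (auto simp: pt_def)
  have form: "pr f (ev a) = c * pr f (ev b)" if f: "f \<in> forms {..m} d" for f
  proof -
    have "pr f (ev x) = pr f (veronese_vec m d x)" for x :: "nat \<Rightarrow> 'a"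
      by (rule pr_cong) (use f in \<open>auto simp: forms_def veronese_vec_ev\<close>)
    then show ?thesis by (simp only: c pr_vec_scale)
  qed
  have "pr (?L ^ d) (ev a) = c * pr (?L ^ d) (ev b)"
    using form[of "?L ^ d"] power_forms[OF lf_forms[of "{..m}" l], of d] by simp
  then have c1: "c = 1" using a b by (simp add: pr_ev_power pr_lf_ev)
  have "a i = b i" if i: "i \<in> {..m}" for i
  proof -
    have "?L ^ (d - 1) * Var i \<in> forms {..m} ((d - 1) * 1 + 1)"
      by (rule mult_forms[OF power_forms[OF lf_forms] Var_forms[OF i]])
    then have "pr (?L ^ (d - 1) * Var i) (ev a) = c * pr (?L ^ (d - 1) * Var i) (ev b)"
      using form assms(1) by simp
    then show ?thesis using a b c1 by (simp add: pr_ev_mult pr_ev_power pr_lf_ev)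
  qed
  moreover have "a i = b i" if "i \<notin> {..m}" for i using that a(1) b(1) unfolding vecs_def by simp
  ultimately show ?thesis by blast
qed

text \<open>Finitely many points have to be avoided.\<close>

lemma exists_good_form:
  fixes Zs :: "(nat \<Rightarrow>\<^sub>0 nat, 'a::field_char_0) mpoly set set"
  assumes "1 \<le> d" "finite Zs" "\<And>Z. Z \<in> Zs \<Longrightarrow> \<exists>r. \<forall>\<^sub>F e in sequentially. hilbert_fun (Ver_coords m d) Z e = r"
  shows "\<exists>l. \<forall>Z\<in>Zs. \<forall>x\<in>zeros {..m} d Z. dot {..m} l x \<noteq> 0"
proof -
  have "\<forall>Z\<in>Zs. \<exists>X. finite X \<and> X \<subseteq> zeros {..m} d Z \<and> (\<forall>x\<in>zeros {..m} d Z. \<exists>z\<in>X. \<exists>c. x = vec_scale c z)"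
  proof
    fix Z assume "Z \<in> Zs"
    then obtain r where "\<forall>\<^sub>F e in sequentially. hilbert_fun (Ver_coords m d) Z e = r" using assms(3) by blast
    from finite_zeros[OF _ assms(1) this]
    show "\<exists>X. finite X \<and> X \<subseteq> zeros {..m} d Z \<and> (\<forall>x\<in>zeros {..m} d Z. \<exists>z\<in>X. \<exists>c. x = vec_scale c z)" by simp
  qed
  from bchoice[OF this] obtain X where "\<forall>Z\<in>Zs. finite (X Z) \<and> X Z \<subseteq> zeros {..m} d Z \<and>
    (\<forall>x\<in>zeros {..m} d Z. \<exists>z\<in>X Z. \<exists>c. x = vec_scale c z)" ..
  then have X: "\<And>Z. Z \<in> Zs \<Longrightarrow> finite (X Z)" "\<And>Z. Z \<in> Zs \<Longrightarrow> X Z \<subseteq> zeros {..m} d Z"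
    "\<And>Z x. Z \<in> Zs \<Longrightarrow> x \<in> zeros {..m} d Z \<Longrightarrow> \<exists>z\<in>X Z. \<exists>c. x = vec_scale c z" by simp_all
  have "finite (\<Union>Z\<in>Zs. X Z)" "(\<Union>Z\<in>Zs. X Z) \<subseteq> vecs {..m} - {0}"
    using assms(2) X(1,2) by (auto simp: zeros_def)
  from exists_avoiding_form[OF this(1) _ this(2)]
  obtain l where l: "\<forall>x\<in>\<Union>Z\<in>Zs. X Z. dot {..m} l x \<noteq> 0" by auto
  have "dot {..m} l x \<noteq> 0" if Zx: "Z \<in> Zs" "x \<in> zeros {..m} d Z" for Z x
  proof -
    obtain z c where z: "z \<in> X Z" "x = vec_scale c z" using X(3)[OF Zx] by blast
    have "x \<noteq> 0" using Zx(2) by (simp add: zeros_def)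
    then have "c \<noteq> 0" using z(2) by auto
    then show ?thesis using l z Zx(1) by (simp add: dot_scale)
  qed
  then show ?thesis by blast
qed

text \<open>A linear form of the ideal vanishes on the span, so the functional on linear forms given
  by the coordinates of \<open>x\<close> kills the ideal in degree \<open>1\<close> and extends to the
  scheme.\<close>

lemma span_functional:
  fixes x :: "(nat \<Rightarrow>\<^sub>0 nat) \<Rightarrow> 'a::{alg_closed_field, field_char_0}"
  assumes d: "1 \<le> m" "1 \<le> d" and Z: "ver_scheme {..m} d Z r"
    and l: "\<And>x. x \<in> zeros {..m} d Z \<Longrightarrow> dot {..m} l x \<noteq> 0"
    and x: "x \<in> vecs (Ver_coords m d)" "pt x \<in> linear_span (Ver_coords m d) Z"
  shows "\<exists>lam\<in>perp {..m} d l Z. x = degree_part m d lam"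
proof -
  let ?W = "Ver_coords m d"
  have "{single 0 d, single 1 d} \<subseteq> ?W" using d by (auto simp: monomials_def)
  then have "card {single (0::nat) d, single 1 d} \<le> card ?W" using card_mono finite_Ver_coords by blast
  moreover have "single (0::nat) d \<noteq> single (1::nat) d"
  proof
    assume "single (0::nat) d = single (1::nat) d"
    then have "lookup (single (0::nat) d) 0 = lookup (single (1::nat) d) 0" by (rule arg_cong[where f = "\<lambda>A. lookup A 0"])
    then show False using d by (simp add: lookup_single)
  qed
  ultimately have W: "finite ?W" "2 \<le> card ?W" using finite_Ver_coords by auto
  have Zid: "ideal Z (poly_ring ?W)" using Z by (simp add: ver_scheme_def closed_subscheme_def)
  have prx: "pr (phi F) x = pr F (ev x)" if F: "F \<in> forms ?W 1" for F
    unfolding pr_phi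
  proof (rule pr_cong)
    fix A assume "A \<in> keys F"
    then have "keys A \<subseteq> ?W" "deg_in ?W A = Suc 0" using F by (auto simp: forms_def monomials_def[of ?W])
    then obtain \<alpha> B where "A = single \<alpha> 1 + B" "B \<in> monomials ?W 0" by (rule monomial_split)
    then show "x (wt A) = ev x A" by simp
  qed
  have "pr (phi F) x = 0" if F: "F \<in> Z" "F \<in> forms ?W 1" for F
    unfolding prx[OF F(2)] by (rule linear_span_killed[OF W Zid x(2) pt_self F])
  from scheme_duality(4)[OF _ d(2) Z l this]
  obtain lam where lam: "lam \<in> perp {..m} d l Z" "\<forall>F\<in>forms ?W 1. pr (phi F) lam = pr (phi F) x" by auto
  have "x \<alpha> = lam \<alpha>" if "\<alpha> \<in> ?W" for \<alpha>
    using lam(2)[THEN bspec, OF Var_forms[OF that]] by (simp add: phi_def Var_def)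
  then have "x = degree_part m d lam" using x(1) by (auto simp: degree_part_def vecs_def fun_eq_iff)
  then show ?thesis using lam(1) by blast
qed

text \<open>Over a reduced scheme a form that vanishes at all points acts nilpotently, since otherwise its
  stable image would contain an eigenvector, i.e. a further point; hence the functionals are spanned
  by evaluations.\<close>

lemma reduced_span_ev:
  fixes l :: "'v \<Rightarrow> 'a::{alg_closed_field, field_char_0}"
  assumes V: "finite V" "1 \<le> d" and Z: "ver_scheme V d Z r"
    and l: "\<And>x. x \<in> zeros V d Z \<Longrightarrow> dot V l x \<noteq> 0"
    and red: "reduced (monomials V d) Z"
  shows "\<exists>A. finite A \<and> (\<forall>a\<in>A. a \<in> vecs V \<and> dot V l a = 1) \<and> perp V d l Z = vec.span (ev ` A)"
proof -
  let ?N = "perp V d l Z"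
  note dual = scheme_duality[OF V Z l]
  have N: "submod ?N" "vec.subspace ?N" "?N \<subseteq> FL V l" using submod_perp by (auto simp: submod_def perp_def)
  define A where "A = {a \<in> vecs V. dot V l a = 1 \<and> ev a \<in> ?N}"
  have evA: "ev ` A \<subseteq> ?N" by (auto simp: A_def)
  have "finite (ev ` A)" using vec.findim_independent[OF dual(1) ev_independent evA] by blast
  then have fA: "finite A" using finite_imageD[OF _ inj_on_subset[OF inj_ev subset_UNIV]] by blast
  have G: "vec.span (ev ` A) \<subseteq> ?N" using evA N(2) by (intro vec.span_minimal)
  have "lam \<in> vec.span (ev ` A)" if lam: "lam \<in> ?N" for lam
  proof (rule ccontr)
    assume no: "lam \<notin> vec.span (ev ` A)"
    have "lam \<in> FL V l" "vec.findim (vec.span (ev ` A))" "vec.span (ev ` A) \<subseteq> FL V l"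
      using lam N(3) G vec.findim_subset[OF G dual(1)] by auto
    then obtain e F where F: "F \<in> forms (monomials V d) e" "F \<in> apolar V d (vec.span (ev ` A))" "pr (phi F) lam = 1"
      using apolar_separates[OF V(2) vec.subspace_span _ _ _ no] by metis
    define M where "M k = act (phi F ^ k) ` ?N" for k
    have MN: "M k \<subseteq> ?N" for k using N(1) by (auto simp: M_def submod_def)
    have M: "submod (M k)" "M k \<subseteq> ?N" "vec.findim (M k)" for k
      using submod_image[OF N(1)] MN vec.findim_subset[OF MN dual(1)] by (simp_all add: M_def)
    have MS: "M (Suc k) = act (phi F) ` M k" for k
      by (simp add: M_def image_image act_mult)
    obtain k where k: "\<And>j. vec.dim (M k) \<le> vec.dim (M j)"
      using ex_has_least_nat[of "\<lambda>_. True" 0 "\<lambda>j. vec.dim (M j)"] by auto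
    have "M k = {0}"
    proof (rule ccontr)
      assume "M k \<noteq> {0}"
      moreover have "M k \<subseteq> vecs (expo V)" using M(2) N(3) by (auto simp: FL_def)
      ultimately obtain p where p: "p \<in> vecs V" "ev p \<in> M k" using eigenvector_exists[OF M(1,3)] by metis
      have pN: "ev p \<in> ?N" using p(2) M(2) by blast
      then have "act (lf V l) (ev p) 0 = ev p 0" using N(3) by (auto simp: FL_def)
      then have "dot V l p = 1" by (simp add: act_ev pr_lf_ev vec_scale_def)
      then have "p \<in> A" using p pN by (simp add: A_def)
      then have "pr (phi F) (ev p) = 0" using apolarD[OF F(2,1)] by (simp add: vec.span_base)
      then have "ev p \<in> {lam \<in> M k. act (phi F) lam = 0}" using p(2) by (simp add: act_ev)
      then have "1 \<le> vec.dim {lam \<in> M k. act (phi F) lam = 0}"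
        by (intro vec_dim_pos[OF _ _ ev_nonzero] vec.findim_subset[OF _ M(3)[of k]]) auto
      moreover have "vec.dim (M k) = vec.dim {lam \<in> M k. act (phi F) lam = 0} + vec.dim (M (Suc k))"
        unfolding MS using M(1,3) by (intro vecvec.rank_nullity[OF linear_act]) (auto simp: submod_def)
      ultimately show False using k[of "Suc k"] by simp
    qed
    then have kill: "act (phi F ^ k) z = 0" if "z \<in> ?N" for z using that unfolding M_def by blast
    have "F ^ k \<in> apolar V d ?N"
      by (rule apolar_forms[OF power_forms[OF F(1)], THEN iffD2])
         (use kill in \<open>auto simp: phi_power act_at_0[symmetric]\<close>)
    then have "F ^ k \<in> Z" using dual(2) by simp
    then have "F \<in> Z" using red F(1) forms_carrier unfolding reduced_def by blast
    then have "pr (phi F) lam = 0" using perp_pr[OF lam _ F(1)] by blast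
    then show False using F(3) by simp
  qed
  then have "?N = vec.span (ev ` A)" using G by blast
  then show ?thesis using fA by (intro exI[of _ A]) (auto simp: A_def)
qed

text \<open>A point \<open>y\<close> of \<open>\<PP>\<^sup>N\<close> other than the images of the
  points in \<open>A\<close> is excluded by a product of linear forms, one for each \<open>a\<close>,
  that vanish at the image of \<open>a\<close> but not at \<open>y\<close>: the
  \<open>2\<close>-minors of the coordinates of the two points.\<close>

lemma scheme_points_apolar:
  fixes l :: "nat \<Rightarrow> 'a::field_char_0"
  assumes d: "1 \<le> d" and A: "finite A" "\<And>a. a \<in> A \<Longrightarrow> a \<in> vecs {..m} \<and> dot {..m} l a = 1"
    and N: "vec.subspace N" "N \<subseteq> vec.span (ev ` A)"
  shows "scheme_points (Ver_coords m d) (apolar {..m} d N) =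
    (\<lambda>a. pt (veronese_vec m d a)) ` {a \<in> A. ev a \<in> N}"
proof -
  let ?W = "Ver_coords m d" and ?nu = "veronese_vec m d"
  have A0: "a \<in> vecs {..m} - {0}" if "a \<in> A" for a using A(2)[OF that] by auto
  have NF: "vec.findim N" "N \<subseteq> FL {..m} l"
  proof -
    have "vec.findim (vec.span (ev ` A))" using A(1) by (intro vec.findim_span) simp
    then show "vec.findim N" using vec.findim_subset[OF N(2)] by blast
    have "vec.span (ev ` A) \<subseteq> FL {..m} l" using A(2) ev_FL by (intro vec.span_minimal[OF _ subspace_FL]) blast
    then show "N \<subseteq> FL {..m} l" using N(2) by blast
  qed
  show ?thesis
  proof (intro equalityI subsetI)
    fix p assume p: "p \<in> scheme_points ?W (apolar {..m} d N)"
    then obtain y where y: "y \<in> vecs ?W" "y \<noteq> 0" "p = pt y" by (auto simp: scheme_points_def proj_space_pt)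
    have van: "pr F (ev y) = 0" if "F \<in> apolar {..m} d N" for F
      using p that pt_self[of y] unfolding scheme_points_def y(3) eval_at_pr by blast
    have "\<exists>a\<in>A. y \<in> pt (?nu a)"
    proof (rule ccontr)
      assume no: "\<not> ?thesis"
      have "\<exists>\<alpha> \<beta>. \<alpha> \<in> ?W \<and> \<beta> \<in> ?W \<and> ?nu a \<alpha> * y \<beta> \<noteq> ?nu a \<beta> * y \<alpha>" if a: "a \<in> A" for a
      proof (rule ccontr)
        assume eq: "\<not> ?thesis"
        obtain \<alpha> where \<alpha>: "?nu a \<alpha> \<noteq> 0" using veronese_vec_nonzero[OF A0[OF a], of d] by (auto simp: fun_eq_iff)
        then have "\<alpha> \<in> ?W" using veronese_vec_vecs[of m d a] by (auto simp: vecs_def)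
        then have "y \<beta> = y \<alpha> / ?nu a \<alpha> * ?nu a \<beta>" if "\<beta> \<in> ?W" for \<beta>
          using eq that \<alpha> by (auto simp: field_simps)
        moreover have "y \<beta> = y \<alpha> / ?nu a \<alpha> * ?nu a \<beta>" if "\<beta> \<notin> ?W" for \<beta>
          using that y(1) veronese_vec_vecs[of m d a] by (auto simp: vecs_def)
        ultimately have yy: "y = vec_scale (y \<alpha> / ?nu a \<alpha>) (?nu a)" by (auto simp: vec_scale_def fun_eq_iff)
        then have "y \<alpha> / ?nu a \<alpha> \<noteq> 0" using y(2) by (metis vec.scale_zero_left)
        then have "y \<in> pt (?nu a)" using yy unfolding pt_def by blast
        then show False using no a by blast
      qed
      then obtain s t where st: "\<And>a. a \<in> A \<Longrightarrow> s a \<in> ?W" "\<And>a. a \<in> A \<Longrightarrow> t a \<in> ?W"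
        "\<And>a. a \<in> A \<Longrightarrow> ?nu a (s a) * y (t a) \<noteq> ?nu a (t a) * y (s a)" by metis
      define g where "g a = Const (?nu a (s a)) * Var (t a) - Const (?nu a (t a)) * Var (s a)" for a
      have gf: "g a \<in> forms ?W 1" if "a \<in> A" for a
      proof -
        have "Const c * Var b \<in> forms ?W 1" if "b \<in> ?W" for c :: 'a and b
          using mult_forms[OF Const_forms Var_forms[OF that], of c] by simp
        then show ?thesis unfolding g_def using st that by (intro mpoly.subspace_diff[OF subspace_forms]) blast+
      qed
      have prg: "pr (g a) (ev z) = ?nu a (s a) * z (t a) - ?nu a (t a) * z (s a)" for a z
        by (simp add: g_def pr_diff pr_ev_mult)
      have "finite B \<Longrightarrow> B \<subseteq> A \<Longrightarrow> prod g B \<in> forms ?W (card B)" for B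
      proof (induction B rule: finite_induct)
        case (insert b B)
        then show ?case using mult_forms[OF gf[of b], of "prod g B" "card B"] by simp
      qed (simp add: one_forms)
      then have GF: "prod g A \<in> forms ?W (card A)" using A(1) by blast
      have "pr (phi (prod g A)) (ev a) = 0" if a: "a \<in> A" for a
        unfolding pr_ev_veronese[OF GF, symmetric] pr_ev_prod
        by (rule prod_zero[OF A(1)]) (use a prg in \<open>auto intro!: bexI[of _ a]\<close>)
      then have "pr (phi (prod g A)) z = 0" if "z \<in> vec.span (ev ` A)" for z
        using pr_zero_span[of "ev ` A" "phi (prod g A)" z] that by blast
      then have "prod g A \<in> apolar {..m} d N" using N(2) by (intro apolar_forms[OF GF, THEN iffD2]) blast
      then have "(\<Prod>a\<in>A. pr (g a) (ev y)) = 0" using van by (simp only: pr_ev_prod[symmetric])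
      then show False using A(1) st(3) by (auto simp: prg)
    qed
    then obtain a where a: "a \<in> A" "y \<in> pt (?nu a)" by blast
    then obtain c where c: "c \<noteq> 0" "y = vec_scale c (?nu a)" by (auto simp: pt_def)
    have "ev a \<in> N"
    proof (rule ccontr)
      assume "ev a \<notin> N"
      moreover have "ev a \<in> FL {..m} l" using A(2)[OF a(1)] ev_FL by blast
      ultimately obtain e F where F: "F \<in> forms ?W e" "F \<in> apolar {..m} d N" "pr (phi F) (ev a) = 1"
        using apolar_separates[OF d N(1) NF] by metis
      have "pr F (ev y) = c ^ e" unfolding c(2) ev_scale_form[OF F(1)] pr_ev_veronese[OF F(1)] F(3) by simp
      then show False using van[OF F(2)] c(1) by simp
    qed
    then show "p \<in> (\<lambda>a. pt (?nu a)) ` {a \<in> A. ev a \<in> N}" using a pt_eqI[OF a(2)] y(3) by blast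
  next
    fix p assume "p \<in> (\<lambda>a. pt (?nu a)) ` {a \<in> A. ev a \<in> N}"
    then obtain a where a: "a \<in> A" "ev a \<in> N" "p = pt (?nu a)" by blast
    have "apolar {..m} d N \<subseteq> vanishing_ideal ?W ((\<lambda>a. pt (?nu a)) ` {a})"
      unfolding vanishing_ideal_veronese using a(2) by (intro apolar_mono) simp
    moreover have "p \<in> proj_space ?W"
      unfolding a(3) proj_space_pt using veronese_vec_vecs veronese_vec_nonzero[OF A0[OF a(1)]] by blast
    ultimately show "p \<in> scheme_points ?W (apolar {..m} d N)"
      unfolding scheme_points_def vanishing_ideal_def a(3) by blast
  qed
qed

section \<open>Decomposition of the schemes\<close>

lemma zero_dimensional_ver_scheme:
  fixes Z :: "(nat \<Rightarrow>\<^sub>0 nat, 'a::field_char_0) mpoly set"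
  assumes "1 \<le> d" "in_Ver m d Z" "zero_dimensional (Ver_coords m d) Z"
  shows "ver_scheme {..m} d Z (scheme_degree (Ver_coords m d) Z)"
proof -
  obtain r where r: "\<forall>\<^sub>F e in sequentially. hilbert_fun (Ver_coords m d) Z e = r"
    using assms(3) by (auto simp: zero_dimensional_def)
  then show ?thesis using in_Ver_ver_scheme[OF assms(1,2) r] scheme_degree_eq[OF r] by simp
qed

text \<open>The dual of \<open>S\<close> is spanned by the evaluations at its points
  \<open>A\<close>. A coefficient of \<open>x\<close> in these evaluations cannot vanish, as the
  remaining points would span the point of \<open>x\<close> as well.\<close>

lemma spanning_pair_of_schemes:
  fixes x :: "(nat \<Rightarrow>\<^sub>0 nat) \<Rightarrow> 'a::{alg_closed_field, field_char_0}"
  assumes d: "1 \<le> m" "1 \<le> d" and x: "x \<in> vecs (Ver_coords m d) - {0}"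
    and num: "sbr m d (pt x) < sr m d (pt x)" "sbr m d (pt x) + sr m d (pt x) \<le> 2 * d + 1"
    and S: "computes_sr m d (pt x) S" and Z: "bounded_by_sbr m d (pt x) Z"
    and l: "\<forall>y\<in>zeros {..m} d S \<union> zeros {..m} d Z. dot {..m} l y \<noteq> 0"
  shows "\<exists>A. S = apolar {..m} d (vec.span (ev ` A)) \<and> Z = apolar {..m} d (perp {..m} d l Z) \<and>
    vec.dim (perp {..m} d l Z) = scheme_degree (Ver_coords m d) Z \<and>
    spanning_pair m d l x A (perp {..m} d l Z)"
proof -
  let ?W = "Ver_coords m d" and ?V = "{..m}" and ?N = "perp {..m} d l Z"
  have V: "finite ?V" by simp
  have lS: "\<And>y. y \<in> zeros ?V d S \<Longrightarrow> dot ?V l y \<noteq> 0" and lZ: "\<And>y. y \<in> zeros ?V d Z \<Longrightarrow> dot ?V l y \<noteq> 0"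
    using l by auto
  have vS: "ver_scheme ?V d S (scheme_degree ?W S)" and vZ: "ver_scheme ?V d Z (scheme_degree ?W Z)"
    using zero_dimensional_ver_scheme[OF d(2)] S Z by (auto simp: computes_sr_def bounded_by_sbr_def)
  note dS = scheme_duality[OF V d(2) vS lS]
  note dZ = scheme_duality[OF V d(2) vZ lZ]
  obtain A where A: "finite A" "\<And>a. a \<in> A \<Longrightarrow> a \<in> vecs ?V \<and> dot ?V l a = 1" "perp ?V d l S = vec.span (ev ` A)"
    using reduced_span_ev[OF V d(2) vS lS] S by (auto simp: computes_sr_def)
  have SA: "S = apolar ?V d (vec.span (ev ` A))" using dS(2) A(3) by simp
  have A0: "A \<subseteq> vecs ?V - {0}" using A(2) by force
  have xW: "x \<in> vecs ?W" using x by simp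
  obtain lam where lam: "lam \<in> vec.span (ev ` A)" "x = degree_part m d lam"
    using span_functional[OF d vS lS xW] S A(3) by (auto simp: computes_sr_def)
  obtain c where c: "lam = (\<Sum>a\<in>A. vec_scale (c a) (ev a))" using span_ev_sum[OF A(1) lam(1)] by blast
  have le: "sr m d (pt x) \<le> card A" by (rule sr_le[OF A(1) A0]) (use x lam(2) c in auto)
  have ge: "card A \<le> sr m d (pt x)"
  proof -
    have pts: "scheme_points ?W S = (\<lambda>a. pt (veronese_vec m d a)) ` A"
      unfolding SA using scheme_points_apolar[OF d(2) A(1,2) vec.subspace_span subset_refl]
      by (auto simp: vec.span_base)
    have "inj_on (\<lambda>a. pt (veronese_vec m d a)) A"
    proof (rule inj_onI)
      fix a b assume ab: "a \<in> A" "b \<in> A" "pt (veronese_vec m d a) = pt (veronese_vec m d b)"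
      then have "veronese_vec m d a \<in> pt (veronese_vec m d b)" using pt_self by blast
      then show "a = b" using veronese_pt_inj[OF d(2), of a m l b] A(2) ab by blast
    qed
    then have "card (scheme_points ?W S) = card A" unfolding pts by (rule card_image)
    then show ?thesis using S by (simp add: computes_sr_def)
  qed
  have cne: "c a \<noteq> 0" if a: "a \<in> A" for a
  proof
    assume c0: "c a = 0"
    have "lam = vec_scale (c a) (ev a) + (\<Sum>b\<in>A - {a}. vec_scale (c b) (ev b))"
      unfolding c by (rule sum.remove[OF A(1) a])
    then have "lam = (\<Sum>b\<in>A - {a}. vec_scale (c b) (ev b))" by (simp only: c0 vec.scale_zero_left add_0_left)
    then have "sr m d (pt x) \<le> card (A - {a})"
      using A(1) A0 x lam(2) by (intro sr_le[where c = c]) auto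
    then show False using ge A(1) a card_Diff1_less[OF A(1) a] by simp
  qed
  have ex: "\<exists>c. (\<forall>a\<in>A. c a \<noteq> 0) \<and> x = degree_part m d (\<Sum>a\<in>A. vec_scale (c a) (ev a))"
    using cne lam(2) c by blast
  have N: "submod ?N" "vec.findim ?N" "?N \<subseteq> FL ?V l" using submod_perp dZ(1) by (auto simp: perp_def)
  have exZ: "\<exists>lam\<in>?N. x = degree_part m d lam"
    using span_functional[OF d vZ lZ xW] Z by (auto simp: bounded_by_sbr_def)
  have "vec.dim ?N \<le> sbr m d (pt x)" using dZ(3) Z by (simp add: bounded_by_sbr_def)
  then have "spanning_pair m d l x A ?N"
    unfolding spanning_pair_def using d(2) x A(1,2) le ge ex N exZ num by (intro conjI ballI) auto
  then show ?thesis using SA dZ(2,3) by blast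
qed

lemma apolar_Int: "apolar V d N \<inter> apolar V d M = apolar V d (vec.span (N \<union> M))"
  unfolding apolar_span by (auto simp: apolar_def)

lemma projectivization_pt:
  assumes "vec.subspace L" "L \<subseteq> vecs V" shows "projectivization V L = pt ` (L - {0})"
  using assms pt_subset_subspace[OF assms(1)] by (auto simp: projectivization_def proj_space_pt)

lemma curve_of_line:
  fixes L :: "(nat \<Rightarrow> 'a::field_char_0) set"
  assumes "vec.subspace L" "L \<subseteq> vecs {..m}"
  shows "vanishing_ideal (Ver_coords m d) (veronese m d ` projectivization {..m} L) = apolar {..m} d (ev ` (L - {0}))"
proof -
  have "veronese m d ` projectivization {..m} L = (\<lambda>x. pt (veronese_vec m d x)) ` (L - {0})"
    unfolding projectivization_pt[OF assms] image_image
    by (rule image_cong[OF refl veronese_pt]) (use assms(2) in auto)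
  then show ?thesis by (simp only: vanishing_ideal_veronese)
qed

text \<open>All operations on schemes are translated into operations on their functionals: union
  into sum, intersection with the curve into intersection with \<open>on_line\<close>, degree into
  dimension.\<close>

lemma scheme_decomposition:
  fixes l :: "nat \<Rightarrow> 'a::{alg_closed_field, field_char_0}"
  assumes sp: "spanning_pair m d l x A N" and dec: "decomposes_along m d l A N v w"
    and S: "S = apolar {..m} d (vec.span (ev ` A))" and Z: "Z = apolar {..m} d N"
  defines "C0 \<equiv> apolar {..m} d (ev ` (vec.span {v, w} - {0}))"
  shows "special_curve m d S Z C0"
    "\<And>C. special_curve m d S Z C \<Longrightarrow> C = C0"
    "common_part m d S Z C0 = apolar {..m} d (ev ` (A - vec.span {v, w}))"
    "is_disjoint_union (Ver_coords m d) S (scheme_inter (Ver_coords m d) S C0) (common_part m d S Z C0)"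
    "is_disjoint_union (Ver_coords m d) Z (scheme_inter (Ver_coords m d) Z C0) (common_part m d S Z C0)"
proof -
  let ?W = "Ver_coords m d" and ?V = "{..m}" and ?Lam = "vec.span {v, w}"
  let ?O = "on_line ?V l v w" and ?E = "vec.span (ev ` A)"
  define A2 where "A2 = A - ?Lam"
  let ?E2 = "vec.span (ev ` A2)" and ?M = "vec.span (?E \<union> N)"
  have V: "finite ?V" by simp
  have d: "1 \<le> d" and A: "finite A" "\<And>a. a \<in> A \<Longrightarrow> a \<in> vecs ?V \<and> dot ?V l a = 1"
    and N: "submod N" "vec.findim N" "N \<subseteq> FL ?V l"
    using sp by (auto simp: spanning_pair_def)
  have sN: "vec.subspace N" using N(1) by (simp add: submod_def)
  have vw: "line_basis ?V l v w" and Neq: "N = vec.span ((N \<inter> ?O) \<union> ev ` A2)"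
    and big: "d + 2 \<le> vec.dim (vec.span (N \<union> ev ` A) \<inter> ?O)"
    using dec by (auto simp: decomposes_along_def A2_def)
  have sO: "vec.subspace ?O" "submod ?O" using submod_on_line[of ?V l v w] by (auto simp: submod_def)
  have A2: "finite A2" "\<And>a. a \<in> A2 \<Longrightarrow> a \<in> vecs ?V \<and> dot ?V l a = 1 \<and> a \<notin> ?Lam"
    using A by (auto simp: A2_def)
  have evF: "ev ` B \<subseteq> FL ?V l" if "B \<subseteq> A" for B using A(2) ev_FL that by blast
  have spF: "vec.span (ev ` B) \<subseteq> FL ?V l" if "B \<subseteq> A" for B
    using evF[OF that] by (intro vec.span_minimal[OF _ subspace_FL])
  have fin: "vec.findim (vec.span (ev ` B))" if "B \<subseteq> A" for B
    using finite_subset[OF that A(1)] by (intro vec.findim_span) simp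
  have E: "submod ?E" "vec.findim ?E" "?E \<subseteq> FL ?V l" using submod_span_ev fin spF by auto
  have E2: "submod ?E2" "vec.findim ?E2" "?E2 \<subseteq> FL ?V l" using submod_span_ev fin spF by (auto simp: A2_def)
  have Meq: "?M = vec.span (N \<union> ev ` A)"
  proof (rule equalityI)
    have "?E \<subseteq> vec.span (N \<union> ev ` A)" by (rule vec.span_mono) auto
    moreover have "N \<subseteq> vec.span (N \<union> ev ` A)" using vec.span_superset[of "N \<union> ev ` A"] by blast
    ultimately show "?M \<subseteq> vec.span (N \<union> ev ` A)" by (intro vec.span_minimal vec.subspace_span) blast
    show "vec.span (N \<union> ev ` A) \<subseteq> ?M"
      using vec.span_superset[of "ev ` A"] by (intro vec.span_mono) blast
  qed
  have M: "submod ?M" "vec.findim ?M" "?M \<subseteq> FL ?V l"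
  proof -
    show "vec.findim ?M" by (rule vec.findim_Un_span[OF E(2) N(2)])
    show "?M \<subseteq> FL ?V l" using E(3) N(3) by (intro vec.span_minimal[OF _ subspace_FL]) blast
    show "submod ?M"
    proof (rule submod_if_Var[OF vec.subspace_span])
      fix i lam assume "lam \<in> ?M"
      then have "act (Var i) lam \<in> vec.span (act (Var i) ` (?E \<union> N))"
        using vecvec.linear_span_image[OF linear_act] by blast
      moreover have "act (Var i) ` (?E \<union> N) \<subseteq> ?E \<union> N" using E(1) N(1) by (auto simp: submod_def)
      ultimately show "act (Var i) lam \<in> ?M" using vec.span_mono by blast
    qed
  qed
  have union: "scheme_union S Z = apolar ?V d ?M" unfolding scheme_union_def S Z by (rule apolar_Int)
  have C: "ideal (apolar ?V d (ev ` X)) (poly_ring ?W)" "homogeneous_wrt ?W (apolar ?V d (ev ` X))"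
    "\<And>F. F \<in> carrier (poly_ring ?W) \<Longrightarrow> phi F = 0 \<Longrightarrow> F \<in> apolar ?V d (ev ` X)" for X :: "(nat \<Rightarrow> 'a) set"
    using apolar_ev_ideal homogeneous_apolar apolar_ker[OF d] by auto
  have interC: "scheme_inter ?W (apolar ?V d N') (apolar ?V d (ev ` X)) = apolar ?V d (N' \<inter> perp ?V d l (apolar ?V d (ev ` X)))"
    if "submod N'" "vec.findim N'" "N' \<subseteq> FL ?V l" for N' and X :: "(nat \<Rightarrow> 'a) set"
    by (rule scheme_inter_apolar[OF d that C])
  have perpC: "perp ?V d l C0 = ?O" unfolding C0_def by (rule perp_line[OF d V vw])
  have interC0: "scheme_inter ?W (apolar ?V d N') C0 = apolar ?V d (N' \<inter> ?O)"
    if "submod N'" "vec.findim N'" "N' \<subseteq> FL ?V l" for N'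
    using interC[OF that, of "?Lam - {0}"] perpC unfolding C0_def by simp
  have degree: "scheme_degree ?W (apolar ?V d N') = vec.dim N'" if "vec.findim N'" "N' \<subseteq> FL ?V l"
    for N' :: "((nat \<Rightarrow>\<^sub>0 nat) \<Rightarrow> 'a) set" by (rule scheme_degree_apolar[OF V d that])
  have rnc: "rational_normal_curve m d C0"
    unfolding rational_normal_curve_def
  proof (intro exI[of _ "projectivization ?V ?Lam"] conjI)
    show "line ?V (projectivization ?V ?Lam)" unfolding line_def
      using span_pair_vecs[OF vw] dim_span_pair[OF vw] vec.subspace_span by blast
    show "C0 = vanishing_ideal ?W (veronese m d ` projectivization ?V ?Lam)"
      unfolding C0_def by (rule curve_of_line[OF vec.subspace_span span_pair_vecs[OF vw], symmetric])
  qed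
  have "vec.findim (?M \<inter> ?O)" "?M \<inter> ?O \<subseteq> FL ?V l" using vec.findim_subset[OF _ M(2)] M(3) by auto
  then have "scheme_degree ?W (scheme_inter ?W (scheme_union S Z) C0) = vec.dim (?M \<inter> ?O)"
    unfolding union interC0[OF M] by (rule degree)
  then show special: "special_curve m d S Z C0" using rnc big Meq by (simp add: special_curve_def)
  show "C = C0" if special': "special_curve m d S Z C" for C
  proof -
    obtain L where L: "L \<subseteq> vecs ?V" "vec.subspace L" "vec.dim L = 2"
      and CL: "C = vanishing_ideal ?W (veronese m d ` projectivization ?V L)"
      using special' by (auto simp: special_curve_def rational_normal_curve_def line_def)
    have CX: "C = apolar ?V d (ev ` (L - {0}))" unfolding CL by (rule curve_of_line[OF L(2,1)])
    let ?K = "perp ?V d l C"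
    have "vec.findim (?M \<inter> ?K)" "?M \<inter> ?K \<subseteq> FL ?V l" using vec.findim_subset[OF _ M(2)] M(3) by auto
    then have "scheme_degree ?W (scheme_inter ?W (scheme_union S Z) C) = vec.dim (?M \<inter> ?K)"
      unfolding union CX interC[OF M] by (rule degree)
    then have bigK: "d + 2 \<le> vec.dim (?M \<inter> ?K)" using special' by (simp add: special_curve_def)
    \<comment> \<open>Any other line whose curve meets \<open>S \<union> Z\<close> in degree at
      least \<open>d + 2\<close> coincides with this one.\<close>
    have "L = ?Lam"
    proof (rule line_unique[OF vw vec.subspace_span M(2) _ _ L(2,1,3) _ _ bigK])
      show "vec.dim ?M \<le> 2 * d + 1" using spanning_pair_sum(2)[OF sp] Meq by simp
      show "d + 2 \<le> vec.dim (?M \<inter> ?O)" using big Meq by simp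
      show "vec.subspace ?K" using submod_perp by (auto simp: submod_def)
      show "act (lf ?V u) lam = 0" if "lam \<in> ?K" "\<forall>x\<in>L. dot ?V u x = 0" for u lam
        using perp_line_killed[OF d, of lam ?V l "L - {0}" u] that by (simp add: CX)
    qed
    then show ?thesis by (simp add: CX C0_def)
  qed
  have evN: "ev ` A2 \<subseteq> N"
  proof -
    have "ev ` A2 \<subseteq> vec.span ((N \<inter> ?O) \<union> ev ` A2)"
      using vec.span_superset[of "(N \<inter> ?O) \<union> ev ` A2"] by blast
    also have "\<dots> = N" by (rule Neq[symmetric])
    finally show ?thesis .
  qed
  have onO: "ev a \<in> ?O \<longleftrightarrow> a \<in> ?Lam" if "a \<in> A" for a using ev_on_line_iff[OF V vw] A(2)[OF that] by blast
  show common: "common_part m d S Z C0 = apolar ?V d (ev ` (A - vec.span {v, w}))"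
  proof -
    have "scheme_inter ?W S Z = apolar ?V d (?E \<inter> perp ?V d l Z)"
      unfolding S Z
      by (rule scheme_inter_apolar[OF d E apolar_ideal[OF N(1)] homogeneous_apolar apolar_ker[OF d]])
    then have SZ: "scheme_inter ?W S Z = apolar ?V d (?E \<inter> N)" unfolding Z perp_apolar[OF d N] .
    have p1: "scheme_points ?W (scheme_inter ?W S Z) = (\<lambda>a. pt (veronese_vec m d a)) ` {a \<in> A. ev a \<in> ?E \<inter> N}"
      unfolding SZ by (rule scheme_points_apolar[OF d A]) (use sN vec.subspace_inter[OF vec.subspace_span] in auto)
    have p2: "scheme_points ?W (scheme_inter ?W S C0) = (\<lambda>a. pt (veronese_vec m d a)) ` {a \<in> A. ev a \<in> ?E \<inter> ?O}"
      unfolding S interC0[OF E]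
      by (rule scheme_points_apolar[OF d A]) (use sO vec.subspace_inter[OF vec.subspace_span] in auto)
    have inj: "inj_on (\<lambda>a. pt (veronese_vec m d a)) A"
    proof (rule inj_onI)
      fix a b assume ab: "a \<in> A" "b \<in> A" "pt (veronese_vec m d a) = pt (veronese_vec m d b)"
      then have "veronese_vec m d a \<in> pt (veronese_vec m d b)" using pt_self by blast
      then show "a = b" using veronese_pt_inj[OF d, of a m l b] A(2) ab by blast
    qed
    have sets: "{a \<in> A. ev a \<in> ?E \<inter> N} - {a \<in> A. ev a \<in> ?E \<inter> ?O} = A2"
      using evN onO by (auto simp: A2_def vec.span_base)
    have "scheme_points ?W (scheme_inter ?W S Z) - scheme_points ?W (scheme_inter ?W S C0) = (\<lambda>a. pt (veronese_vec m d a)) ` A2"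
      unfolding p1 p2 using inj_on_image_set_diff[OF inj, of "{a \<in> A. ev a \<in> ?E \<inter> N}" "{a \<in> A. ev a \<in> ?E \<inter> ?O}"] sets by auto
    then show ?thesis by (simp add: common_part_def Let_def vanishing_ideal_veronese A2_def)
  qed
  have zero: "?O \<inter> ?E2 = {0}" by (rule on_line_Int_span_ev[OF V vw A2])
  have disjoint: "is_disjoint_union ?W (apolar ?V d N') (scheme_inter ?W (apolar ?V d N') C0) (common_part m d S Z C0)"
    if N': "submod N'" "vec.findim N'" "N' \<subseteq> FL ?V l" "N' = vec.span ((N' \<inter> ?O) \<union> ev ` A2)" for N'
    unfolding is_disjoint_union_def
  proof
    have "apolar ?V d (N' \<inter> ?O) \<inter> apolar ?V d (ev ` A2) = apolar ?V d N'"
      unfolding apolar_Int using N'(4) by simp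
    then show "apolar ?V d N' = scheme_union (scheme_inter ?W (apolar ?V d N') C0) (common_part m d S Z C0)"
      unfolding scheme_union_def interC0[OF N'(1-3)] common by (simp add: A2_def)
    have NO: "submod (N' \<inter> ?O)" "vec.findim (N' \<inter> ?O)" "N' \<inter> ?O \<subseteq> FL ?V l"
      using N'(1,3) sO vec.findim_subset[OF _ N'(2)] by (auto simp: submod_def vec.subspace_inter)
    have "scheme_inter ?W (scheme_inter ?W (apolar ?V d N') C0) (common_part m d S Z C0) =
        apolar ?V d ((N' \<inter> ?O) \<inter> perp ?V d l (apolar ?V d (ev ` A2)))"
      unfolding interC0[OF N'(1-3)] common A2_def[symmetric] by (rule interC[OF NO])
    also have "perp ?V d l (apolar ?V d (ev ` A2)) = ?E2"
      using perp_apolar[OF d E2] by (simp only: apolar_span)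
    also have "(N' \<inter> ?O) \<inter> ?E2 \<subseteq> {0}" using zero by blast
    then have "apolar ?V d ((N' \<inter> ?O) \<inter> ?E2) = empty_scheme ?W" by (force simp: apolar_def empty_scheme_def)
    finally show "scheme_inter ?W (scheme_inter ?W (apolar ?V d N') C0) (common_part m d S Z C0) = empty_scheme ?W" .
  qed
  show "is_disjoint_union ?W Z (scheme_inter ?W Z C0) (common_part m d S Z C0)"
    unfolding Z using disjoint[OF N Neq] by (simp add: Z)
  have "?E = vec.span ((?E \<inter> ?O) \<union> ev ` A2)"
  proof (rule equalityI)
    have "ev ` A \<subseteq> (?E \<inter> ?O) \<union> ev ` A2"
    proof clarify
      fix a assume a: "a \<in> A" "ev a \<notin> ev ` A2"
      then have "a \<in> ?Lam" by (auto simp: A2_def)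
      then show "ev a \<in> ?E \<inter> ?O" using onO[OF a(1)] a(1) by (simp add: vec.span_base)
    qed
    then show "?E \<subseteq> vec.span ((?E \<inter> ?O) \<union> ev ` A2)" by (rule vec.span_mono)
    have "ev ` A2 \<subseteq> ?E" by (auto simp: A2_def intro!: vec.span_base)
    then show "vec.span ((?E \<inter> ?O) \<union> ev ` A2) \<subseteq> ?E" by (intro vec.span_minimal vec.subspace_span) blast
  qed
  then show "is_disjoint_union ?W S (scheme_inter ?W S C0) (common_part m d S Z C0)"
    unfolding S using disjoint[OF E] by (simp add: S)
qed

theorem theorem1:
  fixes m d :: nat
    and P :: "((nat \<Rightarrow>\<^sub>0 nat) \<Rightarrow> 'a::{alg_closed_field, field_char_0}) set"
    and S Z :: "(nat \<Rightarrow>\<^sub>0 nat, 'a) mpoly set"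
  assumes "1 \<le> m" and "2 \<le> d"
    and "P \<in> proj_space (Ver_coords m d)"
    and "sbr m d P < sr m d P"
    and "sbr m d P + sr m d P \<le> 2 * d + 1"
    and "computes_sr m d P S"
    and "bounded_by_sbr m d P Z"
  shows "(\<exists>!C. special_curve m d S Z C) \<and>
    (\<forall>C. special_curve m d S Z C \<longrightarrow>
      (let W = Ver_coords m d;
           S1 = scheme_inter W S C;
           Z1 = scheme_inter W Z C;
           S2 = common_part m d S Z C
       in is_disjoint_union W S S1 S2 \<and> is_disjoint_union W Z Z1 S2 \<and>
          (\<forall>S' Z' C'. computes_sr m d P S' \<and> bounded_by_sbr m d P Z' \<and> special_curve m d S' Z' C'
             \<longrightarrow> common_part m d S' Z' C' = S2))) \<and>
    scheme_degree (Ver_coords m d) Z = sbr m d P"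
proof -
  let ?W = "Ver_coords m d" and ?V = "{..m}"
  have d: "1 \<le> d" using assms(2) by simp
  obtain x where x: "x \<in> vecs ?W - {0}" "P = pt x" using assms(3) by (auto simp: proj_space_pt)
  note num = assms(4,5)[unfolded x(2)]
  have hil: "\<exists>r. \<forall>\<^sub>F e in sequentially. hilbert_fun ?W T e = r"
    if "computes_sr m d P T \<or> bounded_by_sbr m d P T" for T
    using that by (auto simp: computes_sr_def bounded_by_sbr_def zero_dimensional_def)
  have uniq: "common_part m d S' Z' C' = common_part m d S Z C"
    if S': "computes_sr m d P S'" and Z': "bounded_by_sbr m d P Z'"
      and C': "special_curve m d S' Z' C'" and C: "special_curve m d S Z C" for S' Z' C' C
  proof -
    \<comment> \<open>One linear form has to avoid all four schemes, so that their functionals live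
      in the same space.\<close>
    have "\<exists>l. \<forall>T\<in>{S, Z, S', Z'}. \<forall>y\<in>zeros ?V d T. dot ?V l y \<noteq> 0"
      by (rule exists_good_form[OF d]) (use hil assms(6,7) S' Z' in auto)
    then obtain l where "\<forall>T\<in>{S, Z, S', Z'}. \<forall>y\<in>zeros ?V d T. dot ?V l y \<noteq> 0" ..
    then have l: "\<forall>y\<in>zeros ?V d S \<union> zeros ?V d Z. dot ?V l y \<noteq> 0"
      "\<forall>y\<in>zeros ?V d S' \<union> zeros ?V d Z'. dot ?V l y \<noteq> 0" by auto
    let ?N = "perp ?V d l Z" and ?N' = "perp ?V d l Z'"
    obtain A where A: "S = apolar ?V d (vec.span (ev ` A))" "Z = apolar ?V d ?N" "spanning_pair m d l x A ?N"
      using spanning_pair_of_schemes[OF assms(1) d x(1) num _ _ l(1)] assms(6,7) x(2) by blast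
    obtain A' where A': "S' = apolar ?V d (vec.span (ev ` A'))" "Z' = apolar ?V d ?N'" "spanning_pair m d l x A' ?N'"
      using spanning_pair_of_schemes[OF assms(1) d x(1) num _ _ l(2)] S' Z' x(2) by blast
    obtain v w where dec: "decomposes_along m d l A ?N v w" using exists_decomposition[OF A(3)] by blast
    obtain v' w' where dec': "decomposes_along m d l A' ?N' v' w'" using exists_decomposition[OF A'(3)] by blast
    note sd = scheme_decomposition[OF A(3) dec A(1,2)] and sd' = scheme_decomposition[OF A'(3) dec' A'(1,2)]
    show ?thesis
      unfolding sd(2)[OF C] sd'(2)[OF C'] sd(3) sd'(3) off_line_points_unique[OF A(3) A'(3) dec dec'] by (rule refl)
  qed
  have "\<exists>l. \<forall>T\<in>{S, Z}. \<forall>y\<in>zeros ?V d T. dot ?V l y \<noteq> 0"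
    by (rule exists_good_form[OF d]) (use hil assms(6,7) in auto)
  then obtain l where "\<forall>T\<in>{S, Z}. \<forall>y\<in>zeros ?V d T. dot ?V l y \<noteq> 0" ..
  then have l: "\<forall>y\<in>zeros ?V d S \<union> zeros ?V d Z. dot ?V l y \<noteq> 0" by auto
  let ?N = "perp ?V d l Z"
  obtain A where A: "S = apolar ?V d (vec.span (ev ` A))" "Z = apolar ?V d ?N"
    "vec.dim ?N = scheme_degree ?W Z" "spanning_pair m d l x A ?N"
    using spanning_pair_of_schemes[OF assms(1) d x(1) num _ _ l] assms(6,7) x(2) by blast
  obtain v w where dec: "decomposes_along m d l A ?N v w" and dimN: "vec.dim ?N = sbr m d P"
    using exists_decomposition[OF A(4)] x(2) by blast
  note sd = scheme_decomposition[OF A(4) dec A(1,2)]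
  show ?thesis
    unfolding Let_def
  proof (intro conjI allI impI)
    show "\<exists>!C. special_curve m d S Z C" using sd(1,2) by blast
    show "scheme_degree ?W Z = sbr m d P" using A(3) dimN by simp
  next
    fix C assume C: "special_curve m d S Z C"
    show "is_disjoint_union ?W S (scheme_inter ?W S C) (common_part m d S Z C)"
      unfolding sd(2)[OF C] by (rule sd(4))
    show "is_disjoint_union ?W Z (scheme_inter ?W Z C) (common_part m d S Z C)"
      unfolding sd(2)[OF C] by (rule sd(5))
    fix S' Z' C' assume "computes_sr m d P S' \<and> bounded_by_sbr m d P Z' \<and> special_curve m d S' Z' C'"
    then show "common_part m d S' Z' C' = common_part m d S Z C" using uniq C by blast
  qed
qed

end
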